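(* Let $T>0$, $\beta>0$, $q_*>0$, $Q=(-1,1)\times(0,T)$ and fix $\omega,\omega_0,\eta,m$ and the weights $\alpha,\xi,\hat\alpha,\hat\xi$ as in the context. Assume $(\bar p,\bar q)\in[W^{1,\infty}(0,T;H^1(-1,1))\cap H^{1,2}_0(Q)]\times W^{1,\infty}(0,T)$ with $\bar q(t)\in(q_*,+\infty)$ for all $t\in[0,T]$. There exist constants $\lambda_0\ge1$, $s_0\ge1$ and $C_0>0$ such that, for any $\lambda\ge\lambda_0$, any $s\ge s_0(T+T^2)$, any $\varphi_T\in H^1(-1,1)$ and $\gamma_T\in\mathbb{R}$ with $\varphi_T(-1)=0$ and $\varphi_T(1)=\gamma_T+\frac1\beta\int_{-1}^1\bar p_x(x,T)x\varphi_T(x)\,dx$, and any $g_1\in L^2(Q)$, $g_2\in L^2(0,T)$, the strong solution $(\varphi,\gamma)$ of $$-\bar q\varphi_t-\varphi_{xx}-\tfrac{x}{\beta}\bar p_x(1,\cdot)\varphi_x+\tfrac1\beta\bar p_x(1,\cdot)\varphi=g_1\text{ in }Q,\quad \varphi(-1,\cdot)=0,\quad \varphi(1,\cdot)=\gamma+\int_{-1}^1\tfrac{x}{\beta}\bar p_x(x,\cdot)\varphi(x,\cdot)\,dx\text{ in }(0,T),$$ $$\varphi(\cdot,T)=\varphi_T\text{ in }(-1,1),\quad \gamma_t=\int_{-1}^1\tfrac2\beta\bar p_t(x,\cdot)\varphi(x,\cdot)\,dx+g_2\text{ in }(0,T),\quad\gamma(T)=\gamma_T$$ satisfies $$\iint_Q\big[(s\xi)^{-1}(|\varphi_t|^2+|\varphi_{xx}|^2)+\lambda^2(s\xi)|\varphi_x|^2+\lambda^4(s\xi)^3|\varphi|^2\big]e^{-2s\alpha}\,dx\,dt$$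 $$+\int_0^T\big[|\gamma_t|^2+\lambda(s\hat\xi)(|\varphi_x(-1,t)|^2+|\varphi_x(1,t)|^2)+\lambda^3(s\hat\xi)^3(|\varphi(1,t)|^2+|\gamma|^2)\big]e^{-2s\hat\alpha}\,dt$$ $$\le C_0\Big(\iint_Q|g_1|^2e^{-2s\alpha}\,dx\,dt+\int_0^T|g_2|^2e^{-2s\hat\alpha}\,dt+s^3\lambda^4\int_0^T\!\!\int_\omega\xi^3|\varphi|^2e^{-2s\alpha}\,dx\,dt\Big).$$
   Context: $H^{1,2}_0(Q)=\{u\in L^2(Q):u_x,u_{xx},u_t\in L^2(Q),\ u(\pm1,\cdot)=0\}$; strong solution means $(\varphi,\gamma)\in H^{1,2}(Q)\times H^1(0,T)$. $\omega\subset\subset(-1,0)$ is a non-empty open set, $\omega_0$ a non-empty open set with $\omega_0\subset\subset\omega$, and $\eta\in C^2([-1,1])$ satisfies $\eta>0$ on $[-1,1]$, $\min_{x\in[-1,1]\setminus\omega_0}|\eta_x(x)|>0$, $\eta(-1)=\eta(1)=\min_{[-1,1]}\eta$. With $m>1$ fixed: $\alpha(x,t)=\dfrac{e^{2\lambda m\|\eta\|_\infty}-e^{\lambda(m\|\eta\|_\infty+\eta(x))}}{t(T-t)}$, $\xi(x,t)=\dfrac{e^{\lambda(m\|\eta\|_\infty+\eta(x))}}{t(T-t)}$, $\hat\alpha(t)=\max_x\alpha(x,t)=\alpha(\pm1,t)$, $\hat\xi(t)=\min_x\xi(x,t)=\xi(\pm1,t)$. *)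

theory Defs
  imports "HOL-Analysis.Analysis"
begin

definition Qset :: "real \<Rightarrow> (real \<times> real) set" where
  "Qset T = {-1<..<1} \<times> {0<..<T}"

definition L2_on :: "'a::euclidean_space set \<Rightarrow> ('a \<Rightarrow> real) \<Rightarrow> bool" where
  "L2_on S f \<longleftrightarrow> set_borel_measurable lebesgue S f \<and> set_integrable lebesgue S (\<lambda>z. (f z)\<^sup>2)"

definition pdx :: "(real \<times> real \<Rightarrow> real) \<Rightarrow> real \<times> real \<Rightarrow> real" where
  "pdx \<psi> = (\<lambda>z. deriv (\<lambda>y. \<psi> (y, snd z)) (fst z))"

definition pdt :: "(real \<times> real \<Rightarrow> real) \<Rightarrow> real \<times> real \<Rightarrow> real" where
  "pdt \<psi> = (\<lambda>z. deriv (\<lambda>s. \<psi> (fst z, s)) (snd z))"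

primrec iter_pd :: "bool list \<Rightarrow> (real \<times> real \<Rightarrow> real) \<Rightarrow> real \<times> real \<Rightarrow> real" where
  "iter_pd [] \<psi> = \<psi>"
| "iter_pd (b # ds) \<psi> = (if b then pdx (iter_pd ds \<psi>) else pdt (iter_pd ds \<psi>))"

definition test_fun2 :: "(real \<times> real) set \<Rightarrow> (real \<times> real \<Rightarrow> real) \<Rightarrow> bool" where
  "test_fun2 U \<psi> \<longleftrightarrow>
     (\<forall>ds. continuous_on UNIV (iter_pd ds \<psi>) \<and>
        (\<forall>x t. (\<lambda>y. iter_pd ds \<psi> (y, t)) differentiable (at x) \<and>
               (\<lambda>s. iter_pd ds \<psi> (x, s)) differentiable (at t))) \<and>
     compact (closure {z. \<psi> z \<noteq> 0}) \<and> closure {z. \<psi> z \<noteq> 0} \<subseteq> U"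

definition test_fun1 :: "real set \<Rightarrow> (real \<Rightarrow> real) \<Rightarrow> bool" where
  "test_fun1 U \<psi> \<longleftrightarrow>
     (\<forall>n x. (deriv ^^ n) \<psi> differentiable (at x)) \<and>
     compact (closure {x. \<psi> x \<noteq> 0}) \<and> closure {x. \<psi> x \<noteq> 0} \<subseteq> U"

definition weak_dx :: "(real \<times> real) set \<Rightarrow> (real \<times> real \<Rightarrow> real) \<Rightarrow> (real \<times> real \<Rightarrow> real) \<Rightarrow> bool" where
  "weak_dx U u v \<longleftrightarrow> (\<forall>\<psi>. test_fun2 U \<psi> \<longrightarrow>
     (LINT z:U|lebesgue. u z * pdx \<psi> z) = - (LINT z:U|lebesgue. v z * \<psi> z))"

definition weak_dt :: "(real \<times> real) set \<Rightarrow> (real \<times> real \<Rightarrow> real) \<Rightarrow> (real \<times> real \<Rightarrow> real) \<Rightarrow> bool" where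
  "weak_dt U u v \<longleftrightarrow> (\<forall>\<psi>. test_fun2 U \<psi> \<longrightarrow>
     (LINT z:U|lebesgue. u z * pdt \<psi> z) = - (LINT z:U|lebesgue. v z * \<psi> z))"

definition weak_deriv1 :: "real set \<Rightarrow> (real \<Rightarrow> real) \<Rightarrow> (real \<Rightarrow> real) \<Rightarrow> bool" where
  "weak_deriv1 U u v \<longleftrightarrow> (\<forall>\<psi>. test_fun1 U \<psi> \<longrightarrow>
     (LINT x:U|lebesgue. u x * deriv \<psi> x) = - (LINT x:U|lebesgue. v x * \<psi> x))"

text \<open>Boundary value of the x-derivative at x = a (a = -1 or 1) at time t, taken as the
  one-sided derivative of the continuous representative x \<mapsto> f(x,t) on [-1,1]
  (it exists for a.e. t for the functions considered).\<close>
definition bdx :: "(real \<times> real \<Rightarrow> real) \<Rightarrow> real \<Rightarrow> real \<Rightarrow> real" where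
  "bdx f a t = (THE d. ((\<lambda>x. f (x, t)) has_real_derivative d) (at a within {-1..1}))"

definition eta_norm :: "(real \<Rightarrow> real) \<Rightarrow> real" where
  "eta_norm \<eta> = Sup ((\<lambda>x. \<bar>\<eta> x\<bar>) ` {-1..1})"

definition alpha :: "(real \<Rightarrow> real) \<Rightarrow> real \<Rightarrow> real \<Rightarrow> real \<Rightarrow> real \<Rightarrow> real \<Rightarrow> real" where
  "alpha \<eta> m lam T x t =
     (exp (2 * lam * m * eta_norm \<eta>) - exp (lam * (m * eta_norm \<eta> + \<eta> x))) / (t * (T - t))"

definition xi :: "(real \<Rightarrow> real) \<Rightarrow> real \<Rightarrow> real \<Rightarrow> real \<Rightarrow> real \<Rightarrow> real \<Rightarrow> real" where
  "xi \<eta> m lam T x t = exp (lam * (m * eta_norm \<eta> + \<eta> x)) / (t * (T - t))"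

definition alpha_hat :: "(real \<Rightarrow> real) \<Rightarrow> real \<Rightarrow> real \<Rightarrow> real \<Rightarrow> real \<Rightarrow> real" where
  "alpha_hat \<eta> m lam T t = Sup ((\<lambda>x. alpha \<eta> m lam T x t) ` {-1..1})"

definition xi_hat :: "(real \<Rightarrow> real) \<Rightarrow> real \<Rightarrow> real \<Rightarrow> real \<Rightarrow> real \<Rightarrow> real" where
  "xi_hat \<eta> m lam T t = Inf ((\<lambda>x. xi \<eta> m lam T x t) ` {-1..1})"

end

theory Submission
  imports Defs
begin

text \<open>
  The weak derivatives of a strong solution are first identified with genuine ones: on almost every
  slice \<open>phi\<close> is absolutely continuous in \<open>x\<close> (with its derivative) and in \<open>t\<close>. The same for \<open>pbar\<close>, together
  with the \<open>W^{1,infinity}(H^1)\<close> bound, shows that \<open>pbar_x(1,.)\<close> is bounded and that \<open>phi(1,.)\<close> is absolutely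
  continuous, with a derivative controlled by \<open>gamma_t\<close> and the \<open>L^2\<close> norms of \<open>phi\<close> and \<open>phi_t\<close> on the slice.
  Then \<open>w = exp (-s alpha) phi\<close> satisfies \<open>P1 w + P2 w = F\<close>, where \<open>P1 w = w_xx + V w\<close> and
  \<open>P2 w = q w_t - 2 s lam eta' xi w_x - 2 s lam^2 eta'^2 xi w\<close>. The cross term \<open>2 P1 w P2 w\<close> is a divergence plus
  a quadratic form in \<open>(w, w_x)\<close> that is coercive for large \<open>lam\<close> and \<open>s\<close> wherever \<open>eta'\<close> does not vanish; on
  \<open>omega0\<close> coercivity is restored by adding the derivative of \<open>rho lam^2 s xi w w_x\<close> with a cutoff \<open>rho\<close>
  supported in \<open>omega\<close>. At \<open>x = 1\<close> the only boundary term of the wrong sign involves \<open>w_t(1,.)\<close>; it carries a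
  factor \<open>1 / lam\<close> and is absorbed through the nonlocal boundary condition.
\<close>

text \<open>Two limits of regularity shape the argument. \<open>eta\<close> is only C^2, so the
  zero-order coefficient of \<open>P2\<close> is built from \<open>eta'\<close> alone; what
  conjugation produces with \<open>eta''\<close> goes into \<open>F\<close>, and the product
  \<open>w w_x\<close> left by differentiating that coefficient is bounded by Young's inequality,
  since a second integration by parts would need a third derivative of \<open>eta\<close>. And
  \<open>pbar_xx\<close> is only in L^2(Q), so a trace inequality on single slices does not bound
  \<open>pbar_x(1,.)\<close>; the bound comes from a chain of times approaching t geometrically
  (\<open>bounded_chain\<close>), using that \<open>pbar_x\<close> is Lipschitz in time with values
  in L^2. One small number \<open>dl\<close> governs all absorptions. A constant \<open>K\<close>
  first collects the bounds on T, the derivatives of \<open>eta\<close>, the cutoff,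
  \<open>qbar\<close> and \<open>pbar\<close>. Then \<open>dl\<close> is chosen from
  \<open>K\<close> and the lower bound \<open>c0\<close> of |eta'|, and the thresholds for
  \<open>lam\<close> and \<open>s\<close> are set so that \<open>1 <= dl lam\<close>,
  \<open>1 <= dl s\<close> and \<open>1 <= dl s xi\<close>. Lower-order remainders then carry a
  factor \<open>dl\<close>, and the final constant depends on neither \<open>lam\<close> nor
  \<open>s\<close>.\<close>

abbreviation lb2 :: "(real * real) measure" where "lb2 == lborel \<Otimes>\<^sub>M lborel"
abbreviation bor2 :: "(real * real) measure" where "bor2 == borel \<Otimes>\<^sub>M borel"

lemmas lint_cong = Bochner_Integration.integral_cong
 and lint_cong_iff = Bochner_Integration.integrable_cong
 and lint_add = Bochner_Integration.integrable_add
 and lint_diff = Bochner_Integration.integrable_diff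
 and lint_bound = Bochner_Integration.integrable_bound

section \<open>Square integrable functions\<close>

definition sqint :: "'a measure => ('a => real) => bool" where
 "sqint M f \<longleftrightarrow> f : borel_measurable M & integrable M (%z. (f z)^2)"

lemma sqint_measurable: "sqint M f ==> f : borel_measurable M" by (simp add: sqint_def)

lemma sqintD: "sqint M f ==> integrable M (%z. (f z)^2)" by (simp add: sqint_def)

lemma sqint_bound:
 assumes f: "sqint M f" and g[measurable]: "g : borel_measurable M"
  and le: "!!z. z : space M ==> \<bar>g z\<bar> <= C * \<bar>f z\<bar>"
 shows "sqint M g"
 unfolding sqint_def
proof
 show "integrable M (%z. (g z)^2)"
 proof (rule lint_bound)
  show "integrable M (%z. C^2 * (f z)^2)" using sqintD[OF f] by simp
  show "AE z in M. norm ((g z)^2) <= norm (C^2 * (f z)^2)"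
  proof (rule AE_I2)
   fix z assume "z : space M"
   then have "\<bar>g z\<bar>\<^sup>2 <= (C * \<bar>f z\<bar>)^2" by (intro power_mono le) auto
   then show "norm ((g z)^2) <= norm (C^2 * (f z)^2)" by (simp add: power_mult_distrib)
  qed
 qed measurable
qed fact

lemma sqint_mult_bounded:
 assumes "sqint M f" "b : borel_measurable M" "!!z. z : space M ==> \<bar>b z\<bar> <= C"
 shows "sqint M (%z. b z * f z)"
proof (rule sqint_bound[OF assms(1), where C = C])
 show "(%z. b z * f z) : borel_measurable M" using assms(1,2) by (auto simp: sqint_def)
 show "\<bar>b z * f z\<bar> <= C * \<bar>f z\<bar>" if "z : space M" for z using assms(3)[OF that] by (simp add: abs_mult mult_right_mono)
qed

lemma sqint_cmult: "sqint M f ==> sqint M (%z. c * f z)" by (auto simp: sqint_def power_mult_distrib)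

lemma sqint_mult:
 assumes f: "sqint M f" and g: "sqint M g"
 shows "integrable M (%z. f z * g z)"
proof (rule lint_bound)
 show "integrable M (%z. (f z)^2 + (g z)^2)" using sqintD[OF f] sqintD[OF g] by simp
 show "(%z. f z * g z) : borel_measurable M" using assms by (auto simp: sqint_def)
 have "\<bar>x * y\<bar> <= x^2 + y^2" for x y :: real
 proof -
  have "2 * \<bar>x * y\<bar> <= x^2 + y^2" using sum_squares_bound[of "\<bar>x\<bar>" "\<bar>y\<bar>"] by (simp add: abs_mult)
  then show ?thesis using abs_ge_zero[of "x * y"] by linarith
 qed
 then show "AE z in M. norm (f z * g z) <= norm ((f z)^2 + (g z)^2)" by simp
qed

lemma sqint_add:
 assumes f: "sqint M f" and g: "sqint M g"
 shows "sqint M (%z. f z + g z)"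
proof -
 have "(f z + g z)^2 = (f z)^2 + 2 * (f z * g z) + (g z)^2" for z by (simp add: power2_eq_square algebra_simps)
 then show ?thesis using assms sqint_mult[OF f g] by (auto simp: sqint_def)
qed

lemma sqint_diff:
 assumes f: "sqint M f" and g: "sqint M g"
 shows "sqint M (%z. f z - g z)" using sqint_add[OF f sqint_cmult[OF g, of "-1"]] by simp

lemma sqint_cong_AE:
 assumes "sqint M f" "g : borel_measurable M" "AE z in M. f z = g z"
 shows "sqint M g" using assms unfolding sqint_def by (auto intro: integrable_cong_AE_imp[where g="%z. (f z)^2"])

lemma Cauchy_Schwarz_integral:
 assumes f: "sqint M f" and g: "sqint M g"
 shows "(LINT z|M. f z * g z)^2 <= (LINT z|M. (f z)^2) * (LINT z|M. (g z)^2)"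
proof -
 define A B C where "A = (LINT z|M. (f z)^2)" and "B = (LINT z|M. f z * g z)"
  and "C = (LINT z|M. (g z)^2)"
 note i = sqintD[OF f] sqintD[OF g] sqint_mult[OF f g]
 have AC: "A >= 0" "C >= 0" by (auto simp: A_def C_def)
 have quad: "0 <= r^2 * A - 2 * r * B + C" for r
 proof -
  have "0 <= (LINT z|M. (r * f z - g z)^2)" by simp
  also have "(%z. (r * f z - g z)^2) = (%z. r^2 * (f z)^2 - 2 * r * (f z * g z) + (g z)^2)" by (auto simp: power2_eq_square algebra_simps)
  also have "(LINT z|M. r^2 * (f z)^2 - 2 * r * (f z * g z) + (g z)^2) = r^2 * A - 2 * r * B + C" using i by (simp add: A_def B_def C_def)
  finally show ?thesis .
 qed
 show ?thesis
 proof (cases "A = 0")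
  case True
  have "B = 0"
  proof (rule ccontr)
   assume "B ~= 0"
   \<comment> \<open>With \<open>A = 0\<close> the quadratic is linear in r, and at this r it equals
     -1.\<close>
   then show False using quad[of "(C + 1) / (2 * B)"] True AC by (simp add: field_simps)
  qed
  then show ?thesis using True AC by (simp add: A_def B_def C_def)
 next
  case False
  then have "A > 0" using AC by simp
  with quad[of "B / A"] have "B^2 <= A * C" by (simp add: field_simps power2_eq_square)
  then show ?thesis by (simp add: A_def B_def C_def)
 qed
qed

lemma slice_Fubini:
 fixes f :: "real \<times> real => real"
 assumes "integrable (lborel \<Otimes>\<^sub>M lborel) f"
 shows "AE t in lborel. integrable lborel (%x. f (x, t))"
  and "integrable lborel (%t. \<integral>x. f (x, t) \<partial>lborel)"
  and "(LBINT t. (LBINT x. f (x, t))) = integral\<^sup>L (lborel \<Otimes>\<^sub>M lborel) f"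
  and "AE x in lborel. integrable lborel (%t. f (x, t))"
  and "integrable lborel (%x. \<integral>t. f (x, t) \<partial>lborel)"
  and "(LBINT x. (LBINT t. f (x, t))) = integral\<^sup>L (lborel \<Otimes>\<^sub>M lborel) f"
 using lborel_pair.AE_integrable_snd[of "%x y. f (x, y)"] lborel_pair.integrable_snd[of "%x y. f (x, y)"]
  lborel_pair.integral_snd[of "%x y. f (x, y)"] lborel_pair.AE_integrable_fst'[of f]
  lborel_pair.integrable_fst'[of f] lborel_pair.integral_fst'[of f] assms by simp_all

lemma sqint_slices:
 assumes "sqint (lborel \<Otimes>\<^sub>M lborel) f"
 shows "AE t in lborel. sqint lborel (%x. f (x, t :: real))"
  and "AE x in lborel. sqint lborel (%t. f (x :: real, t))"
proof -
 have [measurable]: "f : borel_measurable bor2" using sqint_measurable[OF assms] by (simp cong: measurable_cong_sets)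
 show "AE t in lborel. sqint lborel (%x. f (x, t :: real))" using slice_Fubini(1)[OF sqintD[OF assms]]
  unfolding sqint_def by eventually_elim auto
 show "AE x in lborel. sqint lborel (%t. f (x :: real, t))" using slice_Fubini(4)[OF sqintD[OF assms]]
  unfolding sqint_def by eventually_elim auto
qed

lemma sqint_indicator:
 assumes "A : sets M" "emeasure M A < \<infinity>"
 shows "sqint M (indicator A)"
proof -
 have "(%z. (indicator A z)^2) = (indicator A :: _ => real)" by (auto split: split_indicator)
 then show ?thesis using assms by (simp add: sqint_def)
qed

text \<open>The positive and negative parts of f are densities of two finite measures that agree on
  boxes, an intersection-stable generator of the Borel sets, so the densities agree almost
  everywhere. Box integrals are what product test functions give access to.\<close>

lemma AE_zero_if_box_integrals_zero:
 fixes f :: "'a::euclidean_space => real"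
 assumes f: "integrable lborel f"
  and box0: "!!a b. (LBINT z. indicator (box a b) z * f z) = 0"
 shows "AE z in lborel. f z = 0"
proof -
 have [measurable]: "f : borel_measurable borel" using borel_measurable_integrable[OF f] by simp
 define P N where "P = density lborel (%z. ennreal (f z))" and "N = density lborel (%z. ennreal (- f z))"
 have fin: "(\<integral>\<^sup>+z. ennreal (f z) \<partial>lborel) ~= \<infinity>" "(\<integral>\<^sup>+z. ennreal (- f z) \<partial>lborel) ~= \<infinity>"
  using f unfolding real_integrable_def by auto
 have "P = N"
 proof (rule measure_eqI_generator_eq[where E = "range (%(a, b). box a b)" and \<Omega> = UNIV
    and A = "%i. box (- (real i *\<^sub>R One)) (real i *\<^sub>R One)"])
  show "Int_stable (range (%(a, b). box a b :: 'a set))" by (auto simp: Int_stable_def box_Int_box)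
  show "sets P = sigma_sets UNIV (range (%(a, b). box a b))" "sets N = sigma_sets UNIV (range (%(a, b). box a b))" by (simp_all add: P_def N_def borel_eq_box)
  show "emeasure P X = emeasure N X" if XE: "X : range (%(a, b). box a b)" for X
  proof -
   obtain a b where X: "X = box a b" using XE by (auto simp: image_iff)
   have i: "integrable lborel (%z. indicator X z * f z)" using integrable_mult_indicator[OF _ f, of X] X by simp
   have e: "ennreal (indicator X z * f z) = ennreal (f z) * indicator X z"
    "ennreal (- (indicator X z * f z)) = ennreal (- f z) * indicator X z" for z by (auto split: split_indicator)
   have "enn2real (\<integral>\<^sup>+z. ennreal (f z) * indicator X z \<partial>lborel)
     = enn2real (\<integral>\<^sup>+z. ennreal (- f z) * indicator X z \<partial>lborel)"
    using real_lebesgue_integral_def[OF i] box0[of a b] unfolding X[symmetric] e by simp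
   moreover have "(\<integral>\<^sup>+z. ennreal (f z) * indicator X z \<partial>lborel) < top"
    "(\<integral>\<^sup>+z. ennreal (- f z) * indicator X z \<partial>lborel) < top" using i unfolding real_integrable_def e by (auto simp: top.not_eq_extremum)
   ultimately have "(\<integral>\<^sup>+z. ennreal (f z) * indicator X z \<partial>lborel)
     = (\<integral>\<^sup>+z. ennreal (- f z) * indicator X z \<partial>lborel)" by (metis ennreal_enn2real)
   then show ?thesis using X by (simp add: P_def N_def emeasure_density)
  qed
  show "emeasure P (box (- (real i *\<^sub>R One)) (real i *\<^sub>R One)) ~= \<infinity>" for i
  proof -
   have "emeasure P (box (- (real i *\<^sub>R One)) (real i *\<^sub>R One)) <= (\<integral>\<^sup>+z. ennreal (f z) \<partial>lborel)"
    by (auto simp: P_def emeasure_density intro!: nn_integral_mono split: split_indicator)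
   then show ?thesis using fin(1) by (auto simp: top_unique)
  qed
  show "(\<Union>i. box (- (real i *\<^sub>R One)) (real i *\<^sub>R One)) = (UNIV :: 'a set)" using UN_box_eq_UNIV by simp
 qed auto
 then have "AE z in lborel. ennreal (f z) = ennreal (- f z)"
  unfolding P_def N_def by (intro sigma_finite_measure.density_unique) (auto simp: lborel.sigma_finite_measure_axioms)
 \<comment> \<open>\<open>ennreal\<close> sends negative numbers to 0, so one of the two sides is 0
   and then so is the other.\<close>
 moreover have "x = 0" if "ennreal x = ennreal (- x)" for x :: real
 proof (cases "x <= 0")
  case True
  then have "ennreal (- x) = 0" using that by (simp add: ennreal_neg)
  then show ?thesis using True by (simp add: ennreal_eq_0_iff)
 next
  case False
  then have "ennreal x = 0" using that by (simp add: ennreal_neg)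
  then show ?thesis using False by (simp add: ennreal_eq_0_iff)
 qed
 ultimately show ?thesis by (auto elim: eventually_mono)
qed

lemma AE_not_endpoint: "AE x in lborel. x ~= (-1::real) & x ~= 1" using AE_lborel_singleton[of "-1::real"] AE_lborel_singleton[of "1::real"] by eventually_elim auto

section \<open>Absolutely continuous functions on an interval\<close>

text \<open>Absolute continuity encoded by the integral formula: f matters only up to null sets, and
  no theorem on almost everywhere differentiability enters. The condition is void when
  \<open>b < a\<close>.\<close>

definition ac_deriv :: "real => real => (real => real) => (real => real) => bool" where
 "ac_deriv a b F f \<longleftrightarrow> set_integrable lborel {a..b} f \<and>
   (\<forall>x\<in>{a..b}. F x = F a + (LBINT y:{a..x}. f y))"

lemma ac_deriv_integrable: "ac_deriv a b F f ==> set_integrable lborel {a..b} f" by (simp add: ac_deriv_def)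

lemma ac_derivD: "ac_deriv a b F f ==> a <= x ==> x <= b ==> F x = F a + (LBINT y:{a..x}. f y)"
 unfolding ac_deriv_def by (meson atLeastAtMost_iff)

lemma ac_derivI:
 assumes "set_integrable lborel {a..b} f" "!!x. a <= x ==> x <= b ==> F x = F a + (LBINT y:{a..x}. f y)"
 shows "ac_deriv a b F f"
 unfolding ac_deriv_def using assms by (metis atLeastAtMost_iff)

lemma ac_deriv_diff:
 assumes "ac_deriv a b F f" "a <= x" "x <= y" "y <= b"
 shows "F y - F x = (LBINT z:{x..y}. f z)"
proof -
 note i = ac_deriv_integrable[OF assms(1)]
 have s: "set_integrable lborel {a..x} f" "set_integrable lborel {a..y} f" "set_integrable lborel {x..y} f"
  using assms by (auto intro: set_integrable_subset[OF i])
 have "F y - F x = (LBINT z:{a..y}. f z) - (LBINT z:{a..x}. f z)" using ac_derivD[OF assms(1), of x] ac_derivD[OF assms(1), of y] assms by linarith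
 also have "... = integral {a..y} f - integral {a..x} f" using s by (simp add: set_borel_integral_eq_integral)
 also have "... = integral {x..y} f" using Henstock_Kurzweil_Integration.integral_combine[OF assms(2,3)
    set_borel_integral_eq_integral(1)[OF s(2)]] by simp
 finally show ?thesis using s by (simp add: set_borel_integral_eq_integral)
qed

lemma ac_deriv_subinterval:
 assumes "ac_deriv a b F f" "a <= c" "d <= b"
 shows "ac_deriv c d F f"
proof -
 have "set_integrable lborel {c..d} f" using set_integrable_subset[OF ac_deriv_integrable[OF assms(1)], of "{c..d}"] assms by auto
 moreover have "F x = F c + (LBINT y:{c..x}. f y)" if "c <= x" "x <= d" for x using ac_deriv_diff[OF assms(1), of c x] assms(2,3) that by simp
 ultimately show ?thesis by (rule ac_derivI)
qed

lemma ac_deriv_continuous: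
 assumes "ac_deriv a b F f"
 shows "continuous_on {a..b} F"
proof -
 note i = ac_deriv_integrable[OF assms(1)]
 have "continuous_on {a..b} (%x. F a + integral {a..x} f)" by (intro continuous_intros indefinite_integral_continuous_1 set_borel_integral_eq_integral(1)[OF i])
 also have "?this \<longleftrightarrow> ?thesis"
 proof (rule continuous_on_cong)
  fix x assume x: "x : {a..b}"
  then have "set_integrable lborel {a..x} f" by (intro set_integrable_subset[OF i]) auto
  then show "F a + integral {a..x} f = F x" using ac_derivD[OF assms, of x] x by (simp add: set_borel_integral_eq_integral)
 qed simp
 finally show ?thesis .
qed

lemma ac_deriv_C1:
 assumes "!!x. x : {a..b} ==> (F has_real_derivative f x) (at x within {a..b})"
  and "continuous_on {a..b} f"
 shows "ac_deriv a b F f"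
proof -
 have i: "set_integrable lborel {a..b} f" by (rule borel_integrable_atLeastAtMost'[OF assms(2)])
 have "F x = F a + (LBINT y:{a..x}. f y)" if x: "a <= x" "x <= b" for x
 proof -
  have "(f has_integral (F x - F a)) {a..x}"
  proof (rule fundamental_theorem_of_calculus)
   show "a <= x" by fact
   show "(F has_vector_derivative f y) (at y within {a..x})" if "y : {a..x}" for y using DERIV_subset[OF assms(1)[of y], of "{a..x}"] x that
    by (auto simp: has_real_derivative_iff_has_vector_derivative)
  qed
  moreover have "set_integrable lborel {a..x} f" using that by (intro set_integrable_subset[OF i]) auto
  ultimately show ?thesis by (simp add: set_borel_integral_eq_integral integral_unique)
 qed
 with i show ?thesis by (rule ac_derivI)
qed

lemma ac_deriv_has_derivative:
 assumes F: "ac_deriv a b F f" and f: "continuous_on {a..b} f" and x: "x : {a..b}"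
 shows "(F has_real_derivative f x) (at x within {a..b})"
proof -
 note i = ac_deriv_integrable[OF F]
 have "((%u. integral {a..u} f) has_vector_derivative f x) (at x within {a..b})" using x f by (intro integral_has_vector_derivative) auto
 then have "((%u. F a + integral {a..u} f) has_real_derivative f x) (at x within {a..b})"
  by (auto simp: has_real_derivative_iff_has_vector_derivative intro!: derivative_eq_intros)
 then show ?thesis
 proof (rule has_field_derivative_transform_within[where d = 1])
  fix y assume y: "y : {a..b}"
  then have "set_integrable lborel {a..y} f" by (intro set_integrable_subset[OF i]) auto
  then show "F a + integral {a..y} f = F y" using ac_derivD[OF F, of y] y by (simp add: set_borel_integral_eq_integral)
 qed (use x in auto)
qed

lemma ac_deriv_cong:
 assumes "ac_deriv a b F f" "!!x. x : {a..b} ==> F x = G x" 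
  "set_borel_measurable lborel {a..b} g" "AE x in lborel. x : {a..b} --> f x = g x"
 shows "ac_deriv a b G g"
proof -
 note i = ac_deriv_integrable[OF assms(1)]
 have g: "set_integrable lborel {a..b} g"
  unfolding set_integrable_def
 proof (rule integrable_cong_AE_imp[OF i[unfolded set_integrable_def]])
  show "(%x. indicat_real {a..b} x *\<^sub>R g x) : borel_measurable lborel" using assms(3) by (simp add: set_borel_measurable_def)
  show "AE x in lborel. indicat_real {a..b} x *\<^sub>R f x = indicat_real {a..b} x *\<^sub>R g x"
   using assms(4) by eventually_elim (auto split: split_indicator)
 qed
 have "(LBINT y:{a..x}. f y) = (LBINT y:{a..x}. g y)" if "x : {a..b}" for x
  unfolding set_lebesgue_integral_def
 proof (rule integral_cong_AE)
  show "AE y in lborel. indicat_real {a..x} y *\<^sub>R f y = indicat_real {a..x} y *\<^sub>R g y"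
   using assms(4) by eventually_elim (use that in "auto split: split_indicator")
  show "(%y. indicat_real {a..x} y *\<^sub>R f y) : borel_measurable lborel"
   "(%y. indicat_real {a..x} y *\<^sub>R g y) : borel_measurable lborel"
   using that set_integrable_subset[OF i, of "{a..x}"] set_integrable_subset[OF g, of "{a..x}"] by (auto simp: set_integrable_def)
 qed
 note eq = this
 have "G x = G a + (LBINT y:{a..x}. g y)" if "a <= x" "x <= b" for x using assms(2)[of a] assms(2)[of x] ac_derivD[OF assms(1) that] eq[of x] that by simp
 with g show ?thesis by (rule ac_derivI)
qed

lemma ac_deriv_cong':
 assumes "ac_deriv a b F f" "!!x. x : {a..b} ==> F x = G x" "!!x. x : {a..b} ==> f x = g x"
 shows "ac_deriv a b G g"
proof -
 have "set_integrable lborel {a..b} g \<longleftrightarrow> set_integrable lborel {a..b} f" using assms(3) by (intro set_integrable_cong) auto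
 then have g: "set_integrable lborel {a..b} g" using ac_deriv_integrable[OF assms(1)] by simp
 have "(LBINT y:{a..x}. f y) = (LBINT y:{a..x}. g y)" if "x : {a..b}" for x using that assms(3) by (intro set_lebesgue_integral_cong) auto
 note eq = this
 have "G x = G a + (LBINT y:{a..x}. g y)" if "a <= x" "x <= b" for x using assms(2)[of a] assms(2)[of x] ac_derivD[OF assms(1) that] eq[of x] that by simp
 with g show ?thesis by (rule ac_derivI)
qed

lemma ac_deriv_add:
 assumes F: "ac_deriv a b F f" and G: "ac_deriv a b G g"
 shows "ac_deriv a b (%x. F x + G x) (%x. f x + g x)"
proof -
 note i = F[THEN ac_deriv_integrable] G[THEN ac_deriv_integrable]
 show ?thesis
 proof (rule ac_derivI)
  fix x assume x: "a <= x" "x <= b"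
  have "(LBINT y:{a..x}. f y + g y) = (LBINT y:{a..x}. f y) + (LBINT y:{a..x}. g y)"
   using x i[THEN set_integrable_subset, of "{a..x}"] by (intro set_integral_add) auto
  then show "F x + G x = F a + G a + (LBINT y:{a..x}. f y + g y)" using ac_derivD[OF F x] ac_derivD[OF G x] by simp
 qed (use i in auto)
qed

lemma ac_deriv_cmult:
 assumes F: "ac_deriv a b F f"
 shows "ac_deriv a b (%x. c * F x) (%x. c * f x)"
proof (rule ac_derivI)
 show "c * F x = c * F a + (LBINT y:{a..x}. c * f y)" if "a <= x" "x <= b" for x using ac_derivD[OF F that] by (simp add: distrib_left)
qed (use ac_deriv_integrable[OF F] in auto)

section \<open>Integration by parts and the product rule, from Fubini on two triangles\<close>

lemma integrable_tensor:
 fixes f g :: "real => real"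
 assumes f: "integrable lborel f" and g: "integrable lborel g"
 shows "integrable (lborel \<Otimes>\<^sub>M lborel) (%z. f (fst z) * g (snd z))"
proof (rule lborel_pair.Fubini_integrable)
 have [measurable]: "f : borel_measurable borel" "g : borel_measurable borel" using f g borel_measurable_integrable by fastforce+
 show "(%z. f (fst z) * g (snd z)) : borel_measurable (lborel \<Otimes>\<^sub>M lborel)" by measurable
 show "integrable lborel (%x. \<integral>y. norm (f (fst (x, y)) * g (snd (x, y))) \<partial>lborel)" using f by (simp add: abs_mult)
 show "AE x in lborel. integrable lborel (%y. f (fst (x, y)) * g (snd (x, y)))" using g by simp
qed

text \<open>The triangles \<open>y <= x\<close> and \<open>x < y\<close> partition the plane, and
  Fubini is applied on each in the convenient order. This is integration by parts for primitives; it
  serves the product rule below and, in \<open>weak_derivative_representation\<close>, moves a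
  primitive from one factor to the other.\<close>

lemma integral_triangle_sum:
 fixes f g :: "real => real"
 assumes f: "integrable lborel f" and g: "integrable lborel g"
 shows "(LBINT x. f x * (LBINT y. indicator {..x} y * g y))
    + (LBINT y. g y * (LBINT x. indicator {..y} x * f x))
    = (LBINT x. f x) * (LBINT y. g y)"
  and "integrable lborel (%x. f x * (LBINT y. indicator {..x} y * g y))"
proof -
 have [measurable]: "f : borel_measurable borel" "g : borel_measurable borel" using f g borel_measurable_integrable by fastforce+
 define h1 where "h1 = (%z::real\<times>real. indicator {z. snd z <= fst z} z * (f (fst z) * g (snd z)))"
 define h2 where "h2 = (%z::real\<times>real. indicator {z. fst z < snd z} z * (f (fst z) * g (snd z)))"
 note t = integrable_tensor[OF f g]
 have m: "{z::real\<times>real. snd z <= fst z} : sets (lborel \<Otimes>\<^sub>M lborel)"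
   "{z::real\<times>real. fst z < snd z} : sets (lborel \<Otimes>\<^sub>M lborel)"
  unfolding lborel_prod sets_lborel by (intro borel_closed borel_open closed_Collect_le open_Collect_less continuous_intros)+
 have i: "integrable (lborel \<Otimes>\<^sub>M lborel) h1" "integrable (lborel \<Otimes>\<^sub>M lborel) h2"
  unfolding h1_def h2_def using integrable_mult_indicator[OF m(1) t] integrable_mult_indicator[OF m(2) t] by simp_all
 have h1x: "(LBINT y. h1 (x, y)) = f x * (LBINT y. indicator {..x} y * g y)" for x
 proof -
  have "(%y. h1 (x, y)) = (%y. f x * (indicator {..x} y * g y))" by (auto simp: h1_def split: split_indicator)
  then show ?thesis by simp
 qed
 have h2y: "(LBINT x. h2 (x, y)) = g y * (LBINT x. indicator {..y} x * f x)" for y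
 proof -
  \<comment> \<open>The strict triangle and the closed half-line differ in the single point
    \<open>x = y\<close>.\<close>
  have "(LBINT x. h2 (x, y)) = (LBINT x. g y * (indicator {..y} x * f x))"
  proof (rule integral_cong_AE)
   show "AE x in lborel. h2 (x, y) = g y * (indicator {..y} x * f x)"
    using AE_lborel_singleton[of y] by eventually_elim (auto simp: h2_def split: split_indicator)
   show "(%x. h2 (x, y)) : borel_measurable lborel"
    unfolding h2_def by (auto simp: indicator_def)
  qed measurable
  then show ?thesis by simp
 qed
 have "(\<integral>z. h1 z + h2 z \<partial>(lborel \<Otimes>\<^sub>M lborel)) = (\<integral>z. f (fst z) * g (snd z) \<partial>(lborel \<Otimes>\<^sub>M lborel))"
  by (intro lint_cong) (auto simp: h1_def h2_def split: split_indicator)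
 also have "... = (LBINT x. f x) * (LBINT y. g y)" using slice_Fubini(6)[OF t] by simp
 finally show "(LBINT x. f x * (LBINT y. indicator {..x} y * g y))
    + (LBINT y. g y * (LBINT x. indicator {..y} x * f x))
    = (LBINT x. f x) * (LBINT y. g y)" using slice_Fubini(6)[OF i(1)] slice_Fubini(3)[OF i(2)] i by (simp add: h1x h2y)
 show "integrable lborel (%x. f x * (LBINT y. indicator {..x} y * g y))" using slice_Fubini(5)[OF i(1)] by (simp add: h1x)
qed

text \<open>With F and G written as an initial value plus a primitive, the only nontrivial part is a
  sum of two iterated integrals, and the triangle identity evaluates it as the product of the two
  increments.\<close>

lemma ac_deriv_mult:
 assumes F: "ac_deriv a b F f" and G: "ac_deriv a b G g"
 shows "ac_deriv a b (%x. F x * G x) (%x. f x * G x + F x * g x)"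
proof -
 have prod: "integrable lborel (%x. indicator {a..c} x * (f x * G x)) \<and>
   integrable lborel (%x. indicator {a..c} x * (F x * g x)) \<and>
   F c * G c = F a * G a + (LBINT x:{a..c}. f x * G x + F x * g x)" if c: "a <= c" "c <= b" for c
 proof -
  define f1 g1 where "f1 = (%x. indicator {a..c} x * f x)" and "g1 = (%x. indicator {a..c} x * g x)"
  have i: "integrable lborel f1" "integrable lborel g1" using set_integrable_subset[OF ac_deriv_integrable[OF F], of "{a..c}"]
    set_integrable_subset[OF ac_deriv_integrable[OF G], of "{a..c}"] c by (auto simp: f1_def g1_def set_integrable_def)
  have FF: "F x = F a + (LBINT y. indicator {..x} y * f1 y)"
   and GG: "G x = G a + (LBINT y. indicator {..x} y * g1 y)" if "x : {a..c}" for x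
  proof -
   have "(%y. indicator {..x} y * f1 y) = (%y. indicator {a..x} y * f y)"
    "(%y. indicator {..x} y * g1 y) = (%y. indicator {a..x} y * g y)" using that by (auto simp: f1_def g1_def split: split_indicator)
   then show "F x = F a + (LBINT y. indicator {..x} y * f1 y)"
    "G x = G a + (LBINT y. indicator {..x} y * g1 y)" using ac_derivD[OF F, of x] ac_derivD[OF G, of x] that c by (auto simp: set_lebesgue_integral_def)
  qed
  have e1: "indicator {a..c} x * (f x * G x) = G a * f1 x + f1 x * (LBINT y. indicator {..x} y * g1 y)" for x
   using GG[of x] by (auto simp: f1_def algebra_simps split: split_indicator)
  have e2: "indicator {a..c} x * (F x * g x) = F a * g1 x + g1 x * (LBINT y. indicator {..x} y * f1 y)" for x
   using FF[of x] by (auto simp: g1_def algebra_simps split: split_indicator)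
  note tri = integral_triangle_sum(2)[OF i] integral_triangle_sum(2)[OF i(2,1)]
  have j: "integrable lborel (%x. indicator {a..c} x * (f x * G x))"
   "integrable lborel (%x. indicator {a..c} x * (F x * g x))"
   unfolding e1 e2 using i tri by auto
  have "(LBINT x:{a..c}. f x * G x + F x * g x)
    = (LBINT x. indicator {a..c} x * (f x * G x)) + (LBINT x. indicator {a..c} x * (F x * g x))" using j by (simp add: set_lebesgue_integral_def distrib_left)
  also have "... = G a * (LBINT x. f1 x) + F a * (LBINT x. g1 x) + (LBINT x. f1 x) * (LBINT x. g1 x)"
   unfolding e1 e2 using i tri integral_triangle_sum(1)[OF i] by simp
  finally have *: "(LBINT x:{a..c}. f x * G x + F x * g x) = ..." .
  have "(%x. indicator {..c} x * f1 x) = f1" "(%x. indicator {..c} x * g1 x) = g1" by (auto simp: f1_def g1_def split: split_indicator)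
  then have "F c = F a + (LBINT x. f1 x)" "G c = G a + (LBINT x. g1 x)" using FF[of c] GG[of c] c by auto
  then show ?thesis using j * by (simp add: algebra_simps)
 qed
 show ?thesis
 proof (cases "a <= b")
  case True
  show ?thesis
  proof (rule ac_derivI)
   show "set_integrable lborel {a..b} (%x. f x * G x + F x * g x)" using prod[OF True order_refl] by (simp add: set_integrable_def distrib_left)
  qed (use prod in blast)
 qed (simp add: ac_deriv_def set_integrable_def)
qed

text \<open>Needed because the weights are smooth only on compact subintervals of (0,T). The
  difference \<open>K\<close> of F and the primitive of f is constant on the open interval, hence by
  continuity on its closure.\<close>

lemma ac_deriv_closed_interval:
 assumes ab: "a < b" and cont: "continuous_on {a..b} F"
  and f: "set_integrable lborel {a..b} f"
  and ac: "!!c d. a < c ==> c <= d ==> d < b ==> ac_deriv c d F f"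
 shows "ac_deriv a b F f"
proof -
 have step: "F y - F x = integral {x..y} f" if "a < x" "x <= y" "y < b" for x y
 proof -
  have "set_integrable lborel {x..y} f" using that by (intro set_integrable_subset[OF f]) auto
  then show ?thesis using ac_deriv_diff[OF ac[OF that], of x y] that by (simp add: set_borel_integral_eq_integral)
 qed
 define m where "m = (a + b) / 2"
 have m: "a < m" "m < b" using ab by (auto simp: m_def)
 define K where "K = (%x. F x - integral {a..x} f)"
 have fi: "f integrable_on {a..b}" by (rule set_borel_integral_eq_integral(1)[OF f])
 have Kc: "continuous_on {a..b} K"
  unfolding K_def by (intro continuous_intros cont indefinite_integral_continuous_1 fi)
 have Km: "K x = K m" if x: "x : {a<..<b}" for x
 proof (cases "m <= x")
  case True
  have "integral {a..m} f + integral {m..x} f = integral {a..x} f"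
   using True m x by (intro Henstock_Kurzweil_Integration.integral_combine integrable_subinterval_real[OF fi]) auto
  then show ?thesis using step[of m x] True m x by (simp add: K_def algebra_simps)
 next
  case False
  have "integral {a..x} f + integral {x..m} f = integral {a..m} f"
   using False m x by (intro Henstock_Kurzweil_Integration.integral_combine integrable_subinterval_real[OF fi]) auto
  then show ?thesis using step[of x m] False m x by (simp add: K_def algebra_simps)
 qed
 have cl: "closure {a<..<b} = {a..b}" using ab by simp
 have "K x = K m" if "x : {a..b}" for x using continuous_constant_on_closure[of "{a<..<b}" K "K m" x] Kc Km that cl by auto
 note KK = this
 show ?thesis
 proof (rule ac_derivI)
  fix x assume x: "a <= x" "x <= b"
  have "set_integrable lborel {a..x} f" using x by (intro set_integrable_subset[OF f]) auto
  moreover have "K x = K a" using KK[of x] KK[of a] x by simp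
  ultimately show "F x = F a + (LBINT y:{a..x}. f y)" by (simp add: K_def set_borel_integral_eq_integral)
 qed (rule f)
qed

section \<open>Smooth functions with compact support\<close>

text \<open>From \<open>exp y >= (1 + y/n)^n\<close>. It makes \<open>flat_exp\<close> flat at 0
  and, later, lets the exponential weight beat every power of
  \<open>1 / (t (T - t))\<close>.\<close>

lemma exp_minus_le_power:
 fixes y :: real
 assumes "y > 0" "n > 0"
 shows "exp (- y) <= (real n / y) ^ n"
proof -
 have "(y / real n) ^ n <= (1 + y / real n) ^ n" using assms by (intro power_mono) auto
 also have "... <= exp y" using assms by (intro exp_ge_one_plus_x_over_n_power_n) auto
 finally have "(y / real n) ^ n <= exp y" .
 moreover have "(y / real n) ^ n > 0" using assms by simp
 ultimately have "inverse (exp y) <= inverse ((y / real n) ^ n)" by (intro le_imp_inverse_le)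
 then show ?thesis by (simp add: exp_minus power_inverse flip: power_inverse)
qed

text \<open>The classical flat function; the powers of x in the denominator close the family under
  differentiation up to linear combinations.\<close>

definition flat_exp :: "nat => real => real" where
 "flat_exp k x = (if x > 0 then exp (- (1 / x)) / x ^ k else 0)"

lemma flat_exp_deriv:
 "(flat_exp k has_real_derivative (flat_exp (k + 2) x - real k * flat_exp (k + 1) x)) (at x)"
proof -
 consider "x > 0" | "x < 0" | "x = 0" by linarith
 then show ?thesis
 proof cases
  case 1
  have "((%x. exp (- (1 / x)) / x ^ k) has_real_derivative (flat_exp (k + 2) x - real k * flat_exp (k + 1) x)) (at x)"
  proof (cases k)
   case 0
   then show ?thesis using 1 by (auto intro!: derivative_eq_intros simp: flat_exp_def field_simps power2_eq_square)
  next
   case (Suc j)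
   have "((%x. exp (- (1 / x)) / x ^ k) has_real_derivative
     (exp (- (1 / x)) * (1 / x^2) * x ^ k - exp (- (1 / x)) * (real k * x ^ (k - 1))) / (x ^ k * x ^ k)) (at x)"
    using 1 by (auto intro!: derivative_eq_intros simp: power2_eq_square)
   also have "(exp (- (1 / x)) * (1 / x^2) * x ^ k - exp (- (1 / x)) * (real k * x ^ (k - 1))) / (x ^ k * x ^ k)
     = flat_exp (k + 2) x - real k * flat_exp (k + 1) x" using 1 Suc by (simp add: flat_exp_def field_simps power2_eq_square)
   finally show ?thesis .
  qed
  moreover have "\<forall>\<^sub>F y in nhds x. exp (- (1 / y)) / y ^ k = flat_exp k y" using eventually_nhds_in_open[of "{0<..}" x] 1
   by (auto simp: flat_exp_def elim!: eventually_mono)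
  ultimately show ?thesis by (simp add: DERIV_cong_ev)
 next
  case 2
  have "\<forall>\<^sub>F y in nhds x. 0 = flat_exp k y" using eventually_nhds_in_open[of "{..<0}" x] 2 by (auto simp: flat_exp_def elim!: eventually_mono)
  then have "(flat_exp k has_real_derivative 0) (at x)" using DERIV_cong_ev[OF refl _ refl, of "%_. 0" "flat_exp k" x 0] by simp
  then show ?thesis using 2 by (simp add: flat_exp_def)
 next
  case 3
  \<comment> \<open>A quadratic bound makes the difference quotient at 0 of order |y|, so the
    derivative there is 0.\<close>
  have bd: "\<bar>flat_exp k y\<bar> <= (real (k + 2)) ^ (k + 2) * y^2" for y
  proof (cases "y > 0")
   case True
   have "exp (- (1 / y)) <= (real (k + 2) / (1 / y)) ^ (k + 2)" using True by (intro exp_minus_le_power) auto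
   also have "... = (real (k + 2)) ^ (k + 2) * y^2 * y ^ k" by (simp add: power_mult_distrib power_add power2_eq_square mult_ac)
   finally show ?thesis using True by (simp add: flat_exp_def field_simps)
  qed (simp add: flat_exp_def)
  have "((%y. (flat_exp k y - flat_exp k 0) / (y - 0)) \<longlongrightarrow> 0) (at 0)"
  proof (rule Lim_null_comparison[where g = "%y. (real (k + 2)) ^ (k + 2) * \<bar>y\<bar>"])
   have "norm ((flat_exp k y - flat_exp k 0) / (y - 0)) <= (real (k + 2)) ^ (k + 2) * \<bar>y\<bar>" if "y ~= 0" for y
    using bd[of y] that by (simp add: flat_exp_def[of k 0] field_simps power2_eq_square abs_mult_self_eq)
   then show "\<forall>\<^sub>F y in at 0. norm ((flat_exp k y - flat_exp k 0) / (y - 0)) <= (real (k + 2)) ^ (k + 2) * \<bar>y\<bar>"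
    by (auto simp: eventually_at_filter)
   show "((%y. (real (k + 2)) ^ (k + 2) * \<bar>y\<bar>) \<longlongrightarrow> 0) (at 0)" by (rule tendsto_eq_intros refl | simp)+
  qed
  then show ?thesis using 3 by (simp add: has_field_derivative_iff flat_exp_def)
 qed
qed

text \<open>Test functions need all iterated derivatives, and an inductive class closed under
  \<open>deriv\<close> provides them at once. \<open>smooth_antideriv\<close> is there because
  primitives of bumps with mean zero are used as test functions.\<close>

inductive smooth_fun :: "(real => real) => bool" where
 smooth_const: "smooth_fun (%x. c)"
| smooth_flat: "smooth_fun (%x. flat_exp k (p * x + c))"
| smooth_add: "smooth_fun f ==> smooth_fun g ==> smooth_fun (%x. f x + g x)"
| smooth_mult: "smooth_fun f ==> smooth_fun g ==> smooth_fun (%x. f x * g x)"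
| smooth_exp: "smooth_fun f ==> smooth_fun (%x. exp (f x))"
| smooth_antideriv: "smooth_fun f ==> (!!x. (F has_real_derivative f x) (at x)) ==> smooth_fun F"

lemma smooth_fun_has_deriv:
 "smooth_fun f ==> \<exists>f'. smooth_fun f' & (\<forall>x. (f has_real_derivative f' x) (at x))"
proof (induction rule: smooth_fun.induct)
 case (smooth_const c)
 show ?case by (rule exI[of _ "%_. 0"]) (auto intro: smooth_fun.smooth_const)
next
 case (smooth_flat k p c)
 have lin: "((%x. p * x + c) has_real_derivative p) (at x)" for x by (auto intro!: derivative_eq_intros)
 have "((%x. flat_exp k (p * x + c)) has_real_derivative
   p * (flat_exp (k + 2) (p * x + c) + - real k * flat_exp (k + 1) (p * x + c))) (at x)" for x
  using DERIV_chain2[where f = "flat_exp k" and g = "%x. p * x + c", OF flat_exp_deriv lin[of x]] by (simp add: algebra_simps)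
 moreover have "smooth_fun (%x. p * (flat_exp (k + 2) (p * x + c) + - real k * flat_exp (k + 1) (p * x + c)))"
  by (intro smooth_fun.smooth_mult smooth_fun.smooth_add smooth_fun.smooth_const smooth_fun.smooth_flat)
 ultimately show ?case by blast
next
 case (smooth_add f g)
 then obtain f' g' where fg: "smooth_fun f'" "smooth_fun g'" "!!x. (f has_real_derivative f' x) (at x)"
  "!!x. (g has_real_derivative g' x) (at x)" by blast
 then show ?case by (intro exI[of _ "%x. f' x + g' x"]) (auto intro!: smooth_fun.smooth_add derivative_eq_intros)
next
 case (smooth_mult f g)
 then obtain f' g' where fg: "smooth_fun f'" "smooth_fun g'" "!!x. (f has_real_derivative f' x) (at x)"
  "!!x. (g has_real_derivative g' x) (at x)" by blast
 have "((%x. f x * g x) has_real_derivative f' x * g x + g' x * f x) (at x)" for x by (rule DERIV_mult[OF fg(3,4)])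
 moreover have "smooth_fun (%x. f' x * g x + g' x * f x)" using fg smooth_mult by (intro smooth_fun.smooth_add smooth_fun.smooth_mult)
 ultimately show ?case by blast
next
 case (smooth_exp f)
 then obtain f' where f: "smooth_fun f'" "!!x. (f has_real_derivative f' x) (at x)" by blast
 have "((%x. exp (f x)) has_real_derivative exp (f x) * f' x) (at x)" for x using DERIV_chain2[OF DERIV_exp f(2)] by simp
 moreover have "smooth_fun (%x. exp (f x) * f' x)" using f smooth_exp by (intro smooth_fun.smooth_mult smooth_fun.smooth_exp)
 ultimately show ?case by blast
next
 case (smooth_antideriv f F)
 then show ?case by blast
qed

lemma smooth_fun_deriv:
 assumes "smooth_fun f"
 shows "smooth_fun (deriv f)" and "(f has_real_derivative deriv f x) (at x)"
proof -
 obtain f' where f: "smooth_fun f'" "!!x. (f has_real_derivative f' x) (at x)" using smooth_fun_has_deriv[OF assms] by blast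
 then have "deriv f = f'" by (auto intro!: DERIV_imp_deriv)
 then show "smooth_fun (deriv f)" "(f has_real_derivative deriv f x) (at x)" using f by auto
qed

lemma smooth_fun_continuous: "smooth_fun f ==> continuous_on UNIV f" using smooth_fun_deriv(2) by (meson DERIV_isCont continuous_at_imp_continuous_on)

lemma smooth_fun_borel: "smooth_fun f ==> f : borel_measurable borel" by (simp add: borel_measurable_continuous_onI smooth_fun_continuous)

lemma test_fun1_smooth:
 assumes f: "smooth_fun f" and U: "{c..d} \<subseteq> U" and zero: "!!x. x ~: {c..d} ==> f x = 0"
 shows "test_fun1 U f"
proof -
 have "smooth_fun ((deriv ^^ n) f)" for n by (induction n) (auto intro: f smooth_fun_deriv(1))
 then have d: "(deriv ^^ n) f differentiable at x" for n x using smooth_fun_deriv(2) by (auto simp: real_differentiable_def)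
 have "closure {x. f x ~= 0} \<subseteq> {c..d}" using zero by (intro closure_minimal) (auto, (metis atLeastAtMost_iff)+)
 then show ?thesis using d U unfolding test_fun1_def
  by (auto intro: compact_closure[THEN iffD2] bounded_subset[OF bounded_closed_interval[of c d]] closure_subset[THEN subsetD])
qed

text \<open>Smooth functions with values in [0,1] that tend pointwise to the indicator of (a,b): n
  times a bump, positive exactly on a shrunken interval, stands in the exponent. The margin
  \<open>(b - a) / (n + 3)\<close> is less than half the length and keeps the support compact in
  (a,b).\<close>

definition indicator_approx :: "real => real => nat => real => real" where
 "indicator_approx a b n x = 1 - exp (- (real n *
   (flat_exp 0 (x - (a + (b - a) / (real n + 3))) * flat_exp 0 (b - (b - a) / (real n + 3) - x))))"

lemma flat_exp_pos: "x > 0 ==> flat_exp k x > 0"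
 and flat_exp_zero: "x <= 0 ==> flat_exp k x = 0"
 and flat_exp_nonneg: "flat_exp k x >= 0" by (auto simp: flat_exp_def)

lemma indicator_approx_smooth: "smooth_fun (indicator_approx a b n)"
proof -
 define d where "d = (b - a) / (real n + 3)"
 have "smooth_fun (%x. 1 + (-1) * exp ((- real n) * (flat_exp 0 (1 * x + (- (a + d))) * flat_exp 0 ((-1) * x + (b - d)))))"
  by (intro smooth_add smooth_mult smooth_const smooth_exp smooth_flat)
 also have "(%x. 1 + (-1) * exp ((- real n) * (flat_exp 0 (1 * x + (- (a + d))) * flat_exp 0 ((-1) * x + (b - d)))))
   = indicator_approx a b n" by (auto simp: indicator_approx_def d_def algebra_simps fun_eq_iff)
 finally show ?thesis .
qed

lemma indicator_approx_bounds: "0 <= indicator_approx a b n x" "indicator_approx a b n x <= 1" by (auto simp: indicator_approx_def flat_exp_nonneg)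

lemma indicator_approx_support:
 assumes "a < b" "x ~: {a + (b - a) / (real n + 3) .. b - (b - a) / (real n + 3)}"
 shows "indicator_approx a b n x = 0" using assms by (auto simp: indicator_approx_def flat_exp_zero)

lemma indicator_approx_support':
 assumes "a < b" "x ~: {a<..<b}"
 shows "indicator_approx a b n x = 0"
proof (rule indicator_approx_support[OF assms(1)])
 have "(b - a) / (real n + 3) > 0" using assms by simp
 then show "x ~: {a + (b - a) / (real n + 3) .. b - (b - a) / (real n + 3)}" using assms(2) by auto
qed

lemma indicator_approx_tendsto:
 assumes "a < b"
 shows "(%n. indicator_approx a b n x) \<longlonglongrightarrow> indicator {a<..<b} x"
proof (cases "x : {a<..<b}")
 case False
 then show ?thesis using indicator_approx_support'[OF assms False] by simp
next
 case True
 have cont: "isCont (flat_exp 0) y" for y using flat_exp_deriv by (rule DERIV_isCont)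
 have d: "(%n. (b - a) / (real n + 3)) \<longlonglongrightarrow> 0" using LIMSEQ_ignore_initial_segment[OF lim_const_over_n[of "b - a"], of 3] by simp
 have 1: "(%n. flat_exp 0 (x - (a + (b - a) / (real n + 3))) * flat_exp 0 (b - (b - a) / (real n + 3) - x))
    \<longlonglongrightarrow> flat_exp 0 (x - (a + 0)) * flat_exp 0 (b - 0 - x)" by (intro tendsto_mult isCont_tendsto_compose[OF cont] tendsto_intros d)
 have "filterlim (%n. (flat_exp 0 (x - (a + (b - a) / (real n + 3))) * flat_exp 0 (b - (b - a) / (real n + 3) - x)) * real n) at_top sequentially"
  by (rule filterlim_tendsto_pos_mult_at_top[OF 1]) (use True in "auto intro!: mult_pos_pos flat_exp_pos filterlim_real_sequentially")
 then have "filterlim (%n. - (real n * (flat_exp 0 (x - (a + (b - a) / (real n + 3))) * flat_exp 0 (b - (b - a) / (real n + 3) - x)))) at_bot sequentially"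
  by (simp add: filterlim_uminus_at_top mult.commute)
 then have "(%n. exp (- (real n * (flat_exp 0 (x - (a + (b - a) / (real n + 3))) * flat_exp 0 (b - (b - a) / (real n + 3) - x))))) \<longlonglongrightarrow> 0"
  by (rule filterlim_compose[OF exp_at_bot])
 then have "(%n. indicator_approx a b n x) \<longlonglongrightarrow> 1 - 0"
  unfolding indicator_approx_def by (intro tendsto_intros)
 then show ?thesis using True by simp
qed

lemma indicator_approx_integrable:
 assumes "a < b" shows "integrable lborel (indicator_approx a b n)"
proof (rule lint_bound)
 show "integrable lborel (indicator {a<..<b} :: real => real)" using assms by simp
 show "AE x in lborel. norm (indicator_approx a b n x) <= norm (indicator {a<..<b} x :: real)"
  using indicator_approx_bounds[of a b n] indicator_approx_support'[OF assms, of _ n] by (auto split: split_indicator)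
qed (simp add: smooth_fun_borel indicator_approx_smooth)

lemma indicator_approx_integral_tendsto:
 assumes "a < b"
 shows "(%n. \<integral>x. indicator_approx a b n x \<partial>lborel) \<longlonglongrightarrow> b - a"
proof -
 have "(%n. \<integral>x. indicator_approx a b n x \<partial>lborel) \<longlonglongrightarrow> (LBINT x. indicator {a<..<b} x)"
 proof (rule integral_dominated_convergence[where w = "indicator {a<..<b}"])
  show "integrable lborel (indicator {a<..<b} :: real => real)" using assms by simp
  show "AE x in lborel. (%n. indicator_approx a b n x) \<longlonglongrightarrow> indicator {a<..<b} x" using indicator_approx_tendsto[OF assms] by simp
  show "AE x in lborel. norm (indicator_approx a b n x) <= (indicator {a<..<b} x :: real)" for n
   using indicator_approx_bounds[of a b n] indicator_approx_support'[OF assms, of _ n] by (auto split: split_indicator)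
 qed (auto simp: smooth_fun_borel indicator_approx_smooth)
 then show ?thesis using assms by simp
qed

section \<open>Weak derivatives and absolute continuity on slices\<close>

lemma AE_lb2_slices:
 assumes "AE z in lb2. P z"
 shows "AE t in lborel. AE x in lborel. P (x, t)" and "AE x in lborel. AE t in lborel. P (x, t)"
proof -
 obtain N where N: "{z : space lb2. \<not> P z} \<subseteq> N" "N : null_sets lb2" using assms by (auto elim!: AE_E simp: null_sets_def)
 have ae: "AE z in lb2. z ~: N" by (rule AE_not_in[OF N(2)])
 have P: "P z" if "z ~: N" for z using N(1) that by (auto simp: space_pair_measure)
 have "AE x in lborel. AE t in lborel. (x, t) ~: N" by (rule lborel_pair.AE_pair[OF ae])
 moreover have [measurable]: "N : sets (lborel \<Otimes>\<^sub>M lborel)" using N(2) by auto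
 ultimately have "AE t in lborel. AE x in lborel. (x, t) ~: N" using sets.compl_sets[OF \<open>N : sets lb2\<close>]
  by (subst lborel_pair.AE_commute[symmetric]) (auto simp: set_diff_eq)
 then show "AE t in lborel. AE x in lborel. P (x, t)" by (rule eventually_mono) (auto elim!: eventually_mono intro: P)
 show "AE x in lborel. AE t in lborel. P (x, t)" using \<open>AE x in lborel. AE t in lborel. (x, t) ~: N\<close>
  by (rule eventually_mono) (auto elim!: eventually_mono intro: P)
qed

lemma AE_lb2I:
 assumes "Measurable.pred (borel \<Otimes>\<^sub>M borel) P" and "AE t in lborel. AE x in lborel. P (x, t)"
 shows "AE z in lb2. P z"
proof -
 have s: "{z : space lb2. P z} : sets lb2" using assms(1) unfolding pred_def
  by (simp add: space_pair_measure sets_pair_measure_cong[OF sets_lborel sets_lborel])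
 have "AE x in lborel. AE t in lborel. P (x, t)" using assms(2) s by (subst lborel_pair.AE_commute) auto
 then show ?thesis by (rule lborel_pair.AE_pair_measure[OF s])
qed

lemma borel_measurable_integral_param:
 fixes f :: "'a \<times> real => real"
 assumes "f : borel_measurable (N \<Otimes>\<^sub>M borel)"
 shows "(%x. \<integral>y. f (x, y) \<partial>lborel) : borel_measurable N"
proof -
 have "f : borel_measurable (N \<Otimes>\<^sub>M lborel)" using assms by (simp cong: measurable_cong_sets add: sets_pair_measure_cong[OF refl sets_lborel])
 then show ?thesis by (intro lborel.borel_measurable_lebesgue_integral) (simp add: case_prod_unfold)
qed

text \<open>Replaces a moving half-line by a fixed set evaluated at \<open>x - y\<close>, which
  makes the integrand jointly measurable.\<close>

lemma indicator_atMost_shift: "indicator {..x} y = (indicator {0..} (x - y) :: real)" for x y :: real by (auto split: split_indicator)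

lemma borel_measurable_integral_atMost:
 fixes g :: "real => real"
 assumes [measurable]: "g : borel_measurable borel"
 shows "(%x. \<integral>y. indicator {..x} y * g y \<partial>lborel) : borel_measurable borel"
 using borel_measurable_integral_param[of "%p::real\<times>real. indicator {0..} (fst p - snd p) * g (snd p)" borel] by (simp add: indicator_atMost_shift)

lemma borel_measurable_integral_atMost2:
 fixes v :: "real \<times> real => real"
 assumes [measurable]: "v : borel_measurable bor2"
 shows "(%z. \<integral>y. indicator {..fst z} y * v (y, snd z) \<partial>lborel) : borel_measurable bor2"
 using borel_measurable_integral_param[of "%p::(real\<times>real)\<times>real. indicator {0..} (fst (fst p) - snd p) * v (snd p, snd (fst p))" "borel \<Otimes>\<^sub>M borel"]
 by (simp add: indicator_atMost_shift)

lemma integral_atMost_antideriv: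
 fixes g :: "real => real"
 assumes g: "integrable lborel g" and cont: "continuous_on UNIV g"
 shows "((%x. \<integral>y. indicator {..x} y * g y \<partial>lborel) has_real_derivative g x) (at x)"
proof -
 let ?F = "%x. \<integral>y. indicator {..x} y * g y \<partial>lborel"
 have i: "set_integrable lborel A g" if "A : sets borel" for A using integrable_mult_indicator[OF _ g, of A] that by (simp add: set_integrable_def)
 have "ac_deriv (x - 1) (x + 1) ?F g"
 proof (rule ac_derivI)
  fix z assume z: "x - 1 <= z" "z <= x + 1"
  have "?F z = (LBINT y:({..x-1} \<union> {x-1<..z}). g y)"
   unfolding set_lebesgue_integral_def using z by (intro lint_cong) (auto split: split_indicator)
  also have "... = (LBINT y:{..x-1}. g y) + (LBINT y:{x-1<..z}. g y)" by (intro set_integral_Un i) auto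
  also have "(LBINT y:{x-1<..z}. g y) = (LBINT y:{x-1..z}. g y)"
  proof (rule set_integral_cong_set)
   show "AE y in lborel. (y : {x-1..z}) = (y : {x-1<..z})" using AE_lborel_singleton[of "x-1"] by eventually_elim auto
  qed (use i[of "{x-1..z}"] i[of "{x-1<..z}"] in "auto simp: set_integrable_def set_borel_measurable_def")
  finally show "?F z = ?F (x - 1) + (LBINT y:{x-1..z}. g y)" by (simp add: set_lebesgue_integral_def)
 qed (simp add: i)
 then have "(?F has_real_derivative g x) (at x within {x-1..x+1})" by (rule ac_deriv_has_derivative) (use continuous_on_subset[OF cont] in auto)
 then show ?thesis using at_within_interior[of x "{x-1..x+1}"] by simp
qed

lemma integrable_mult_bdd:
 fixes f g :: "'a => real"
 assumes f: "integrable M f" and g: "g : borel_measurable M" and C: "!!z. \<bar>g z\<bar> <= C"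
 shows "integrable M (%z. f z * g z)"
proof (rule lint_bound)
 show "integrable M (%z. C * f z)" using f by simp
 show "(%z. f z * g z) : borel_measurable M" using f g by auto
 show "AE z in M. norm (f z * g z) <= norm (C * f z)"
 proof (rule AE_I2)
  fix z show "norm (f z * g z) <= norm (C * f z)"
   using mult_left_mono[OF order_trans[OF C[of z] abs_ge_self[of C]], of "\<bar>f z\<bar>"] by (simp add: abs_mult mult.commute)
 qed
qed

text \<open>The test function is the primitive of a smooth approximation of the indicator of (x1,x2)
  minus a multiple of the fixed bump B. The multiple makes the mean zero, which is what gives the
  primitive compact support. Dominated convergence then replaces the approximations by the
  indicators.\<close>

lemma weak_derivative_box_identity:
 fixes u v :: "real \<times> real => real"
 assumes ab: "a <= x1" "x1 < x2" "x2 <= b" and cd: "c <= t1" "t1 < t2" "t2 <= d"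
  and B: "smooth_fun B" "integrable lborel B" "(LBINT x. B x) = 1" "!!x. \<bar>B x\<bar> <= C"
   "!!x. x ~: {p..q} ==> B x = 0" "{p..q} \<subseteq> {a<..<b}"
  and u: "integrable lb2 u" and v: "integrable lb2 v"
  and weak: "!!ch th. test_fun1 {a<..<b} ch ==> test_fun1 {c<..<d} th ==>
    (LINT z|lb2. u z * (deriv ch (fst z) * th (snd z))) = - (LINT z|lb2. v z * (ch (fst z) * th (snd z)))"
 defines "g \<equiv> %x. indicator {x1<..<x2} x - (x2 - x1) * B x"
 shows "(LINT z|lb2. u z * (g (fst z) * indicator {t1<..<t2} (snd z)))
   = - (LINT z|lb2. v z * ((LBINT y. indicator {..fst z} y * g y) * indicator {t1<..<t2} (snd z)))"
proof -
 have [measurable]: "B : borel_measurable borel" by (rule smooth_fun_borel[OF B(1)])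
 have um[measurable]: "u : borel_measurable bor2" "v : borel_measurable bor2" using u v by (auto dest!: borel_measurable_integrable cong: measurable_cong_sets)
 define z1 where "z1 = indicator_approx x1 x2"
 define z2 where "z2 = indicator_approx t1 t2"
 have [measurable]: "z1 n : borel_measurable borel" "z2 n : borel_measurable borel" for n
  by (auto simp: z1_def z2_def intro!: smooth_fun_borel indicator_approx_smooth)
 define m where "m n = (LBINT x. z1 n x)" for n
 have z1: "integrable lborel (z1 n)" "0 <= z1 n x" "z1 n x <= 1" "x ~: {x1<..<x2} ==> z1 n x = 0"
  "(%n. z1 n x) \<longlonglongrightarrow> indicator {x1<..<x2} x" for n x
  using ab by (auto simp: z1_def indicator_approx_integrable indicator_approx_bounds indicator_approx_support' indicator_approx_tendsto)
 have z2: "0 <= z2 n x" "z2 n x <= 1" "(%n. z2 n x) \<longlonglongrightarrow> indicator {t1<..<t2} x" for n x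
  using cd by (auto simp: z2_def indicator_approx_bounds indicator_approx_tendsto)
 have m_lim: "m \<longlonglongrightarrow> x2 - x1" unfolding m_def z1_def using indicator_approx_integral_tendsto ab by auto
 have m0: "0 <= m n" for n unfolding m_def using z1 by (intro integral_nonneg_AE) auto
 have m1: "m n <= x2 - x1" for n
 proof -
  have "m n <= (LBINT x. indicator {x1<..<x2} x)"
   unfolding m_def using z1 ab by (intro integral_mono) (auto split: split_indicator)
  then show ?thesis using ab by simp
 qed
 have C0: "C >= 0" using B(4)[of 0] by linarith
 define gn where "gn n x = z1 n x - m n * B x" for n x
 define Fn where "Fn n x = (LBINT y. indicator {..x} y * gn n y)" for n x
 define F where "F x = (LBINT y. indicator {..x} y * g y)" for x
 have [measurable]: "gn n : borel_measurable borel" "g : borel_measurable borel" for n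
  unfolding gn_def g_def by measurable
 have gni: "integrable lborel (gn n)" for n unfolding gn_def using z1(1) B(2) by simp
 have gn_lim: "(%n. gn n x) \<longlonglongrightarrow> g x" for x unfolding gn_def g_def by (intro tendsto_intros z1 m_lim)
 have gn_bd: "\<bar>gn n x\<bar> <= 1 + (x2 - x1) * C" for n x
 proof -
  have "\<bar>m n * B x\<bar> <= (x2 - x1) * C" unfolding abs_mult using m0[of n] m1[of n] B(4)[of x] C0 by (intro mult_mono) auto
  then show ?thesis using z1(2,3)[of n x] unfolding gn_def by linarith
 qed
 \<comment> \<open>An integrable majorant of all \<open>gn n\<close>, independent of n and of the
   point where the primitive is cut off.\<close>
 define K where "K y = indicator {x1<..<x2} y + (x2 - x1) * \<bar>B y\<bar>" for y
 have Ki: "integrable lborel K" unfolding K_def using ab B(2) by simp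
 have gn_K: "\<bar>indicator {..x} y * gn n y\<bar> <= K y" for n x y
 proof -
  have "\<bar>m n * B y\<bar> <= (x2 - x1) * \<bar>B y\<bar>" unfolding abs_mult using m0[of n] m1[of n] by (intro mult_right_mono) auto
  moreover have "\<bar>z1 n y\<bar> <= indicator {x1<..<x2} y" using z1(2,3)[of n y] z1(4)[of y n] by (auto split: split_indicator)
  moreover have "K y >= 0" unfolding K_def using ab by simp
  ultimately show ?thesis by (auto simp: gn_def K_def split: split_indicator)
 qed
 have Fn_lim: "(%n. Fn n x) \<longlonglongrightarrow> F x" for x
  unfolding Fn_def F_def
 proof (rule integral_dominated_convergence[where w = K])
  show "AE y in lborel. (%n. indicator {..x} y * gn n y) \<longlonglongrightarrow> indicator {..x} y * g y" by (intro AE_I2 tendsto_intros gn_lim)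
 qed (use gn_K Ki in auto)
 have Fn_bd: "\<bar>Fn n x\<bar> <= (LBINT y. K y)" for n x
 proof -
  have "integrable lborel (%y. indicator {..x} y * gn n y)" using integrable_mult_indicator[OF _ gni[of n], of "{..x}"] by simp
  then have "\<bar>Fn n x\<bar> <= (LBINT y. \<bar>indicator {..x} y * gn n y\<bar>)" unfolding Fn_def by (intro integral_abs_bound)
  also have "... <= (LBINT y. K y)" using gn_K Ki \<open>integrable lborel (%y. indicator {..x} y * gn n y)\<close> by (intro integral_mono) auto
  finally show ?thesis .
 qed
 have gn_smooth: "smooth_fun (gn n)" for n
 proof -
  have "smooth_fun (%x. z1 n x + (- m n) * B x)"
   unfolding z1_def by (intro smooth_add smooth_mult smooth_const indicator_approx_smooth B)
  then show ?thesis by (simp add: gn_def[abs_def])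
 qed
 have Fn_deriv: "(Fn n has_real_derivative gn n x) (at x)" for n x
  unfolding Fn_def by (intro integral_atMost_antideriv gni smooth_fun_continuous gn_smooth)
 have Fn_smooth: "smooth_fun (Fn n)" for n by (rule smooth_antideriv[OF gn_smooth Fn_deriv])
 have dFn: "deriv (Fn n) = gn n" for n using Fn_deriv by (auto intro!: DERIV_imp_deriv)
 have test_Fn: "test_fun1 {a<..<b} (Fn n)" for n
 proof -
  define dl where "dl = (x2 - x1) / (real n + 3)"
  have dl: "dl > 0" using ab by (simp add: dl_def)
  \<comment> \<open>An interval containing the supports of \<open>z1 n\<close> and B. To its left
    the primitive is trivially 0, to its right it equals the full integral, which is 0.\<close>
  define l r where "l = min (x1 + dl) p" and "r = max (x2 - dl) q"
  have pq: "p <= q" proof (rule ccontr)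
   assume "\<not> p <= q" then have "B = (%x. 0)" using B(5) by auto
   then show False using B(3) by simp
  qed
  have lr: "a < l" "r < b" using B(6) pq ab dl by (auto simp: l_def r_def)
  have gz: "gn n y = 0" if "y < l \<or> r < y" for y using that B(5)[of y] indicator_approx_support[OF ab(2), of y n]
   by (auto simp: gn_def l_def r_def z1_def dl_def)
  show ?thesis
  proof (rule test_fun1_smooth[OF Fn_smooth])
   show "{l..r} \<subseteq> {a<..<b}" using lr by auto
   fix x assume "x ~: {l..r}"
   then consider "x < l" | "r < x" by fastforce
   then show "Fn n x = 0"
   proof cases
    case 1
    then have "(%y. indicator {..x} y * gn n y) = (%y. 0)" using gz by (auto split: split_indicator)
    then show ?thesis by (simp add: Fn_def)
   next
    case 2
    then have "(%y. indicator {..x} y * gn n y) = gn n" using gz by (force split: split_indicator)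
    then have "Fn n x = (LBINT y. gn n y)" by (simp add: Fn_def)
    also have "... = 0" unfolding gn_def using z1(1) B(2,3) by (simp add: m_def)
    finally show ?thesis .
   qed
  qed
 qed
 have test_z2: "test_fun1 {c<..<d} (z2 n)" for n
 proof (rule test_fun1_smooth)
  show "smooth_fun (z2 n)" by (simp add: z2_def indicator_approx_smooth)
  define e where "e = (t2 - t1) / (real n + 3)"
  have "e > 0" using cd by (simp add: e_def)
  then show "{t1 + (t2 - t1) / (real n + 3) .. t2 - (t2 - t1) / (real n + 3)} \<subseteq> {c<..<d}"
   unfolding e_def[symmetric] using cd by auto
 qed (use indicator_approx_support[OF cd(2)] in "simp add: z2_def")
 have [measurable]: "Fn n : borel_measurable borel" "F : borel_measurable borel" for n
  unfolding Fn_def F_def by (auto intro!: borel_measurable_integral_atMost)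
 have L: "(%n. \<integral>z. u z * (gn n (fst z) * z2 n (snd z)) \<partial>lb2) \<longlonglongrightarrow> (LINT z|lb2. u z * (g (fst z) * indicator {t1<..<t2} (snd z)))"
 proof (rule integral_dominated_convergence[where w = "%z. \<bar>u z\<bar> * ((1 + (x2 - x1) * C) * 1)"])
  show "AE z in lb2. (%n. u z * (gn n (fst z) * z2 n (snd z))) \<longlonglongrightarrow> u z * (g (fst z) * indicator {t1<..<t2} (snd z))"
   by (intro AE_I2 tendsto_intros gn_lim z2)
  have "\<bar>u z * (gn n (fst z) * z2 n (snd z))\<bar> <= \<bar>u z\<bar> * ((1 + (x2 - x1) * C) * 1)" for n z
   unfolding abs_mult using gn_bd[of n "fst z"] z2(1,2)[of n "snd z"] ab C0 by (intro mult_mono) auto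
  then show "AE z in lb2. norm (u z * (gn n (fst z) * z2 n (snd z))) <= \<bar>u z\<bar> * ((1 + (x2 - x1) * C) * 1)" for n by simp
 qed (use u in auto)
 have R: "(%n. \<integral>z. v z * (Fn n (fst z) * z2 n (snd z)) \<partial>lb2) \<longlonglongrightarrow> (LINT z|lb2. v z * (F (fst z) * indicator {t1<..<t2} (snd z)))"
 proof (rule integral_dominated_convergence[where w = "%z. \<bar>v z\<bar> * ((LBINT y. K y) * 1)"])
  show "AE z in lb2. (%n. v z * (Fn n (fst z) * z2 n (snd z))) \<longlonglongrightarrow> v z * (F (fst z) * indicator {t1<..<t2} (snd z))"
   by (intro AE_I2 tendsto_intros Fn_lim z2)
  have K0: "(LBINT y. K y) >= 0" using Fn_bd[of 0 0] by linarith
  have "\<bar>v z * (Fn n (fst z) * z2 n (snd z))\<bar> <= \<bar>v z\<bar> * ((LBINT y. K y) * 1)" for n z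
   unfolding abs_mult using Fn_bd[of n "fst z"] z2(1,2)[of n "snd z"] K0 by (intro mult_mono) auto
  then show "AE z in lb2. norm (v z * (Fn n (fst z) * z2 n (snd z))) <= \<bar>v z\<bar> * ((LBINT y. K y) * 1)" for n by simp
 qed (use v in auto)
 have "(%n. \<integral>z. u z * (gn n (fst z) * z2 n (snd z)) \<partial>lb2) = (%n. - (LINT z|lb2. v z * (Fn n (fst z) * z2 n (snd z))))"
  using weak[OF test_Fn test_z2] by (simp add: dFn)
 then have "(%n. \<integral>z. u z * (gn n (fst z) * z2 n (snd z)) \<partial>lb2) \<longlonglongrightarrow> - (LINT z|lb2. v z * (F (fst z) * indicator {t1<..<t2} (snd z)))"
  using tendsto_minus[OF R] by simp
 from LIMSEQ_unique[OF L this] show ?thesis unfolding F_def .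
qed

text \<open>The du Bois-Reymond argument with t as a parameter. Let r be u minus the primitive of v.
  Over every box r has the same integral as a function k of t alone, the mean of r against a fixed
  bump, so \<open>r = k\<close> almost everywhere.\<close>

lemma weak_derivative_representation:
 fixes u v :: "real \<times> real => real"
 assumes ab: "a < b"
  and u: "integrable lb2 u" and v: "integrable lb2 v"
  and u0: "!!z. z ~: {a<..<b} \<times> {c<..<d} ==> u z = 0"
  and v0: "!!z. z ~: {a<..<b} \<times> {c<..<d} ==> v z = 0"
  and weak: "!!ch th. test_fun1 {a<..<b} ch ==> test_fun1 {c<..<d} th ==>
    (LINT z|lb2. u z * (deriv ch (fst z) * th (snd z))) = - (LINT z|lb2. v z * (ch (fst z) * th (snd z)))"
 shows "\<exists>k\<in>borel_measurable borel. AE z in lb2. z : {a<..<b} \<times> {c<..<d} -->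
   u z = k (snd z) + (LBINT y. indicator {..fst z} y * v (y, snd z))"
proof -
 have um[measurable]: "u : borel_measurable bor2" "v : borel_measurable bor2" using u v by (auto dest!: borel_measurable_integrable cong: measurable_cong_sets)
 \<comment> \<open>The bump lives on the middle half of (a,b); it is normalised by its integral,
   which is positive for some n.\<close>
 define p q where "p = (3 * a + b) / 4" and "q = (a + 3 * b) / 4"
 have pq: "a < p" "p < q" "q < b" using ab by (auto simp: p_def q_def field_simps)
 obtain n where n: "(LBINT x. indicator_approx p q n x) > 0"
 proof -
  have "\<forall>\<^sub>F n in sequentially. (LBINT x. indicator_approx p q n x) > 0"
   using order_tendstoD(1)[OF indicator_approx_integral_tendsto[OF pq(2)], of 0] pq by simp
  then show thesis using that by (auto simp: eventually_sequentially)
 qed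
 define I where "I = (LBINT x. indicator_approx p q n x)"
 define B where "B x = 1 / I * indicator_approx p q n x" for x
 have "smooth_fun B" unfolding B_def by (intro smooth_mult smooth_const indicator_approx_smooth)
 then have B: "smooth_fun B" "integrable lborel B" "(LBINT x. B x) = 1" "\<bar>B x\<bar> <= 1 / I"
   "x ~: {p..q} ==> B x = 0" "{p..q} \<subseteq> {a<..<b}" for x
  unfolding B_def using n pq indicator_approx_bounds[of p q n x] indicator_approx_support'[OF pq(2), of x n]
  by (auto simp: I_def[symmetric] abs_mult divide_right_mono
    intro!: indicator_approx_integrable)
 have [measurable]: "B : borel_measurable borel" by (rule smooth_fun_borel[OF B(1)])
 define vh where "vh z = indicator {a<..<b} (fst z) * (LBINT y. indicator {..fst z} y * v (y, snd z))" for z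
 have [measurable]: "vh : borel_measurable bor2"
  unfolding vh_def using borel_measurable_integral_atMost2[OF um(2)] by measurable
 have vslice: "AE t in lborel. integrable lborel (%y. v (y, t))" by (rule slice_Fubini(1)[OF v])
 define N where "N t = (LBINT y. \<bar>v (y, t)\<bar>)" for t
 have Ni: "integrable lborel N" unfolding N_def using slice_Fubini(2)[of "%z. \<bar>v z\<bar>"] v by simp
 have vh_bd: "AE z in lb2. \<bar>vh z\<bar> <= indicator {a<..<b} (fst z) * N (snd z)"
 proof -
  have "AE t in lborel. AE x in lborel. \<bar>vh (x, t)\<bar> <= indicator {a<..<b} x * N t" using vslice
  proof eventually_elim
   case (elim t)
   show ?case
   proof (rule AE_I2)
    fix x
    have i: "integrable lborel (%y. indicator {..x} y * v (y, t))" using integrable_mult_indicator[OF _ elim, of "{..x}"] by simp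
    have "\<bar>\<integral>y. indicator {..x} y * v (y, t) \<partial>lborel\<bar> <= (LBINT y. \<bar>indicator {..x} y * v (y, t)\<bar>)"
     by (rule integral_abs_bound)
    also have "... <= N t" unfolding N_def using i elim by (intro integral_mono) (auto split: split_indicator)
    finally show "\<bar>vh (x, t)\<bar> <= indicator {a<..<b} x * N t" by (auto simp: vh_def split: split_indicator)
   qed
  qed
  moreover have [measurable]: "N : borel_measurable borel" using borel_measurable_integrable[OF Ni] by simp
  have "Measurable.pred (borel \<Otimes>\<^sub>M borel) (%z. \<bar>vh z\<bar> <= indicator {a<..<b} (fst z) * N (snd z))" by measurable
  ultimately show ?thesis by (intro AE_lb2I) auto
 qed
 have vhi: "integrable lb2 vh"
 proof (rule lint_bound)
  show "integrable lb2 (%z. indicator {a<..<b} (fst z) * N (snd z))" using ab Ni by (intro integrable_tensor) auto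
  show "AE z in lb2. norm (vh z) <= norm (indicator {a<..<b} (fst z) * N (snd z))" using vh_bd by eventually_elim auto
 qed measurable
 define r where "r z = u z - vh z" for z
 have ri: "integrable lb2 r" unfolding r_def using u vhi by simp
 have [measurable]: "r : borel_measurable bor2" unfolding r_def by measurable
 \<comment> \<open>The candidate for the constant of integration on the slice at time t.\<close>
 define k where "k t = (LBINT y. r (y, t) * B y)" for t
 have km[measurable]: "k : borel_measurable borel"
  unfolding k_def using borel_measurable_integral_param[of "%p. r (snd p, fst p) * B (snd p)" borel] by simp
 have rB: "integrable lb2 (%z. r z * B (fst z))" using B by (intro integrable_mult_bdd[OF ri, where C = "1 / I"]) auto
 have ki: "integrable lborel k" unfolding k_def using slice_Fubini(2)[OF rB] by simp
 define w where "w z = indicator ({a<..<b} \<times> {c<..<d}) z * (r z - k (snd z))" for z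
 have w_alt: "w z = indicator {a<..<b} (fst z) * indicator {c<..<d} (snd z) * (r z - k (snd z))" for z by (cases z) (auto simp: w_def split: split_indicator)
 have tk: "integrable lb2 (%z. indicator {a<..<b} (fst z) * k (snd z))" using ab ki by (intro integrable_tensor) auto
 have wi: "integrable lb2 w"
 proof -
  have "integrable lb2 (%z. r z * (indicator {a<..<b} (fst z) * indicator {c<..<d} (snd z)))"
   by (rule integrable_mult_bdd[OF ri, where C = 1]) (auto split: split_indicator)
  moreover have "integrable lb2 (%z. (indicator {a<..<b} (fst z) * k (snd z)) * indicator {c<..<d} (snd z))"
   by (rule integrable_mult_bdd[OF tk, where C = 1]) (auto split: split_indicator)
  ultimately have "integrable lb2 (%z. r z * (indicator {a<..<b} (fst z) * indicator {c<..<d} (snd z)) - (indicator {a<..<b} (fst z) * k (snd z)) * indicator {c<..<d} (snd z))"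
   by (rule lint_diff)
  also have "(%z. r z * (indicator {a<..<b} (fst z) * indicator {c<..<d} (snd z)) - (indicator {a<..<b} (fst z) * k (snd z)) * indicator {c<..<d} (snd z)) = w"
   by (auto simp: w_alt fun_eq_iff algebra_simps)
  finally show ?thesis .
 qed
 have box: "(LINT z|lb2. indicator ({x1<..<x2} \<times> {t1<..<t2}) z * (r z - k (snd z))) = 0"
  if x: "a <= x1" "x1 < x2" "x2 <= b" and t: "c <= t1" "t1 < t2" "t2 <= d" for x1 x2 t1 t2
 proof -
  define g where "g x = indicator {x1<..<x2} x - (x2 - x1) * B x" for x
  define F where "F x = (LBINT y. indicator {..x} y * g y)" for x
  have [measurable]: "g : borel_measurable borel" unfolding g_def by measurable
  have [measurable]: "F : borel_measurable borel" unfolding F_def by (auto intro!: borel_measurable_integral_atMost)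
  have gi: "integrable lborel g" unfolding g_def using B x by auto
  have gint: "(LBINT x. g x) = 0" unfolding g_def using B x by simp
  have gbd: "\<bar>g y\<bar> <= 1 + (x2 - x1) * (1 / I)" for y
  proof -
   have "\<bar>(x2 - x1) * B y\<bar> <= (x2 - x1) * (1 / I)" unfolding abs_mult using B(4)[of y] x by (intro mult_mono) auto
   moreover have "\<bar>indicator {x1<..<x2} y :: real\<bar> <= 1" by (auto split: split_indicator)
   ultimately show ?thesis unfolding g_def by linarith
  qed
  have Fbd: "\<bar>F y\<bar> <= (LBINT x. \<bar>g x\<bar>)" for y
  proof -
   have i: "integrable lborel (%x. indicator {..y} x * g x)" using integrable_mult_indicator[OF _ gi, of "{..y}"] by simp
   have "\<bar>F y\<bar> <= (LBINT x. \<bar>indicator {..y} x * g x\<bar>)" unfolding F_def by (rule integral_abs_bound)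
   also have "... <= (LBINT x. \<bar>g x\<bar>)" using i gi by (intro integral_mono) (auto split: split_indicator)
   finally show ?thesis .
  qed
  have g0: "g y = 0" if "y ~: {a<..<b}" for y
  proof -
   have "y ~: {p..q}" using that B(6) by blast
   then show ?thesis using that B(5)[of y] x by (auto simp: g_def split: split_indicator)
  qed
  let ?T = "%z::real\<times>real. indicator {t1<..<t2} (snd z) :: real"
  have id: "(LINT z|lb2. u z * (g (fst z) * ?T z)) = - (LINT z|lb2. v z * (F (fst z) * ?T z))"
   unfolding F_def g_def by (rule weak_derivative_box_identity[OF x t B(1-3) B(4) B(5) B(6) u v weak])
  have vF: "integrable lb2 (%z. v z * (F (fst z) * ?T z))" by (rule integrable_mult_bdd[OF v, where C = "\<integral>x. \<bar>g x\<bar> \<partial>lborel"])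
     (use Fbd order_trans[OF abs_ge_zero Fbd] in "auto split: split_indicator")
  have vhg: "integrable lb2 (%z. vh z * (g (fst z) * ?T z))" and ug: "integrable lb2 (%z. u z * (g (fst z) * ?T z))"
  proof -
   have "\<bar>g (fst z) * ?T z\<bar> <= 1 + (x2 - x1) * (1 / I)" for z using gbd[of "fst z"] order_trans[OF abs_ge_zero gbd] by (simp split: split_indicator)
   then show "integrable lb2 (%z. vh z * (g (fst z) * ?T z))" "integrable lb2 (%z. u z * (g (fst z) * ?T z))" by (intro integrable_mult_bdd vhi u; measurable)+
  qed
  \<comment> \<open>The triangle identity on almost every slice moves the primitive from g to v. The
    product of the two total integrals drops out because g has mean zero.\<close>
  have "(LINT z|lb2. v z * (F (fst z) * ?T z)) = (LBINT t. (LBINT x. v (x, t) * (F x * indicator {t1<..<t2} t)))" using slice_Fubini(3)[OF vF] by simp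
  also have "... = (LBINT t. - (LBINT x. vh (x, t) * (g x * indicator {t1<..<t2} t)))"
  proof (rule integral_cong_AE)
   show "AE t in lborel. (LBINT x. v (x, t) * (F x * indicator {t1<..<t2} t))
     = - (LBINT x. vh (x, t) * (g x * indicator {t1<..<t2} t))" using vslice
   proof eventually_elim
    case (elim t)
    have "(LBINT x. v (x, t) * F x) + (LBINT y. g y * (LBINT x. indicator {..y} x * v (x, t))) = 0"
     using integral_triangle_sum(1)[OF elim gi] gint unfolding F_def by simp
    moreover have "(%y. g y * (LBINT x. indicator {..y} x * v (x, t))) = (%y. vh (y, t) * g y)"
     using g0 by (auto simp: vh_def fun_eq_iff split: split_indicator)
    ultimately have "(LBINT x. v (x, t) * F x) = - (LBINT x. vh (x, t) * g x)" by simp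
    then show ?case by (auto split: split_indicator)
   qed
  qed (use slice_Fubini(2)[OF vF] slice_Fubini(2)[OF vhg] in "auto dest: borel_measurable_integrable")
  also have "... = - (LINT z|lb2. vh z * (g (fst z) * ?T z))" using slice_Fubini(3)[OF vhg] by simp
  finally have "(LINT z|lb2. u z * (g (fst z) * ?T z)) = (LINT z|lb2. vh z * (g (fst z) * ?T z))" using id by simp
  then have "(LINT z|lb2. u z * (g (fst z) * ?T z) - vh z * (g (fst z) * ?T z)) = 0" using ug vhg by simp
  then have rg: "(LINT z|lb2. r z * (g (fst z) * ?T z)) = 0" by (simp add: r_def left_diff_distrib)
  have i1: "integrable lb2 (%z. r z * (indicator {x1<..<x2} (fst z) * ?T z))" by (rule integrable_mult_bdd[OF ri, where C = 1]) (auto split: split_indicator)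
  have i2: "integrable lb2 (%z. r z * B (fst z) * ?T z)" by (rule integrable_mult_bdd[OF rB, where C = 1]) (auto split: split_indicator)
  have ik: "integrable lborel (%t. k t * indicator {t1<..<t2} t)" by (rule integrable_mult_bdd[OF ki, where C = 1]) (auto split: split_indicator)
  have i3: "integrable lb2 (%z. indicator {x1<..<x2} (fst z) * (k (snd z) * ?T z))" using integrable_tensor[OF _ ik, of "indicator {x1<..<x2}"] x by simp
  have "r z * (g (fst z) * ?T z) = r z * (indicator {x1<..<x2} (fst z) * ?T z) - (x2 - x1) * (r z * B (fst z) * ?T z)" for z by (simp add: g_def algebra_simps)
  then have "(LINT z|lb2. r z * (indicator {x1<..<x2} (fst z) * ?T z)) = (x2 - x1) * (LINT z|lb2. r z * B (fst z) * ?T z)" using rg i1 i2 by simp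
  also have "(LINT z|lb2. r z * B (fst z) * ?T z) = (LBINT t. k t * indicator {t1<..<t2} t)" using slice_Fubini(3)[OF i2] by (simp add: k_def)
  also have "(x2 - x1) * (LBINT t. k t * indicator {t1<..<t2} t) = (LINT z|lb2. indicator {x1<..<x2} (fst z) * (k (snd z) * ?T z))"
   using slice_Fubini(6)[OF i3] x by simp
  finally have "(LINT z|lb2. r z * (indicator {x1<..<x2} (fst z) * ?T z) - indicator {x1<..<x2} (fst z) * (k (snd z) * ?T z)) = 0" using i1 i3 by simp
  also have "(%z. r z * (indicator {x1<..<x2} (fst z) * ?T z) - indicator {x1<..<x2} (fst z) * (k (snd z) * ?T z))
    = (%z. indicator ({x1<..<x2} \<times> {t1<..<t2}) z * (r z - k (snd z)))"
  proof
   fix z show "r z * (indicator {x1<..<x2} (fst z) * ?T z) - indicator {x1<..<x2} (fst z) * (k (snd z) * ?T z)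
     = indicator ({x1<..<x2} \<times> {t1<..<t2}) z * (r z - k (snd z))" by (cases z) (auto split: split_indicator)
  qed
  finally show ?thesis .
 qed
 have "AE z in lborel. w z = 0"
 proof (rule AE_zero_if_box_integrals_zero)
  show "integrable lborel w" using wi by (simp add: lborel_prod)
  fix A B :: "real \<times> real"
  \<comment> \<open>An arbitrary box is clipped to the rectangle, outside of which w is 0; what
    remains is a box of the kind just treated, or empty.\<close>
  define x1 x2 t1 t2 where "x1 = max a (fst A)" and "x2 = min b (fst B)" and "t1 = max c (snd A)" and "t2 = min d (snd B)"
  have e: "indicator (box A B) z * w z = indicator ({x1<..<x2} \<times> {t1<..<t2}) z * (r z - k (snd z))" for z
   by (cases z) (auto simp: box_prod w_def x1_def x2_def t1_def t2_def split: split_indicator)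
  show "(LBINT z. indicator (box A B) z * w z) = 0"
  proof (cases "x1 < x2 & t1 < t2")
   case True
   then show ?thesis using box[of x1 x2 t1 t2] unfolding e lborel_prod by (auto simp: x1_def x2_def t1_def t2_def)
  next
   case False
   then have "(%z. indicator (box A B) z * w z) = (%z. 0)"
    unfolding e by (auto simp: fun_eq_iff split: split_indicator)
   then show ?thesis by (simp only: Bochner_Integration.integral_zero)
  qed
 qed
 then have "AE z in lb2. w z = 0" unfolding lborel_prod .
 then have "AE z in lb2. z : {a<..<b} \<times> {c<..<d} -->
   u z = k (snd z) + (LBINT y. indicator {..fst z} y * v (y, snd z))"
 proof eventually_elim
  case (elim z)
  show ?case
  proof
   assume z: "z : {a<..<b} \<times> {c<..<d}"
   then have "r z = k (snd z)" "fst z : {a<..<b}" using elim by (auto simp: w_def mem_Times_iff)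
   then show "u z = k (snd z) + (LBINT y. indicator {..fst z} y * v (y, snd z))" by (simp add: r_def vh_def)
  qed
 qed
 then show ?thesis using km by blast
qed

section \<open>Averages of square integrable functions\<close>

lemma square_add_le: "((x::real) + y)^2 <= 2 * x^2 + 2 * y^2" using zero_le_power2[of "x - y"] by (simp add: power2_eq_square algebra_simps)

lemma clamp_abs_le: "\<bar>max (- n) (min n x)\<bar> <= n" if "n >= 0" for n x :: real using that by (auto simp: max_def min_def abs_le_iff)

lemma sqint_indicator_Icc: "sqint lborel (indicator {a..b} :: real => real)" by (rule sqint_indicator) (auto simp: emeasure_lborel_Icc_eq)

lemma integrable_indicator_Icc: "integrable lborel (indicator {a..b} :: real => real)" by (rule integrable_real_indicator) (auto simp: emeasure_lborel_Icc_eq)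

lemma clamp_bounded_approx:
 fixes f :: "real => real"
 assumes f: "sqint lborel f" and e: "e > 0"
 shows "\<exists>n::nat. (LBINT x. (f x - indicator {-real n..real n} x * max (- real n) (min (real n) (f x)))^2) < e"
proof -
 have [measurable]: "f : borel_measurable borel" using sqint_measurable[OF f] by simp
 define g where "g n x = indicator {-real n..real n} x * max (- real n) (min (real n) (f x))" for n x
 have "(%n. \<integral>x. (f x - g n x)^2 \<partial>lborel) \<longlonglongrightarrow> (\<integral>x. 0 \<partial>(lborel :: real measure))"
 proof (rule integral_dominated_convergence[where w = "%x. (f x)^2"])
  show "(%x. (f x - g n x)^2) : borel_measurable lborel" for n unfolding g_def by measurable
  show "integrable lborel (%x. (f x)^2)" by (rule sqintD[OF f])
  have "(%n. (f x - g n x)^2) \<longlonglongrightarrow> 0" for x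
  proof (rule tendsto_eventually)
   obtain N where N: "real N >= \<bar>x\<bar> + \<bar>f x\<bar>" using real_arch_simple by blast
   show "\<forall>\<^sub>F n in sequentially. (f x - g n x)^2 = 0" using eventually_ge_at_top[of N]
   proof eventually_elim
    case (elim n)
    then have "real n >= \<bar>x\<bar> + \<bar>f x\<bar>" using N by linarith
    then have "g n x = f x" by (auto simp: g_def max_def min_def split: split_indicator)
    then show ?case by simp
   qed
  qed
  then show "AE x in lborel. (%n. (f x - g n x)^2) \<longlonglongrightarrow> 0" by simp
  have "\<bar>f x - g n x\<bar> <= \<bar>f x\<bar>" for n x by (auto simp: g_def max_def min_def split: split_indicator)
  then have "(f x - g n x)^2 <= (f x)^2" for n x by (rule abs_le_square_iff[THEN iffD1])
  then show "AE x in lborel. norm ((f x - g n x)^2) <= (f x)^2" for n by simp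
 qed simp
 then have "\<forall>\<^sub>F n in sequentially. (LBINT x. (f x - g n x)^2) < e" using order_tendstoD(2) e by fastforce
 then show ?thesis unfolding g_def by (auto simp: eventually_sequentially)
qed

text \<open>After truncating values and support, f is almost everywhere a limit of continuous
  functions; these are clamped and multiplied by a continuous cutoff so that a fixed square
  integrable majorant exists.\<close>

lemma continuous_dense_sqint:
 fixes f :: "real => real"
 assumes f: "sqint lborel f" and e: "e > 0"
 shows "\<exists>g M. continuous_on UNIV g & (\<forall>x. \<bar>g x\<bar> <= M) & (\<forall>x. \<bar>x\<bar> > M --> g x = 0) \<and>
   sqint lborel g & (LBINT x. (f x - g x)^2) < e"
proof -
 have [measurable]: "f : borel_measurable borel" using sqint_measurable[OF f] by simp
 \<comment> \<open>\<open>square_add_le\<close> doubles both squared errors, so each has to stay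
   below a quarter of e.\<close>
 obtain N :: nat where N: "(LBINT x. (f x - indicator {-real N..real N} x * max (- real N) (min (real N) (f x)))^2) < e / 4"
  using clamp_bounded_approx[OF f, of "e / 4"] e by auto
 define n where "n = real N"
 define f1 where "f1 x = indicator {-n..n} x * max (- n) (min n (f x))" for x
 have n0: "n >= 0" by (simp add: n_def)
 have [measurable]: "f1 : borel_measurable borel" unfolding f1_def by measurable
 have ff1: "(LBINT x. (f x - f1 x)^2) < e / 4" using N by (simp add: f1_def n_def)
 have f1sq: "sqint lborel f1" by (rule sqint_bound[OF f, where C = 1]) (auto simp: f1_def max_def min_def n0 split: split_indicator)
 have "f1 measurable_on UNIV" by (rule lebesgue_measurable_imp_measurable_on) (auto intro: measurable_completion)
 then obtain Z G where Z: "negligible Z" and G: "!!k. continuous_on UNIV (G k)"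
  and lim: "!!x. x ~: Z ==> (%k. G k x) \<longlonglongrightarrow> f1 x"
  unfolding measurable_on_def by auto
 define h where "h k x = max 0 (min 1 (n + 1 - \<bar>x\<bar>)) * max (- n) (min n (G k x))" for k x
 have hc: "continuous_on UNIV (h k)" for k unfolding h_def by (intro continuous_intros G)
 have [measurable]: "h k : borel_measurable borel" for k by (rule borel_measurable_continuous_onI[OF hc])
 have h_bd: "\<bar>h k x\<bar> <= n * indicator {-(n+1)..n+1} x" for k x
 proof -
  have "\<bar>h k x\<bar> <= 1 * n" unfolding h_def abs_mult by (intro mult_mono clamp_abs_le n0) auto
  moreover have "h k x = 0" if "x ~: {-(n+1)..n+1}" using that by (auto simp: h_def)
  ultimately show ?thesis by (auto split: split_indicator)
 qed
 have f1_bd: "\<bar>f1 x\<bar> <= n * indicator {-(n+1)..n+1} x" for x using clamp_abs_le[OF n0, of "f x"] by (auto simp: f1_def split: split_indicator)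
 have ind: "sqint lborel (%x. n * indicator {-(n+1)..n+1} x)" by (intro sqint_cmult sqint_indicator_Icc)
 have hsq: "sqint lborel (h k)" for k by (rule sqint_bound[OF ind, where C = 1]) (use h_bd n0 in "auto simp: abs_mult")
 have "(%k. \<integral>x. (f1 x - h k x)^2 \<partial>lborel) \<longlonglongrightarrow> (\<integral>x. 0 \<partial>(lborel :: real measure))"
 proof (rule integral_dominated_convergence[where w = "%x. (2 * (n * indicator {-(n+1)..n+1} x))^2"])
  show "integrable lborel (%x. (2 * (n * indicator {-(n+1)..n+1} x))^2)" using sqintD[OF sqint_cmult[OF ind, of 2]] .
  have "AE x in lebesgue. x ~: Z" using Z by (simp add: AE_not_in negligible_iff_null_sets)
  then have "AE x in lborel. x ~: Z" by (simp add: AE_completion_iff)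
  then show "AE x in lborel. (%k. (f1 x - h k x)^2) \<longlonglongrightarrow> 0"
  proof eventually_elim
   case (elim x)
   have "(%k. h k x) \<longlonglongrightarrow> max 0 (min 1 (n + 1 - \<bar>x\<bar>)) * max (- n) (min n (f1 x))"
    unfolding h_def by (intro tendsto_intros lim elim)
   also have "max 0 (min 1 (n + 1 - \<bar>x\<bar>)) * max (- n) (min n (f1 x)) = f1 x" using clamp_abs_le[OF n0, of "f x"] n0
    by (cases "x : {-n..n}") (auto simp: f1_def)
   finally have "(%k. (f1 x - h k x)^2) \<longlonglongrightarrow> (f1 x - f1 x)^2" by (intro tendsto_intros)
   then show ?case by simp
  qed
  have "\<bar>f1 x - h k x\<bar> <= \<bar>2 * (n * indicator {-(n+1)..n+1} x)\<bar>" for k x using f1_bd[of x] h_bd[of k x] by linarith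
  then have "(f1 x - h k x)^2 <= (2 * (n * indicator {-(n+1)..n+1} x))^2" for k x by (rule abs_le_square_iff[THEN iffD1])
  then show "AE x in lborel. norm ((f1 x - h k x)^2) <= (2 * (n * indicator {-(n+1)..n+1} x))^2" for k by simp
 qed simp_all
 then have "\<forall>\<^sub>F k in sequentially. (LBINT x. (f1 x - h k x)^2) < e / 4"
  using order_tendstoD(2)[of _ "\<integral>x. 0 \<partial>(lborel :: real measure)" sequentially "e / 4"] e by simp
 then obtain k where k: "(LBINT x. (f1 x - h k x)^2) < e / 4" by (auto simp: eventually_sequentially)
 have s: "integrable lborel (%x. (f x - f1 x)^2)" "integrable lborel (%x. (f1 x - h k x)^2)" "integrable lborel (%x. (f x - h k x)^2)"
  using f f1sq hsq[of k] by (auto intro!: sqintD sqint_diff)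
 have "(LBINT x. (f x - h k x)^2) <= (LBINT x. 2 * (f x - f1 x)^2 + 2 * (f1 x - h k x)^2)"
 proof (rule integral_mono)
  show "(f x - h k x)^2 <= 2 * (f x - f1 x)^2 + 2 * (f1 x - h k x)^2" for x using square_add_le[of "f x - f1 x" "f1 x - h k x"] by simp
 qed (use s in auto)
 also have "... < e" using s ff1 k by simp
 finally have "(LBINT x. (f x - h k x)^2) < e" .
 moreover have "\<bar>h k x\<bar> <= n + 1" "\<bar>x\<bar> > n + 1 ==> h k x = 0" for x using h_bd[of k x] n0 by (auto split: split_indicator_asm)
 ultimately show ?thesis by (intro exI[of _ "h k"] exI[of _ "n + 1"] conjI allI impI hc hsq)
qed

text \<open>The forward Steklov average. Applied to the derivative of an absolutely continuous
  function it is the difference quotient of that function.\<close>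

definition avg :: "real => (real => real) => real => real" where
 "avg h f t = (1 / h) * (LBINT sg. indicator {0..h} sg * f (t + sg))"

lemma integral_shift: "(LBINT x. f (x + t)) = (LBINT x. f x)" for f :: "real => real" using lborel_integral_real_affine[of 1 f t] by (simp add: add.commute)

lemma integrable_shift: "integrable lborel f ==> integrable lborel (%x. f (x + t))" for f :: "real => real"
 using lborel_integrable_real_affine[of f 1 t] by (simp add: add.commute)

lemma sqint_shift:
 "sqint lborel f ==> sqint lborel (%x. f (x + t))" for f :: "real => real"
 unfolding sqint_def using integrable_shift[of "%x. (f x)^2" t] by auto

lemma AE_shift:
 assumes "AE t in lborel. P t"
 shows "AE t in lborel. P (t + h :: real)"
proof -
 have "AE x in distr lborel borel ((+) h). P x" using assms unfolding lborel_distr_plus .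
 from AE_distrD[OF _ this] show ?thesis by (simp add: add.commute)
qed

lemma avg_measurable[measurable]:
 assumes [measurable]: "f : borel_measurable borel"
 shows "avg h f : borel_measurable borel"
 unfolding avg_def[abs_def] using borel_measurable_integral_param[of "%p. indicator {0..h} (snd p) * f (fst p + snd p)" borel] by simp

text \<open>Cauchy-Schwarz over the window bounds the squared average by the average of the square,
  and translation invariance integrates this. The point is that the bound does not depend on
  h.\<close>

lemma avg_sqint:
 assumes f: "sqint lborel f" and h: "h > 0"
 shows "sqint lborel (avg h f)" "(LBINT t. (avg h f t)^2) <= (LBINT t. (f t)^2)"
proof -
 have [measurable]: "f : borel_measurable borel" using sqint_measurable[OF f] by simp
 define K where "K z = indicator {0..h} (fst z) * (f (snd z + fst z))^2" for z
 have [measurable]: "K : borel_measurable bor2" unfolding K_def by measurable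
 have Kx: "integrable lborel (%t. K (x, t))" "(LBINT t. K (x, t)) = indicator {0..h} x * (LBINT t. (f t)^2)" for x
  unfolding K_def using integrable_shift[OF sqintD[OF f], of x] integral_shift[of "%t. (f t)^2" x] by simp_all
 have Ki: "integrable lb2 K"
 proof (rule lborel_pair.Fubini_integrable)
  have "(LBINT t. norm (K (x, t))) = indicator {0..h} x * (LBINT t. (f t)^2)" for x using Kx(2)[of x] by (simp add: K_def)
  then show "integrable lborel (%x. \<integral>t. norm (K (x, t)) \<partial>lborel)" by (simp add: integrable_indicator_Icc)
 qed (use Kx in auto)
 have pt: "(avg h f t)^2 <= 1 / h * (LBINT sg. K (sg, t))" for t
 proof -
  have s1: "sqint lborel (indicator {0..h} :: real => real)" by (rule sqint_indicator_Icc)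
  have s2: "sqint lborel (%sg. indicator {0..h} sg * f (t + sg))" using sqint_shift[OF f, of t]
   by (intro sqint_mult_bounded[where C = 1]) (auto simp: add.commute split: split_indicator)
  have "(LBINT sg. indicator {0..h} sg * (indicator {0..h} sg * f (t + sg)))^2
    <= (LBINT sg. (indicator {0..h} sg)^2) * (LBINT sg. (indicator {0..h} sg * f (t + sg))^2)" by (rule Cauchy_Schwarz_integral[OF s1 s2])
  also have "(%sg. (indicator {0..h} sg)^2) = (indicator {0..h} :: real => real)" by (auto split: split_indicator)
  also have "(%sg. (indicator {0..h} sg * f (t + sg))^2) = (%sg. K (sg, t))" by (auto simp: K_def split: split_indicator)
  also have "(%sg. indicator {0..h} sg * (indicator {0..h} sg * f (t + sg))) = (%sg. indicator {0..h} sg * f (t + sg))" by (auto split: split_indicator)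
  finally have "(LBINT sg. indicator {0..h} sg * f (t + sg))^2 <= h * (LBINT sg. K (sg, t))" using h by simp
  then have "(LBINT sg. indicator {0..h} sg * f (t + sg))^2 / h^2 <= h * (LBINT sg. K (sg, t)) / h^2" by (rule divide_right_mono) simp
  then show ?thesis using h by (simp add: avg_def power_divide power_mult_distrib power2_eq_square)
 qed
 have Kt: "integrable lborel (%t. \<integral>sg. K (sg, t) \<partial>lborel)" by (rule slice_Fubini(2)[OF Ki])
 have K0: "(LBINT sg. K (sg, t)) >= 0" for t by (simp add: K_def)
 have int: "integrable lborel (%t. (avg h f t)^2)"
 proof (rule lint_bound)
  show "integrable lborel (%t. 1 / h * (LBINT sg. K (sg, t)))" using Kt by simp
  show "AE t in lborel. norm ((avg h f t)^2) <= norm (1 / h * (LBINT sg. K (sg, t)))" using pt K0 h by simp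
 qed measurable
 then show "sqint lborel (avg h f)" by (simp add: sqint_def)
 have "(LBINT t. (avg h f t)^2) <= (LBINT t. 1 / h * (LBINT sg. K (sg, t)))" using int Kt pt by (intro integral_mono) auto
 also have "... = 1 / h * (LBINT x. \<integral>t. K (x, t) \<partial>lborel)" using slice_Fubini(3,6)[OF Ki] by simp
 also have "... = (LBINT t. (f t)^2)" using h by (simp add: Kx)
 finally show "(LBINT t. (avg h f t)^2) <= (LBINT t. (f t)^2)" .
qed

lemma avg_diff:
 assumes f: "sqint lborel f" and g: "sqint lborel g"
 shows "avg h (%t. f t - g t) t = avg h f t - avg h g t"
proof -
 have "integrable lborel (%sg. indicator {0..h} sg * F (t + sg))" if "sqint lborel F" for F using sqint_shift[OF that, of t]
  by (intro sqint_mult sqint_indicator_Icc) (simp add: add.commute)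
 from this[OF f] this[OF g] show ?thesis by (simp add: avg_def right_diff_distrib)
qed

lemma avg_continuous_tendsto:
 assumes c: "continuous_on UNIV c" and h: "h \<longlonglongrightarrow> 0" "!!n. h n > 0"
 shows "(%n. avg (h n) c t) \<longlonglongrightarrow> c t"
proof (rule LIMSEQ_I)
 fix r :: real assume r: "r > 0"
 have "isCont c t" using c by (simp add: continuous_on_eq_continuous_at)
 then obtain d where d: "d > 0" "!!x. \<bar>x - t\<bar> < d ==> \<bar>c x - c t\<bar> < r / 2"
  using r unfolding continuous_at_eps_delta dist_real_def by (metis half_gt_zero)
 obtain N where N: "!!n. n >= N ==> h n < d" using order_tendstoD(2)[OF h(1) d(1)] by (auto simp: eventually_sequentially)
 have "norm (avg (h n) c t - c t) < r" if n: "n >= N" for n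
 proof -
  have ci: "integrable lborel (%sg. indicator {0..h n} sg * c (t + sg))"
   using borel_integrable_atLeastAtMost'[of 0 "h n" "%sg. c (t + sg)"] continuous_on_compose2[OF c, of "{0..h n}" "%sg. t + sg"]
   continuous_on_add[OF continuous_on_const continuous_on_id, of "{0..h n}" t] by (simp add: set_integrable_def)
  have ii: "integrable lborel (%sg. indicator {0..h n} sg * c t)" by (simp add: integrable_indicator_Icc)
  have I2: "(LBINT sg. indicator {0..h n} sg * c t) = h n * c t" using h(2)[of n] by simp
  have "avg (h n) c t - c t = 1 / h n * (LBINT sg. indicator {0..h n} sg * c (t + sg) - indicator {0..h n} sg * c t)"
   unfolding avg_def Bochner_Integration.integral_diff[OF ci ii] I2 using h(2)[of n] by (simp add: right_diff_distrib)
  then have "\<bar>avg (h n) c t - c t\<bar> = 1 / h n * \<bar>\<integral>sg. indicator {0..h n} sg * c (t + sg) - indicator {0..h n} sg * c t \<partial>lborel\<bar>"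
   using h(2)[of n] by (simp only: abs_mult) simp
  also have "... <= 1 / h n * (LBINT sg. indicator {0..h n} sg * (r / 2))"
  proof (rule mult_left_mono)
   have "\<bar>\<integral>sg. indicator {0..h n} sg * c (t + sg) - indicator {0..h n} sg * c t \<partial>lborel\<bar>
     <= (LBINT sg. \<bar>indicator {0..h n} sg * c (t + sg) - indicator {0..h n} sg * c t\<bar>)" by (rule integral_abs_bound)
   also have "... <= (LBINT sg. indicator {0..h n} sg * (r / 2))"
   proof (rule integral_mono)
    show "\<bar>indicator {0..h n} sg * c (t + sg) - indicator {0..h n} sg * c t\<bar> <= indicator {0..h n} sg * (r / 2)" for sg
     using d(2)[of "t + sg"] N[OF n] by (auto split: split_indicator)
   qed (use ci ii in "auto simp: integrable_indicator_Icc")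
   finally show "\<bar>\<integral>sg. indicator {0..h n} sg * c (t + sg) - indicator {0..h n} sg * c t \<partial>lborel\<bar> <= (LBINT sg. indicator {0..h n} sg * (r / 2))" .
  qed (use h(2)[of n] in simp)
  also have "... = r / 2" using h(2)[of n] by simp
  finally show ?thesis using r by simp
 qed
 then show "\<exists>N. \<forall>n\<ge>N. norm (avg (h n) c t - c t) < r" by blast
qed

lemma avg_bounded_support:
 assumes c: "continuous_on UNIV c" "!!x. \<bar>c x\<bar> <= M" "!!x. \<bar>x\<bar> > M ==> c x = 0" and h: "h > 0" "h <= 1"
 shows "\<bar>avg h c t\<bar> <= M * indicator {-(M+1)..M+1} t"
proof -
 have ci: "integrable lborel (%sg. indicator {0..h} sg * c (t + sg))"
  using borel_integrable_atLeastAtMost'[of 0 h "%sg. c (t + sg)"] continuous_on_compose2[OF c(1), of "{0..h}" "%sg. t + sg"]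
   continuous_on_add[OF continuous_on_const continuous_on_id, of "{0..h}" t] by (simp add: set_integrable_def)
 show ?thesis
 proof (cases "t : {-(M+1)..M+1}")
  case True
  have "\<bar>\<integral>sg. indicator {0..h} sg * c (t + sg) \<partial>lborel\<bar> <= (LBINT sg. \<bar>indicator {0..h} sg * c (t + sg)\<bar>)"
   by (rule integral_abs_bound)
  also have "... <= (LBINT sg. indicator {0..h} sg * M)" using ci c(2) by (intro integral_mono) (auto simp: integrable_indicator_Icc split: split_indicator)
  also have "... = h * M" using h by simp
  finally show ?thesis using True h by (simp add: avg_def abs_mult field_simps)
 next
  case False
  have "c (t + sg) = 0" if "sg : {0..h}" for sg using False that h by (intro c(3)) auto
  then have "(%sg. indicator {0..h} sg * c (t + sg)) = (%sg. 0)" by (auto split: split_indicator)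
  then show ?thesis using False by (simp add: avg_def)
 qed
qed

text \<open>Replace f by a continuous c of compact support: since averaging is a contraction, both
  errors are at most the norm of g times that of \<open>f - c\<close>. Weak convergence suffices
  because the averages occur only in integrals against a fixed function.\<close>

lemma avg_weak_tendsto:
 assumes f: "sqint lborel f" and g: "sqint lborel g"
  and h: "h \<longlonglongrightarrow> 0" "!!n. h n > 0" "!!n. h n <= 1"
 shows "(%n. \<integral>t. g t * avg (h n) f t \<partial>lborel) \<longlonglongrightarrow> (LBINT t. g t * f t)"
proof (rule LIMSEQ_I)
 fix r :: real assume r: "r > 0"
 have [measurable]: "f : borel_measurable borel" "g : borel_measurable borel" using f g sqint_measurable by fastforce+
 define G where "G = (LBINT t. (g t)^2)"
 have G: "G >= 0" by (simp add: G_def)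
 \<comment> \<open>Chosen so that the norm of g times the root of e is at most \<open>r / 4\<close>;
   the summand 1 covers a g of norm 0.\<close>
 define e where "e = (r / 4)^2 / (G + 1)"
 have e: "e > 0" using r G by (simp add: e_def)
 have Ge: "G * e <= (r / 4)^2"
 proof -
  have "G * e <= (G + 1) * e" using e by simp
  also have "... = (r / 4)^2" using G by (simp add: e_def)
  finally show ?thesis .
 qed
 obtain c M where c: "continuous_on UNIV c" "!!x. \<bar>c x\<bar> <= M" "!!x. \<bar>x\<bar> > M ==> c x = 0"
  "sqint lborel c" "(LBINT x. (f x - c x)^2) < e" using continuous_dense_sqint[OF f e] by blast
 have [measurable]: "c : borel_measurable borel" by (rule borel_measurable_continuous_onI[OF c(1)])
 have fc: "sqint lborel (%t. f t - c t)" by (intro sqint_diff f c)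
 have small: "\<bar>\<integral>t. g t * F t \<partial>lborel\<bar> <= r / 4" if F: "sqint lborel F" "(LBINT t. (F t)^2) <= e" for F
 proof -
  have "(LBINT t. g t * F t)^2 <= G * (LBINT t. (F t)^2)"
   unfolding G_def by (rule Cauchy_Schwarz_integral[OF g F(1)])
  also have "... <= G * e" using F(2) G by (rule mult_left_mono)
  also have "... <= (r / 4)^2" by (rule Ge)
  finally show ?thesis using r by (simp add: abs_le_square_iff[symmetric])
 qed
 have "(%n. \<integral>t. g t * avg (h n) c t \<partial>lborel) \<longlonglongrightarrow> (LBINT t. g t * c t)"
 proof (rule integral_dominated_convergence[where w = "%t. \<bar>g t\<bar> * (M * indicator {-(M+1)..M+1} t)"])
  have "integrable lborel (%t. g t * (M * indicator {-(M+1)..M+1} t))" by (intro sqint_mult g sqint_cmult sqint_indicator_Icc)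
  then have "integrable lborel (%t. \<bar>g t * (M * indicator {-(M+1)..M+1} t)\<bar>)" by simp
  moreover have "M >= 0" using c(2)[of 0] by linarith
  ultimately show "integrable lborel (%t. \<bar>g t\<bar> * (M * indicator {-(M+1)..M+1} t))" by (simp add: abs_mult)
  show "AE t in lborel. (%n. g t * avg (h n) c t) \<longlonglongrightarrow> g t * c t" by (intro AE_I2 tendsto_intros avg_continuous_tendsto c h)
  show "AE t in lborel. norm (g t * avg (h n) c t) <= \<bar>g t\<bar> * (M * indicator {-(M+1)..M+1} t)" for n
   using avg_bounded_support[OF c(1-3) h(2,3)] by (intro AE_I2) (simp add: abs_mult mult_left_mono)
 qed measurable
 from LIMSEQ_D[OF this, of "r / 4"] r obtain N where N: "!!n. n >= N ==> \<bar>(LBINT t. g t * avg (h n) c t) - (LBINT t. g t * c t)\<bar> < r / 4" by auto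
 have "norm ((LBINT t. g t * avg (h n) f t) - (LBINT t. g t * f t)) < r" if n: "n >= N" for n
 proof -
  note i = sqint_mult[OF g]
  have 1: "\<bar>\<integral>t. g t * avg (h n) (%t. f t - c t) t \<partial>lborel\<bar> <= r / 4" using avg_sqint[OF fc h(2)[of n]] c(5) by (intro small) auto
  have 2: "\<bar>\<integral>t. g t * (f t - c t) \<partial>lborel\<bar> <= r / 4" using c(5) by (intro small fc) auto
  have "(LBINT t. g t * avg (h n) (%t. f t - c t) t) = (LBINT t. g t * avg (h n) f t) - (LBINT t. g t * avg (h n) c t)"
   using i[OF avg_sqint(1)[OF f h(2)]] i[OF avg_sqint(1)[OF c(4) h(2)]] by (simp add: avg_diff[OF f c(4)] right_diff_distrib)
  moreover have "(LBINT t. g t * (f t - c t)) = (LBINT t. g t * f t) - (LBINT t. g t * c t)" using i[OF f] i[OF c(4)] by (simp add: right_diff_distrib)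
  ultimately show ?thesis using 1 2 N[OF n] r unfolding real_norm_def by linarith
 qed
 then show "\<exists>N. \<forall>n\<ge>N. norm ((LBINT t. g t * avg (h n) f t) - (LBINT t. g t * f t)) < r" by blast
qed

lemma avg_slice_measurable:
 fixes f :: "real \<times> real => real"
 assumes [measurable]: "f : borel_measurable bor2"
 shows "(%z. avg h (%t. f (fst z, t)) (snd z)) : borel_measurable bor2"
 unfolding avg_def
 using borel_measurable_integral_param[of "%p::(real\<times>real)\<times>real. indicator {0..h} (snd p) * f (fst (fst p), snd (fst p) + snd p)" "borel \<Otimes>\<^sub>M borel"]
 by simp

lemma avg_slice_sqint:
 assumes f: "sqint lb2 f" and h: "h > 0"
 shows "sqint lb2 (%z. avg h (%t. f (fst z, t)) (snd z))"
proof -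
 have fm[measurable]: "f : borel_measurable bor2" using sqint_measurable[OF f] by (simp cong: measurable_cong_sets)
 let ?A = "%z. avg h (%t. f (fst z, t)) (snd z)"
 have Am[measurable]: "?A : borel_measurable bor2" by (rule avg_slice_measurable[OF fm])
 have sl: "AE x in lborel. sqint lborel (%t. f (x, t))" by (rule sqint_slices(2)[OF f])
 have "integrable lb2 (%z. (?A z)^2)"
 proof (rule lborel_pair.Fubini_integrable)
  show "integrable lborel (%x. \<integral>t. norm ((?A (x, t))^2) \<partial>lborel)"
  proof (rule lint_bound)
   show "integrable lborel (%x. \<integral>t. (f (x, t))^2 \<partial>lborel)" using slice_Fubini(5)[OF sqintD[OF f]] .
   show "(%x. \<integral>t. norm ((?A (x, t))^2) \<partial>lborel) : borel_measurable lborel"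
    using borel_measurable_integral_param[of "%z. (?A z)^2" borel] by simp
   show "AE x in lborel. norm (LBINT t. norm ((?A (x, t))^2)) <= norm (LBINT t. (f (x, t))^2)" using sl by eventually_elim (use avg_sqint(2)[OF _ h] in simp)
  qed
  show "AE x in lborel. integrable lborel (%t. (?A (x, t))^2)" using sl by eventually_elim (use avg_sqint(1)[OF _ h] sqintD in auto)
 qed measurable
 then show ?thesis by (simp add: sqint_def)
qed

text \<open>Weak convergence on almost every line of constant x is integrated in x; the sum of the
  squared norms of f and g on the line dominates.\<close>

lemma avg_slice_weak_tendsto:
 assumes f: "sqint lb2 f" and g: "sqint lb2 g"
  and h: "h \<longlonglongrightarrow> 0" "!!n. h n > 0" "!!n. h n <= 1"
 shows "(%n. \<integral>z. g z * avg (h n) (%t. f (fst z, t)) (snd z) \<partial>lb2) \<longlonglongrightarrow> (LINT z|lb2. g z * f z)"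
proof -
 have fm[measurable]: "f : borel_measurable bor2" "g : borel_measurable bor2"
  using sqint_measurable[OF f] sqint_measurable[OF g] by (simp_all cong: measurable_cong_sets)
 note [measurable] = avg_slice_measurable[OF fm(1)]
 have "(%n. \<integral>x. (LBINT t. g (x, t) * avg (h n) (%t. f (x, t)) t) \<partial>lborel) \<longlonglongrightarrow> (LBINT x. (LBINT t. g (x, t) * f (x, t)))"
 proof (rule integral_dominated_convergence[where w = "%x. (LBINT t. (g (x, t))^2) + (LBINT t. (f (x, t))^2)"])
  show "(%x. \<integral>t. g (x, t) * f (x, t) \<partial>lborel) : borel_measurable lborel"
   using borel_measurable_integral_param[of "%z. g z * f z" borel] by simp
  show "(%x. \<integral>t. g (x, t) * avg (h n) (%t. f (x, t)) t \<partial>lborel) : borel_measurable lborel" for n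
   using borel_measurable_integral_param[of "%z. g z * avg (h n) (%t. f (fst z, t)) (snd z)" borel] by simp
  show "integrable lborel (%x. (LBINT t. (g (x, t))^2) + (LBINT t. (f (x, t))^2))"
   using slice_Fubini(5)[OF sqintD[OF f]] slice_Fubini(5)[OF sqintD[OF g]] by simp
  show "AE x in lborel. (%n. \<integral>t. g (x, t) * avg (h n) (%t. f (x, t)) t \<partial>lborel) \<longlonglongrightarrow> (LBINT t. g (x, t) * f (x, t))"
   using sqint_slices(2)[OF f] sqint_slices(2)[OF g] by eventually_elim (rule avg_weak_tendsto[OF _ _ h])
  show "AE x in lborel. norm (LBINT t. g (x, t) * avg (h n) (%t. f (x, t)) t) <= (LBINT t. (g (x, t))^2) + (LBINT t. (f (x, t))^2)" for n
   using sqint_slices(2)[OF f] sqint_slices(2)[OF g]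
  proof eventually_elim
   case (elim x)
   let ?G = "\<integral>t. (g (x, t))^2 \<partial>lborel" and ?F = "\<integral>t. (f (x, t))^2 \<partial>lborel"
   have "(LBINT t. g (x, t) * avg (h n) (%t. f (x, t)) t)^2 <= ?G * (LBINT t. (avg (h n) (%t. f (x, t)) t)^2)"
    by (rule Cauchy_Schwarz_integral[OF elim(2) avg_sqint(1)[OF elim(1) h(2)]])
   also have "... <= ?G * ?F" by (intro mult_left_mono avg_sqint(2)[OF elim(1) h(2)]) simp
   also have "... <= (?G + ?F)^2"
   proof -
    have "?G >= 0" "?F >= 0" by simp_all
    then show ?thesis by (simp add: power2_eq_square algebra_simps)
   qed
   finally show ?case by (simp add: abs_le_square_iff[symmetric])
  qed
 qed
 moreover have "(LBINT x. (LBINT t. g (x, t) * f (x, t))) = (LINT z|lb2. g z * f z)" using slice_Fubini(6)[OF sqint_mult[OF g f]] .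
 moreover have "(LBINT x. (LBINT t. g (x, t) * avg (h n) (%t. f (x, t)) t))
   = (LINT z|lb2. g z * avg (h n) (%t. f (fst z, t)) (snd z))" for n using slice_Fubini(6)[OF sqint_mult[OF g avg_slice_sqint[OF f h(2)]]] by simp
 ultimately show ?thesis by simp
qed

section \<open>The energy inequality\<close>

text \<open>Since \<open>E(t) = \<integral> w\<^sub>x(x,t)^2 dx\<close> is a convex function of \<open>w\<close>, its difference quotients are bounded below
 by the first variation at time \<open>t\<close>; this replaces the formal identity \<open>E' = 2 [w\<^sub>x w\<^sub>t] - 2 \<integral> w\<^sub>x\<^sub>x w\<^sub>t\<close>,
 whose derivation would need a mixed derivative \<open>w\<^sub>x\<^sub>t\<close>.\<close>

lemma energy_difference:
 fixes u v ux vx vxx :: "real => real"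
 assumes u: "ac_deriv (-1) 1 u ux" and v: "ac_deriv (-1) 1 v vx" and vx: "ac_deriv (-1) 1 vx vxx"
  and ux2: "sqint lborel ux" and vx2: "sqint lborel vx"
  and ux0: "!!x. x ~: {-1..1} ==> ux x = 0" and vx0: "!!x. x ~: {-1..1} ==> vx x = 0"
  and z: "u (-1) = 0" "v (-1) = 0"
 shows "(LBINT x. (ux x)^2) - (LBINT x. (vx x)^2)
  >= 2 * (vx 1 * (u 1 - v 1)) - 2 * (LBINT x. indicator {-1..1} x * (vxx x * (u x - v x)))"
proof -
 note uv = sqint_mult[OF vx2 ux2]
 note sq = sqintD[OF ux2] sqintD[OF vx2]
 have d: "ac_deriv (-1) 1 (%x. u x - v x) (%x. ux x - vx x)" using ac_deriv_add[OF u ac_deriv_cmult[OF v, of "-1"]] by simp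
 have m: "ac_deriv (-1) 1 (%x. vx x * (u x - v x)) (%x. vxx x * (u x - v x) + vx x * (ux x - vx x))" by (rule ac_deriv_mult[OF vx d])
 have "vx 1 * (u 1 - v 1) = (LBINT x:{-1..1}. vxx x * (u x - v x) + vx x * (ux x - vx x))" using ac_derivD[OF m, of 1] z by simp
 also have "... = (LBINT x. indicator {-1..1} x * (vxx x * (u x - v x)) + (vx x * ux x - (vx x)^2))"
  unfolding set_lebesgue_integral_def using vx0 by (intro lint_cong) (auto split: split_indicator simp: algebra_simps power2_eq_square)
 also have "... = (LBINT x. indicator {-1..1} x * (vxx x * (u x - v x))) + (LBINT x. vx x * ux x - (vx x)^2)"
 proof (rule Bochner_Integration.integral_add)
  have "integrable lborel (%x. indicator {-1..1} x * (vxx x * (u x - v x) + vx x * (ux x - vx x)) - (vx x * ux x - (vx x)^2))"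
   using ac_deriv_integrable[OF m] uv sq by (auto simp: set_integrable_def)
  also have "(%x. indicator {-1..1} x * (vxx x * (u x - v x) + vx x * (ux x - vx x)) - (vx x * ux x - (vx x)^2))
    = (%x. indicator {-1..1} x * (vxx x * (u x - v x)))" using vx0 by (auto split: split_indicator simp: algebra_simps power2_eq_square)
  finally show "integrable lborel (%x. indicator {-1..1} x * (vxx x * (u x - v x)))" .
 qed (use uv sq in simp)
 finally have 1: "vx 1 * (u 1 - v 1) = ..." .
 have "0 <= (LBINT x. (ux x - vx x)^2)" by simp
 also have "(%x. (ux x - vx x)^2) = (%x. (ux x)^2 - 2 * (vx x * ux x) + (vx x)^2)" by (auto simp: power2_eq_square algebra_simps)
 also have "(LBINT x. (ux x)^2 - 2 * (vx x * ux x) + (vx x)^2)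
   = (LBINT x. (ux x)^2) - 2 * (LBINT x. vx x * ux x) + (LBINT x. (vx x)^2)" using uv sq by simp
 finally show ?thesis using 1 uv sq by simp
qed

lemma energy_inequality:
 fixes w wx wxx wt :: "real \<times> real => real" and q wt1 :: "real => real"
 assumes wx: "sqint lb2 wx" and wxx: "sqint lb2 wxx" and wt: "sqint lb2 wt"
  and supp: "!!x t. x ~: {-1..1} ==> wx (x, t) = 0" "!!x t. x ~: {-1..1} ==> wxx (x, t) = 0"
  and acx: "AE t in lborel. ac_deriv (-1) 1 (%x. w (x, t)) (%x. wx (x, t)) \<and>
    ac_deriv (-1) 1 (%x. wx (x, t)) (%x. wxx (x, t))"
  and act: "AE x in lborel. x : {-1..1} --> (\<forall>t h. h > 0 --> w (x, t + h) - w (x, t) = h * avg h (%t. wt (x, t)) t)"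
  and act1: "!!t h. h > 0 ==> w (1, t + h) - w (1, t) = h * avg h wt1 t"
  and left: "!!t. w (-1, t) = 0"
  and wt1: "sqint lborel wt1" and wx1: "sqint lborel (%t. wx (1, t))"
  and q: "q : borel_measurable borel" "!!t. 0 <= q t" "!!t. q t <= Q" "!!s t. \<bar>q s - q t\<bar> <= L * \<bar>s - t\<bar>"
 shows "2 * (LBINT t. q t * wx (1, t) * wt1 t) - L * (LINT z|lb2. (wx z)^2)
   <= 2 * (LINT z|lb2. q (snd z) * wxx z * wt z)"
proof -
 note [measurable] = q(1)
 have [measurable]: "wxx : borel_measurable bor2" "wx : borel_measurable bor2"
  using sqint_measurable[OF wxx] sqint_measurable[OF wx] by (simp_all cong: measurable_cong_sets)
 define E where "E t = (LBINT x. (wx (x, t))^2)" for t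
 have Ei: "integrable lborel E" unfolding E_def by (rule slice_Fubini(2)[OF sqintD[OF wx]])
 have [measurable]: "E : borel_measurable borel" using borel_measurable_integrable[OF Ei] by simp
 have E0: "E t >= 0" for t by (simp add: E_def)
 have EI: "(LBINT t. E t) = (LINT z|lb2. (wx z)^2)"
  unfolding E_def by (rule slice_Fubini(3)[OF sqintD[OF wx]])
 have qbd: "\<bar>q t\<bar> <= Q" for t using q(2,3)[of t] by simp
 have qx: "sqint lb2 (%z. q (snd z) * wxx z)" by (intro sqint_mult_bounded[OF wxx, where C = Q]) (use qbd in auto)
 have q1: "sqint lborel (%t. q t * wx (1, t))" by (intro sqint_mult_bounded[OF wx1, where C = Q]) (use qbd in auto)
 define A where "A h z = avg h (%t. wt (fst z, t)) (snd z)" for h z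
 have step: "2 * (LBINT t. q t * wx (1, t) * avg h wt1 t) - L * (LINT z|lb2. (wx z)^2)
   <= 2 * (LINT z|lb2. q (snd z) * wxx z * A h z)" if h: "h > 0" for h
 proof -
  have Asq: "sqint lb2 (A h)" unfolding A_def[abs_def] by (rule avg_slice_sqint[OF wt h])
  have qA: "integrable lb2 (%z. q (snd z) * wxx z * A h z)" by (rule sqint_mult[OF qx Asq])
  have q1i: "integrable lborel (%t. q t * wx (1, t) * avg h wt1 t)" by (rule sqint_mult[OF q1 avg_sqint(1)[OF wt1 h]])
  \<comment> \<open>\<open>energy_difference\<close> is applied with the slices at
    \<open>t + h\<close> and t, both regular for almost every t, and is multiplied by
    \<open>q t >= 0\<close>.\<close>
  have pt: "AE t in lborel. q t * (E (t + h) - E t)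
    >= h * (2 * (q t * wx (1, t) * avg h wt1 t) - 2 * (LBINT x. q t * wxx (x, t) * A h (x, t)))"
   using acx AE_shift[OF acx, of h] sqint_slices(1)[OF wx] AE_shift[OF sqint_slices(1)[OF wx], of h]
  proof eventually_elim
   case (elim t)
   have "(LBINT x. (wx (x, t + h))^2) - (LBINT x. (wx (x, t))^2)
    >= 2 * (wx (1, t) * (w (1, t + h) - w (1, t))) - 2 * (LBINT x. indicator {-1..1} x * (wxx (x, t) * (w (x, t + h) - w (x, t))))"
    using elim supp left by (intro energy_difference) auto
   also have "(LBINT x. indicator {-1..1} x * (wxx (x, t) * (w (x, t + h) - w (x, t))))
     = (LBINT x. h * (wxx (x, t) * A h (x, t)))"
   proof (rule integral_cong_AE)
    have Am: "A h : borel_measurable bor2" using sqint_measurable[OF Asq] by (simp cong: measurable_cong_sets)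
    have am: "(%x. A h (x, t)) : borel_measurable borel" using measurable_compose[OF measurable_Pair2'[of t borel borel] Am] by simp
    then show 2: "(%x. h * (wxx (x, t) * A h (x, t))) : borel_measurable lborel" by measurable
    have cw: "continuous_on {-1..1} (%x. w (x, t + h) - w (x, t))" using elim by (intro continuous_intros) (auto dest: ac_deriv_continuous)
    have "(%x. indicator {-1..1} x * (w (x, t + h) - w (x, t))) : borel_measurable borel" using borel_measurable_continuous_on_indicator[OF _ cw] by simp
    then have "(%x. wxx (x, t) * (indicator {-1..1} x * (w (x, t + h) - w (x, t)))) : borel_measurable borel" by measurable
    then show "(%x. indicator {-1..1} x * (wxx (x, t) * (w (x, t + h) - w (x, t)))) : borel_measurable lborel" by (simp add: mult.left_commute)
    show "AE x in lborel. indicator {-1..1} x * (wxx (x, t) * (w (x, t + h) - w (x, t))) = h * (wxx (x, t) * A h (x, t))"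
     using act by eventually_elim (use h supp in "auto simp: A_def split: split_indicator")
   qed
   also have "w (1, t + h) - w (1, t) = h * avg h wt1 t" by (rule act1[OF h])
   finally have "E (t + h) - E t >= h * (2 * (wx (1, t) * avg h wt1 t) - 2 * (LBINT x. wxx (x, t) * A h (x, t)))" by (simp add: E_def algebra_simps)
   from mult_left_mono[OF this q(2)[of t]] show ?case by (simp add: algebra_simps mult.assoc)
  qed
  have i1: "integrable lborel (%t. E t * q t)" by (rule integrable_mult_bdd[OF Ei _ qbd]) simp
  have i2: "integrable lborel (%t. E (t + h) * q t)" by (rule integrable_mult_bdd[OF integrable_shift[OF Ei] _ qbd]) simp
  have i3: "integrable lborel (%t. E t * q (t - h))" by (rule integrable_mult_bdd[OF Ei, where C = Q]) (use qbd in auto)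
  have i4: "integrable lborel (%t. \<integral>x. q t * wxx (x, t) * A h (x, t) \<partial>lborel)" using slice_Fubini(2)[OF qA] by simp
  have "h * (2 * (LBINT t. q t * wx (1, t) * avg h wt1 t) - 2 * (LINT z|lb2. q (snd z) * wxx z * A h z))
    = (LBINT t. h * (2 * (q t * wx (1, t) * avg h wt1 t) - 2 * (LBINT x. q t * wxx (x, t) * A h (x, t))))" using q1i i4 slice_Fubini(3)[OF qA] by simp
  also have "... <= (LBINT t. E (t + h) * q t - E t * q t)"
  proof (rule integral_mono_AE)
   show "AE t in lborel. h * (2 * (q t * wx (1, t) * avg h wt1 t) - 2 * (LBINT x. q t * wxx (x, t) * A h (x, t))) <= E (t + h) * q t - E t * q t"
    using pt by eventually_elim (simp add: algebra_simps)
  qed (use q1i i4 i1 i2 in auto)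
  also have "... = (LBINT t. E (t + h) * q t) - (LBINT t. E t * q t)" using i1 i2 by simp
  \<comment> \<open>Summation by parts in discrete form: translation puts the shift on q. As
    \<open>E >= 0\<close>, the Lipschitz bound for q costs at most \<open>L * h\<close> times the
    integral of E. The integrals run over the whole line, so no terms at initial or final time
    appear.\<close>
  also have "(LBINT t. E (t + h) * q t) = (LBINT t. E t * q (t - h))" using integral_shift[of "%t. E t * q (t - h)" h] by simp
  also have "(LBINT t. E t * q (t - h)) - (LBINT t. E t * q t) = (LBINT t. E t * (q (t - h) - q t))" using i1 i3 by (simp add: right_diff_distrib)
  also have "... <= (LBINT t. E t * (L * h))"
  proof (rule integral_mono)
   show "E t * (q (t - h) - q t) <= E t * (L * h)" for t using q(4)[of "t - h" t] h by (intro mult_left_mono E0) auto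
  qed (use i1 i3 Ei in "auto simp: right_diff_distrib")
  also have "... = h * (L * (LINT z|lb2. (wx z)^2))" using EI Ei by simp
  finally have "2 * (LBINT t. q t * wx (1, t) * avg h wt1 t) - 2 * (LINT z|lb2. q (snd z) * wxx z * A h z) <= L * (LINT z|lb2. (wx z)^2)" using h by simp
  then show ?thesis by simp
 qed
 define hn where "hn n = 1 / real (Suc n)" for n
 have hn: "hn \<longlonglongrightarrow> 0" "hn n > 0" "hn n <= 1" for n using LIMSEQ_inverse_real_of_nat by (auto simp: hn_def[abs_def] inverse_eq_divide)
 have "(%n. 2 * (LBINT t. q t * wx (1, t) * avg (hn n) wt1 t) - L * (LINT z|lb2. (wx z)^2))
   \<longlonglongrightarrow> 2 * (LBINT t. q t * wx (1, t) * wt1 t) - L * (LINT z|lb2. (wx z)^2)" by (intro tendsto_intros avg_weak_tendsto[OF wt1 q1] hn)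
 moreover have "(%n. 2 * (LINT z|lb2. q (snd z) * wxx z * A (hn n) z)) \<longlonglongrightarrow> 2 * (LINT z|lb2. q (snd z) * wxx z * wt z)"
  unfolding A_def by (intro tendsto_intros avg_slice_weak_tendsto[OF wt qx] hn)
 ultimately show ?thesis by (rule LIMSEQ_le) (use step hn in blast)
qed

section \<open>Borel representatives\<close>

text \<open>Slices of a Lebesgue measurable function of two variables need not be measurable. A
  Borel version, set to 0 off S, is what the product measure and Fubini can handle.\<close>

lemma L2_on_borel_version:
 fixes f :: "'a::euclidean_space => real"
 assumes f: "L2_on S f" and S: "S : sets borel"
 obtains g where "sqint lborel g" "!!z. z ~: S ==> g z = 0" "AE z in lborel. z : S --> f z = g z"
proof -
 have fm: "(%z. indicator S z *\<^sub>R f z) : borel_measurable (completion lborel)" using f by (simp add: L2_on_def set_borel_measurable_def)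
 obtain g' where g': "g' : borel_measurable lborel" "AE z in lborel. indicator S z *\<^sub>R f z = g' z"
  using completion_ex_borel_measurable_real[OF fm] by auto
 define g where "g z = indicator S z * g' z" for z
 have [measurable]: "g' : borel_measurable borel" "S : sets borel" using g'(1) S by simp_all
 have gm[measurable]: "g : borel_measurable borel" unfolding g_def by measurable
 have ae: "AE z in lborel. z : S --> f z = g z" using g'(2) by eventually_elim (auto simp: g_def)
 have "integrable lebesgue (%z. indicator S z *\<^sub>R (f z)^2)" using f by (simp add: L2_on_def set_integrable_def)
 then have "integrable lebesgue (%z. (g z)^2)"
 proof (rule integrable_cong_AE_imp)
  show "(%z. (g z)^2) : borel_measurable lebesgue" by (intro measurable_completion) measurable
  show "AE z in lebesgue. indicator S z *\<^sub>R (f z)^2 = (g z)^2" using AE_completion[OF ae] by eventually_elim (auto simp: g_def split: split_indicator)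
 qed
 then have "integrable lborel (%z. (g z)^2)" by (rule iffD1[OF integrable_completion, rotated]) measurable
 then show thesis using that[of g] gm ae by (auto simp: sqint_def g_def)
qed

lemma set_integral_borel_version:
 fixes f :: "'a::euclidean_space => real"
 assumes f: "L2_on S f" and g: "g : borel_measurable borel" "!!z. z ~: S ==> g z = 0"
  and ae: "AE z in lborel. z : S --> f z = g z" and k: "k : borel_measurable borel"
 shows "(LINT z:S|lebesgue. f z * k z) = (LBINT z. g z * k z)"
proof -
 have fm: "(%z. indicator S z *\<^sub>R f z) : borel_measurable lebesgue" using f by (simp add: L2_on_def set_borel_measurable_def)
 have km: "k : borel_measurable lebesgue" using k by (intro measurable_completion) simp
 have gm: "g : borel_measurable lebesgue" using g by (intro measurable_completion) simp
 have "(LINT z:S|lebesgue. f z * k z) = (\<integral>z. (indicator S z *\<^sub>R f z) * k z \<partial>lebesgue)"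
  by (simp add: set_lebesgue_integral_def mult.assoc)
 also have "... = (\<integral>z. g z * k z \<partial>lebesgue)"
 proof (rule integral_cong_AE)
  show "AE z in lebesgue. (indicator S z *\<^sub>R f z) * k z = g z * k z"
   using AE_completion[OF ae] by eventually_elim (auto simp: g(2) split: split_indicator)
 qed (use fm km gm in measurable)
 also have "... = (LBINT z. g z * k z)" using g(1) k by (intro integral_completion) simp
 finally show ?thesis .
qed

lemma sqint_support_integrable:
 assumes g: "sqint M g" and A: "A : sets M" "emeasure M A < \<infinity>" and z: "!!z. z ~: A ==> g z = 0"
 shows "integrable M g"
proof -
 have "integrable M (%z. g z * indicator A z)" by (intro sqint_mult g sqint_indicator A)
 also have "(%z. g z * indicator A z) = g" using z by (auto simp: fun_eq_iff split: split_indicator)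
 finally show ?thesis .
qed

text \<open>The numbers i and j count the x- and t-derivatives in the word \<open>ds\<close>; their
  existence is all that the smoothness conditions on test functions ask for.\<close>

lemma iter_pd_product:
 assumes f: "!!n x. (deriv ^^ n) f differentiable at x" and g: "!!n x. (deriv ^^ n) g differentiable at x"
 shows "\<exists>i j. iter_pd ds (%z. f (fst z) * g (snd z)) = (%z. (deriv ^^ i) f (fst z) * (deriv ^^ j) g (snd z))"
proof (induction ds)
 case Nil
 show ?case by (rule exI[of _ 0], rule exI[of _ 0]) simp
next
 case (Cons b ds)
 then obtain i j where IH: "iter_pd ds (%z. f (fst z) * g (snd z)) = (%z. (deriv ^^ i) f (fst z) * (deriv ^^ j) g (snd z))" by blast
 have df: "((deriv ^^ i) f has_real_derivative (deriv ^^ Suc i) f x) (at x)" for x using f[of i x] by (simp add: DERIV_deriv_iff_real_differentiable)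
 have dg: "((deriv ^^ j) g has_real_derivative (deriv ^^ Suc j) g x) (at x)" for x using g[of j x] by (simp add: DERIV_deriv_iff_real_differentiable)
 show ?case
 proof (cases b)
  case True
  have "deriv (%y. (deriv ^^ i) f y * c) x = (deriv ^^ Suc i) f x * c" for x c by (rule DERIV_imp_deriv) (rule DERIV_cmult_right[OF df])
  then have "iter_pd (b # ds) (%z. f (fst z) * g (snd z)) = (%z. (deriv ^^ Suc i) f (fst z) * (deriv ^^ j) g (snd z))" using True by (simp add: IH pdx_def)
  then show ?thesis by blast
 next
  case False
  have "deriv (%y. c * (deriv ^^ j) g y) x = c * (deriv ^^ Suc j) g x" for x c by (rule DERIV_imp_deriv) (rule DERIV_cmult[OF dg])
  then have "iter_pd (b # ds) (%z. f (fst z) * g (snd z)) = (%z. (deriv ^^ i) f (fst z) * (deriv ^^ Suc j) g (snd z))" using False by (simp add: IH pdt_def)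
  then show ?thesis by blast
 qed
qed

lemma differentiable_imp_continuous_UNIV:
 fixes f :: "real => real"
 shows "(!!x. f differentiable at x) ==> continuous_on UNIV f" by (meson continuous_at_imp_continuous_on differentiable_imp_continuous_within)

lemma test_fun2_product:
 assumes f: "test_fun1 A f" and g: "test_fun1 B g"
 shows "test_fun2 (A \<times> B) (%z. f (fst z) * g (snd z))"
  and "pdx (%z. f (fst z) * g (snd z)) = (%z. deriv f (fst z) * g (snd z))"
  and "pdt (%z. f (fst z) * g (snd z)) = (%z. f (fst z) * deriv g (snd z))"
  and "deriv f : borel_measurable borel" "f : borel_measurable borel"
proof -
 have df: "(deriv ^^ n) f differentiable at x" for n x using f by (simp add: test_fun1_def)
 have dg: "(deriv ^^ n) g differentiable at x" for n x using g by (simp add: test_fun1_def)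
 have "(f has_real_derivative deriv f x) (at x)" for x using df[of 0 x] by (simp add: DERIV_deriv_iff_real_differentiable)
 then show "pdx (%z. f (fst z) * g (snd z)) = (%z. deriv f (fst z) * g (snd z))"
  unfolding pdx_def by (auto intro!: DERIV_imp_deriv DERIV_cmult_right)
 have "(g has_real_derivative deriv g x) (at x)" for x using dg[of 0 x] by (simp add: DERIV_deriv_iff_real_differentiable)
 then show "pdt (%z. f (fst z) * g (snd z)) = (%z. f (fst z) * deriv g (snd z))"
  unfolding pdt_def by (auto intro!: DERIV_imp_deriv DERIV_cmult)
 have cf: "continuous_on UNIV ((deriv ^^ n) f)" for n by (rule differentiable_imp_continuous_UNIV[OF df])
 have cg: "continuous_on UNIV ((deriv ^^ n) g)" for n by (rule differentiable_imp_continuous_UNIV[OF dg])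
 show "deriv f : borel_measurable borel" "f : borel_measurable borel" using cf[of 1] cf[of 0] by (auto intro: borel_measurable_continuous_onI)
 have c1: "continuous_on UNIV (iter_pd ds (%z. f (fst z) * g (snd z)))"
  and c2: "(%y. iter_pd ds (%z. f (fst z) * g (snd z)) (y, t)) differentiable (at x)"
  and c3: "(%s. iter_pd ds (%z. f (fst z) * g (snd z)) (x, s)) differentiable (at t)" for ds x t
 proof -
  obtain i j where e: "iter_pd ds (%z. f (fst z) * g (snd z)) = (%z. (deriv ^^ i) f (fst z) * (deriv ^^ j) g (snd z))"
   using iter_pd_product[of f g ds] df dg by blast
  show "continuous_on UNIV (iter_pd ds (%z. f (fst z) * g (snd z)))"
   unfolding e by (intro continuous_intros continuous_on_compose2[OF cf] continuous_on_compose2[OF cg]) auto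
  show "(%y. iter_pd ds (%z. f (fst z) * g (snd z)) (y, t)) differentiable (at x)"
   "(%s. iter_pd ds (%z. f (fst z) * g (snd z)) (x, s)) differentiable (at t)"
   unfolding e using df[of i x] dg[of j t] by (auto intro!: differentiable_mult)
 qed
 let ?C = "closure {x. f x ~= 0} \<times> closure {x. g x ~= 0}"
 have cc: "compact ?C" "?C \<subseteq> A \<times> B" using f g by (auto simp: test_fun1_def intro: compact_Times)
 have "closure {z. f (fst z) * g (snd z) ~= 0} \<subseteq> ?C" by (intro closure_minimal) (auto intro: closed_Times closure_subset[THEN subsetD])
 moreover from this have "compact (closure {z. f (fst z) * g (snd z) ~= 0})"
  using bounded_subset[OF compact_imp_bounded[OF cc(1)]] by (auto simp: compact_eq_bounded_closed simp del: mult_eq_0_iff)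
 ultimately show "test_fun2 (A \<times> B) (%z. f (fst z) * g (snd z))"
  unfolding test_fun2_def using c1 c2 c3 cc(2) by blast
qed

lemma Qset_borel: "Qset T : sets borel"
 unfolding Qset_def by (intro borel_open open_Times) auto

lemma weak_dx_product:
 assumes w: "weak_dx ({a<..<b} \<times> {c<..<d}) u v" and u: "L2_on ({a<..<b} \<times> {c<..<d}) u" and v: "L2_on ({a<..<b} \<times> {c<..<d}) v"
  and u': "u' : borel_measurable borel" "!!z. z ~: {a<..<b} \<times> {c<..<d} ==> u' z = 0" "AE z in lborel. z : {a<..<b} \<times> {c<..<d} --> u z = u' z"
  and v': "v' : borel_measurable borel" "!!z. z ~: {a<..<b} \<times> {c<..<d} ==> v' z = 0" "AE z in lborel. z : {a<..<b} \<times> {c<..<d} --> v z = v' z"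
  and f: "test_fun1 {a<..<b} f" and g: "test_fun1 {c<..<d} g"
 shows "(LINT z|lb2. u' z * (deriv f (fst z) * g (snd z))) = - (LINT z|lb2. v' z * (f (fst z) * g (snd z)))"
proof -
 note t = test_fun2_product[OF f g] and t' = test_fun2_product(4,5)[OF g f]
 have [measurable]: "f : borel_measurable borel" "deriv f : borel_measurable borel" "g : borel_measurable borel" using t t' by auto
 have m: "(%z::real\<times>real. deriv f (fst z) * g (snd z)) : borel_measurable borel" "(%z::real\<times>real. f (fst z) * g (snd z)) : borel_measurable borel"
  unfolding borel_prod[symmetric] by measurable
 have "(LINT z:{a<..<b} \<times> {c<..<d}|lebesgue. u z * (deriv f (fst z) * g (snd z))) = (LBINT z. u' z * (deriv f (fst z) * g (snd z)))"
  by (rule set_integral_borel_version[OF u u'(1) _ u'(3) m(1)]) (rule u'(2))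
 moreover have "(LINT z:{a<..<b} \<times> {c<..<d}|lebesgue. v z * (f (fst z) * g (snd z))) = (LBINT z. v' z * (f (fst z) * g (snd z)))"
  by (rule set_integral_borel_version[OF v v'(1) _ v'(3) m(2)]) (rule v'(2))
 ultimately show ?thesis using w[unfolded weak_dx_def, rule_format, OF t(1)] unfolding t(2) lborel_prod by simp
qed

lemma weak_dt_product:
 assumes w: "weak_dt ({a<..<b} \<times> {c<..<d}) u v" and u: "L2_on ({a<..<b} \<times> {c<..<d}) u" and v: "L2_on ({a<..<b} \<times> {c<..<d}) v"
  and u': "u' : borel_measurable borel" "!!z. z ~: {a<..<b} \<times> {c<..<d} ==> u' z = 0" "AE z in lborel. z : {a<..<b} \<times> {c<..<d} --> u z = u' z"
  and v': "v' : borel_measurable borel" "!!z. z ~: {a<..<b} \<times> {c<..<d} ==> v' z = 0" "AE z in lborel. z : {a<..<b} \<times> {c<..<d} --> v z = v' z"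
  and f: "test_fun1 {a<..<b} f" and g: "test_fun1 {c<..<d} g"
 shows "(LINT z|lb2. u' z * (f (fst z) * deriv g (snd z))) = - (LINT z|lb2. v' z * (f (fst z) * g (snd z)))"
proof -
 note t = test_fun2_product[OF f g] and t' = test_fun2_product(4,5)[OF g f]
 have [measurable]: "f : borel_measurable borel" "deriv g : borel_measurable borel" "g : borel_measurable borel" using t t' by auto
 have m: "(%z::real\<times>real. f (fst z) * deriv g (snd z)) : borel_measurable borel" "(%z::real\<times>real. f (fst z) * g (snd z)) : borel_measurable borel"
  unfolding borel_prod[symmetric] by measurable
 have "(LINT z:{a<..<b} \<times> {c<..<d}|lebesgue. u z * (f (fst z) * deriv g (snd z))) = (LBINT z. u' z * (f (fst z) * deriv g (snd z)))"
  by (rule set_integral_borel_version[OF u u'(1) _ u'(3) m(1)]) (rule u'(2))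
 moreover have "(LINT z:{a<..<b} \<times> {c<..<d}|lebesgue. v z * (f (fst z) * g (snd z))) = (LBINT z. v' z * (f (fst z) * g (snd z)))"
  by (rule set_integral_borel_version[OF v v'(1) _ v'(3) m(2)]) (rule v'(2))
 ultimately show ?thesis using w[unfolded weak_dt_def, rule_format, OF t(1)] unfolding t(3) lborel_prod by simp
qed

lemma weak_derivative_slices:
 fixes u v :: "real \<times> real => real"
 assumes ab: "a < b"
  and u: "integrable lb2 u" and v: "integrable lb2 v"
  and u0: "!!z. z ~: {a<..<b} \<times> {c<..<d} ==> u z = 0"
  and v0: "!!z. z ~: {a<..<b} \<times> {c<..<d} ==> v z = 0"
  and weak: "!!f g. test_fun1 {a<..<b} f ==> test_fun1 {c<..<d} g ==>
    (LINT z|lb2. u z * (deriv f (fst z) * g (snd z))) = - (LINT z|lb2. v z * (f (fst z) * g (snd z)))"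
 obtains k where "k : borel_measurable borel" "AE t in lborel. t : {c<..<d} -->
   (AE x in lborel. x : {a<..<b} --> u (x, t) = k t + (LBINT y. indicator {..x} y * v (y, t)))"
proof -
 obtain k where k: "k : borel_measurable borel" "AE z in lb2. z : {a<..<b} \<times> {c<..<d} -->
   u z = k (snd z) + (LBINT y. indicator {..fst z} y * v (y, snd z))" using weak_derivative_representation[OF assms] by blast
 from AE_lb2_slices(1)[OF k(2)] have "AE t in lborel. t : {c<..<d} -->
   (AE x in lborel. x : {a<..<b} --> u (x, t) = k t + (LBINT y. indicator {..x} y * v (y, t)))" by (rule eventually_mono) (auto elim!: eventually_mono)
 with k(1) show thesis by (rule that)
qed

text \<open>Obtained from the version in x by exchanging the two coordinates.\<close>

lemma weak_derivative_slices_t: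
 fixes u v :: "real \<times> real => real"
 assumes cd: "c < d"
  and u: "integrable lb2 u" and v: "integrable lb2 v"
  and u0: "!!z. z ~: {a<..<b} \<times> {c<..<d} ==> u z = 0"
  and v0: "!!z. z ~: {a<..<b} \<times> {c<..<d} ==> v z = 0"
  and weak: "!!f g. test_fun1 {a<..<b} f ==> test_fun1 {c<..<d} g ==>
    (LINT z|lb2. u z * (f (fst z) * deriv g (snd z))) = - (LINT z|lb2. v z * (f (fst z) * g (snd z)))"
 obtains k where "k : borel_measurable borel" "AE x in lborel. x : {a<..<b} -->
   (AE t in lborel. t : {c<..<d} --> u (x, t) = k x + (LBINT r. indicator {..t} r * v (x, r)))"
proof -
 define us vs where "us = (%z. u (snd z, fst z))" and "vs = (%z. v (snd z, fst z))"
 have sw: "(LINT z|lb2. F (snd z, fst z)) = (LINT z|lb2. F z)" if "F : borel_measurable lb2" for F :: "real \<times> real => real"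
  using lborel_pair.integral_product_swap[OF that] by (simp add: case_prod_unfold)
 obtain k where "k : borel_measurable borel" "AE x in lborel. x : {a<..<b} -->
   (AE t in lborel. t : {c<..<d} --> us (t, x) = k x + (LBINT y. indicator {..t} y * vs (y, x)))"
 proof (rule weak_derivative_slices[OF cd, of us vs a b])
  show "integrable lb2 us" "integrable lb2 vs" using lborel_pair.integrable_product_swap[OF u] lborel_pair.integrable_product_swap[OF v]
   by (simp_all add: us_def vs_def case_prod_unfold)
  show "us z = 0" "vs z = 0" if "z ~: {c<..<d} \<times> {a<..<b}" for z
   using that u0[of "(snd z, fst z)"] v0[of "(snd z, fst z)"] by (auto simp: us_def vs_def mem_Times_iff)
  fix g f assume g: "test_fun1 {c<..<d} g" and f: "test_fun1 {a<..<b} f"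
  have [measurable]: "f : borel_measurable borel" "deriv g : borel_measurable borel" "g : borel_measurable borel"
   using test_fun2_product(4,5)[OF g f] test_fun2_product(4,5)[OF f g] by auto
  have [measurable]: "u : borel_measurable lb2" "v : borel_measurable lb2" using u v by auto
  have "(LINT z|lb2. us z * (deriv g (fst z) * f (snd z))) = (LINT z|lb2. u z * (f (fst z) * deriv g (snd z)))"
   using sw[of "%z. u z * (f (fst z) * deriv g (snd z))"] by (simp add: us_def mult_ac)
  also have "... = - (LINT z|lb2. v z * (f (fst z) * g (snd z)))" by (rule weak[OF f g])
  also have "(LINT z|lb2. v z * (f (fst z) * g (snd z))) = (LINT z|lb2. vs z * (g (fst z) * f (snd z)))"
   using sw[of "%z. v z * (f (fst z) * g (snd z))"] by (simp add: vs_def mult_ac)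
  finally show "(LINT z|lb2. us z * (deriv g (fst z) * f (snd z))) = - (LINT z|lb2. vs z * (g (fst z) * f (snd z)))" .
 qed
 then show thesis using that[of k] by (simp add: us_def vs_def)
qed

text \<open>The set of disagreement in the open interval is open, so it is empty or has positive
  measure; the endpoints follow by continuity.\<close>

lemma continuous_AE_eq:
 fixes f g :: "real => real"
 assumes ab: "a < b" and f: "continuous_on {a..b} f" and g: "continuous_on {a..b} g"
  and ae: "AE x in lborel. x : {a<..<b} --> f x = g x" and x: "x : {a..b}"
 shows "f x = g x"
proof -
 have eq: "f y - g y = 0" if y: "y : {a<..<b}" for y
 proof (rule ccontr)
  assume ne: "f y - g y ~= 0"
  let ?U = "{x : {a<..<b}. f x - g x : - {0}}"
  have "continuous_on {a<..<b} (%x. f x - g x)" by (intro continuous_intros continuous_on_subset[OF f] continuous_on_subset[OF g]) auto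
  then have "open ?U" by (intro continuous_open_preimage[unfolded vimage_def Int_def, simplified]) (auto simp: conj_commute)
  moreover have "?U ~= {}" using y ne by auto
  ultimately have "\<not> negligible ?U" by (rule open_not_negligible)
  moreover have "AE x in lebesgue. x ~: ?U" using AE_completion[OF ae] by eventually_elim auto
  moreover have "?U : sets lebesgue" using \<open>open ?U\<close> by auto
  ultimately show False by (simp add: negligible_iff_null_sets AE_iff_null_sets)
 qed
 have "f x - g x = 0" by (rule continuous_constant_on_closure[of "{a<..<b}" "%x. f x - g x"])
   (use eq x ab f g in "auto intro!: continuous_intros")
 then show ?thesis by simp
qed

lemma integral_atMost_eq_set:
 fixes v :: "real => real"
 assumes "!!y. y <= a ==> v y = 0"
 shows "(LBINT y. indicator {..x} y * v y) = (LBINT y:{a..x}. v y)"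
 unfolding set_lebesgue_integral_def by (intro lint_cong) (use assms in "auto split: split_indicator simp: not_le")

lemma ac_deriv_primitive:
 fixes v :: "real => real"
 assumes "integrable lborel v" "!!y. y <= a ==> v y = 0"
 shows "ac_deriv a b (%x. k + (LBINT y. indicator {..x} y * v y)) v"
proof (rule ac_derivI)
 show "set_integrable lborel {a..b} v" using integrable_mult_indicator[OF _ assms(1), of "{a..b}"] by (simp add: set_integrable_def)
 have z: "(LBINT y. indicator {..a} y * v y) = 0" by (rule integral_eq_zero_AE) (use assms(2) in "auto split: split_indicator")
 show "k + (LBINT y. indicator {..x} y * v y) = k + (LBINT y. indicator {..a} y * v y) + (LBINT y:{a..x}. v y)" for x
  unfolding z by (subst integral_atMost_eq_set[OF assms(2)]) auto
qed

lemma ac_deriv_of_AE_primitive: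
 fixes u v :: "real => real"
 assumes ab: "a < b" and u: "continuous_on {a..b} u" and v: "integrable lborel v" "!!y. y <= a ==> v y = 0"
  and ae: "AE x in lborel. x : {a<..<b} --> u x = k + (LBINT y. indicator {..x} y * v y)"
 shows "ac_deriv a b u v"
proof -
 note p = ac_deriv_primitive[OF v, where b = b and k = k]
 have "u x = k + (LBINT y. indicator {..x} y * v y)" if "x : {a..b}" for x by (rule continuous_AE_eq[OF ab u ac_deriv_continuous[OF p] ae that])
 then show ?thesis by (intro ac_deriv_cong'[OF p]) auto
qed

lemma AE_ex_in_interval:
 fixes a b :: real
 assumes "AE t in lborel. P t" "a < b"
 shows "\<exists>t\<in>{a<..<b}. P t"
proof (rule ccontr)
 assume "\<not> ?thesis"
 with assms(1) have "AE t in lborel. t ~: {a<..<b}" by (auto elim!: eventually_mono)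
 then have "{a<..<b} : null_sets lborel" by (subst AE_iff_null_sets) auto
 then show False using assms(2) by (simp add: null_sets_def)
qed

text \<open>Reduced to two variables: u and \<open>v'\<close> are multiplied by the indicator of
  (0,1) in a dummy variable, and the result is read off on one good slice.\<close>

lemma weak_deriv1_ac_deriv:
 assumes ab: "a < b" and w: "weak_deriv1 {a<..<b} u v" and u: "continuous_on {a..b} u" and v: "L2_on {a<..<b} v"
  and v': "sqint lborel v'" "!!x. x ~: {a<..<b} ==> v' x = 0" "AE x in lborel. x : {a<..<b} --> v x = v' x"
 shows "ac_deriv a b u v'"
proof -
 have v'm[measurable]: "v' : borel_measurable borel" using v'(1) sqint_measurable by fastforce
 define u' where "u' x = indicator {a<..<b} x * u x" for x
 have u'm[measurable]: "u' : borel_measurable borel"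
 proof -
  have "{a<..<b} \<subseteq> {a..b}" by auto
  from borel_measurable_continuous_on_indicator[OF _ continuous_on_subset[OF u this]]
  show ?thesis by (simp add: u'_def[abs_def])
 qed
 have "bounded (u ` {a..b})" by (intro compact_imp_bounded compact_continuous_image u) simp
 then obtain C where "\<forall>y\<in>u ` {a..b}. norm y <= C" unfolding bounded_iff by blast
 then have C: "\<bar>u x\<bar> <= C" if "x : {a..b}" for x using that by auto
 have I1: "sqint lborel (indicator {a<..<b} :: real => real)" using ab by (intro sqint_indicator) auto
 have u'sq: "sqint lborel u'" by (rule sqint_bound[OF I1, where C = C]) (use C in "auto simp: u'_def split: split_indicator")
 have u'i: "integrable lborel u'" by (rule sqint_support_integrable[OF u'sq, of "{a<..<b}"]) (use ab in "simp_all add: u'_def")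
 have v'i: "integrable lborel v'" by (rule sqint_support_integrable[OF v'(1), of "{a<..<b}"]) (use ab v'(2) in simp_all)
 have uL2: "L2_on {a<..<b} u"
 proof -
  have e: "(%x. indicator {a<..<b} x *\<^sub>R u x) = u'" by (simp add: u'_def fun_eq_iff)
  have e2: "(%x. indicator {a<..<b} x *\<^sub>R (u x)^2) = (%x. (u' x)^2)" by (auto simp: u'_def fun_eq_iff split: split_indicator)
  have "u' : borel_measurable lebesgue" by (intro measurable_completion) simp
  moreover have "integrable lebesgue (%x. (u' x)^2)" using sqintD[OF u'sq] by (subst integrable_completion) simp_all
  ultimately show ?thesis
   unfolding L2_on_def set_borel_measurable_def set_integrable_def e e2 by simp
 qed
 define J where "J = (indicator {0<..<1} :: real => real)"
 have Ji: "integrable lborel J" by (simp add: J_def)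
 have [measurable]: "J : borel_measurable borel" by (simp add: J_def)
 obtain k where k: "AE t in lborel. t : {0<..<1} -->
   (AE x in lborel. x : {a<..<b} --> u' x * J t = k t + (LBINT y. indicator {..x} y * (v' y * J t)))"
 proof (rule weak_derivative_slices[OF ab, of "%z. u' (fst z) * J (snd z)" "%z. v' (fst z) * J (snd z)" 0 1])
  show "integrable lb2 (%z. u' (fst z) * J (snd z))" "integrable lb2 (%z. v' (fst z) * J (snd z))" by (intro integrable_tensor u'i v'i Ji)+
  show "u' (fst z) * J (snd z) = 0" "v' (fst z) * J (snd z) = 0" if "z ~: {a<..<b} \<times> {0<..<1}" for z
   using that v'(2)[of "fst z"] by (cases z; auto simp: u'_def J_def split: split_indicator)+
  fix f g assume f: "test_fun1 {a<..<b} f" and g: "test_fun1 {0<..<1} g"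
  note t = test_fun2_product(4,5)[OF f g] test_fun2_product(5)[OF g f]
  note [measurable] = t
  have 1: "(LBINT x. u' x * deriv f x) = - (LBINT x. v' x * f x)"
  proof -
   have "(LINT x:{a<..<b}|lebesgue. u x * deriv f x) = (LBINT x. u' x * deriv f x)"
    by (rule set_integral_borel_version[OF uL2 u'm _ _ t(1)]) (auto simp: u'_def)
   moreover have "(LINT x:{a<..<b}|lebesgue. v x * f x) = (LBINT x. v' x * f x)" by (rule set_integral_borel_version[OF v v'm _ v'(3) t(2)]) (rule v'(2))
   ultimately show ?thesis using w[unfolded weak_deriv1_def, rule_format, OF f] by simp
  qed
  \<comment> \<open>Boundedness of test functions and of their derivatives makes each factor
    integrable, so that the double integrals split into products.\<close>
  have bd: "bounded (range h)" if "continuous_on UNIV h" "!!x. x ~: {l..r} ==> h x = 0" for h :: "real => real" and l r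
  proof -
   have "range h \<subseteq> h ` {l..r} \<union> {0}" using that(2) by blast
   moreover have "bounded (h ` {l..r})" by (intro compact_imp_bounded compact_continuous_image continuous_on_subset[OF that(1)]) auto
   ultimately show ?thesis by (meson bounded_Un bounded_insert bounded_empty bounded_subset)
  qed
  have bt: "\<exists>C. \<forall>x. \<bar>h x\<bar> <= C" if h: "test_fun1 U h0" and hh: "h = h0 \<or> h = deriv h0" for U h0 h
  proof -
   have d: "(deriv ^^ n) h0 differentiable at x" for n x using h by (simp add: test_fun1_def)
   have c: "continuous_on UNIV h"
    using hh differentiable_imp_continuous_UNIV[of h0, OF d[of 0, simplified]] differentiable_imp_continuous_UNIV[of "deriv h0", OF d[of 1, simplified]] by auto
   obtain l r where lr: "closure {x. h0 x ~= 0} \<subseteq> {l..r}" using h compact_imp_bounded bounded_subset_cbox_symmetric unfolding test_fun1_def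
    by (metis box_real(2))
   have z0: "h0 x = 0" if x: "x ~: {l..r}" for x
   proof (rule ccontr)
    assume "h0 x ~= 0"
    then have "x : closure {x. h0 x ~= 0}" using closure_subset[of "{x. h0 x ~= 0}"] by auto
    then show False using x lr by (meson subsetD)
   qed
   have "deriv h0 x = 0" if x: "x ~: {l..r}" for x
   proof (rule DERIV_imp_deriv)
    have "\<forall>\<^sub>F y in nhds x. y : - {l..r}" by (rule eventually_nhds_in_open) (use x in "auto simp: open_Compl")
    then have "\<forall>\<^sub>F y in nhds x. h0 y = 0" by (rule eventually_mono) (use z0 in blast)
    then show "(h0 has_real_derivative 0) (at x)" using DERIV_cong_ev[OF refl _ refl, of h0 "%_. 0" x 0] by simp
   qed
   then have "bounded (range h)" using hh z0 by (intro bd[OF c]) auto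
   then show ?thesis by (auto simp: bounded_iff)
  qed
  obtain C1 C2 C3 where C: "!!x. \<bar>f x\<bar> <= C1" "!!x. \<bar>deriv f x\<bar> <= C2" "!!x. \<bar>g x\<bar> <= C3"
   using bt[OF f, of f] bt[OF f, of "deriv f"] bt[OF g, of g] by blast
  have i: "integrable lborel (%x. u' x * deriv f x)" "integrable lborel (%x. v' x * f x)" "integrable lborel (%x. J x * g x)"
   using C by (auto intro!: integrable_mult_bdd u'i v'i Ji)
  have "(LINT z|lb2. u' (fst z) * J (snd z) * (deriv f (fst z) * g (snd z))) = (LINT z|lb2. (u' (fst z) * deriv f (fst z)) * (J (snd z) * g (snd z)))"
   by (simp add: mult_ac)
  also have "... = (LBINT x. u' x * deriv f x) * (LBINT x. J x * g x)" using slice_Fubini(6)[OF integrable_tensor[OF i(1,3)]] by simp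
  also have "... = - ((LBINT x. v' x * f x) * (LBINT x. J x * g x))" using 1 by simp
  also have "... = - (LINT z|lb2. (v' (fst z) * f (fst z)) * (J (snd z) * g (snd z)))" using slice_Fubini(6)[OF integrable_tensor[OF i(2,3)]] by simp
  finally show "(LINT z|lb2. u' (fst z) * J (snd z) * (deriv f (fst z) * g (snd z))) = - (LINT z|lb2. v' (fst z) * J (snd z) * (f (fst z) * g (snd z)))"
   by (simp add: mult_ac)
 qed (simp only: fst_conv snd_conv)
 obtain t where t: "t : {0<..<1}" "AE x in lborel. x : {a<..<b} --> u' x * J t = k t + (LBINT y. indicator {..x} y * (v' y * J t))"
 proof -
  from AE_ex_in_interval[OF k, of 0 1] show thesis using that by auto
 qed
 show ?thesis
 proof (rule ac_deriv_of_AE_primitive[OF ab u v'i])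
  show "v' y = 0" if "y <= a" for y using v'(2) that by auto
  show "AE x in lborel. x : {a<..<b} --> u x = k t + (LBINT y. indicator {..x} y * v' y)" using t(2) by eventually_elim (use t(1) in "auto simp: u'_def J_def")
 qed
qed

section \<open>Hoelder and trace inequalities on a slice\<close>

lemma ac_deriv_holder:
 assumes F: "ac_deriv a b F f" and f: "sqint lborel f" and x: "x : {a..b}" and y: "y : {a..b}"
 shows "(F y - F x)^2 <= \<bar>y - x\<bar> * (LBINT z. (f z)^2)"
proof -
 have main: "(F y - F x)^2 <= (y - x) * (LBINT z. (f z)^2)" if "a <= x" "x <= y" "y <= b" for x y
 proof -
  have "(F y - F x)^2 = (LBINT z. indicator {x..y} z * f z)^2" using ac_deriv_diff[OF F that] by (simp add: set_lebesgue_integral_def)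
  also have "... <= (LBINT z. (indicator {x..y} z)^2) * (LBINT z. (f z)^2)" by (rule Cauchy_Schwarz_integral[OF sqint_indicator_Icc f])
  also have "(%z. (indicator {x..y} z)^2) = (indicator {x..y} :: real => real)" by (auto split: split_indicator)
  finally show ?thesis using that by simp
 qed
 show ?thesis
 proof (cases "x <= y")
  case True then show ?thesis using main[of x y] x y by simp
 next
  case False then show ?thesis using main[of y x] x y by (simp add: power2_commute)
 qed
qed

text \<open>The Hoelder bound with \<open>\<bar>y - x\<bar> <= 2\<close> is averaged over x in
  [-1,1], an interval of length 2.\<close>

lemma trace_bound:
 assumes F: "ac_deriv (-1) 1 F f" and f: "sqint lborel f" and F2: "sqint lborel F" and y: "y : {-1..1}"
 shows "(F y)^2 <= (LBINT z. (F z)^2) + 4 * (LBINT z. (f z)^2)"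
proof -
 let ?I = "\<integral>z. (f z)^2 \<partial>lborel"
 have I: "?I >= 0" by simp
 have m2: "measure lborel {-1..1::real} = 2" by (subst measure_lborel_Icc) auto
 have pt: "indicator {-1..1} x * (F y)^2 <= 2 * (F x)^2 + 4 * ?I * indicator {-1..1} x" for x
 proof (cases "x : {-1..1}")
  case True
  have "(F y - F x)^2 <= \<bar>y - x\<bar> * ?I" by (rule ac_deriv_holder[OF F f True y])
  also have "... <= 2 * ?I" using True y I by (intro mult_right_mono) auto
  finally show ?thesis using square_add_le[of "F x" "F y - F x"] True by simp
 qed simp
 have "2 * (F y)^2 = (LBINT x. indicator {-1..1::real} x * (F y)^2)" using m2 by (simp del: measure_lborel_Icc)
 also have "... <= (LBINT x. 2 * (F x)^2 + 4 * ?I * indicator {-1..1} x)" using pt sqintD[OF F2] by (intro integral_mono) (auto simp: integrable_indicator_Icc)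
 also have "... = 2 * (LBINT z. (F z)^2) + 8 * ?I" using sqintD[OF F2] m2 by (simp add: integrable_indicator_Icc del: measure_lborel_Icc)
 finally show ?thesis by simp
qed

lemma bdx_eqI:
 assumes "((%x. f (x, t)) has_real_derivative D) (at a within {-1..1})" "a : {-1..1}"
 shows "bdx f a t = D"
 unfolding bdx_def
proof (rule the_equality)
 fix E assume "((%x. f (x, t)) has_real_derivative E) (at a within {-1..1})"
 then show "E = D" using assms vector_derivative_unique_within_closed_interval[of "-1" 1 a "%x. f (x, t)" E D]
  by (simp add: has_real_derivative_iff_has_vector_derivative)
qed fact

section \<open>Slice regularity of strong solutions\<close>

lemma emeasure_Qset: "emeasure lb2 ({-1<..<1} \<times> {0<..<T}) < \<infinity>"
 by (subst lborel.emeasure_pair_measure_Times, simp, simp, cases "0 <= T") (auto simp: ennreal_mult_less_top)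

lemma sets_Qset: "{-1<..<1} \<times> {0<..<T} : sets lb2" by (intro pair_measureI) auto

text \<open>The weak derivatives are given only up to null sets, but the estimate contains values of
  the x-derivative at the two endpoints. Hence d is a particular version of \<open>ux\<close>,
  absolutely continuous in x up to the boundary on almost every slice, whereas \<open>fxx\<close>
  and \<open>ft\<close> may be any Borel versions.\<close>

lemma strong_regularity:
 fixes u ux uxx ut :: "real \<times> real => real"
 assumes T: "T > 0" and cont: "continuous_on ({-1..1} \<times> {0..T}) u"
  and L2: "L2_on (Qset T) u" "L2_on (Qset T) ux" "L2_on (Qset T) uxx" "L2_on (Qset T) ut"
  and weak: "weak_dx (Qset T) u ux" "weak_dx (Qset T) ux uxx" "weak_dt (Qset T) u ut"
 obtains d fxx ft :: "real \<times> real => real" where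
  "sqint lb2 d" "sqint lb2 fxx" "sqint lb2 ft"
  "!!z. z ~: {-1..1} \<times> {0<..<T} ==> d z = 0" "!!z. z ~: Qset T ==> fxx z = 0" "!!z. z ~: Qset T ==> ft z = 0"
  "AE z in lborel. z : Qset T --> ux z = d z & uxx z = fxx z & ut z = ft z"
  "AE t in lborel. t : {0<..<T} --> ac_deriv (-1) 1 (%x. u (x, t)) (%x. d (x, t)) & ac_deriv (-1) 1 (%x. d (x, t)) (%x. fxx (x, t))"
  "AE x in lborel. x : {-1<..<1} --> ac_deriv 0 T (%t. u (x, t)) (%t. ft (x, t))"
  "AE t in lborel. t : {0<..<T} --> bdx u (-1) t = d (-1, t) & bdx u 1 t = d (1, t)"
  "sqint lborel (%t. d (1, t))" "sqint lborel (%t. d (-1, t))"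
proof -
 note Q = Qset_def[of T] and QQ = Qset_def[of T, symmetric]
 obtain f where f: "sqint lb2 f" "!!z. z ~: Qset T ==> f z = 0" "AE z in lborel. z : Qset T --> u z = f z"
  by (rule L2_on_borel_version[OF L2(1) Qset_borel]) (auto simp: lborel_prod)
 obtain fx where fx: "sqint lb2 fx" "!!z. z ~: Qset T ==> fx z = 0" "AE z in lborel. z : Qset T --> ux z = fx z"
  by (rule L2_on_borel_version[OF L2(2) Qset_borel]) (auto simp: lborel_prod)
 obtain fxx where fxx: "sqint lb2 fxx" "!!z. z ~: Qset T ==> fxx z = 0" "AE z in lborel. z : Qset T --> uxx z = fxx z"
  by (rule L2_on_borel_version[OF L2(3) Qset_borel]) (auto simp: lborel_prod)
 obtain ft where ft: "sqint lb2 ft" "!!z. z ~: Qset T ==> ft z = 0" "AE z in lborel. z : Qset T --> ut z = ft z"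
  by (rule L2_on_borel_version[OF L2(4) Qset_borel]) (auto simp: lborel_prod)
 have meas: "F : borel_measurable borel" "F : borel_measurable bor2" if "sqint lb2 F" for F
 proof -
  show "F : borel_measurable bor2" using sqint_measurable[OF that] by (simp cong: measurable_cong_sets)
  then show "F : borel_measurable borel" unfolding borel_prod .
 qed
 have int: "integrable lb2 F" if "sqint lb2 F" "!!z. z ~: Qset T ==> F z = 0" for F
  by (rule sqint_support_integrable[OF that(1) sets_Qset[of T] emeasure_Qset]) (use that(2) Q in simp)
 have fi: "integrable lb2 f" by (rule int[OF f(1)]) (rule f(2))
 have fxi: "integrable lb2 fx" by (rule int[OF fx(1)]) (rule fx(2))
 have fxxi: "integrable lb2 fxx" by (rule int[OF fxx(1)]) (rule fxx(2))
 have fti: "integrable lb2 ft" by (rule int[OF ft(1)]) (rule ft(2))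
 obtain k1 where k1: "AE t in lborel. t : {0<..<T} -->
   (AE x in lborel. x : {-1<..<1} --> f (x, t) = k1 t + (LBINT y. indicator {..x} y * fx (y, t)))"
 proof (rule weak_derivative_slices[of "-1" 1 f fx 0 T])
  show "(LINT z|lb2. f z * (deriv g (fst z) * h (snd z))) = - (LINT z|lb2. fx z * (g (fst z) * h (snd z)))"
   if "test_fun1 {-1<..<1} g" "test_fun1 {0<..<T} h" for g h
   by (rule weak_dx_product[OF weak(1)[unfolded Q] L2(1)[unfolded Q] L2(2)[unfolded Q] meas(1)[OF f(1)] _ f(3)[unfolded Q] meas(1)[OF fx(1)] _ fx(3)[unfolded Q] that])
    (use f(2) fx(2) Q in simp_all)
 qed (use fi fxi f(2) fx(2) in "simp_all add: Q")
 obtain k2 where k2: "k2 : borel_measurable borel" "AE t in lborel. t : {0<..<T} -->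
   (AE x in lborel. x : {-1<..<1} --> fx (x, t) = k2 t + (LBINT y. indicator {..x} y * fxx (y, t)))"
 proof (rule weak_derivative_slices[of "-1" 1 fx fxx 0 T])
  show "(LINT z|lb2. fx z * (deriv g (fst z) * h (snd z))) = - (LINT z|lb2. fxx z * (g (fst z) * h (snd z)))"
   if "test_fun1 {-1<..<1} g" "test_fun1 {0<..<T} h" for g h
   by (rule weak_dx_product[OF weak(2)[unfolded Q] L2(2)[unfolded Q] L2(3)[unfolded Q] meas(1)[OF fx(1)] _ fx(3)[unfolded Q] meas(1)[OF fxx(1)] _ fxx(3)[unfolded Q] that])
    (use fx(2) fxx(2) Q in simp_all)
 qed (use fxi fxxi fx(2) fxx(2) in "simp_all add: Q")
 obtain k3 where k3: "AE x in lborel. x : {-1<..<1} -->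
   (AE t in lborel. t : {0<..<T} --> f (x, t) = k3 x + (LBINT r. indicator {..t} r * ft (x, r)))"
 proof (rule weak_derivative_slices_t[of 0 T f ft "-1" 1])
  show "(LINT z|lb2. f z * (g (fst z) * deriv h (snd z))) = - (LINT z|lb2. ft z * (g (fst z) * h (snd z)))"
   if "test_fun1 {-1<..<1} g" "test_fun1 {0<..<T} h" for g h
   by (rule weak_dt_product[OF weak(3)[unfolded Q] L2(1)[unfolded Q] L2(4)[unfolded Q] meas(1)[OF f(1)] _ f(3)[unfolded Q] meas(1)[OF ft(1)] _ ft(3)[unfolded Q] that])
    (use f(2) ft(2) Q in simp_all)
 qed (use fi fti f(2) ft(2) T in "simp_all add: Q")
 have uf: "AE z in lb2. z : Qset T --> u z = f z" using f(3) unfolding lborel_prod .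
 \<comment> \<open>Given by the integral formula at every x of the closed interval, so
   \<open>d (1, t)\<close> and \<open>d (-1, t)\<close> do not depend on the choice of a version of
   \<open>ux\<close>.\<close>
 define d where "d z = indicator {-1..1} (fst z) * indicator {0<..<T} (snd z) * (k2 (snd z) + (LBINT y. indicator {..fst z} y * fxx (y, snd z)))" for z
 have dm[measurable]: "d : borel_measurable bor2"
  unfolding d_def using borel_measurable_integral_atMost2[OF meas(2)[OF fxx(1)]] k2(1) by measurable
 have [measurable]: "fx : borel_measurable bor2" by (rule meas(2)[OF fx(1)])
 have fxd: "AE z in lb2. fx z = d z"
 proof (rule AE_lb2I)
  show "Measurable.pred (borel \<Otimes>\<^sub>M borel) (%z. fx z = d z)" by measurable
  show "AE t in lborel. AE x in lborel. fx (x, t) = d (x, t)" using k2(2)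
  proof eventually_elim
   case (elim t)
   show ?case
   proof (cases "t : {0<..<T}")
    case True
    with elim have "AE x in lborel. x : {-1<..<1} --> fx (x, t) = k2 t + (LBINT y. indicator {..x} y * fxx (y, t))" by simp
    with AE_not_endpoint show ?thesis by eventually_elim (use True fx(2) in "auto simp: d_def Q split: split_indicator")
   next
    case False
    then show ?thesis using fx(2) by (auto simp: d_def Q)
   qed
  qed
 qed
 have d2: "sqint lb2 d" by (rule sqint_cong_AE[OF fx(1) _ fxd]) (simp cong: measurable_cong_sets)
 have d0: "d z = 0" if "z ~: {-1..1} \<times> {0<..<T}" for z using that by (cases z) (auto simp: d_def split: split_indicator)
 have sl: "AE t in lborel. t : {0<..<T} --> ac_deriv (-1) 1 (%x. u (x, t)) (%x. d (x, t)) & ac_deriv (-1) 1 (%x. d (x, t)) (%x. fxx (x, t))"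
  using k1 AE_lb2_slices(1)[OF uf] AE_lb2_slices(1)[OF fxd] slice_Fubini(1)[OF fxi] slice_Fubini(1)[OF fxxi]
 proof eventually_elim
  case (elim t)
  show ?case
  proof
   assume t: "t : {0<..<T}"
   have c: "continuous_on {-1..1} (%x. u (x, t))" by (rule continuous_on_compose2[OF cont]) (use t in "auto intro!: continuous_intros")
   have a1: "ac_deriv (-1) 1 (%x. u (x, t)) (%x. fx (x, t))"
   proof (rule ac_deriv_of_AE_primitive[where k = "k1 t"])
    have "AE x in lborel. x : {-1<..<1} --> f (x, t) = k1 t + (LBINT y. indicator {..x} y * fx (y, t))" using elim(1) t by simp
    with elim(2) show "AE x in lborel. x : {-1<..<1} --> u (x, t) = k1 t + (LBINT y. indicator {..x} y * fx (y, t))"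
     by eventually_elim (use t in "auto simp: Q")
   qed (use c elim fx(2) in "auto simp: Q")
   have a2: "ac_deriv (-1) 1 (%x. d (x, t)) (%x. fxx (x, t))"
    by (rule ac_deriv_cong'[OF ac_deriv_primitive[where k = "k2 t"]]) (use elim(5) fxx(2) t in "auto simp: d_def Q")
   have "ac_deriv (-1) 1 (%x. u (x, t)) (%x. d (x, t))"
   proof (rule ac_deriv_cong[OF a1])
    show "set_borel_measurable lborel {-1..1} (%x. d (x, t))" unfolding set_borel_measurable_def by measurable
    show "AE x in lborel. x : {-1..1} --> fx (x, t) = d (x, t)" using elim(3) by eventually_elim auto
   qed simp
   with a2 show "ac_deriv (-1) 1 (%x. u (x, t)) (%x. d (x, t)) & ac_deriv (-1) 1 (%x. d (x, t)) (%x. fxx (x, t))" by simp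
  qed
 qed
 have st: "AE x in lborel. x : {-1<..<1} --> ac_deriv 0 T (%t. u (x, t)) (%t. ft (x, t))" using k3 AE_lb2_slices(2)[OF uf] slice_Fubini(4)[OF fti]
 proof eventually_elim
  case (elim x)
  show ?case
  proof
   assume x: "x : {-1<..<1}"
   show "ac_deriv 0 T (%t. u (x, t)) (%t. ft (x, t))"
   proof (rule ac_deriv_of_AE_primitive[where k = "k3 x"])
    show "continuous_on {0..T} (%t. u (x, t))" by (rule continuous_on_compose2[OF cont]) (use x in "auto intro!: continuous_intros")
    have "AE t in lborel. t : {0<..<T} --> f (x, t) = k3 x + (LBINT r. indicator {..t} r * ft (x, r))" using elim(1) x by simp
    with elim(2) show "AE t in lborel. t : {0<..<T} --> u (x, t) = k3 x + (LBINT r. indicator {..t} r * ft (x, r))" by eventually_elim (use x in "auto simp: Q")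
   qed (use T elim ft(2) in "auto simp: Q")
  qed
 qed
 have bd: "AE t in lborel. t : {0<..<T} --> bdx u (-1) t = d (-1, t) & bdx u 1 t = d (1, t)" using sl
 proof eventually_elim
  case (elim t)
  show ?case
  proof
   assume "t : {0<..<T}"
   with elim have a: "ac_deriv (-1) 1 (%x. u (x, t)) (%x. d (x, t))" "ac_deriv (-1) 1 (%x. d (x, t)) (%x. fxx (x, t))" by auto
   show "bdx u (-1) t = d (-1, t) & bdx u 1 t = d (1, t)" using ac_deriv_has_derivative[OF a(1) ac_deriv_continuous[OF a(2)]] by (intro conjI bdx_eqI) auto
  qed
 qed
 have tr: "sqint lborel (%t. d (y, t))" if y: "y : {-1..1}" for y
  unfolding sqint_def
 proof
  show "integrable lborel (%t. (d (y, t))^2)"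
  proof (rule lint_bound)
   show "integrable lborel (%t. (LBINT x. (d (x, t))^2) + 4 * (LBINT x. (fxx (x, t))^2))"
    using slice_Fubini(2)[OF sqintD[OF d2]] slice_Fubini(2)[OF sqintD[OF fxx(1)]] by simp
   show "AE t in lborel. norm ((d (y, t))^2) <= norm ((LBINT x. (d (x, t))^2) + 4 * (LBINT x. (fxx (x, t))^2))"
    using sl sqint_slices(1)[OF d2] sqint_slices(1)[OF fxx(1)]
   proof eventually_elim
    case (elim t)
    show ?case
    proof (cases "t : {0<..<T}")
     case True
     then show ?thesis using trace_bound[of "%x. d (x, t)" "%x. fxx (x, t)" y] elim y by simp
    next
     case False
     then show ?thesis using d0[of "(y, t)"] by simp
    qed
   qed
  qed measurable
 qed measurable
 have ae: "AE z in lborel. z : Qset T --> ux z = d z & uxx z = fxx z & ut z = ft z" using fx(3) fxx(3) ft(3) fxd[unfolded lborel_prod] by eventually_elim auto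
 show thesis
 proof (rule that[of d fxx ft])
  show "d z = 0" if "z ~: {-1..1} \<times> {0<..<T}" for z by (rule d0[OF that])
  show "fxx z = 0" "ft z = 0" if "z ~: Qset T" for z by (rule fxx(2)[OF that], rule ft(2)[OF that])
  show "sqint lborel (%t. d (1, t))" "sqint lborel (%t. d (-1, t))" by (rule tr; simp)+
 qed (fact d2 fxx(1) ft(1) ae sl st bd)+
qed

section \<open>Regularity of the coefficient and of the boundary value\<close>

lemma test_fun1_deriv:
 assumes h: "test_fun1 U h"
 shows "test_fun1 U (deriv h)"
proof -
 have d: "(deriv ^^ n) (deriv h) differentiable at x" for n x using h[unfolded test_fun1_def] by (metis comp_apply funpow_Suc_right)
 let ?S = "closure {x. h x ~= 0}"
 have "deriv h x = 0" if x: "x ~: ?S" for x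
 proof (rule DERIV_imp_deriv)
  have "\<forall>\<^sub>F y in nhds x. y : - ?S" by (rule eventually_nhds_in_open) (use x in "auto simp: open_Compl")
  then have "\<forall>\<^sub>F y in nhds x. h y = 0" by (rule eventually_mono) (use closure_subset[of "{x. h x ~= 0}"] in auto)
  then show "(h has_real_derivative 0) (at x)" using DERIV_cong_ev[OF refl _ refl, of h "%_. 0" x 0] by simp
 qed
 then have sub: "closure {x. deriv h x ~= 0} \<subseteq> ?S" by (intro closure_minimal) auto
 have "compact ?S" "?S \<subseteq> U" using h by (auto simp: test_fun1_def)
 then have "compact (closure {x. deriv h x ~= 0})" "closure {x. deriv h x ~= 0} \<subseteq> U"
  using sub bounded_subset[OF compact_imp_bounded sub] by (auto simp: compact_eq_bounded_closed)
 then show ?thesis using d by (simp add: test_fun1_def)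
qed

lemma AE_lborel_commute:
 fixes P :: "real \<times> real => bool"
 assumes P: "Measurable.pred (borel \<Otimes>\<^sub>M borel) P" and ae: "AE x in lborel. AE t in lborel. P (x, t)"
 shows "AE t in lborel. AE x in lborel. P (x, t)"
proof -
 have s: "{z : space lb2. P z} : sets lb2" using P unfolding pred_def by (simp add: space_pair_measure sets_pair_measure_cong[OF sets_lborel sets_lborel])
 show ?thesis using ae s by (subst lborel_pair.AE_commute[symmetric]) auto
qed

lemma slice_norm_bound:
 fixes f g :: "real \<times> real => real"
 assumes bd: "AE t in lebesgue. t : {0<..<T} -->
    set_nn_integral lebesgue {-1<..<1} (%x. ennreal ((f (x, t))^2 + (g (x, t))^2)) <= ennreal M"
  and g': "sqint lb2 g'" "!!z. z ~: {-1..1} \<times> {0<..<T} ==> g' z = 0"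
  and ae: "AE z in lborel. z : Qset T --> g z = g' z"
 shows "AE t in lborel. (LBINT x. (g' (x, t))^2) <= \<bar>M\<bar>"
proof -
 have bd': "AE t in lborel. t : {0<..<T} -->
    set_nn_integral lebesgue {-1<..<1} (%x. ennreal ((f (x, t))^2 + (g (x, t))^2)) <= ennreal M" using bd by (simp add: AE_completion_iff)
 have ae2: "AE z in lb2. z : Qset T --> g z = g' z" using ae unfolding lborel_prod .
 show ?thesis using bd' AE_lb2_slices(1)[OF ae2] sqint_slices(1)[OF g'(1)]
 proof eventually_elim
  case (elim t)
  show ?case
  proof (cases "t : {0<..<T}")
   case False
   then have "(%x. (g' (x, t))^2) = (%x. 0)" using g'(2) by auto
   then show ?thesis by simp
  next
   case True
   have m: "(%x. ennreal ((g' (x, t))^2)) : borel_measurable lborel" using sqint_measurable[OF elim(3)] by simp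
   have "ennreal (LBINT x. (g' (x, t))^2) = (\<integral>\<^sup>+x. ennreal ((g' (x, t))^2) \<partial>lborel)"
    using sqintD[OF elim(3)] by (simp add: nn_integral_eq_integral)
   also have "... = (\<integral>\<^sup>+x. ennreal ((g' (x, t))^2) \<partial>lebesgue)" using m by (simp add: nn_integral_completion)
   also have "... <= set_nn_integral lebesgue {-1<..<1} (%x. ennreal ((f (x, t))^2 + (g (x, t))^2))"
   proof (rule nn_integral_mono_AE)
    show "AE x in lebesgue. ennreal ((g' (x, t))^2) <= ennreal ((f (x, t))^2 + (g (x, t))^2) * indicator {-1<..<1} x"
     using AE_completion[OF elim(2)] AE_completion[OF AE_not_endpoint]
    proof eventually_elim
     case (elim x)
     show ?case
     proof (cases "x : {-1<..<1}")
      case x: True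
      then have "g (x, t) = g' (x, t)" using elim(1) True by (auto simp: Qset_def)
      then show ?thesis using x by (auto intro: ennreal_leI)
     next
      case False
      then show ?thesis using elim(2) g'(2)[of "(x, t)"] by auto
     qed
    qed
   qed
   also have "... <= ennreal M" using elim(1) True by simp
   also have "... <= ennreal \<bar>M\<bar>" by (intro ennreal_leI) simp
   finally show ?thesis by (simp add: ennreal_le_iff)
  qed
 qed
qed

text \<open>Test p against the product of g' and h' and integrate by parts in either order: the weak
  t-derivative of \<open>px\<close> is the weak x-derivative of \<open>pt\<close>.\<close>

lemma mixed_derivative_representation:
 fixes p px pt pxt dp :: "real \<times> real => real"
 assumes T: "T > 0"
  and L2: "L2_on (Qset T) p" "L2_on (Qset T) px" "L2_on (Qset T) pt" "L2_on (Qset T) pxt"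
  and weak: "weak_dx (Qset T) p px" "weak_dt (Qset T) p pt" "weak_dx (Qset T) pt pxt"
  and dp: "sqint lb2 dp" "AE z in lborel. z : Qset T --> px z = dp z"
  and fxt: "sqint lb2 fxt" "!!z. z ~: Qset T ==> fxt z = 0" "AE z in lborel. z : Qset T --> pxt z = fxt z"
 obtains k where "k : borel_measurable borel" "AE x in lborel. x : {-1<..<1} -->
   (AE t in lborel. t : {0<..<T} --> dp (x, t) = k x + (LBINT r. indicator {..t} r * fxt (x, r)))"
proof -
 note Q = Qset_def[of T]
 have meas: "F : borel_measurable borel" "F : borel_measurable bor2" if "sqint lb2 F" for F
 proof -
  show "F : borel_measurable bor2" using sqint_measurable[OF that] by (simp cong: measurable_cong_sets)
  then show "F : borel_measurable borel" unfolding borel_prod .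
 qed
 obtain f where f: "sqint lb2 f" "!!z. z ~: Qset T ==> f z = 0" "AE z in lborel. z : Qset T --> p z = f z"
  by (rule L2_on_borel_version[OF L2(1) Qset_borel]) (auto simp: lborel_prod)
 obtain ft where ft: "sqint lb2 ft" "!!z. z ~: Qset T ==> ft z = 0" "AE z in lborel. z : Qset T --> pt z = ft z"
  by (rule L2_on_borel_version[OF L2(3) Qset_borel]) (auto simp: lborel_prod)
 define fx where "fx z = indicator (Qset T) z * dp z" for z
 have [measurable]: "Qset T : sets lb2" unfolding Q by (rule sets_Qset)
 have fx: "sqint lb2 fx"
  unfolding fx_def by (intro sqint_mult_bounded[OF dp(1), where C = 1]) (auto split: split_indicator)
 have fx0: "fx z = 0" if "z ~: Qset T" for z using that by (simp add: fx_def)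
 have fxae: "AE z in lborel. z : Qset T --> px z = fx z" using dp(2) by eventually_elim (simp add: fx_def)
 have int: "integrable lb2 F" if "sqint lb2 F" "!!z. z ~: Qset T ==> F z = 0" for F
  by (rule sqint_support_integrable[OF that(1) sets_Qset[of T] emeasure_Qset]) (use that(2) Q in simp)
 have fxi: "integrable lb2 fx" by (rule int[OF fx]) (rule fx0)
 have fxti: "integrable lb2 fxt" by (rule int[OF fxt(1)]) (rule fxt(2))
 obtain k where k: "k : borel_measurable borel" "AE x in lborel. x : {-1<..<1} -->
   (AE t in lborel. t : {0<..<T} --> fx (x, t) = k x + (LBINT r. indicator {..t} r * fxt (x, r)))"
 proof (rule weak_derivative_slices_t[of 0 T fx fxt "-1" 1])
  fix g h assume g: "test_fun1 {-1<..<1} g" and h: "test_fun1 {0<..<T} h"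
  have "(LINT z|lb2. f z * (deriv g (fst z) * deriv h (snd z))) = - (LINT z|lb2. fx z * (g (fst z) * deriv h (snd z)))"
   by (rule weak_dx_product[OF weak(1)[unfolded Q] L2(1)[unfolded Q] L2(2)[unfolded Q] meas(1)[OF f(1)] _ f(3)[unfolded Q] meas(1)[OF fx] _ fxae[unfolded Q] g test_fun1_deriv[OF h]])
    (use f(2) fx0 Q in simp_all)
  moreover have "(LINT z|lb2. f z * (deriv g (fst z) * deriv h (snd z))) = - (LINT z|lb2. ft z * (deriv g (fst z) * h (snd z)))"
   by (rule weak_dt_product[OF weak(2)[unfolded Q] L2(1)[unfolded Q] L2(3)[unfolded Q] meas(1)[OF f(1)] _ f(3)[unfolded Q] meas(1)[OF ft(1)] _ ft(3)[unfolded Q] test_fun1_deriv[OF g] h])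
    (use f(2) ft(2) Q in simp_all)
  moreover have "(LINT z|lb2. ft z * (deriv g (fst z) * h (snd z))) = - (LINT z|lb2. fxt z * (g (fst z) * h (snd z)))"
   by (rule weak_dx_product[OF weak(3)[unfolded Q] L2(3)[unfolded Q] L2(4)[unfolded Q] meas(1)[OF ft(1)] _ ft(3)[unfolded Q] meas(1)[OF fxt(1)] _ fxt(3)[unfolded Q] g h])
    (use ft(2) fxt(2) Q in simp_all)
  ultimately show "(LINT z|lb2. fx z * (g (fst z) * deriv h (snd z))) = - (LINT z|lb2. fxt z * (g (fst z) * h (snd z)))" by simp
 qed (use fxi fxti fx0 fxt(2) T in "simp_all add: Q")
 show thesis
 proof (rule that[OF k(1)])
  show "AE x in lborel. x : {-1<..<1} -->
   (AE t in lborel. t : {0<..<T} --> dp (x, t) = k x + (LBINT r. indicator {..t} r * fxt (x, r)))" using k(2)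
  proof eventually_elim
   case (elim x)
   show ?case
   proof
    assume x: "x : {-1<..<1}"
    with elim have "AE t in lborel. t : {0<..<T} --> fx (x, t) = k x + (LBINT r. indicator {..t} r * fxt (x, r))" by simp
    then show "AE t in lborel. t : {0<..<T} --> dp (x, t) = k x + (LBINT r. indicator {..t} r * fxt (x, r))" by eventually_elim (use x in "auto simp: fx_def Q")
   qed
  qed
 qed
qed

section \<open>Boundedness of \<open>pbar_x(1,.)\<close> in time\<close>

lemma good_point_in_interval:
 fixes A :: "real => real"
 assumes A: "integrable lborel A" "!!t. A t >= 0" and G: "AE t in lborel. G t" and lr: "l < r"
 shows "\<exists>s\<in>{l<..<r}. G s & A s <= ((LBINT t. A t) + 1) / (r - l)"
proof (rule ccontr)
 assume neg: "\<not> ?thesis"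
 let ?K = "\<integral>t. A t \<partial>lborel"
 \<comment> \<open>The summand 1 makes the contradiction strict: if A exceeded the bound at every
   good time of the interval, its integral would be at least \<open>?K + 1\<close>.\<close>
 have "?K + 1 = (LBINT t. indicator {l<..<r} t * ((?K + 1) / (r - l)))" using lr by simp
 also have "... <= ?K"
 proof (rule integral_mono_AE[OF _ A(1)])
  show "integrable lborel (%t. indicator {l<..<r} t * ((?K + 1) / (r - l)))" using lr by simp
  show "AE t in lborel. indicator {l<..<r} t * ((?K + 1) / (r - l)) <= A t" using G
  proof eventually_elim
   case (elim t)
   show ?case using neg elim A(2)[of t] by (cases "t : {l<..<r}") (auto simp: not_le intro: less_imp_le)
  qed
 qed
 finally show False by simp
qed

text \<open>Integrate the derivative of \<open>(1 + x) / 2 * (D x)^2\<close>, which vanishes at -1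
  and equals \<open>(D 1)^2\<close> at 1. The free parameter in Young's inequality for the product
  of D and its derivative is tuned later to the distance of two times.\<close>

lemma boundary_difference_bound:
 assumes D: "ac_deriv (-1) 1 D Dx" "sqint lborel D" "sqint lborel Dx" and mu: "\<mu> > 0"
 shows "(D 1)^2 <= (1/2 + 1 / \<mu>) * (LBINT x. (D x)^2) + \<mu> * (LBINT x. (Dx x)^2)"
proof -
 have lin: "ac_deriv (-1) 1 (%x. (1 + x) / 2) (%x. 1/2)" by (rule ac_deriv_C1) (auto intro!: derivative_eq_intros)
 note m = ac_deriv_mult[OF lin ac_deriv_mult[OF D(1) D(1)]]
 let ?g = "%x. 1/2 * (D x * D x) + (1 + x) / 2 * (Dx x * D x + D x * Dx x)"
 have i: "integrable lborel (%x. indicator {-1..1} x * ?g x)" using ac_deriv_integrable[OF m] by (simp add: set_integrable_def)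
 have "(D 1)^2 = (LBINT x. indicator {-1..1} x * ?g x)" using ac_derivD[OF m, of 1] by (simp add: set_lebesgue_integral_def power2_eq_square)
 also have "... <= (LBINT x. (1/2 + 1 / \<mu>) * (D x)^2 + \<mu> * (Dx x)^2)"
 proof (rule integral_mono[OF i])
  fix x
  have yg: "2 * \<bar>D x * Dx x\<bar> <= 1 / \<mu> * (D x)^2 + \<mu> * (Dx x)^2"
  proof -
   have "0 <= (\<bar>D x\<bar> - \<mu> * \<bar>Dx x\<bar>)^2 / \<mu>" using mu by simp
   also have "... = 1 / \<mu> * (D x)^2 - 2 * \<bar>D x * Dx x\<bar> + \<mu> * (Dx x)^2"
    using mu by (simp add: power2_diff field_simps abs_mult power_mult_distrib power2_eq_square)
   finally show ?thesis by simp
  qed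
  show "indicator {-1..1} x * ?g x <= (1/2 + 1 / \<mu>) * (D x)^2 + \<mu> * (Dx x)^2"
  proof (cases "x : {-1..1}")
   case True
   have "?g x = 1/2 * (D x)^2 + (1 + x) * (D x * Dx x)" by (simp add: power2_eq_square field_simps)
   also have "(1 + x) * (D x * Dx x) <= \<bar>1 + x\<bar> * \<bar>D x * Dx x\<bar>" unfolding abs_mult[symmetric] by (rule abs_ge_self)
   also have "... <= 2 * \<bar>D x * Dx x\<bar>" using True by (intro mult_right_mono) auto
   finally show ?thesis using True yg by (simp add: distrib_right)
  next
   case False
   then show ?thesis using mu by simp
  qed
 qed (use sqintD[OF D(2)] sqintD[OF D(3)] in simp)
 also have "... = (1/2 + 1 / \<mu>) * (LBINT x. (D x)^2) + \<mu> * (LBINT x. (Dx x)^2)" using sqintD[OF D(2)] sqintD[OF D(3)] by simp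
 finally show ?thesis .
qed

text \<open>Think of b as the boundary value and of \<open>A t\<close> as the squared L^2 norm of
  \<open>p_xx\<close> at time t, integrable but not bounded. By averaging there are times
  \<open>s k\<close> within distance of order \<open>16^-k\<close> of t where A is at most
  \<open>L * 16^k\<close>. With parameter \<open>64^-k\<close> both terms of \<open>diff\<close> are
  of order \<open>4^-k\<close>, so the increments of b along the chain form a geometric series with
  a bound independent of t. The last step, from \<open>s n\<close> to t itself, needs only that
  \<open>A t\<close> is a fixed number and that n may be large.\<close>

lemma bounded_chain:
 fixes b :: "real => real" and A :: "real => real"
 assumes T: "T > 0" and A: "integrable lborel A" "!!t. A t >= 0" and M: "M >= 0" and N: "!!t. G t ==> t : {0<..<T} ==> (b t)^2 <= M + 4 * A t"
  and G: "AE t in lborel. G t"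
  and diff: "!!s t \<mu>. G s ==> G t ==> s : {0<..<T} ==> t : {0<..<T} ==> \<mu> > 0 ==>
    (b s - b t)^2 <= (1/2 + 1 / \<mu>) * (M * (s - t)^2) + \<mu> * (2 * A s + 2 * A t)"
 shows "\<exists>C. \<forall>t\<in>{0<..<T}. G t --> \<bar>b t\<bar> <= C"
proof -
 define K where "K = (LBINT t. A t) + 1"
 have K: "K >= 1" unfolding K_def using A(2) by simp
 \<comment> \<open>A window of length \<open>T / 2 / 16^k\<close> contains a good time where A is at
   most K divided by this length, that is \<open>L * 16^k\<close>.\<close>
 define L where "L = 2 * K / T"
 have L: "L > 0" using K T by (simp add: L_def)
 define R where "R = 2 * (M * T^2) + 2 * (17 * L)"
 have R: "R > 0" using M L by (simp add: R_def add_nonneg_pos)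
 \<comment> \<open>The bound \<open>16 * L * 16 ^ k\<close> is the one valid at
   \<open>s (Suc k)\<close>. \<open>A0\<close> is 0 within the chain and \<open>A t\<close> in its
   last step. The factor 17 in R is 16 + 1.\<close>
 have est: "(b s - b t)^2 <= (R + 2 * A0) / 4 ^ k"
  if "G s" "G t" "s : {0<..<T}" "t : {0<..<T}" "\<bar>s - t\<bar> <= T / 16 ^ k" "A s <= 16 * L * 16 ^ k" "A t <= L * 16 ^ k + A0" "A0 >= 0" for s t k A0
 proof -
  have p: "(64::real) ^ k = 4 ^ k * 16 ^ k" "(16::real) ^ k * 16 ^ k = 4 ^ k * 64 ^ k" "(64::real) ^ k >= 1" "(4::real) ^ k >= 1" "(64::real) ^ k >= 4 ^ k"
   by (auto simp flip: power_mult_distrib intro: power_mono)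
  have sq: "(s - t)^2 <= T^2 / (16 ^ k * 16 ^ k)"
  proof -
   have "(s - t)^2 = \<bar>s - t\<bar>\<^sup>2" by simp
   also have "... <= (T / 16 ^ k)^2" using that(5) by (intro power_mono) auto
   finally show ?thesis by (simp add: power_divide power2_eq_square)
  qed
  have "(b s - b t)^2 <= (1/2 + 1 / (1 / 64 ^ k)) * (M * (s - t)^2) + 1 / 64 ^ k * (2 * A s + 2 * A t)" by (intro diff that) simp
  also have "(1/2 + 1 / (1 / 64 ^ k)) * (M * (s - t)^2) <= (2 * 64 ^ k) * (M * (T^2 / (16 ^ k * 16 ^ k)))" using p M sq by (intro mult_mono) auto
  also have "... = 2 * (M * T^2) / 4 ^ k" unfolding p(2) by simp
  also have "1 / 64 ^ k * (2 * A s + 2 * A t) <= 1 / 64 ^ k * (2 * (17 * L) * 16 ^ k + 2 * A0)" using that by (intro mult_left_mono) auto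
  also have "... = 2 * (17 * L) / 4 ^ k + 2 * A0 / 64 ^ k" unfolding p(1) by (simp add: field_simps)
  also have "2 * A0 / 64 ^ k <= 2 * A0 / 4 ^ k" using p that(8) by (intro divide_left_mono) auto
  finally show ?thesis by (simp add: R_def add_divide_distrib)
 qed
 define C where "C = sqrt (M + 4 * L) + 2 * sqrt R + 1"
 have "\<bar>b t\<bar> <= C" if t: "t : {0<..<T}" and Gt: "G t" for t
 proof -
  \<comment> \<open>The windows lie to the right of t in the first half of (0,T) and to the left of
    t in the second half, so they never leave (0,T).\<close>
  define l where "l k = (if t < T / 2 then t else t - T / 2 / 16 ^ k)" for k :: nat
  have r1: "T / 2 / 16 ^ k <= T / 2" "T / 2 / 16 ^ k > 0" for k :: nat using T by (auto simp: divide_le_eq)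
  have "\<exists>s. s : {l k<..<l k + T / 2 / 16 ^ k} & G s & A s <= L * 16 ^ k" for k
  proof -
   have lt: "l k < l k + T / 2 / 16 ^ k" using T by simp
   obtain s where "s : {l k<..<l k + T / 2 / 16 ^ k}" "G s" "A s <= K / (l k + T / 2 / 16 ^ k - l k)"
    using good_point_in_interval[OF A G lt] unfolding K_def by blast
   then show ?thesis using T by (auto simp: L_def field_simps)
  qed
  then have "\<forall>k. \<exists>s. s : {l k<..<l k + T / 2 / 16 ^ k} & G s & A s <= L * 16 ^ k" by blast
  from choice[OF this] obtain s where s: "!!k. s k : {l k<..<l k + T / 2 / 16 ^ k}" "!!k. G (s k)" "!!k. A (s k) <= L * 16 ^ k" by blast
  have sT: "s k : {0<..<T}" for k using s(1)[of k] r1[of k] t by (auto simp: l_def split: if_splits)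
  have near: "\<bar>s k - t\<bar> <= T / 2 / 16 ^ k" for k using s(1)[of k] by (auto simp: l_def split: if_splits)
  have step: "\<bar>b (s (Suc k)) - b (s k)\<bar> <= sqrt R / 2 ^ k" for k
  proof -
   have "\<bar>s (Suc k) - s k\<bar> <= T / 2 / 16 ^ k + T / 2 / 16 ^ Suc k" using near[of k] near[of "Suc k"] by linarith
   also have "... <= T / 16 ^ k" using T by (simp add: field_simps)
   finally have "(b (s (Suc k)) - b (s k))^2 <= (R + 2 * 0) / 4 ^ k" using s(2,3)[of k] s(2,3)[of "Suc k"] sT L by (intro est) auto
   also have "... = (sqrt R / 2 ^ k)^2" using R by (simp add: power_divide power_mult_distrib power2_eq_square flip: power_mult_distrib)
   finally show ?thesis using R by (simp add: abs_le_square_iff[symmetric])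
  qed
  have sum: "\<bar>b (s n)\<bar> <= \<bar>b (s 0)\<bar> + sqrt R * (2 - 2 / 2 ^ n)" for n
  proof (induction n)
   case (Suc n)
   have "\<bar>b (s (Suc n))\<bar> <= \<bar>b (s n)\<bar> + sqrt R / 2 ^ n" using step[of n] by linarith
   moreover have "sqrt R * (2 - 2 / 2 ^ n) + sqrt R / 2 ^ n = sqrt R * (2 - 2 / 2 ^ Suc n)" by (simp add: field_simps)
   ultimately show ?case using Suc by linarith
  qed simp
  have sum2: "\<bar>b (s n)\<bar> <= \<bar>b (s 0)\<bar> + 2 * sqrt R" for n
  proof -
   have "sqrt R * (2 - 2 / 2 ^ n) <= sqrt R * 2" using R by (intro mult_left_mono) auto
   then show ?thesis using sum[of n] by simp
  qed
  have s0: "\<bar>b (s 0)\<bar> <= sqrt (M + 4 * L)"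
  proof -
   have "(b (s 0))^2 <= M + 4 * A (s 0)" by (rule N[OF s(2) sT])
   also have "... <= M + 4 * L" using s(3)[of 0] by simp
   finally show ?thesis by (rule real_le_rsqrt[of "\<bar>b (s 0)\<bar>", simplified])
  qed
  \<comment> \<open>Here n depends on \<open>A t\<close>, but the resulting bound 1 for the last
    step does not.\<close>
  obtain n where n: "(R + 2 * A t) / 4 ^ n <= 1"
  proof -
   obtain n where "R + 2 * A t < 4 ^ n" using real_arch_pow[of 4 "R + 2 * A t"] by auto
   then show thesis using that[of n] by simp
  qed
  have "(b (s n) - b t)^2 <= (R + 2 * A t) / 4 ^ n"
  proof (rule est)
   show "\<bar>s n - t\<bar> <= T / 16 ^ n" using near[of n] r1(2)[of n] by linarith
   have "L * 16 ^ n >= 0" using L by simp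
   then show "A (s n) <= 16 * L * 16 ^ n" "A t <= L * 16 ^ n + A t" using s(3)[of n] by linarith+
  qed (use s sT Gt t A in auto)
  from order_trans[OF this n] have "(b (s n) - b t)^2 <= 1^2" by simp
  then have "\<bar>b (s n) - b t\<bar> <= 1" by (simp add: abs_square_le_1)
  then show ?thesis using sum2[of n] s0 unfolding C_def by linarith
 qed
 then show ?thesis by blast
qed

lemma boundary_derivative_bounded:
 fixes dp fxx fxt :: "real \<times> real => real"
 assumes T: "T > 0"
  and dp: "sqint lb2 dp" "!!z. z ~: {-1..1} \<times> {0<..<T} ==> dp z = 0"
  and fxx: "sqint lb2 fxx" and fxt: "sqint lb2 fxt" "!!z. z ~: Qset T ==> fxt z = 0"
  and ac: "AE t in lborel. t : {0<..<T} --> ac_deriv (-1) 1 (%x. dp (x, t)) (%x. fxx (x, t))"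
  and k: "k : borel_measurable borel" "AE x in lborel. x : {-1<..<1} -->
   (AE t in lborel. t : {0<..<T} --> dp (x, t) = k x + (LBINT r. indicator {..t} r * fxt (x, r)))"
  and M1: "AE t in lborel. (LBINT x. (dp (x, t))^2) <= M" and M2: "AE t in lborel. (LBINT x. (fxt (x, t))^2) <= M"
 shows "\<exists>C. AE t in lborel. t : {0<..<T} --> \<bar>dp (1, t)\<bar> <= C"
proof -
 have meas: "F : borel_measurable bor2" if "sqint lb2 F" for F using sqint_measurable[OF that] by (simp cong: measurable_cong_sets)
 note [measurable] = meas[OF dp(1)] meas[OF fxx] meas[OF fxt(1)] k(1)
 have M: "M >= 0"
 proof -
  obtain t where "(LBINT x. (dp (x, t))^2) <= M" using AE_ex_in_interval[OF M1 T] by blast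
  moreover have "0 <= (LBINT x. (dp (x, t))^2)" by simp
  ultimately show ?thesis by linarith
 qed
 define A where "A t = (LBINT x. (fxx (x, t))^2)" for t
 have Ai: "integrable lborel A" unfolding A_def by (rule slice_Fubini(2)[OF sqintD[OF fxx]])
 have prm: "(%z. \<integral>r. indicator {..snd z} r * fxt (fst z, r) \<partial>lborel) : borel_measurable bor2"
  using borel_measurable_integral_param[of "%p::(real\<times>real)\<times>real. indicator {0..} (snd (fst p) - snd p) * fxt (fst (fst p), snd p)" "borel \<Otimes>\<^sub>M borel"]
  by (simp add: indicator_atMost_shift)
 have rep: "AE t in lborel. AE x in lborel. x : {-1<..<1} --> t : {0<..<T} --> dp (x, t) = k x + (LBINT r. indicator {..t} r * fxt (x, r))"
 proof -
  have "AE t in lborel. AE x in lborel. (%z. fst z : {-1<..<1} --> snd z : {0<..<T} --> dp z = k (fst z) + (LBINT r. indicator {..snd z} r * fxt (fst z, r))) (x, t)"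
  proof (rule AE_lborel_commute)
   show "Measurable.pred (borel \<Otimes>\<^sub>M borel) (%z. fst z : {-1<..<1} --> snd z : {0<..<T} --> dp z = k (fst z) + (LBINT r. indicator {..snd z} r * fxt (fst z, r)))"
    using prm by measurable
   show "AE x in lborel. AE t in lborel. fst (x, t) : {-1<..<1} --> snd (x, t) : {0<..<T} --> dp (x, t) = k (fst (x, t)) + (LBINT r. indicator {..snd (x, t)} r * fxt (fst (x, t), r))"
    using k(2)
   proof eventually_elim
    case (elim x)
    show ?case
    proof (cases "x : {-1<..<1}")
     case True
     with elim have "AE t in lborel. t : {0<..<T} --> dp (x, t) = k x + (LBINT r. indicator {..t} r * fxt (x, r))" by blast
     then show ?thesis by (rule eventually_mono) simp
    next
     case False then show ?thesis by (intro AE_I2) auto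
    qed
   qed
  qed
  then show ?thesis by simp
 qed
 \<comment> \<open>Good times: all almost everywhere facts about a slice are bundled, so that two
   different times can be compared.\<close>
 define G where "G t \<longleftrightarrow> sqint lborel (%x. dp (x, t)) & sqint lborel (%x. fxx (x, t)) \<and>
   (LBINT x. (dp (x, t))^2) <= M & (t : {0<..<T} --> ac_deriv (-1) 1 (%x. dp (x, t)) (%x. fxx (x, t))) \<and>
   (AE x in lborel. x : {-1<..<1} --> t : {0<..<T} --> dp (x, t) = k x + (LBINT r. indicator {..t} r * fxt (x, r)))" for t
 have G: "AE t in lborel. G t" using sqint_slices(1)[OF dp(1)] sqint_slices(1)[OF fxx] M1 ac rep
  unfolding G_def by eventually_elim blast
 have fxts: "AE x in lborel. sqint lborel (%t. fxt (x, t))" by (rule sqint_slices(2)[OF fxt(1)])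
 \<comment> \<open>Lipschitz continuity in time with values in L^2: Cauchy-Schwarz in time on almost
   every line of constant x, then Fubini and the slice bound M for the mixed derivative.\<close>
 have D2: "(LBINT x. (dp (x, s) - dp (x, t))^2) <= M * (s - t)^2"
  if st: "G s" "G t" "s : {0<..<T}" "t : {0<..<T}" "t <= s" for s t
 proof -
  define J where "J z = fxt z * indicator {t<..s} (snd z)" for z
  have J: "sqint lb2 J" using sqint_mult_bounded[OF fxt(1), of "%z. indicator {t<..s} (snd z)" 1]
   by (auto simp: J_def[abs_def] mult.commute split: split_indicator)
  have Dsq: "sqint lborel (%x. dp (x, s) - dp (x, t))" using st by (intro sqint_diff) (auto simp: G_def)
  have "(LBINT x. (dp (x, s) - dp (x, t))^2) <= (LBINT x. (s - t) * (LBINT r. (J (x, r))^2))"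
  proof (rule integral_mono_AE)
   show "integrable lborel (%x. (s - t) * (LBINT r. (J (x, r))^2))" using slice_Fubini(5)[OF sqintD[OF J]] by simp
   have "AE x in lborel. x : {-1<..<1} --> s : {0<..<T} --> dp (x, s) = k x + (LBINT r. indicator {..s} r * fxt (x, r))"
    "AE x in lborel. x : {-1<..<1} --> t : {0<..<T} --> dp (x, t) = k x + (LBINT r. indicator {..t} r * fxt (x, r))" using st by (auto simp: G_def)
   then show "AE x in lborel. (dp (x, s) - dp (x, t))^2 <= (s - t) * (LBINT r. (J (x, r))^2)" using AE_not_endpoint fxts sqint_slices(2)[OF J]
   proof eventually_elim
    case (elim x)
    show ?case
    proof (cases "x : {-1<..<1}")
     case False
     then have "dp (x, s) = 0" "dp (x, t) = 0" using dp(2)[of "(x, s)"] dp(2)[of "(x, t)"] elim(3) by auto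
     then show ?thesis using st by simp
    next
     case True
     have fi: "integrable lborel (%r. indicator {..c} r * fxt (x, r))" for c
     proof -
      have "integrable lborel (%r. fxt (x, r))" by (rule sqint_support_integrable[OF elim(4), of "{0<..<T}"]) (use T fxt(2) in "auto simp: Qset_def")
      from integrable_mult_indicator[OF _ this, of "{..c}"] show ?thesis by simp
     qed
     have "dp (x, s) - dp (x, t) = (LBINT r. indicator {..s} r * fxt (x, r)) - (LBINT r. indicator {..t} r * fxt (x, r))" using elim(1,2) True st by simp
     also have "... = (LBINT r. indicator {..s} r * fxt (x, r) - indicator {..t} r * fxt (x, r))" using fi by simp
     also have "... = (LBINT r. indicator {t..s} r * J (x, r))" by (intro lint_cong) (use st(5) in "auto simp: J_def split: split_indicator")
     finally have "(dp (x, s) - dp (x, t))^2 = (LBINT r. indicator {t..s} r * J (x, r))^2" by simp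
     also have "... <= (LBINT r. (indicator {t..s} r)^2) * (LBINT r. (J (x, r))^2)" by (rule Cauchy_Schwarz_integral[OF sqint_indicator_Icc elim(5)])
     also have "(%r. (indicator {t..s} r)^2) = (indicator {t..s} :: real => real)" by (auto split: split_indicator)
     finally show ?thesis using st(5) by simp
    qed
   qed
  qed (rule sqintD[OF Dsq])
  also have "... = (s - t) * (LBINT r. (LBINT x. (J (x, r))^2))" using slice_Fubini(3,6)[OF sqintD[OF J]] by simp
  also have "... <= (s - t) * (LBINT r. M * indicator {t..s} r)"
  proof (intro mult_left_mono integral_mono_AE)
   show "integrable lborel (%r. \<integral>x. (J (x, r))^2 \<partial>lborel)" by (rule slice_Fubini(2)[OF sqintD[OF J]])
   show "AE r in lborel. (LBINT x. (J (x, r))^2) <= M * indicator {t..s} r" using M2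
   proof eventually_elim
    case (elim r)
    then show ?case using M by (cases "r : {t<..s}") (auto simp: J_def split: split_indicator)
   qed
  qed (use st in "auto simp: integrable_indicator_Icc")
  also have "... = M * (s - t)^2" using st(5) by (simp add: power2_eq_square)
  finally show ?thesis .
 qed
 have "\<exists>C. \<forall>t\<in>{0<..<T}. G t --> \<bar>dp (1, t)\<bar> <= C"
 proof (rule bounded_chain[OF T Ai _ M _ G])
  show "0 <= A t" for t by (simp add: A_def)
  show "(dp (1, t))^2 <= M + 4 * A t" if "G t" "t : {0<..<T}" for t using trace_bound[of "%x. dp (x, t)" "%x. fxx (x, t)" 1] that by (auto simp: G_def A_def)
  fix s t \<mu> :: real assume a: "G s" "G t" "s : {0<..<T}" "t : {0<..<T}" "\<mu> > 0"
  have sq: "sqint lborel (%x. dp (x, s) - dp (x, t))" "sqint lborel (%x. fxx (x, s) - fxx (x, t))" using a by (auto simp: G_def intro!: sqint_diff)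
  have "ac_deriv (-1) 1 (%x. dp (x, s) - dp (x, t)) (%x. fxx (x, s) - fxx (x, t))"
   using ac_deriv_add[of "-1" 1 "%x. dp (x, s)" "%x. fxx (x, s)" "%x. -1 * dp (x, t)" "%x. -1 * fxx (x, t)"]
    ac_deriv_cmult[of "-1" 1 "%x. dp (x, t)" "%x. fxx (x, t)" "-1"] a by (simp add: G_def)
  from boundary_difference_bound[OF this sq a(5)]
  have "(dp (1, s) - dp (1, t))^2 <= (1/2 + 1 / \<mu>) * (LBINT x. (dp (x, s) - dp (x, t))^2) + \<mu> * (LBINT x. (fxx (x, s) - fxx (x, t))^2)" .
  also have "(LBINT x. (dp (x, s) - dp (x, t))^2) <= M * (s - t)^2"
  proof (cases "t <= s")
   case True then show ?thesis using D2 a by blast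
  next
   case False
   then have "(LBINT x. (dp (x, t) - dp (x, s))^2) <= M * (t - s)^2" using D2[of t s] a by auto
   then show ?thesis by (simp add: power2_commute)
  qed
  also have "(LBINT x. (fxx (x, s) - fxx (x, t))^2) <= 2 * A s + 2 * A t"
  proof -
   have i: "integrable lborel (%x. (fxx (x, s))^2)" "integrable lborel (%x. (fxx (x, t))^2)" using a sqintD by (auto simp: G_def)
   have "(LBINT x. (fxx (x, s) - fxx (x, t))^2) <= (LBINT x. 2 * (fxx (x, s))^2 + 2 * (fxx (x, t))^2)"
   proof (rule integral_mono[OF sqintD[OF sq(2)]])
    show "(fxx (x, s) - fxx (x, t))^2 <= 2 * (fxx (x, s))^2 + 2 * (fxx (x, t))^2" for x using square_add_le[of "fxx (x, s)" "- fxx (x, t)"] by simp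
   qed (use i in simp)
   then show ?thesis using i by (simp add: A_def)
  qed
  finally show "(dp (1, s) - dp (1, t))^2 <= (1/2 + 1 / \<mu>) * (M * (s - t)^2) + \<mu> * (2 * A s + 2 * A t)" using a(5) by (simp add: mult_left_mono)
 qed
 then obtain C where "\<forall>t\<in>{0<..<T}. G t --> \<bar>dp (1, t)\<bar> <= C" by blast
 with G show ?thesis by (intro exI[of _ C]) (auto elim!: eventually_mono)
qed

text \<open>There is no trace of \<open>phi_t\<close> at x = 1. Its substitute \<open>h1\<close>
  arises by differentiating the nonlocal condition: \<open>gamma_t\<close> plus the integral of
  \<open>(x/beta) (p_xt phi + p_x phi_t)\<close>. The square bound is Cauchy-Schwarz on slices, with
  M controlling the two factors that come from p.\<close>

lemma boundary_value_ac:
 fixes phi dp fxt ft :: "real \<times> real => real" and gamma gt :: "real => real"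
 assumes T: "T > 0" and beta: "beta > 0"
  and phi: "continuous_on ({-1..1} \<times> {0..T}) phi"
  and ft: "sqint lb2 ft" "!!z. z ~: Qset T ==> ft z = 0"
  and act: "AE x in lborel. x : {-1<..<1} --> ac_deriv 0 T (%t. phi (x, t)) (%t. ft (x, t))"
  and dp: "sqint lb2 dp"
  and fxt: "sqint lb2 fxt" "!!z. z ~: Qset T ==> fxt z = 0"
  and k: "k : borel_measurable borel" "AE x in lborel. x : {-1<..<1} -->
   (AE t in lborel. t : {0<..<T} --> dp (x, t) = k x + (LBINT r. indicator {..t} r * fxt (x, r)))"
  and M1: "AE t in lborel. (LBINT x. (dp (x, t))^2) <= M" and M2: "AE t in lborel. (LBINT x. (fxt (x, t))^2) <= M"
  and gamma: "ac_deriv 0 T gamma gt" "sqint lborel gt" "!!t. t ~: {0<..<T} ==> gt t = 0"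
  and bc: "AE t in lborel. t : {0<..<T} -->
   phi (1, t) = gamma t + (LBINT x. indicator {-1<..<1} x * (x / beta * dp (x, t) * phi (x, t)))"
 obtains h1 where "sqint lborel h1" "!!t. t ~: {0<..<T} ==> h1 t = 0" "ac_deriv 0 T (%t. phi (1, t)) h1"
  "AE t in lborel. t : {0<..<T} --> (h1 t)^2 <= 3 * (gt t)^2 +
   3 * (M / beta^2) * ((LBINT x. indicator {-1<..<1} x * (phi (x, t))^2) + (LBINT x. (ft (x, t))^2))"
proof -
 note Q = Qset_def[of T]
 have meas: "F : borel_measurable bor2" if "sqint lb2 F" for F using sqint_measurable[OF that] by (simp cong: measurable_cong_sets)
 note [measurable] = meas[OF dp] meas[OF ft(1)] meas[OF fxt(1)] k(1)
 have Qsub: "Qset T \<subseteq> {-1..1} \<times> {0..T}" by (auto simp: Q)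
 define pb where "pb z = indicator (Qset T) z * phi z" for z
 have "(%z. indicator (Qset T) z *\<^sub>R phi z) : borel_measurable borel"
  by (rule borel_measurable_continuous_on_indicator[OF Qset_borel continuous_on_subset[OF phi Qsub]])
 then have pbm[measurable]: "pb : borel_measurable bor2" unfolding borel_prod by (simp add: pb_def[abs_def])
 have "bounded (phi ` ({-1..1} \<times> {0..T}))" by (intro compact_imp_bounded compact_continuous_image phi compact_Times) auto
 then obtain C0 where "\<forall>y\<in>phi ` ({-1..1} \<times> {0..T}). norm y <= C0" unfolding bounded_iff by blast
 then have C0: "\<bar>phi z\<bar> <= C0" if "z : {-1..1} \<times> {0..T}" for z using that by auto
 have C0': "C0 >= 0" using C0[of "(0, 0)"] T by auto
 have pb_bd: "\<bar>pb z\<bar> <= C0" for z using C0[of z] C0' Qsub by (auto simp: pb_def split: split_indicator)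
 have pb_eq: "pb (x, t) = phi (x, t)" if "x : {-1<..<1}" "t : {0<..<T}" for x t using that by (simp add: pb_def Q)
 define c where "c x = indicator {-1<..<1} x * (x / beta)" for x
 have [measurable]: "c : borel_measurable borel" unfolding c_def by measurable
 have c_bd: "\<bar>c x\<bar> <= 1 / beta" for x using beta by (auto simp: c_def abs_mult divide_right_mono split: split_indicator)
 \<comment> \<open>The time derivative of the nonlocal integrand, with Borel versions and 0 outside
   Q.\<close>
 define W where "W z = fxt z * (c (fst z) * pb z) + dp z * ft z * c (fst z)" for z
 have fxti: "integrable lb2 fxt" by (rule sqint_support_integrable[OF fxt(1) sets_Qset[of T] emeasure_Qset]) (use fxt(2) Q in simp)
 have cpb: "\<bar>c (fst z) * pb z\<bar> <= 1 / beta * C0" for z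
  unfolding abs_mult using c_bd[of "fst z"] pb_bd[of z] beta by (intro mult_mono) auto
 have Wi: "integrable lb2 W"
  unfolding W_def
 proof (rule lint_add)
  show "integrable lb2 (%z. fxt z * (c (fst z) * pb z))" by (rule integrable_mult_bdd[OF fxti _ cpb]) simp
  show "integrable lb2 (%z. dp z * ft z * c (fst z))" by (rule integrable_mult_bdd[OF sqint_mult[OF dp ft(1)] _ c_bd]) simp
 qed
 have [measurable]: "W : borel_measurable bor2" unfolding W_def by measurable
 have W0: "W (x, t) = 0" if "t ~: {0<..<T}" for x t using fxt(2)[of "(x, t)"] ft(2)[of "(x, t)"] that by (auto simp: W_def Q)
 define h1 where "h1 t = gt t + (LBINT x. W (x, t))" for t
 have h10: "h1 t = 0" if "t ~: {0<..<T}" for t using gamma(3)[OF that] W0[OF that] by (simp add: h1_def)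
 have gtm[measurable]: "gt : borel_measurable borel" using sqint_measurable[OF gamma(2)] by simp
 have h1m[measurable]: "h1 : borel_measurable borel"
  unfolding h1_def using borel_measurable_integral_param[of "%p. W (snd p, fst p)" borel] by simp
 have ind1: "sqint lborel (indicator {-1<..<1} :: real => real)" by (intro sqint_indicator) auto
 have pbs: "sqint lborel (%x. pb (x, t))" for t
 proof (rule sqint_bound[OF ind1, where C = C0])
  show "\<bar>pb (x, t)\<bar> <= C0 * \<bar>indicator {-1<..<1} x\<bar>" for x using pb_bd[of "(x, t)"] by (auto simp: pb_def Q split: split_indicator)
 qed measurable
 have pbI: "(LBINT x. (pb (x, t))^2) = (LBINT x. indicator {-1<..<1} x * (phi (x, t))^2)" if "t : {0<..<T}" for t
  by (intro lint_cong) (use that in "auto simp: pb_def Q split: split_indicator")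
 have bound: "AE t in lborel. (h1 t)^2 <= 3 * (gt t)^2 + 3 * (M / beta^2) * ((LBINT x. (pb (x, t))^2) + (LBINT x. (ft (x, t))^2))"
  using sqint_slices(1)[OF dp] sqint_slices(1)[OF ft(1)] sqint_slices(1)[OF fxt(1)] M1 M2
 proof eventually_elim
  case (elim t)
  have s1: "sqint lborel (%x. c x * pb (x, t))" by (rule sqint_mult_bounded[OF pbs]) (use c_bd in auto)
  have s2: "sqint lborel (%x. c x * ft (x, t))" by (rule sqint_mult_bounded[OF elim(2)]) (use c_bd in auto)
  have M: "0 <= M" using elim(4) integral_nonneg_AE[of "%x. (dp (x, t))^2" lborel] by (meson AE_I2 order_trans zero_le_power2)
  have csq: "(LBINT x. (c x * F x)^2) <= 1 / beta^2 * (LBINT x. (F x)^2)"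
   if "sqint lborel (%x. c x * F x)" "sqint lborel F" for F
  proof -
   have "(LBINT x. (c x * F x)^2) <= (LBINT x. 1 / beta^2 * (F x)^2)"
   proof (rule integral_mono)
    show "(c x * F x)^2 <= 1 / beta^2 * (F x)^2" for x
    proof -
     have "(c x)^2 <= (1 / beta)^2" using c_bd[of x] beta by (simp add: abs_le_square_iff[symmetric])
     then show ?thesis by (simp add: power_mult_distrib power_divide mult_right_mono divide_right_mono) (metis mult_right_mono mult_1 times_divide_eq_left zero_le_power2)
    qed
   qed (use sqintD[OF that(1)] sqintD[OF that(2)] in auto)
   then show ?thesis by simp
  qed
  have e: "(LBINT x. W (x, t)) = (LBINT x. fxt (x, t) * (c x * pb (x, t))) + (LBINT x. dp (x, t) * (c x * ft (x, t)))"
   using sqint_mult[OF elim(3) s1] sqint_mult[OF elim(1) s2] by (simp add: W_def mult_ac)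
  have A: "(LBINT x. fxt (x, t) * (c x * pb (x, t)))^2 <= M / beta^2 * (LBINT x. (pb (x, t))^2)"
  proof -
   have "(LBINT x. fxt (x, t) * (c x * pb (x, t)))^2 <= (LBINT x. (fxt (x, t))^2) * (LBINT x. (c x * pb (x, t))^2)"
    by (rule Cauchy_Schwarz_integral[OF elim(3) s1])
   also have "... <= M * (1 / beta^2 * (LBINT x. (pb (x, t))^2))" using M by (intro mult_mono elim csq s1 pbs) auto
   finally show ?thesis by simp
  qed
  have B: "(LBINT x. dp (x, t) * (c x * ft (x, t)))^2 <= M / beta^2 * (LBINT x. (ft (x, t))^2)"
  proof -
   have "(LBINT x. dp (x, t) * (c x * ft (x, t)))^2 <= (LBINT x. (dp (x, t))^2) * (LBINT x. (c x * ft (x, t))^2)"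
    by (rule Cauchy_Schwarz_integral[OF elim(1) s2])
   also have "... <= M * (1 / beta^2 * (LBINT x. (ft (x, t))^2))" using M by (intro mult_mono elim csq s2) auto
   finally show ?thesis by simp
  qed
  have three: "(x + (y + z))^2 <= 3 * x^2 + 3 * y^2 + 3 * z^2" for x y z :: real
   using zero_le_power2[of "x - y"] zero_le_power2[of "y - z"] zero_le_power2[of "x - z"] by (simp add: power2_eq_square algebra_simps)
  have dist: "3 * (M / beta^2) * (a + b) = 3 * (M / beta^2 * a) + 3 * (M / beta^2 * b)" for a b by (simp only: distrib_left mult.assoc)
  show ?case unfolding h1_def e dist using three[of "gt t" "\<integral>x. fxt (x, t) * (c x * pb (x, t)) \<partial>lborel" "\<integral>x. dp (x, t) * (c x * ft (x, t)) \<partial>lborel"] A B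
   by linarith
 qed
 have h1sq: "sqint lborel h1"
  unfolding sqint_def
 proof
  have pb2: "sqint lb2 pb"
  proof (rule sqint_bound[OF sqint_indicator[OF sets_Qset[of T] emeasure_Qset], where C = C0])
   show "\<bar>pb z\<bar> <= C0 * \<bar>indicator ({-1<..<1} \<times> {0<..<T}) z\<bar>" for z using pb_bd[of z] by (auto simp: pb_def Q split: split_indicator)
  qed measurable
  show "integrable lborel (%t. (h1 t)^2)"
  proof (rule lint_bound)
   show "integrable lborel (%t. 3 * (gt t)^2 + 3 * (M / beta^2) * ((LBINT x. (pb (x, t))^2) + (LBINT x. (ft (x, t))^2)))"
    using sqintD[OF gamma(2)] slice_Fubini(2)[OF sqintD[OF pb2]] slice_Fubini(2)[OF sqintD[OF ft(1)]] by simp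
   show "AE t in lborel. norm ((h1 t)^2) <= norm (3 * (gt t)^2 + 3 * (M / beta^2) * ((LBINT x. (pb (x, t))^2) + (LBINT x. (ft (x, t))^2)))"
    using bound by eventually_elim simp
  qed measurable
 qed measurable
 have h1i: "integrable lborel h1" by (rule sqint_support_integrable[OF h1sq, of "{0<..<T}"]) (use T h10 in auto)
 have prm: "(%z. \<integral>r. indicator {..snd z} r * fxt (fst z, r) \<partial>lborel) : borel_measurable bor2"
  using borel_measurable_integral_param[of "%p::(real\<times>real)\<times>real. indicator {0..} (snd (fst p) - snd p) * fxt (fst (fst p), snd p)" "borel \<Otimes>\<^sub>M borel"]
  by (simp add: indicator_atMost_shift)
 \<comment> \<open>For fixed x this is the version of \<open>dp (x, .)\<close> that is absolutely
   continuous in time. The product rule applies to it, and it agrees with \<open>dp\<close> almost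
   everywhere.\<close>
 define P where "P x t = k x + (LBINT r. indicator {..t} r * fxt (x, r))" for x t
 have rep: "AE t in lborel. AE x in lborel. x : {-1<..<1} --> t : {0<..<T} --> dp (x, t) = P x t"
 proof -
  have "AE t in lborel. AE x in lborel. (%z. fst z : {-1<..<1} --> snd z : {0<..<T} --> dp z = k (fst z) + (LBINT r. indicator {..snd z} r * fxt (fst z, r))) (x, t)"
  proof (rule AE_lborel_commute)
   show "Measurable.pred (borel \<Otimes>\<^sub>M borel) (%z. fst z : {-1<..<1} --> snd z : {0<..<T} --> dp z = k (fst z) + (LBINT r. indicator {..snd z} r * fxt (fst z, r)))"
    using prm by measurable
   show "AE x in lborel. AE t in lborel. fst (x, t) : {-1<..<1} --> snd (x, t) : {0<..<T} --> dp (x, t) = k (fst (x, t)) + (LBINT r. indicator {..snd (x, t)} r * fxt (fst (x, t), r))"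
    using k(2)
   proof eventually_elim
    case (elim x)
    show ?case
    proof (cases "x : {-1<..<1}")
     case True
     with elim have "AE t in lborel. t : {0<..<T} --> dp (x, t) = k x + (LBINT r. indicator {..t} r * fxt (x, r))" by blast
     then show ?thesis by (rule eventually_mono) simp
    next
     case False then show ?thesis by (intro AE_I2) auto
    qed
   qed
  qed
  then show ?thesis by (simp add: P_def)
 qed
 have xrep: "AE x in lborel. x : {-1<..<1} --> (\<forall>s t. 0 < s --> s <= t --> t < T -->
   c x * (P x t * phi (x, t) - P x s * phi (x, s)) = (LBINT r. indicator {s..t} r * W (x, r)))" using act k(2) slice_Fubini(4)[OF fxti]
 proof eventually_elim
  case (elim x)
  show ?case
  proof (intro impI allI)
   fix s t assume x: "x : {-1<..<1}" and st: "0 < s" "s <= t" "t < T"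
   have a1: "ac_deriv 0 T (P x) (%t. fxt (x, t))"
    unfolding P_def by (rule ac_deriv_primitive[OF elim(3)]) (use fxt(2) in "auto simp: Q")
   have a2: "ac_deriv 0 T (%t. phi (x, t)) (%t. ft (x, t))" using elim(1) x by blast
   note m = ac_deriv_mult[OF a1 a2]
   have rp: "AE t in lborel. t : {0<..<T} --> dp (x, t) = P x t" using elim(2) x unfolding P_def by blast
   have "P x t * phi (x, t) - P x s * phi (x, s) = (LBINT r:{s..t}. fxt (x, r) * phi (x, r) + P x r * ft (x, r))" by (rule ac_deriv_diff[OF m]) (use st in auto)
   then have "c x * (P x t * phi (x, t) - P x s * phi (x, s)) = (LBINT r. c x * (indicator {s..t} r * (fxt (x, r) * phi (x, r) + P x r * ft (x, r))))"
    by (simp add: set_lebesgue_integral_def)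
   also have "... = (LBINT r. indicator {s..t} r * W (x, r))"
   proof (rule integral_cong_AE)
    have "set_integrable lborel {s..t} (%r. fxt (x, r) * phi (x, r) + P x r * ft (x, r))"
     by (rule set_integrable_subset[OF ac_deriv_integrable[OF m]]) (use st in auto)
    then show "(%r. c x * (indicator {s..t} r * (fxt (x, r) * phi (x, r) + P x r * ft (x, r)))) : borel_measurable lborel" by (auto simp: set_integrable_def)
    show "AE r in lborel. c x * (indicator {s..t} r * (fxt (x, r) * phi (x, r) + P x r * ft (x, r))) = indicator {s..t} r * W (x, r)"
     using rp by eventually_elim (use st x pb_eq[of x] in "auto simp: W_def algebra_simps split: split_indicator")
   qed measurable
   finally show "c x * (P x t * phi (x, t) - P x s * phi (x, s)) = (LBINT r. indicator {s..t} r * W (x, r))" .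
  qed
 qed
 define H where "H t = (LBINT x. indicator {-1<..<1} x * (x / beta * dp (x, t) * phi (x, t)))" for t
 have Heq: "H t = (LBINT x. dp (x, t) * (c x * pb (x, t)))" if "t : {0<..<T}" for t
  unfolding H_def by (intro lint_cong) (use that pb_eq in "auto simp: c_def split: split_indicator")
 define G where "G t \<longleftrightarrow> sqint lborel (%x. dp (x, t)) & (t : {0<..<T} --> phi (1, t) = gamma t + H t) \<and>
   (AE x in lborel. x : {-1<..<1} --> t : {0<..<T} --> dp (x, t) = P x t)" for t
 have G: "AE t in lborel. G t" using sqint_slices(1)[OF dp] bc rep unfolding G_def H_def by eventually_elim blast
 have Hdiff: "H t - H s = (LBINT r:{s..t}. \<integral>x. W (x, r) \<partial>lborel)" if st: "G s" "G t" "0 < s" "s <= t" "t < T" for s t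
 proof -
  have cs: "sqint lborel (%x. c x * pb (x, r))" for r by (rule sqint_mult_bounded[OF pbs]) (use c_bd in auto)
  have i: "integrable lborel (%x. dp (x, r) * (c x * pb (x, r)))" if "G r" for r using that by (intro sqint_mult cs) (auto simp: G_def)
  have Wst: "integrable lb2 (%z. W z * indicator {s..t} (snd z))" by (rule integrable_mult_bdd[OF Wi, where C = 1]) (auto split: split_indicator)
  have "H t - H s = (LBINT x. dp (x, t) * (c x * pb (x, t)) - dp (x, s) * (c x * pb (x, s)))" using Heq[of t] Heq[of s] st i by simp
  also have "... = (LBINT x. (LBINT r. W (x, r) * indicator {s..t} r))"
  proof (rule integral_cong_AE)
   show "(%x. dp (x, t) * (c x * pb (x, t)) - dp (x, s) * (c x * pb (x, s))) : borel_measurable lborel" by measurable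
   show "(%x. \<integral>r. W (x, r) * indicator {s..t} r \<partial>lborel) : borel_measurable lborel"
    using borel_measurable_integrable[OF slice_Fubini(5)[OF Wst]] by simp
   have "AE x in lborel. x : {-1<..<1} --> t : {0<..<T} --> dp (x, t) = P x t" "AE x in lborel. x : {-1<..<1} --> s : {0<..<T} --> dp (x, s) = P x s"
    using st by (auto simp: G_def)
   then show "AE x in lborel. dp (x, t) * (c x * pb (x, t)) - dp (x, s) * (c x * pb (x, s)) = (LBINT r. W (x, r) * indicator {s..t} r)" using xrep
   proof eventually_elim
    case (elim x)
    show ?case
    proof (cases "x : {-1<..<1}")
     case True
     then have "c x * (P x t * phi (x, t) - P x s * phi (x, s)) = (LBINT r. indicator {s..t} r * W (x, r))" using elim(3) st by blast
     then show ?thesis using elim(1,2) True st pb_eq[of x t] pb_eq[of x s] by (simp add: algebra_simps)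
    next
     case False
     then have "c x = 0" "W (x, r) = 0" for r using fxt(2)[of "(x, r)"] by (auto simp: c_def W_def Q)
     then show ?thesis by simp
    qed
   qed
  qed
  also have "... = (LBINT r. (LBINT x. W (x, r) * indicator {s..t} r))" using slice_Fubini(3,6)[OF Wst] by simp
  also have "... = (LBINT r:{s..t}. \<integral>x. W (x, r) \<partial>lborel)" by (simp add: set_lebesgue_integral_def mult.commute)
  finally show ?thesis .
 qed
 have ac0: "ac_deriv 0 T (%t. 0 + (LBINT r. indicator {..t} r * h1 r)) h1" by (rule ac_deriv_primitive[OF h1i]) (use h10 in auto)
 have phidiff: "phi (1, t) - phi (1, s) = (LBINT r. indicator {..t} r * h1 r) - (LBINT r. indicator {..s} r * h1 r)"
  if st: "G s" "G t" "0 < s" "s <= t" "t < T" for s t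
 proof -
  have gi: "set_integrable lborel {s..t} gt" by (rule set_integrable_subset[OF ac_deriv_integrable[OF gamma(1)]]) (use st in auto)
  have wi: "set_integrable lborel {s..t} (%r. \<integral>x. W (x, r) \<partial>lborel)"
   using integrable_mult_indicator[OF _ slice_Fubini(2)[OF Wi], of "{s..t}"] by (simp add: set_integrable_def)
  have "phi (1, t) - phi (1, s) = (gamma t - gamma s) + (H t - H s)" using st by (auto simp: G_def)
  also have "... = (LBINT r:{s..t}. gt r) + (LBINT r:{s..t}. \<integral>x. W (x, r) \<partial>lborel)"
   using Hdiff[OF st] ac_deriv_diff[OF gamma(1), of s t] st by simp
  also have "... = (LBINT r:{s..t}. h1 r)" unfolding h1_def using gi wi by simp
  also have "... = (LBINT r. indicator {..t} r * h1 r) - (LBINT r. indicator {..s} r * h1 r)" using ac_deriv_diff[OF ac0, of s t] st by simp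
  finally show ?thesis .
 qed
 \<comment> \<open>One good time fixes the constant of integration; continuity of phi then removes
   the exceptional times.\<close>
 obtain s0 where s0: "s0 : {0<..<T}" "G s0" using AE_ex_in_interval[OF G T] by blast
 have "ac_deriv 0 T (%t. phi (1, t)) h1"
 proof (rule ac_deriv_of_AE_primitive[OF T _ h1i, where k = "phi (1, s0) - (LBINT r. indicator {..s0} r * h1 r)"])
  show "continuous_on {0..T} (%t. phi (1, t))" by (rule continuous_on_compose2[OF phi]) (auto intro!: continuous_intros)
  show "h1 y = 0" if "y <= 0" for y using h10[of y] that by auto
  show "AE t in lborel. t : {0<..<T} --> phi (1, t) = phi (1, s0) - (LBINT r. indicator {..s0} r * h1 r) + (LBINT r. indicator {..t} r * h1 r)" using G
  proof eventually_elim
   case (elim t)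
   show ?case
   proof
    assume t: "t : {0<..<T}"
    show "phi (1, t) = phi (1, s0) - (LBINT r. indicator {..s0} r * h1 r) + (LBINT r. indicator {..t} r * h1 r)"
    proof (cases "s0 <= t")
     case True
     from phidiff[OF s0(2) elim _ True] s0 t show ?thesis by simp
    next
     case False
     then have "t <= s0" by simp
     from phidiff[OF elim s0(2) _ this] s0 t show ?thesis by simp
    qed
   qed
  qed
 qed
 moreover have "AE t in lborel. t : {0<..<T} --> (h1 t)^2 <= 3 * (gt t)^2 +
   3 * (M / beta^2) * ((LBINT x. indicator {-1<..<1} x * (phi (x, t))^2) + (LBINT x. (ft (x, t))^2))" using bound
 proof eventually_elim
  case (elim t)
  show ?case
  proof
   assume t: "t : {0<..<T}"
   show "(h1 t)^2 <= 3 * (gt t)^2 + 3 * (M / beta^2) * ((LBINT x. indicator {-1<..<1} x * (phi (x, t))^2) + (LBINT x. (ft (x, t))^2))"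
    using elim unfolding pbI[OF t] .
  qed
 qed
 ultimately show thesis using that[OF h1sq] h10 by blast
qed

section \<open>The pointwise inequalities\<close>

lemma young_scaled:
 fixes A B c :: real
 assumes "c > 0"
 shows "2 * \<bar>A * B\<bar> <= c * A^2 + B^2 / c"
proof -
 have "0 <= (c * \<bar>A\<bar> - \<bar>B\<bar>)^2 / c" using assms by simp
 also have "... = c * A^2 - 2 * \<bar>A * B\<bar> + B^2 / c" using assms by (simp add: power2_diff field_simps abs_mult power_mult_distrib power2_eq_square)
 finally show ?thesis by simp
qed

text \<open>The geometric mean of the two energy terms is
  \<open>lam^3 * y^2 * \<bar>W * X\<bar>\<close>, so a coefficient of order \<open>lam^3 * y\<close>
  leaves a gain of \<open>1 / y\<close>.\<close>

lemma cross_term_bound: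
 fixes lam y X W \<kappa> K :: real
 assumes lam: "lam >= 1" and y: "y >= 1" and k: "\<bar>\<kappa>\<bar> <= K * (lam ^ 3 * y)"
 shows "\<bar>\<kappa> * (W * X)\<bar> <= K / y * (lam^2 * y * X^2 + lam ^ 4 * y ^ 3 * W^2)"
proof -
 have K: "K >= 0"
 proof -
  have "0 <= K * (lam ^ 3 * y)" using k by linarith
  moreover have "lam ^ 3 * y > 0" using lam y by simp
  ultimately show ?thesis by (simp add: zero_le_mult_iff)
 qed
 have "2 * \<bar>W * X\<bar> <= (lam * y) * W^2 + X^2 / (lam * y)" by (rule young_scaled) (use lam y in simp)
 then have "lam ^ 3 * y * (2 * \<bar>W * X\<bar>) <= lam ^ 3 * y * ((lam * y) * W^2 + X^2 / (lam * y))" using lam y by (intro mult_left_mono) auto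
 also have "... = (lam^2 * y * X^2 + lam ^ 4 * y ^ 3 * W^2) / y" using lam y by (simp add: field_simps power2_eq_square power3_eq_cube power4_eq_xxxx)
 finally have *: "lam ^ 3 * y * (2 * \<bar>W * X\<bar>) <= (lam^2 * y * X^2 + lam ^ 4 * y ^ 3 * W^2) / y" .
 have "\<bar>\<kappa> * (W * X)\<bar> <= K * (lam ^ 3 * y) * \<bar>W * X\<bar>" unfolding abs_mult[of \<kappa>] using k by (intro mult_right_mono) auto
 also have "... <= K * (lam ^ 3 * y * (2 * \<bar>W * X\<bar>))" using K lam y by (simp add: mult_left_mono)
 also have "... <= K * ((lam^2 * y * X^2 + lam ^ 4 * y ^ 3 * W^2) / y)" using K * by (intro mult_left_mono)
 finally show ?thesis by simp
qed

text \<open>Here y is \<open>s xi\<close>, X and W are \<open>w_x\<close> and w, D is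
  \<open>eta'\<close>, and \<open>oi\<close> is the indicator of omega. Where |D| >= c0, the leading
  coefficients 6 D^2 and 2 D^4 are coercive; elsewhere the cutoff gives the term in X and the
  observation term the one in W. The other terms are small through \<open>dl\<close>, apart from
  half of \<open>P1^2\<close> spent on the product \<open>W * P1\<close> and from the term with V,
  which lives on omega and is paid by the observation term.\<close>

lemma pointwise_interior:
 fixes lam y X W P1 P2 rx rw \<kappa> sg \<rho> V D K c0 dl oi :: real
 assumes lam: "lam >= 1" and y: "y >= 1" and yd: "1 / y <= dl" and K: "K >= 1" and c0: "c0 > 0"
  and k: "\<bar>\<kappa>\<bar> <= K * (lam ^ 3 * y)" and s: "\<bar>sg\<bar> <= K * (lam ^ 3 * y)"
  and rx: "\<bar>rx\<bar> <= K * dl * (lam^2 * y)" and rw: "\<bar>rw\<bar> <= K * dl * (lam ^ 4 * y ^ 3)"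
  and rho: "0 <= \<rho>" "\<rho> <= K * oi" and oi: "0 <= oi" "oi <= 1" and V: "\<bar>V\<bar> <= K * (lam^2 * y^2)"
  and dich: "\<bar>D\<bar> >= c0 \<or> (\<rho> >= 1 & oi = 1)"
  and delta: "K^2 * dl * 8 <= min (min (6 * c0^2) 1) (2 * c0 ^ 4)"
 shows "P1^2 + P2^2 + (6 * (lam^2 * D^2 * y) + rx) * X^2 + \<kappa> * (W * X) + (2 * (lam ^ 4 * D ^ 4 * y ^ 3) + rw) * W^2
   + sg * (W * X) + \<rho> * (lam^2 * y) * X^2 + \<rho> * (lam^2 * y) * (W * (P1 - V * W)) + 2 * K^2 * oi * (lam ^ 4 * y ^ 3 * W^2)
  >= 1 / 2 * P1^2 + P2^2 + min (min (6 * c0^2) 1) (2 * c0 ^ 4) / 2 * (lam^2 * y * X^2 + lam ^ 4 * y ^ 3 * W^2)"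
proof -
 define XX WW where "XX = lam^2 * y * X^2" and "WW = lam ^ 4 * y ^ 3 * W^2"
 have XX: "XX >= 0" and WW: "WW >= 0" using lam y by (auto simp: XX_def WW_def)
 define c where "c = min (min (6 * c0^2) 1) (2 * c0 ^ 4)"
 have d0: "dl > 0" using yd y by (smt (verit) divide_pos_pos)
 have KK: "K <= K^2" "1 <= K^2" using K one_le_power[OF K, of 2] by (simp_all add: power2_eq_square)
 have Kd: "K * dl <= K^2 * dl" using KK d0 by (simp add: mult_right_mono)
 have Ky: "K / y <= K^2 * dl" "K^2 / y <= K^2 * dl"
 proof -
  have "K * (1 / y) <= K * dl" "K^2 * (1 / y) <= K^2 * dl" using mult_left_mono[OF yd, of K] mult_left_mono[OF yd, of "K^2"] K by simp_all
  then show "K / y <= K^2 * dl" "K^2 / y <= K^2 * dl" using Kd by auto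
 qed
 have t1: "\<kappa> * (W * X) >= - (K^2 * dl * (XX + WW))"
 proof -
  have "\<bar>\<kappa> * (W * X)\<bar> <= K / y * (XX + WW)" unfolding XX_def WW_def by (rule cross_term_bound[OF lam y k])
  also have "... <= K^2 * dl * (XX + WW)" using Ky XX WW by (intro mult_right_mono) auto
  finally show ?thesis by linarith
 qed
 have t2: "sg * (W * X) >= - (K^2 * dl * (XX + WW))"
 proof -
  have "\<bar>sg * (W * X)\<bar> <= K / y * (XX + WW)" unfolding XX_def WW_def by (rule cross_term_bound[OF lam y s])
  also have "... <= K^2 * dl * (XX + WW)" using Ky XX WW by (intro mult_right_mono) auto
  finally show ?thesis by linarith
 qed
 have t3: "rx * X^2 >= - (K^2 * dl * XX)"
 proof -
  have "\<bar>rx * X^2\<bar> <= K * dl * (lam^2 * y) * X^2" unfolding abs_mult using rx by (simp add: mult_right_mono)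
  also have "... = K * dl * XX" by (simp add: XX_def)
  also have "... <= K^2 * dl * XX" using Kd XX by (rule mult_right_mono)
  finally show ?thesis by linarith
 qed
 have t4: "rw * W^2 >= - (K^2 * dl * WW)"
 proof -
  have "\<bar>rw * W^2\<bar> <= K * dl * (lam ^ 4 * y ^ 3) * W^2" unfolding abs_mult using rw by (simp add: mult_right_mono)
  also have "... = K * dl * WW" by (simp add: WW_def)
  also have "... <= K^2 * dl * WW" using Kd WW by (rule mult_right_mono)
  finally show ?thesis by linarith
 qed
 have rK: "\<rho> <= K" using rho oi K by (metis mult.right_neutral mult_left_mono order_trans zero_le_one)
 have t5: "\<rho> * (lam^2 * y) * (W * P1) >= - (1 / 2 * P1^2) - K^2 * dl * WW"
 proof -
  have "2 * \<bar>P1 * (\<rho> * (lam^2 * y) * W)\<bar> <= 1 * P1^2 + (\<rho> * (lam^2 * y) * W)^2 / 1" by (rule young_scaled) simp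
  moreover have "(\<rho> * (lam^2 * y) * W)^2 <= 2 * (K^2 * dl * WW)"
  proof -
   have "(\<rho> * (lam^2 * y) * W)^2 = \<rho>^2 / y * WW" using y by (simp add: WW_def power_mult_distrib field_simps power2_eq_square power3_eq_cube power4_eq_xxxx)
   also have "... <= K^2 / y * WW" using rho(1) rK y WW by (intro mult_right_mono divide_right_mono power_mono) auto
   also have "... <= K^2 * dl * WW" using Ky WW by (intro mult_right_mono) auto
   moreover have "0 <= K^2 * dl * WW" using d0 WW by simp
   ultimately show ?thesis by linarith
  qed
  moreover have "\<rho> * (lam^2 * y) * (W * P1) = P1 * (\<rho> * (lam^2 * y) * W)" by simp
  ultimately show ?thesis using abs_ge_minus_self[of "P1 * (\<rho> * (lam^2 * y) * W)"] by linarith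
 qed
 \<comment> \<open>This uses one of the two copies of \<open>K^2 * oi * WW\<close>; the other is
   kept for coercivity in \<open>m2\<close>.\<close>
 have t6: "- (\<rho> * (lam^2 * y) * (V * W^2)) >= - (K^2 * oi * WW)"
 proof -
  have "\<rho> * (lam^2 * y) * (V * W^2) <= \<rho> * (lam^2 * y) * (K * (lam^2 * y^2) * W^2)" using rho lam y V by (intro mult_left_mono mult_right_mono) auto
  also have "... = \<rho> * (K * WW)" by (simp add: WW_def field_simps power2_eq_square power3_eq_cube power4_eq_xxxx)
  also have "... <= K * oi * (K * WW)" using rho K WW by (intro mult_right_mono) auto
  finally show ?thesis by (simp add: power2_eq_square mult_ac)
 qed
 have m1: "(6 * D^2 + \<rho>) * XX >= c * XX"
 proof -
  have "6 * D^2 + \<rho> >= c"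
  proof (cases "\<bar>D\<bar> >= c0")
   case True
   then have "c0^2 <= D^2" using c0 by (simp add: abs_le_square_iff[symmetric])
   then show ?thesis using rho by (simp add: c_def min_def)
  next
   case False
   then have "\<rho> >= 1" using dich by simp
   moreover have "c <= 1" by (simp add: c_def)
   moreover have "D^2 >= 0" by simp
   ultimately show ?thesis by linarith
  qed
  then show ?thesis using XX by (rule mult_right_mono)
 qed
 have m2: "(2 * D ^ 4 + K^2 * oi) * WW >= c * WW"
 proof -
  have "2 * D ^ 4 + K^2 * oi >= c"
  proof (cases "\<bar>D\<bar> >= c0")
   case True
   then have "c0 ^ 4 <= \<bar>D\<bar> ^ 4" using c0 by (intro power_mono) auto
   then have "c0 ^ 4 <= D ^ 4" by simp
   moreover have "K^2 * oi >= 0" using oi by simp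
   moreover have "c <= 2 * c0 ^ 4" by (simp add: c_def)
   ultimately show ?thesis by linarith
  next
   case False
   then have "K^2 * oi >= 1" using dich KK by simp
   moreover have "c <= 1" by (simp add: c_def)
   moreover have "D ^ 4 >= 0" by simp
   ultimately show ?thesis by linarith
  qed
  then show ?thesis using WW by (rule mult_right_mono)
 qed
 \<comment> \<open>The two cross terms, the two remainders together and what is left of
   \<open>t5\<close> each cost at most \<open>K^2 * dl * (XX + WW)\<close>: four in all.\<close>
 have e: "K^2 * dl * (XX + WW) * 4 <= c / 2 * (XX + WW)" using mult_right_mono[OF delta, of "XX + WW"] XX WW unfolding c_def[symmetric] by simp
 have id: "P1^2 + P2^2 + (6 * (lam^2 * D^2 * y) + rx) * X^2 + \<kappa> * (W * X) + (2 * (lam ^ 4 * D ^ 4 * y ^ 3) + rw) * W^2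
   + sg * (W * X) + \<rho> * (lam^2 * y) * X^2 + \<rho> * (lam^2 * y) * (W * (P1 - V * W)) + 2 * K^2 * oi * (lam ^ 4 * y ^ 3 * W^2)
   = P1^2 + P2^2 + (6 * D^2 + \<rho>) * XX + (2 * D ^ 4 + K^2 * oi) * WW + K^2 * oi * WW + rx * X^2 + rw * W^2
   + \<kappa> * (W * X) + sg * (W * X) + \<rho> * (lam^2 * y) * (W * P1) + (- (\<rho> * (lam^2 * y) * (V * W^2)))"
  by (simp add: XX_def WW_def algebra_simps power2_eq_square)
 have pos: "0 <= K^2 * dl * XX" "0 <= K^2 * dl * WW" using d0 XX WW by auto
 have ex: "K^2 * dl * (XX + WW) = K^2 * dl * XX + K^2 * dl * WW" "c / 2 * (XX + WW) * 2 = c * XX + c * WW" by (simp_all add: algebra_simps)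
 show ?thesis
  unfolding id unfolding XX_def[symmetric] WW_def[symmetric] c_def[symmetric] using t1 t2 t3 t4 t5 t6 m1 m2 e pos ex by linarith
qed

text \<open>Solve the definitions of P1 and P2 for \<open>wxx\<close> and \<open>wt\<close>. After
  division by y the squared coefficients of w and \<open>w_x\<close> are at most those of the energy
  terms, up to powers of K.\<close>

lemma pointwise_recover:
 fixes lam y X W wxx wt P1 P2 V D q K :: real
 assumes lam: "lam >= 1" and y: "y >= 1" and K: "K >= 1" and V: "\<bar>V\<bar> <= K * (lam^2 * y^2)" and D: "\<bar>D\<bar> <= K" and q: "q >= 1 / K"
  and P1: "P1 = wxx + V * W" and P2: "P2 = q * wt - 2 * (lam * D * y) * X - 2 * (lam^2 * D^2 * y) * W"
 shows "(wt^2 + wxx^2) / y <= 14 * K ^ 6 * (P1^2 + P2^2 + lam^2 * y * X^2 + lam ^ 4 * y ^ 3 * W^2)"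
proof -
 define XX WW where "XX = lam^2 * y * X^2" and "WW = lam ^ 4 * y ^ 3 * W^2"
 have XX: "XX >= 0" and WW: "WW >= 0" using lam y by (auto simp: XX_def WW_def)
 have Kp: "1 <= K^2" "K^2 <= K ^ 6" "K ^ 4 <= K ^ 6" using K by (auto intro: power_increasing one_le_power)
 have "wxx^2 / y <= 2 * P1^2 + 2 * K^2 * WW"
 proof -
  have "wxx^2 <= 2 * P1^2 + 2 * (- V * W)^2" using square_add_le[of P1 "- V * W"] by (simp add: P1)
  then have "wxx^2 / y <= (2 * P1^2 + 2 * (- V * W)^2) / y" using y by (intro divide_right_mono) auto
  also have "... = 2 * P1^2 / y + 2 * (V^2 * W^2) / y" by (simp add: add_divide_distrib power_mult_distrib)
  also have "2 * P1^2 / y <= 2 * P1^2" using y by (simp add: divide_le_eq mult_le_cancel_left1)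
  also have "2 * (V^2 * W^2) / y <= 2 * ((K * (lam^2 * y^2))^2 * W^2) / y"
  proof -
   have "V^2 <= (K * (lam^2 * y^2))^2" using power_mono[OF V, of 2] by simp
   then show ?thesis using y by (intro divide_right_mono mult_left_mono mult_right_mono) auto
  qed
  also have "... = 2 * K^2 * WW" using y by (simp add: WW_def field_simps power2_eq_square power3_eq_cube power4_eq_xxxx)
  finally show ?thesis by simp
 qed
 moreover have "wt^2 / y <= K^2 * (3 * P2^2 + 12 * K^2 * XX + 12 * K ^ 4 * WW)"
 proof -
  have three: "(a + (b + c))^2 <= 3 * a^2 + 3 * b^2 + 3 * c^2" for a b c :: real
   using zero_le_power2[of "a - b"] zero_le_power2[of "b - c"] zero_le_power2[of "a - c"] by (simp add: power2_eq_square algebra_simps)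
  have "(q * wt)^2 <= 3 * P2^2 + 3 * (2 * (lam * D * y) * X)^2 + 3 * (2 * (lam^2 * D^2 * y) * W)^2"
   using three[of P2 "2 * (lam * D * y) * X" "2 * (lam^2 * D^2 * y) * W"] by (simp add: P2)
  also have "3 * (2 * (lam * D * y) * X)^2 = 12 * D^2 * (y * XX)" by (simp add: XX_def power_mult_distrib power2_eq_square)
  also have "3 * (2 * (lam^2 * D^2 * y) * W)^2 = 12 * D ^ 4 * (WW / y)" using y by (simp add: WW_def field_simps power_mult_distrib power2_eq_square power3_eq_cube power4_eq_xxxx)
  also have "12 * D^2 * (y * XX) <= 12 * K^2 * (y * XX)" using power_mono[OF D, of 2] y XX by (intro mult_right_mono mult_left_mono) auto
  also have "12 * D ^ 4 * (WW / y) <= 12 * K ^ 4 * (y * WW)"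
  proof (rule mult_mono)
   show "12 * D ^ 4 <= 12 * K ^ 4" using power_mono[OF D, of 4] by simp
   have "WW / y <= WW" using y WW by (simp add: divide_le_eq mult_le_cancel_left1)
   also have "WW <= y * WW" using y WW by (simp add: mult_le_cancel_right1)
   finally show "WW / y <= y * WW" .
  qed (use y WW K in auto)
  also have "3 * P2^2 <= y * (3 * P2^2)" using y by (simp add: mult_le_cancel_right1)
  finally have qw: "(q * wt)^2 <= y * (3 * P2^2 + 12 * K^2 * XX + 12 * K ^ 4 * WW)" by (simp add: algebra_simps)
  have "1 <= K * q" using q K by (simp add: field_simps)
  then have "wt^2 <= (K * q)^2 * wt^2" by (simp add: mult_le_cancel_right1 one_le_power)
  also have "... = K^2 * (q * wt)^2" by (simp add: power_mult_distrib)
  also have "... <= K^2 * (y * (3 * P2^2 + 12 * K^2 * XX + 12 * K ^ 4 * WW))" using qw by (intro mult_left_mono) auto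
  finally show ?thesis using y by (simp add: divide_le_eq mult_ac)
 qed
 moreover have "K^2 * (3 * P2^2 + 12 * K^2 * XX + 12 * K ^ 4 * WW) = 3 * (K^2 * P2^2) + 12 * (K ^ 4 * XX) + 12 * (K ^ 6 * WW)"
  by (simp add: algebra_simps power2_eq_square power4_eq_xxxx) (simp add: eval_nat_numeral)
 moreover have "K^2 * P2^2 <= K ^ 6 * P2^2" "K ^ 4 * XX <= K ^ 6 * XX" "K^2 * WW <= K ^ 6 * WW" "P1^2 <= K ^ 6 * P1^2"
  using Kp XX WW by (auto intro!: mult_right_mono simp: mult_le_cancel_right1)
 moreover have "0 <= K ^ 6 * P2^2" "0 <= K ^ 6 * XX" "0 <= K ^ 6 * WW" "0 <= K ^ 6 * P1^2" using XX WW K by auto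
 moreover have "(wt^2 + wxx^2) / y = wt^2 / y + wxx^2 / y" by (rule add_divide_distrib)
 moreover have "14 * K ^ 6 * (P1^2 + P2^2 + XX + WW) = 14 * (K ^ 6 * P1^2) + 14 * (K ^ 6 * P2^2) + 14 * (K ^ 6 * XX) + 14 * (K ^ 6 * WW)"
  by (simp add: algebra_simps)
 ultimately show ?thesis unfolding XX_def[symmetric] WW_def[symmetric] by linarith
qed

text \<open>At x = 1 the sign of D makes the contributions of \<open>X^2\<close> and
  \<open>W^2\<close> positive. Young's inequality on the product of X and \<open>wt\<close> leaves
  \<open>wt^2 / (lam * y)\<close> as the only debt.\<close>

lemma pointwise_boundary:
 fixes lam y X W wt v1 D q K c0 dl :: real
 assumes lam: "lam >= 1" and y: "y >= 1" and yd: "1 / y <= dl" and K: "K >= 1" and c0: "c0 > 0"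
  and D: "D <= - c0" "\<bar>D\<bar> <= K" and v1: "\<bar>v1\<bar> <= K * dl * y^2" and q: "\<bar>q\<bar> <= K"
  and delta: "2 * K^2 * dl + 8 * K ^ 4 / c0 * dl <= c0 ^ 3"
 shows "2 * (- (lam * D * y) * X^2 - 2 * (lam^2 * D^2 * y) * (W * X) - (lam * D * y) * ((lam^2 * D^2 * y^2 + v1) * W^2)) + 2 * (q * X * wt)
  >= c0 * (lam * y * X^2) + c0 ^ 3 * (lam ^ 3 * y ^ 3 * W^2) - 2 * K^2 / c0 * (wt^2 / (lam * y))"
proof -
 define XX WW where "XX = lam * y * X^2" and "WW = lam ^ 3 * y ^ 3 * W^2"
 have XX: "XX >= 0" and WW: "WW >= 0" using lam y by (auto simp: XX_def WW_def)
 have d0: "dl > 0" using yd y by (smt (verit) divide_pos_pos)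
 have a1: "- (lam * D * y) * X^2 >= c0 * XX"
 proof -
  have "- (lam * D * y) * X^2 = (- D) * XX" by (simp add: XX_def)
  also have "... >= c0 * XX" using D XX by (intro mult_right_mono) auto
  finally show ?thesis .
 qed
 have a2: "2 * \<bar>2 * (lam^2 * D^2 * y) * (W * X)\<bar> <= c0 / 2 * XX + 8 * K ^ 4 / c0 * dl * WW"
 proof -
  have "2 * \<bar>X * (4 * (lam * D^2) * W)\<bar> <= c0 * X^2 + (4 * (lam * D^2) * W)^2 / c0" by (rule young_scaled[OF c0])
  then have "lam * y / 2 * (2 * \<bar>X * (4 * (lam * D^2) * W)\<bar>) <= lam * y / 2 * (c0 * X^2 + (4 * (lam * D^2) * W)^2 / c0)"
   using lam y by (intro mult_left_mono) auto
  also have "... = c0 / 2 * XX + 8 * D ^ 4 / c0 * (WW * (1 / y^2))"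
   using y c0 by (simp add: XX_def WW_def field_simps power_mult_distrib power2_eq_square power3_eq_cube power4_eq_xxxx)
  also have "8 * D ^ 4 / c0 * (WW * (1 / y^2)) <= 8 * K ^ 4 / c0 * (WW * dl)"
  proof (rule mult_mono)
   show "8 * D ^ 4 / c0 <= 8 * K ^ 4 / c0" using power_mono[OF D(2), of 4] c0 by (intro divide_right_mono) auto
   have "1 / y^2 <= 1 / y" using y by (simp add: power2_eq_square divide_le_eq)
   then show "WW * (1 / y^2) <= WW * dl" using yd WW by (intro mult_left_mono) auto
  qed (use WW c0 K in auto)
  finally have "lam * y / 2 * (2 * \<bar>X * (4 * (lam * D^2) * W)\<bar>) <= c0 / 2 * XX + 8 * K ^ 4 / c0 * (WW * dl)" by simp
  moreover have "lam * y / 2 * (2 * \<bar>X * (4 * (lam * D^2) * W)\<bar>) = 2 * \<bar>2 * (lam^2 * D^2 * y) * (W * X)\<bar>"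
   using lam y by (simp add: abs_mult power2_eq_square)
  ultimately show ?thesis by (simp add: mult_ac)
 qed
 have a3: "- (lam * D * y) * ((lam^2 * D^2 * y^2 + v1) * W^2) >= c0 ^ 3 * WW - K^2 * dl * WW"
 proof -
  have e: "- (lam * D * y) * ((lam^2 * D^2 * y^2 + v1) * W^2) = (- D) ^ 3 * WW + (- D) * (lam * y * (v1 * W^2))"
   by (simp add: WW_def field_simps power2_eq_square power3_eq_cube)
  have "c0 ^ 3 <= (- D) ^ 3" using D c0 by (intro power_mono) auto
  then have 1: "(- D) ^ 3 * WW >= c0 ^ 3 * WW" using WW by (rule mult_right_mono)
  have "\<bar>(- D) * (lam * y * (v1 * W^2))\<bar> <= K * (lam * y * ((K * dl * y^2) * W^2))"
   unfolding abs_mult using D v1 lam y K d0 by (intro mult_mono) auto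
  also have "... = K^2 * dl * (lam * y ^ 3 * W^2)" by (simp add: power2_eq_square power3_eq_cube)
  also have "... <= K^2 * dl * WW"
  proof -
   have "lam * y ^ 3 * W^2 <= lam ^ 3 * y ^ 3 * W^2" using lam y power_increasing[of 1 3 lam] by (intro mult_right_mono) auto
   then show ?thesis using d0 unfolding WW_def by (intro mult_left_mono) auto
  qed
  finally show ?thesis using e 1 by linarith
 qed
 have a4: "2 * \<bar>q * X * wt\<bar> <= c0 / 2 * XX + 2 * K^2 / c0 * (wt^2 / (lam * y))"
 proof -
  have p: "c0 / 2 * (lam * y) > 0" using c0 lam y by simp
  have "2 * \<bar>X * (q * wt)\<bar> <= c0 / 2 * (lam * y) * X^2 + (q * wt)^2 / (c0 / 2 * (lam * y))" by (rule young_scaled[OF p])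
  also have "(q * wt)^2 / (c0 / 2 * (lam * y)) <= (K^2 * wt^2) / (c0 / 2 * (lam * y))"
   using power_mono[OF q, of 2] p by (intro divide_right_mono) (auto simp: power_mult_distrib mult_right_mono)
  also have "(K^2 * wt^2) / (c0 / 2 * (lam * y)) = 2 * K^2 / c0 * (wt^2 / (lam * y))" by simp
  finally show ?thesis by (simp add: XX_def mult_ac)
 qed
 \<comment> \<open>Of \<open>2 * c0 * XX\<close> one half is spent on \<open>a2\<close> and
   \<open>a4\<close>; of \<open>2 * c0 ^ 3 * WW\<close> one half is spent here.\<close>
 have e: "(2 * K^2 * dl + 8 * K ^ 4 / c0 * dl) * WW <= c0 ^ 3 * WW" using delta WW by (rule mult_right_mono)
 show ?thesis unfolding XX_def[symmetric] WW_def[symmetric] using a1 a2 a3 a4 e by (simp add: algebra_simps)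
qed

text \<open>The coefficients of the quadratic form with their leading parts removed. The letters
  \<open>u1\<close> to \<open>u5\<close> stand for \<open>s q alpha_t\<close>, its x-derivative, the
  t-derivative of \<open>lam eta' s xi\<close>, \<open>s q_t alpha_t\<close> and
  \<open>s q alpha_tt\<close>. Each carries \<open>dl\<close>, because they are controlled by
  \<open>s xi^2\<close> or \<open>s xi^3\<close>, which is at most \<open>dl\<close> times the same
  power of \<open>s xi\<close> when \<open>1 <= dl s <= dl s^2\<close>.\<close>

lemma coefficient_bounds:
 fixes lam y K D D2 u1 u2 u3 u4 u5 qv qtv L dl :: real
 assumes lam: "lam >= 1" "1 <= dl * lam" and y: "y >= 1" "1 <= dl * y" and K: "K >= 1" and d: "dl <= 1"
  and D: "\<bar>D\<bar> <= K" "\<bar>D2\<bar> <= K" and q: "\<bar>qv\<bar> <= K" "\<bar>qtv\<bar> <= K" "\<bar>L\<bar> <= K"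
  and u: "\<bar>u1\<bar> <= K^2 * dl * y^2" "\<bar>u2\<bar> <= K ^ 3 * dl * (lam * y^2)" "\<bar>u3\<bar> <= K^2 * dl * (lam * y^2)"
   "\<bar>u4\<bar> <= K^2 * dl * y^2" "\<bar>u5\<bar> <= 3 * K^2 * dl * y ^ 3"
 shows "\<bar>2 * (lam * D2 * y) - L\<bar> <= 40 * K ^ 5 * dl * (lam^2 * y)"
  and "\<bar>4 * (lam^2 * y * (2 * D * D2 + lam * D ^ 3))\<bar> <= 40 * K ^ 5 * (lam ^ 3 * y)"
  and "\<bar>lam^2 * D^2 * y^2 + u1\<bar> <= 2 * K^2 * (lam^2 * y^2)"
  and "\<bar>6 * (lam ^ 3 * D^2 * D2 * y ^ 3) + 2 * ((lam * D2 * y + lam^2 * D^2 * y) * u1) + 2 * (lam * D * y * u2)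
    - 4 * (lam^2 * D^2 * y * u1) - qtv * (lam^2 * D^2 * y^2 + u1) - qv * (2 * (lam * D * y) * u3 + u4 + u5)\<bar>
    <= 40 * K ^ 5 * dl * (lam ^ 4 * y ^ 3)"
proof -
 have d0: "dl > 0" using lam by (smt (verit) mult_nonpos_nonneg)
 have lp: "1 <= lam" "lam <= lam^2" "lam^2 <= lam ^ 3" "lam ^ 3 <= lam ^ 4" "lam^2 <= lam ^ 4" "1 <= lam^2"
  using lam(1) power_increasing[of 1 2 lam] power_increasing[of 2 3 lam] power_increasing[of 3 4 lam] power_increasing[of 2 4 lam] one_le_power[OF lam(1), of 2] by auto
 have yp: "y^2 <= y ^ 3" "y <= y^2" "y > 0" using y(1) power_increasing[of 2 3 y] power_increasing[of 1 2 y] by auto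
 have kp: "K <= K ^ 5" "K^2 <= K ^ 5" "K ^ 3 <= K ^ 5" "K ^ 4 <= K ^ 5" "0 < K ^ 5" "1 <= K"
  using K power_increasing[of 1 5 K] power_increasing[of 2 5 K] power_increasing[of 3 5 K] power_increasing[of 4 5 K] by auto
 have ly: "lam * y <= dl * (lam^2 * y)" using mult_right_mono[OF lam(2), of "lam * y"] lam y by (simp add: power2_eq_square mult_ac)
 have l2y: "lam^2 <= dl * (lam^2 * y)" using mult_right_mono[OF y(2), of "lam^2"] by (simp add: mult_ac)
 have D2b: "D^2 <= K^2" using power_mono[OF D(1), of 2] by simp
 have D3b: "\<bar>D ^ 3\<bar> <= K ^ 3" using power_mono[OF D(1), of 3] by (simp add: power_abs)
 show "\<bar>2 * (lam * D2 * y) - L\<bar> <= 40 * K ^ 5 * dl * (lam^2 * y)"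
 proof -
  have "\<bar>lam * D2 * y\<bar> <= K * (lam * y)" using D(2) lam y by (simp add: abs_mult mult.commute mult.left_commute mult_right_mono)
  also have "... <= K * (dl * (lam^2 * y))" using ly K by (intro mult_left_mono) auto
  finally have 1: "\<bar>lam * D2 * y\<bar> <= K * (dl * (lam^2 * y))" .
  have "1 <= dl * (lam^2 * y)" using l2y lp by linarith
  then have "K * 1 <= K * (dl * (lam^2 * y))" using K by (intro mult_left_mono) auto
  then have 2: "\<bar>L\<bar> <= K * (dl * (lam^2 * y))" using q(3) by simp
  have "K * (dl * (lam^2 * y)) <= K ^ 5 * (dl * (lam^2 * y))" using kp d0 y lp by (intro mult_right_mono) auto
  moreover have "0 <= K ^ 5 * (dl * (lam^2 * y))" using kp d0 y by simp
  ultimately show ?thesis using 1 2 by (simp add: mult.assoc)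
 qed
 show "\<bar>4 * (lam^2 * y * (2 * D * D2 + lam * D ^ 3))\<bar> <= 40 * K ^ 5 * (lam ^ 3 * y)"
 proof -
  have a: "\<bar>D * D2\<bar> <= K^2" unfolding abs_mult power2_eq_square using D K by (intro mult_mono) auto
  have "\<bar>2 * D * D2 + lam * D ^ 3\<bar> <= 2 * \<bar>D * D2\<bar> + lam * \<bar>D ^ 3\<bar>"
   using abs_triangle_ineq[of "2 * D * D2" "lam * D ^ 3"] lam by (simp add: abs_mult)
  also have "... <= 2 * K^2 + lam * K ^ 3" using a D3b lam by (simp add: add_mono mult_left_mono)
  also have "... <= 2 * (K ^ 5 * lam) + lam * K ^ 5"
  proof (rule add_mono)
   have "K^2 * 1 <= K ^ 5 * lam" using kp lam by (intro mult_mono) auto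
   then show "2 * K^2 <= 2 * (K ^ 5 * lam)" by simp
   show "lam * K ^ 3 <= lam * K ^ 5" using kp lam by (intro mult_left_mono) auto
  qed
  also have "... = 3 * K ^ 5 * lam" by simp
  finally have "\<bar>2 * D * D2 + lam * D ^ 3\<bar> <= 3 * K ^ 5 * lam" .
  then have "lam^2 * y * \<bar>2 * D * D2 + lam * D ^ 3\<bar> <= lam^2 * y * (3 * K ^ 5 * lam)" using y by (intro mult_left_mono) auto
  also have "... = 3 * (K ^ 5 * (lam ^ 3 * y))" by (simp add: power2_eq_square power3_eq_cube)
  finally have "\<bar>lam^2 * y * (2 * D * D2 + lam * D ^ 3)\<bar> <= 3 * (K ^ 5 * (lam ^ 3 * y))" using y by (simp add: abs_mult)
  moreover have "0 <= K ^ 5 * (lam ^ 3 * y)" using kp lam y by simp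
  moreover have "40 * K ^ 5 * (lam ^ 3 * y) = 40 * (K ^ 5 * (lam ^ 3 * y))" by simp
  ultimately show ?thesis by linarith
 qed
 have A1: "lam^2 * D^2 * y^2 <= K^2 * (lam^2 * y^2)" using D2b by (simp add: mult.commute mult.left_commute mult_right_mono)
 have A2: "\<bar>u1\<bar> <= K^2 * (lam^2 * y^2)"
 proof -
  have "\<bar>u1\<bar> <= K^2 * (dl * y^2)" using u(1) by simp
  also have "... <= K^2 * (lam^2 * y^2)" using d lp by (intro mult_left_mono mult_right_mono) auto
  finally show ?thesis .
 qed
 have A0: "0 <= lam^2 * D^2 * y^2" by simp
 show Vb: "\<bar>lam^2 * D^2 * y^2 + u1\<bar> <= 2 * K^2 * (lam^2 * y^2)" using A0 A1 A2 by linarith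
 define U where "U = K ^ 5 * (dl * (lam ^ 4 * y ^ 3))"
 have U: "U >= 0" using kp d0 lam y by (simp add: U_def)
 have gen: "a * b <= U" if "0 <= a" "a <= K ^ 5" "0 <= b" "b <= dl * (lam ^ 4 * y ^ 3)" for a b
  unfolding U_def using that kp by (intro mult_mono) auto
 have y3: "dl * (lam ^ j * y ^ 3) <= dl * (lam ^ 4 * y ^ 3)" if "j <= 4" for j
  using power_increasing[OF that lam(1)] d0 y by (intro mult_left_mono mult_right_mono) auto
 have b1: "\<bar>lam ^ 3 * D^2 * D2 * y ^ 3\<bar> <= U"
 proof -
  have "\<bar>lam ^ 3 * D^2 * D2 * y ^ 3\<bar> = \<bar>D2\<bar> * D^2 * (lam ^ 3 * y ^ 3)" using lam y by (simp add: abs_mult)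
  also have "... <= K * K^2 * (lam ^ 3 * y ^ 3)" using D D2b K lam y by (intro mult_right_mono mult_mono) auto
  also have "... = K ^ 3 * (lam ^ 3 * y ^ 3)" by (simp add: power2_eq_square power3_eq_cube)
  also have "... <= U"
  proof (rule gen)
   show "lam ^ 3 * y ^ 3 <= dl * (lam ^ 4 * y ^ 3)"
    using mult_right_mono[OF lam(2), of "lam ^ 3 * y ^ 3"] lam y by (simp add: power3_eq_cube power4_eq_xxxx mult_ac)
  qed (use kp lam y K in auto)
  finally show ?thesis .
 qed
 have uu: "\<bar>u1\<bar> <= K^2 * (dl * y^2)" "\<bar>u2\<bar> <= K ^ 3 * (dl * (lam * y^2))" "\<bar>u3\<bar> <= K^2 * (dl * (lam * y^2))" "\<bar>u4\<bar> <= K^2 * (dl * y^2)" using u by simp_all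
 \<comment> \<open>Bookkeeping of exponents: a factor of order y times a factor of order
   \<open>dl * y^2\<close> stays below U as long as the powers of K and lam add up to at most 5 and
   4.\<close>
 have prod: "\<bar>p * r\<bar> <= U" if "\<bar>p\<bar> <= K ^ i * (lam ^ j * y)" "\<bar>r\<bar> <= K ^ i' * (dl * (lam ^ j' * y^2))" "i + i' <= 5" "j + j' <= 4" for p r i j i' j'
 proof -
  have "\<bar>p * r\<bar> <= K ^ i * (lam ^ j * y) * (K ^ i' * (dl * (lam ^ j' * y^2)))"
   unfolding abs_mult using that(1,2) K lam y d0 by (intro mult_mono) auto
  also have "... = K ^ (i + i') * (dl * (lam ^ (j + j') * y ^ 3))" by (simp add: power_add power2_eq_square power3_eq_cube mult_ac)
  also have "... <= U" using K lam y d0 that y3[OF that(4)] by (intro gen power_increasing) auto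
  finally show ?thesis .
 qed
 have b2: "\<bar>(lam * D2 * y) * u1\<bar> <= U"
 proof (rule prod[of _ 1 1 _ 2 0])
  show "\<bar>lam * D2 * y\<bar> <= K ^ 1 * (lam ^ 1 * y)" using D(2) lam y by (simp add: abs_mult mult.commute mult.left_commute mult_right_mono)
 qed (use uu in auto)
 have ld: "\<bar>lam^2 * D^2 * y\<bar> <= K ^ 2 * (lam ^ 2 * y)" using D2b y by (simp add: abs_mult mult.commute mult.left_commute mult_right_mono)
 have b3: "\<bar>(lam^2 * D^2 * y) * u1\<bar> <= U" by (rule prod[of _ 2 2 _ 2 0]) (use uu ld in auto)
 have lD: "\<bar>lam * D * y\<bar> <= K ^ 1 * (lam ^ 1 * y)" using D(1) lam y by (simp add: abs_mult mult.commute mult.left_commute mult_right_mono)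
 have b4: "\<bar>(lam * D * y) * u2\<bar> <= U" by (rule prod[of _ 1 1 _ 3 1]) (use uu lD in auto)
 have b5: "\<bar>qtv * (lam^2 * D^2 * y^2 + u1)\<bar> <= 2 * U"
 proof -
  have "\<bar>qtv * (lam^2 * D^2 * y^2 + u1)\<bar> <= K * (2 * K^2 * (lam^2 * y^2))" unfolding abs_mult using q Vb K by (intro mult_mono) auto
  also have "... = 2 * (K ^ 3 * (lam^2 * y^2))" by (simp add: power2_eq_square power3_eq_cube)
  also have "K ^ 3 * (lam^2 * y^2) <= U"
  proof (rule gen)
   have "lam^2 * y^2 <= dl * (lam^2 * y ^ 3)" using mult_right_mono[OF y(2), of "lam^2 * y^2"] lam y by (simp add: power2_eq_square power3_eq_cube mult_ac)
   also have "... <= dl * (lam ^ 4 * y ^ 3)" by (rule y3) simp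
   finally show "lam^2 * y^2 <= dl * (lam ^ 4 * y ^ 3)" .
  qed (use kp K in auto)
  finally show ?thesis by simp
 qed
 have b6: "\<bar>qv * ((lam * D * y) * u3)\<bar> <= U"
 proof -
  have "\<bar>qv * (lam * D * y)\<bar> <= K * (K ^ 1 * (lam ^ 1 * y))" unfolding abs_mult[of qv] using q lD K by (intro mult_mono) auto
  then have "\<bar>(qv * (lam * D * y)) * u3\<bar> <= U" using uu by (intro prod[of _ 2 1 _ 2 1]) (auto simp: power2_eq_square)
  then show ?thesis by (simp add: mult.assoc)
 qed
 have b7: "\<bar>qv * u4\<bar> <= U"
 proof -
  have "\<bar>qv * u4\<bar> <= K * (K^2 * (dl * y^2))" unfolding abs_mult using q uu K by (intro mult_mono) auto
  also have "... = K ^ 3 * (dl * y^2)" by (simp add: power2_eq_square power3_eq_cube)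
  also have "... <= U"
  proof (rule gen)
   have "dl * (1 * y^2) <= dl * (lam ^ 4 * y ^ 3)" using d0 lp yp y one_le_power[OF lam(1), of 4] by (intro mult_left_mono mult_mono) auto
   then show "dl * y^2 <= dl * (lam ^ 4 * y ^ 3)" by simp
  qed (use kp K d0 in auto)
  finally show ?thesis .
 qed
 have b8: "\<bar>qv * u5\<bar> <= 3 * U"
 proof -
  have "\<bar>qv * u5\<bar> <= K * (3 * K^2 * dl * y ^ 3)" unfolding abs_mult using q u K by (intro mult_mono) auto
  also have "... = 3 * (K ^ 3 * (dl * y ^ 3))" by (simp add: power2_eq_square power3_eq_cube)
  also have "K ^ 3 * (dl * y ^ 3) <= U" using y3[of 0] d0 y kp K by (intro gen) auto
  finally show ?thesis by simp
 qed
 have split: "6 * (lam ^ 3 * D^2 * D2 * y ^ 3) + 2 * ((lam * D2 * y + lam^2 * D^2 * y) * u1) + 2 * (lam * D * y * u2)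
    - 4 * (lam^2 * D^2 * y * u1) - qtv * (lam^2 * D^2 * y^2 + u1) - qv * (2 * (lam * D * y) * u3 + u4 + u5)
   = 6 * (lam ^ 3 * D^2 * D2 * y ^ 3) + 2 * ((lam * D2 * y) * u1) - 2 * ((lam^2 * D^2 * y) * u1) + 2 * ((lam * D * y) * u2)
    - qtv * (lam^2 * D^2 * y^2 + u1) - 2 * (qv * ((lam * D * y) * u3)) - qv * u4 - qv * u5" by (simp add: algebra_simps)
 have "40 * K ^ 5 * dl * (lam ^ 4 * y ^ 3) = 40 * U" by (simp add: U_def)
 then show "\<bar>6 * (lam ^ 3 * D^2 * D2 * y ^ 3) + 2 * ((lam * D2 * y + lam^2 * D^2 * y) * u1) + 2 * (lam * D * y * u2)
    - 4 * (lam^2 * D^2 * y * u1) - qtv * (lam^2 * D^2 * y^2 + u1) - qv * (2 * (lam * D * y) * u3 + u4 + u5)\<bar>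
    <= 40 * K ^ 5 * dl * (lam ^ 4 * y ^ 3)"
  unfolding split using b1 b2 b3 b4 b5 b6 b7 b8 U by linarith
qed

section \<open>The weight functions\<close>

text \<open>N plays the part of the maximum norm of \<open>eta\<close>. Continuity and bounds are
  asked on the whole line, derivatives only within [-1,1]; this fits a function extended by
  constants.\<close>

locale carleman_weights =
 fixes T lam s N m :: real and eta eta' eta'' :: "real => real"
 assumes T: "T > 0" and lam: "lam >= 1" and s: "s >= 1" and m: "m > 1" and N: "N > 0"
  and eta_cont: "continuous_on UNIV eta" "continuous_on UNIV eta'" "continuous_on UNIV eta''"
  and eta_bd: "!!x. 0 < eta x" "!!x. eta x <= N"
  and eta_deriv: "!!x. x : {-1..1} ==> (eta has_real_derivative eta' x) (at x within {-1..1})"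
   "!!x. x : {-1..1} ==> (eta' has_real_derivative eta'' x) (at x within {-1..1})"
  and eta_der_bounded: "\<exists>C. \<forall>x. \<bar>eta' x\<bar> <= C" "\<exists>C. \<forall>x. \<bar>eta'' x\<bar> <= C"
begin

definition "th t = t * (T - t)" for t
definition "dth t = T - 2 * t" for t
definition "Ef x = exp (lam * (m * N + eta x))" for x
definition "Af x = exp (2 * lam * m * N) - Ef x" for x
definition "xiw x t = Ef x / th t" for x t
definition "alw x t = Af x / th t" for x t
definition "xit x t = - (Ef x * dth t / (th t)^2)" for x t
definition "alt x t = - (Af x * dth t / (th t)^2)" for x t
definition "altt x t = Af x * (2 * (dth t)^2 / (th t) ^ 3 + 2 / (th t)^2)" for x t
definition "yw x t = s * xiw x t" for x t
text \<open>The extension by 0 is essential at the end times: division by zero gives 0 there, and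
  the exponential alone would be 1.\<close>

definition "ew x t = (if 0 < t & t < T then exp (- s * alw x t) else 0)" for x t

lemma th_pos: "t : {0<..<T} ==> th t > 0" by (simp add: th_def)

lemma th_le: "th t <= T^2 / 4" using zero_le_power2[of "T / 2 - t"] by (simp add: th_def power2_eq_square field_simps)

lemma dth_le: "t : {0<..<T} ==> \<bar>dth t\<bar> <= T" by (auto simp: dth_def)

lemma Ef_ge1: "Ef x >= 1" using lam m N eta_bd(1)[of x] by (simp add: Ef_def)

lemma Ef_le: "Ef x <= exp (lam * (m * N + N))" using lam eta_bd(2)[of x] by (simp add: Ef_def mult_left_mono)

text \<open>A lower bound for the numerator of alpha, uniform in x, and positive because
  \<open>m > 1\<close>.\<close>

definition "A0 = exp (2 * lam * m * N) - exp (lam * (m * N + N))"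

lemma A0_pos: "A0 > 0"
proof -
 have "N * 1 < N * m" using N m by (intro mult_strict_left_mono) auto
 then have "lam * (m * N + N) < lam * (2 * m * N)" using lam by (intro mult_strict_left_mono) (auto simp: mult.commute)
 then show ?thesis by (simp add: A0_def mult_ac)
qed

lemma Af_ge: "Af x >= A0" using Ef_le[of x] by (simp add: Af_def A0_def)

lemma Af_pos: "Af x > 0" using Af_ge[of x] A0_pos by linarith

text \<open>Since \<open>eta > 0\<close>, already \<open>exp (2 lam m N)\<close> is below the square
  of \<open>Ef\<close>. This bounds the time derivatives of alpha by powers of xi alone, with
  constants free of lam.\<close>

lemma Af_le_sq: "Af x <= (Ef x)^2"
proof -
 have "exp (2 * lam * m * N) <= exp (2 * (lam * (m * N + eta x)))" using lam eta_bd(1)[of x] by (simp add: algebra_simps)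
 also have "... = (Ef x)^2" by (simp add: Ef_def exp_double)
 finally show ?thesis using Ef_ge1[of x] by (simp add: Af_def)
qed

lemma xiw_pos: "t : {0<..<T} ==> xiw x t > 0" using Ef_ge1[of x] th_pos[of t] by (simp add: xiw_def)

lemma xiw_ge: "t : {0<..<T} ==> xiw x t >= 4 / T^2"
proof -
 assume t: "t : {0<..<T}"
 have "4 / T^2 = 1 / (T^2 / 4)" by simp
 also have "... <= 1 / th t" using th_le[of t] th_pos[OF t] T by (intro divide_left_mono) auto
 also have "... <= xiw x t" using Ef_ge1[of x] th_pos[OF t] by (simp add: xiw_def divide_right_mono)
 finally show ?thesis .
qed

lemma alt_le: "t : {0<..<T} ==> \<bar>alt x t\<bar> <= T * (xiw x t)^2"
proof -
 assume t: "t : {0<..<T}"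
 have "\<bar>alt x t\<bar> = Af x * \<bar>dth t\<bar> / (th t)^2" using Af_pos[of x] by (simp add: alt_def abs_mult)
 also have "... <= (Ef x)^2 * T / (th t)^2" using Af_pos[of x] Af_le_sq[of x] dth_le[OF t] by (intro divide_right_mono mult_mono) auto
 finally show ?thesis by (simp add: xiw_def power_divide mult.commute)
qed

lemma xit_le: "t : {0<..<T} ==> \<bar>xit x t\<bar> <= T * (xiw x t)^2"
proof -
 assume t: "t : {0<..<T}"
 have "\<bar>xit x t\<bar> = Ef x * \<bar>dth t\<bar> / (th t)^2" using Ef_ge1[of x] by (simp add: xit_def abs_mult)
 also have "... <= (Ef x)^2 * T / (th t)^2"
  using Ef_ge1[of x] dth_le[OF t] by (intro divide_right_mono mult_mono) (auto simp: power2_eq_square mult_le_cancel_right1)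
 finally show ?thesis by (simp add: xiw_def power_divide mult.commute)
qed

lemma altt_le: "t : {0<..<T} ==> \<bar>altt x t\<bar> <= 3 * T^2 * (xiw x t) ^ 3"
proof -
 assume t: "t : {0<..<T}"
 note p = th_pos[OF t]
 have d2: "(dth t)^2 <= T^2" using power_mono[OF dth_le[OF t], of 2] by simp
 have "2 / (th t)^2 = 2 * th t / (th t) ^ 3" using p by (simp add: power2_eq_square power3_eq_cube)
 also have "... <= T^2 / (th t) ^ 3"
 proof (rule divide_right_mono)
  have "2 * th t <= T^2 / 2" using th_le[of t] by simp
  also have "... <= T^2" by simp
  finally show "2 * th t <= T^2" .
 qed (use p in simp)
 finally have b: "2 / (th t)^2 <= T^2 / (th t) ^ 3" .
 have "2 * (dth t)^2 / (th t) ^ 3 <= 2 * T^2 / (th t) ^ 3" using d2 p by (intro divide_right_mono) auto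
 with b have c: "2 * (dth t)^2 / (th t) ^ 3 + 2 / (th t)^2 <= 3 * T^2 / (th t) ^ 3" by simp
 have c0: "0 <= 2 * (dth t)^2 / (th t) ^ 3 + 2 / (th t)^2" using p by simp
 have "Af x <= (Ef x) ^ 3" using order_trans[OF Af_le_sq power_increasing[of 2 3 "Ef x"]] Ef_ge1[of x] by simp
 then have "Af x * (2 * (dth t)^2 / (th t) ^ 3 + 2 / (th t)^2) <= (Ef x) ^ 3 * (3 * T^2 / (th t) ^ 3)" using c c0 Ef_ge1[of x] by (intro mult_mono) auto
 then show ?thesis using Af_pos[of x] c0 by (simp add: altt_def xiw_def power_divide abs_mult mult_ac)
qed

section \<open>Measurability, and decay of the exponential weight against poles in time\<close>

lemma eta_measurable[measurable]:
 "eta : borel_measurable borel" "eta' : borel_measurable borel" "eta'' : borel_measurable borel" using eta_cont by (auto intro: borel_measurable_continuous_onI)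

lemma weights_measurable[measurable]:
 "th : borel_measurable borel" "dth : borel_measurable borel" "Ef : borel_measurable borel" "Af : borel_measurable borel"
 unfolding th_def[abs_def] dth_def[abs_def] Ef_def[abs_def] Af_def[abs_def] by measurable

lemma weights2_measurable[measurable]:
 "(%z. xiw (fst z) (snd z)) : borel_measurable bor2" "(%z. alw (fst z) (snd z)) : borel_measurable bor2"
 "(%z. xit (fst z) (snd z)) : borel_measurable bor2" "(%z. alt (fst z) (snd z)) : borel_measurable bor2"
 "(%z. altt (fst z) (snd z)) : borel_measurable bor2" "(%z. yw (fst z) (snd z)) : borel_measurable bor2"
 "(%z. ew (fst z) (snd z)) : borel_measurable bor2"
 unfolding xiw_def alw_def xit_def alt_def altt_def yw_def ew_def by measurable

lemma ew_nonneg: "ew x t >= 0" by (simp add: ew_def)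

text \<open>On (0,T) alpha is at least \<open>A0 / th t\<close>, so the exponential falls faster
  than any power of \<open>1 / th t\<close> grows, uniformly in x.\<close>

lemma ew_power_bound: "\<exists>B\<ge>0. \<forall>x. \<forall>t\<in>{0<..<T}. (1 / th t) ^ n * ew x t <= B"
proof (cases "n = 0")
 case True
 have "ew x t <= 1" if "t : {0<..<T}" for x t using that Af_pos[of x] th_pos[OF that] s by (simp add: ew_def alw_def)
 then show ?thesis using True by (intro exI[of _ 1]) simp
next
 case False
 have "(1 / th t) ^ n * ew x t <= (real n / (s * A0)) ^ n" if t: "t : {0<..<T}" for x t
 proof -
  note p = th_pos[OF t]
  have sa: "s * A0 / th t > 0" using s A0_pos p by simp
  have "ew x t = exp (- (s * Af x / th t))" using t by (simp add: ew_def alw_def)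
  also have "... <= exp (- (s * A0 / th t))" using Af_ge[of x] p s by (simp add: divide_right_mono mult_left_mono)
  also have "... <= (real n / (s * A0 / th t)) ^ n" by (rule exp_minus_le_power[OF sa]) (use False in simp)
  finally have "(1 / th t) ^ n * ew x t <= (1 / th t) ^ n * (real n / (s * A0 / th t)) ^ n" using p by (intro mult_left_mono) auto
  also have "... = (real n / (s * A0)) ^ n" using p by (simp add: power_mult_distrib[symmetric])
  finally show ?thesis .
 qed
 moreover have "0 <= (real n / (s * A0)) ^ n" using s A0_pos by simp
 ultimately show ?thesis by blast
qed

text \<open>Coefficients with at most polynomial blow-up at \<open>t = 0\<close> and \<open>t = T\<close>; the factor \<open>ew\<close> absorbs all of them.\<close>

definition mild :: "(real \<times> real => real) => bool" where
 "mild c \<longleftrightarrow> c : borel_measurable bor2 \<and>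
   (\<exists>C n. C >= 0 & (\<forall>x. \<forall>t\<in>{0<..<T}. \<bar>c (x, t)\<bar> <= C * (1 / th t) ^ n))"

lemma mildI:
 assumes "c : borel_measurable bor2" "C >= 0" "!!x t. t : {0<..<T} ==> \<bar>c (x, t)\<bar> <= C * (1 / th t) ^ n"
 shows "mild c" using assms unfolding mild_def by blast

lemma mild_bounded:
 assumes "c : borel_measurable bor2" "!!x t. t : {0<..<T} ==> \<bar>c (x, t)\<bar> <= C"
 shows "mild c"
proof (rule mildI[OF assms(1), of "\<bar>C\<bar>" 0])
 show "\<bar>c (x, t)\<bar> <= \<bar>C\<bar> * (1 / th t) ^ 0" if "t : {0<..<T}" for x t using assms(2)[OF that, of x] by simp
qed simp

lemma mild_const: "mild (%z. c)" by (rule mild_bounded[of _ "\<bar>c\<bar>"]) auto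

lemma mild_mult:
 assumes "mild c" "mild d"
 shows "mild (%z. c z * d z)"
proof -
 obtain C n where C: "C >= 0" "!!x t. t : {0<..<T} ==> \<bar>c (x, t)\<bar> <= C * (1 / th t) ^ n" using assms(1) unfolding mild_def by blast
 obtain D k where D: "D >= 0" "!!x t. t : {0<..<T} ==> \<bar>d (x, t)\<bar> <= D * (1 / th t) ^ k" using assms(2) unfolding mild_def by blast
 show ?thesis
 proof (rule mildI[of _ "C * D" "n + k"])
  have [measurable]: "c : borel_measurable bor2" "d : borel_measurable bor2" using assms by (auto simp: mild_def)
  show "(%z. c z * d z) : borel_measurable bor2" by measurable
  show "\<bar>c (x, t) * d (x, t)\<bar> <= C * D * (1 / th t) ^ (n + k)" if "t : {0<..<T}" for x t
  proof -
   have "\<bar>c (x, t) * d (x, t)\<bar> <= (C * (1 / th t) ^ n) * (D * (1 / th t) ^ k)"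
    unfolding abs_mult using C D that th_pos[OF that] by (intro mult_mono) auto
   then show ?thesis by (simp add: power_add mult_ac)
  qed
 qed (use C D in simp)
qed

lemma mild_add:
 assumes "mild c" "mild d"
 shows "mild (%z. c z + d z)"
proof -
 obtain C n where C: "C >= 0" "!!x t. t : {0<..<T} ==> \<bar>c (x, t)\<bar> <= C * (1 / th t) ^ n" using assms(1) unfolding mild_def by blast
 obtain D k where D: "D >= 0" "!!x t. t : {0<..<T} ==> \<bar>d (x, t)\<bar> <= D * (1 / th t) ^ k" using assms(2) unfolding mild_def by blast
 \<comment> \<open>Since \<open>1 <= A * (1 / th t)\<close> on (0,T), a power of
   \<open>1 / th\<close> can be raised at the price of a power of A; this brings both summands to
   the same exponent.\<close>
 define A where "A = max 1 (T^2 / 4)"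
 have A1: "A >= 1" by (simp add: A_def)
 have inc: "(1 / th t) ^ i <= A ^ j * (1 / th t) ^ (i + j)" if "t : {0<..<T}" for t i j
 proof -
  have "1 <= A * (1 / th t)" using th_pos[OF that] th_le[of t] by (simp add: A_def le_divide_eq)
  then have "1 <= (A * (1 / th t)) ^ j" by (rule one_le_power)
  then have "(1 / th t) ^ i * 1 <= (1 / th t) ^ i * (A * (1 / th t)) ^ j" using th_pos[OF that] by (intro mult_left_mono) auto
  then show ?thesis by (simp add: power_mult_distrib power_add power_divide mult_ac)
 qed
 show ?thesis
 proof (rule mildI[of _ "C * A ^ k + D * A ^ n" "n + k"])
  have [measurable]: "c : borel_measurable bor2" "d : borel_measurable bor2" using assms by (auto simp: mild_def)
  show "(%z. c z + d z) : borel_measurable bor2" by measurable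
  show "\<bar>c (x, t) + d (x, t)\<bar> <= (C * A ^ k + D * A ^ n) * (1 / th t) ^ (n + k)" if t: "t : {0<..<T}" for x t
  proof -
   have "\<bar>c (x, t) + d (x, t)\<bar> <= C * (1 / th t) ^ n + D * (1 / th t) ^ k" using C(2)[OF t, of x] D(2)[OF t, of x] by linarith
   also have "... <= C * (A ^ k * (1 / th t) ^ (n + k)) + D * (A ^ n * (1 / th t) ^ (k + n))"
    using inc[OF t, of n k] inc[OF t, of k n] C D by (intro add_mono mult_left_mono) auto
   finally show ?thesis by (simp add: algebra_simps)
  qed
 qed (use C D A1 in simp)
qed

lemma mild_power: "mild c ==> mild (%z. c z ^ n)" by (induction n) (auto intro: mild_const mild_mult)

lemma mild_minus: "mild c ==> mild (%z. - c z)" using mild_mult[OF mild_const[of "-1"], of c] by simp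

lemma mild_diff: "mild c ==> mild d ==> mild (%z. c z - d z)" using mild_add[of c "%z. - d z"] mild_minus[of d] by simp

lemma mild_ri: "mild (%z. 1 / th (snd z))" by (rule mildI[of _ 1 1]) (use th_pos in "auto simp: abs_of_pos")

lemma mild_Ef: "mild (%z. Ef (fst z))"
proof (rule mild_bounded[of _ "exp (lam * (m * N + N))"])
 show "\<bar>Ef (fst (x, t))\<bar> <= exp (lam * (m * N + N))" for x t :: real using Ef_le[of x] Ef_ge1[of x] by simp
qed measurable

lemma mild_Af: "mild (%z. Af (fst z))"
 unfolding Af_def by (intro mild_diff mild_const mild_Ef)

lemma mild_dth: "mild (%z. dth (snd z))" by (rule mild_bounded[of _ T]) (use dth_le in auto)

lemma mild_eta: "mild (%z. eta' (fst z))" "mild (%z. eta'' (fst z))"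
proof -
 obtain C1 where "!!x. \<bar>eta' x\<bar> <= C1" using eta_der_bounded by blast
 then show "mild (%z. eta' (fst z))" by (intro mild_bounded[of _ C1]) auto
 obtain C2 where "!!x. \<bar>eta'' x\<bar> <= C2" using eta_der_bounded by blast
 then show "mild (%z. eta'' (fst z))" by (intro mild_bounded[of _ C2]) auto
qed

lemma mild_xiw: "mild (%z. xiw (fst z) (snd z))" using mild_mult[OF mild_Ef mild_ri] by (simp add: xiw_def)

lemma mild_yw: "mild (%z. yw (fst z) (snd z))"
 unfolding yw_def by (intro mild_mult mild_const mild_xiw)

lemma mild_alt: "mild (%z. alt (fst z) (snd z))"
proof -
 have "mild (%z. - (Af (fst z) * dth (snd z) * (1 / th (snd z)) ^ 2))" by (intro mild_minus mild_mult mild_power mild_Af mild_dth mild_ri)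
 then show ?thesis by (simp add: alt_def power_divide)
qed

lemma mild_xit: "mild (%z. xit (fst z) (snd z))"
proof -
 have "mild (%z. - (Ef (fst z) * dth (snd z) * (1 / th (snd z)) ^ 2))" by (intro mild_minus mild_mult mild_power mild_Ef mild_dth mild_ri)
 then show ?thesis by (simp add: xit_def power_divide)
qed

lemma mild_altt: "mild (%z. altt (fst z) (snd z))"
proof -
 have "mild (%z. Af (fst z) * (2 * dth (snd z) ^ 2 * (1 / th (snd z)) ^ 3 + 2 * (1 / th (snd z)) ^ 2))"
  by (intro mild_add mild_mult mild_power mild_Af mild_dth mild_ri mild_const)
 then show ?thesis by (simp add: altt_def power_divide)
qed

lemma mild_inverse_yw: "mild (%z. 1 / yw (fst z) (snd z))"
proof (rule mild_bounded[of _ "T^2 / 4"])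
 show "\<bar>1 / yw (fst (x, t)) (snd (x, t))\<bar> <= T^2 / 4" if t: "t : {0<..<T}" for x t
 proof -
  define b where "b = 4 / T^2"
  have b: "b > 0" using T by (simp add: b_def)
  have "b <= 1 * xiw x t" using xiw_ge[OF t, of x] by (simp add: b_def)
  also have "... <= s * xiw x t" using s xiw_pos[OF t, of x] by (intro mult_right_mono) auto
  finally have "b <= yw x t" by (simp add: yw_def)
  then have "1 / yw x t <= 1 / b" "yw x t > 0" using b by (auto intro!: divide_left_mono)
  then show ?thesis by (simp add: b_def)
 qed
qed measurable

text \<open>Quantifying over all mild factors makes the property stable under multiplication by
  them, so that integrability of every weighted product follows from closure rules.\<close>

definition damped :: "(real \<times> real => real) => bool" where
 "damped u \<longleftrightarrow> (\<forall>c. mild c --> sqint lb2 (%z. c z * u z))"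

lemma damped_sqint: "damped u ==> sqint lb2 u"
 unfolding damped_def using mild_const[of 1] by fastforce

lemma damped_mult: "mild c ==> damped u ==> damped (%z. c z * u z)"
 unfolding damped_def using mild_mult by (fastforce simp: mult.assoc[symmetric])

lemma damped_add: "damped u ==> damped v ==> damped (%z. u z + v z)"
 unfolding damped_def by (auto simp: distrib_left intro!: sqint_add)

lemma damped_diff: "damped u ==> damped v ==> damped (%z. u z - v z)" using damped_add[of u "%z. -1 * v z"] damped_mult[OF mild_const[of "-1"], of v] by simp

lemma damped_ew:
 assumes f: "sqint lb2 f"
 shows "damped (%z. ew (fst z) (snd z) * f z)"
 unfolding damped_def
proof (intro allI impI)
 fix c assume c: "mild c"
 then obtain C n where C: "C >= 0" "!!x t. t : {0<..<T} ==> \<bar>c (x, t)\<bar> <= C * (1 / th t) ^ n" unfolding mild_def by blast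
 obtain B where B: "B >= 0" "!!x t. t : {0<..<T} ==> (1 / th t) ^ n * ew x t <= B" using ew_power_bound[of n] by blast
 have [measurable]: "c : borel_measurable bor2" using c by (simp add: mild_def)
 have "sqint lb2 (%z. (c z * ew (fst z) (snd z)) * f z)"
 proof (rule sqint_mult_bounded[OF f, where C = "C * B"])
  fix z :: "real \<times> real"
  obtain x t where z: "z = (x, t)" by (cases z)
  show "\<bar>c z * ew (fst z) (snd z)\<bar> <= C * B"
  proof (cases "t : {0<..<T}")
   case True
   have "\<bar>c (x, t) * ew x t\<bar> <= C * (1 / th t) ^ n * ew x t"
    unfolding abs_mult using C(2)[OF True, of x] ew_nonneg[of x t] by (simp add: mult_right_mono)
   also have "... <= C * B" using B(2)[OF True, of x] C(1) by (simp add: mult.assoc mult_left_mono)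
   finally show ?thesis by (simp add: z)
  next
   case False
   then have "ew x t = 0" by (auto simp: ew_def)
   then show ?thesis using B(1) C(1) by (simp add: z)
  qed
 qed (simp cong: measurable_cong_sets)
 then show "sqint lb2 (%z. c z * (ew (fst z) (snd z) * f z))" by (simp add: mult.assoc)
qed

lemma damped_integrable:
 assumes "mild c" "damped u" "damped v"
 shows "integrable lb2 (%z. c z * (u z * v z))"
proof -
 have "integrable lb2 (%z. (c z * u z) * v z)" using assms by (intro sqint_mult damped_sqint[OF damped_mult] damped_sqint)
 then show ?thesis by (simp add: mult.assoc)
qed

text \<open>The counterpart for traces on the line \<open>x = x0\<close>.\<close>

definition damped1 :: "real => (real => real) => bool" where
 "damped1 x0 u \<longleftrightarrow> (\<forall>c. mild c --> sqint lborel (%t. c (x0, t) * u t))"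

lemma damped1_sqint: "damped1 x0 u ==> sqint lborel u"
 unfolding damped1_def using mild_const[of 1] by fastforce

lemma damped1_mult: "mild c ==> damped1 x0 u ==> damped1 x0 (%t. c (x0, t) * u t)"
 unfolding damped1_def using mild_mult by (fastforce simp: mult.assoc[symmetric])

lemma damped1_add: "damped1 x0 u ==> damped1 x0 v ==> damped1 x0 (%t. u t + v t)"
 unfolding damped1_def by (auto simp: distrib_left intro!: sqint_add)

lemma damped1_diff: "damped1 x0 u ==> damped1 x0 v ==> damped1 x0 (%t. u t - v t)"
 using damped1_add[of x0 u "%z. -1 * v z"] damped1_mult[OF mild_const[of "-1"], of x0 v] by simp

lemma damped1_ew:
 assumes f: "sqint lborel f"
 shows "damped1 x0 (%t. ew x0 t * f t)"
 unfolding damped1_def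
proof (intro allI impI)
 fix c assume c: "mild c"
 then obtain C n where C: "C >= 0" "!!x t. t : {0<..<T} ==> \<bar>c (x, t)\<bar> <= C * (1 / th t) ^ n" unfolding mild_def by blast
 obtain B where B: "B >= 0" "!!x t. t : {0<..<T} ==> (1 / th t) ^ n * ew x t <= B" using ew_power_bound[of n] by blast
 have [measurable]: "c : borel_measurable bor2" using c by (simp add: mild_def)
 have ewm: "(%t. ew x0 t) : borel_measurable borel" using measurable_compose[OF _ weights2_measurable(7), of "%t. (x0, t)" borel] by simp
 have "sqint lborel (%t. (c (x0, t) * ew x0 t) * f t)"
 proof (rule sqint_mult_bounded[OF f, where C = "C * B"])
  fix t :: real
  show "\<bar>c (x0, t) * ew x0 t\<bar> <= C * B"
  proof (cases "t : {0<..<T}")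
   case True
   have "\<bar>c (x0, t) * ew x0 t\<bar> <= C * (1 / th t) ^ n * ew x0 t"
    unfolding abs_mult using C(2)[OF True, of x0] ew_nonneg[of x0 t] by (simp add: mult_right_mono)
   also have "... <= C * B" using B(2)[OF True, of x0] C(1) by (simp add: mult.assoc mult_left_mono)
   finally show ?thesis .
  next
   case False
   then have "ew x0 t = 0" by (auto simp: ew_def)
   then show ?thesis using B(1) C(1) by simp
  qed
 qed (use ewm in measurable)
 then show "sqint lborel (%t. c (x0, t) * (ew x0 t * f t))" by (simp add: mult.assoc)
qed

lemma damped1_integrable:
 assumes "mild c" "damped1 x0 u" "damped1 x0 v"
 shows "integrable lborel (%t. c (x0, t) * (u t * v t))"
proof -
 have "integrable lborel (%t. (c (x0, t) * u t) * v t)" using assms by (intro sqint_mult damped1_sqint[OF damped1_mult] damped1_sqint)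
 then show ?thesis by (simp add: mult.assoc)
qed

text \<open>The exponential absorbs one more power of \<open>1 / th\<close> than the coefficient
  contains; the spare factor \<open>th\<close> forces the limit 0 at both end times.\<close>

lemma continuous_on_damped_product:
 assumes c: "mild c" "continuous_on {0<..<T} (%t. c (x, t))" and f: "continuous_on {0..T} f"
 shows "continuous_on {0..T} (%t. c (x, t) * (ew x t * f t))"
proof -
 obtain C n where C: "C >= 0" "!!x t. t : {0<..<T} ==> \<bar>c (x, t)\<bar> <= C * (1 / th t) ^ n" using c(1) unfolding mild_def by blast
 obtain B where B: "B >= 0" "!!x t. t : {0<..<T} ==> (1 / th t) ^ Suc n * ew x t <= B" using ew_power_bound[of "Suc n"] by blast
 have "bounded (f ` {0..T})" by (intro compact_imp_bounded compact_continuous_image f) simp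
 then obtain C1 where "\<forall>y\<in>f ` {0..T}. norm y <= C1" unfolding bounded_iff by blast
 then have C1: "\<bar>f t\<bar> <= C1" if "t : {0..T}" for t using that by auto
 let ?g = "%t. c (x, t) * (ew x t * f t)"
 have bd: "\<bar>?g t\<bar> <= C * B * C1 * \<bar>th t\<bar>" if t: "t : {0..T}" for t
 proof (cases "t : {0<..<T}")
  case True
  have p: "th t > 0" by (rule th_pos[OF True])
  have "\<bar>?g t\<bar> <= C * (1 / th t) ^ n * (ew x t * C1)"
   unfolding abs_mult using C(1) C(2)[OF True, of x] ew_nonneg[of x t] C1[OF t] p by (intro mult_mono) auto
  also have "... = C * ((1 / th t) ^ Suc n * ew x t) * C1 * th t" using p by simp
  also have "... <= C * B * C1 * th t" using B(2)[OF True, of x] C(1) p C1[OF t] by (intro mult_right_mono mult_left_mono) auto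
  finally show ?thesis using p by simp
 next
  case False
  then have "ew x t = 0" by (auto simp: ew_def)
  moreover have "0 <= C * B * C1 * \<bar>th t\<bar>" using C(1) B(1) C1[OF t] by simp
  ultimately show ?thesis by simp
 qed
 have ewc: "continuous_on {0<..<T} (%t. ew x t)"
 proof -
  have "continuous_on {0<..<T} (%t. exp (- s * (Af x / (t * (T - t)))))" by (intro continuous_intros) auto
  moreover have "ew x t = exp (- s * (Af x / (t * (T - t))))" if "t : {0<..<T}" for t using that by (simp add: ew_def alw_def th_def)
  ultimately show ?thesis by (subst continuous_on_cong[OF refl]) auto
 qed
 have inner: "continuous_on {0<..<T} ?g" by (intro continuous_intros c(2) ewc continuous_on_subset[OF f]) auto
 show ?thesis
  unfolding continuous_on_eq_continuous_within
 proof
  fix t assume t: "t : {0..T}"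
  show "continuous (at t within {0..T}) ?g"
  proof (cases "t : {0<..<T}")
   case True
   then have "isCont ?g t" using inner by (simp add: continuous_on_eq_continuous_at)
   then show ?thesis by (rule continuous_at_imp_continuous_at_within)
  next
   case False
   then have g0: "?g t = 0" and th0: "th t = 0" using t by (auto simp: ew_def th_def)
   have "(?g \<longlongrightarrow> 0) (at t within {0..T})"
   proof (rule Lim_null_comparison)
    show "\<forall>\<^sub>F u in at t within {0..T}. norm (?g u) <= C * B * C1 * \<bar>th u\<bar>"
     unfolding eventually_at_filter using bd by (intro always_eventually) simp
    have "isCont (%u. C * B * C1 * \<bar>th u\<bar>) t" unfolding th_def by (intro continuous_intros)
    then have "((%u. C * B * C1 * \<bar>th u\<bar>) \<longlongrightarrow> C * B * C1 * \<bar>th t\<bar>) (at t within {0..T})"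
     by (meson continuous_at_imp_continuous_at_within continuous_within)
    then show "((%u. C * B * C1 * \<bar>th u\<bar>) \<longlongrightarrow> 0) (at t within {0..T})" using th0 by simp
   qed
   then show ?thesis unfolding continuous_within g0 .
  qed
 qed
qed

section \<open>Derivatives, continuity and comparison of the weights\<close>

lemma th_deriv: "(th has_real_derivative dth t) (at t within S)"
 unfolding th_def[abs_def] dth_def by (auto intro!: derivative_eq_intros)

lemma xiw_deriv_t: "t : {0<..<T} ==> (xiw x has_real_derivative xit x t) (at t within S)"
 unfolding xiw_def[abs_def] xit_def using th_pos[of t] by (auto intro!: derivative_eq_intros th_deriv simp: power2_eq_square)

lemma alw_deriv_t: "t : {0<..<T} ==> (alw x has_real_derivative alt x t) (at t within S)"
 unfolding alw_def[abs_def] alt_def using th_pos[of t] by (auto intro!: derivative_eq_intros th_deriv simp: power2_eq_square)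

lemma alt_deriv_t:
 assumes t: "t : {0<..<T}"
 shows "(alt x has_real_derivative altt x t) (at t within S)"
proof -
 have dd: "(dth has_real_derivative -2) (at t within S)"
  unfolding dth_def[abs_def] by (auto intro!: derivative_eq_intros)
 have "((%t. - (Af x * (dth t / (th t)^2))) has_real_derivative - (Af x * (((-2) * (th t)^2 - dth t * (2 * th t * dth t)) / ((th t)^2 * (th t)^2)))) (at t within S)"
  using th_pos[OF t] by (auto intro!: derivative_eq_intros dd th_deriv simp: algebra_simps)
 also have "- (Af x * (((-2) * (th t)^2 - dth t * (2 * th t * dth t)) / ((th t)^2 * (th t)^2))) = altt x t"
  using th_pos[OF t] by (simp add: altt_def field_simps power2_eq_square power3_eq_cube)
 finally show ?thesis by (simp add: alt_def[abs_def])
qed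

lemma ew_deriv_t:
 assumes t: "t : {0<..<T}"
 shows "(ew x has_real_derivative - s * alt x t * ew x t) (at t)"
proof -
 have "((%t. exp (- s * alw x t)) has_real_derivative exp (- s * alw x t) * (- s * alt x t)) (at t)" using t by (auto intro!: derivative_eq_intros alw_deriv_t)
 moreover have "\<forall>\<^sub>F u in nhds t. exp (- s * alw x u) = ew x u"
  using eventually_nhds_in_open[of "{0<..<T}" t] t by (auto simp: ew_def elim!: eventually_mono)
 ultimately have "(ew x has_real_derivative exp (- s * alw x t) * (- s * alt x t)) (at t)" by (simp add: DERIV_cong_ev)
 then show ?thesis using t by (simp add: ew_def mult.commute)
qed

lemma Ef_deriv: "x : {-1..1} ==> (Ef has_real_derivative lam * eta' x * Ef x) (at x within {-1..1})"
 unfolding Ef_def[abs_def] by (auto intro!: derivative_eq_intros eta_deriv(1) simp: mult_ac)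

lemma xiw_deriv_x: "x : {-1..1} ==> ((%x. xiw x t) has_real_derivative lam * eta' x * xiw x t) (at x within {-1..1})"
 unfolding xiw_def using DERIV_cdivide[OF Ef_deriv, of x "th t"] by (simp add: mult_ac)

lemma ew_deriv_x:
 assumes x: "x : {-1..1}" and t: "t : {0<..<T}"
 shows "((%x. ew x t) has_real_derivative (lam * eta' x * yw x t) * ew x t) (at x within {-1..1})"
proof -
 have al: "((%x. alw x t) has_real_derivative - (lam * eta' x * xiw x t)) (at x within {-1..1})"
  unfolding alw_def Af_def xiw_def using th_pos[OF t] x by (auto intro!: derivative_eq_intros Ef_deriv)
 have "((%x. exp (- s * alw x t)) has_real_derivative exp (- s * alw x t) * (- s * (- (lam * eta' x * xiw x t)))) (at x within {-1..1})"
  by (auto intro!: derivative_eq_intros al)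
 then show ?thesis using t by (simp add: ew_def yw_def mult_ac)
qed

lemma alt_deriv_x: "x : {-1..1} ==> ((%x. alt x t) has_real_derivative - (lam * eta' x * xit x t)) (at x within {-1..1})"
proof -
 assume x: "x : {-1..1}"
 have "(Af has_real_derivative - (lam * eta' x * Ef x)) (at x within {-1..1})"
  unfolding Af_def[abs_def] using x by (auto intro!: derivative_eq_intros Ef_deriv)
 from DERIV_minus[OF DERIV_cdivide[OF DERIV_cmult_right[OF this, of "dth t"], of "(th t)^2"]]
 show ?thesis unfolding alt_def xit_def by (simp add: mult_ac)
qed

lemma cont_x: "continuous_on S (%x. Ef x)" "continuous_on S (%x. Af x)" "continuous_on S eta'" "continuous_on S eta''"
 "continuous_on S (%x. xiw x t)" "continuous_on S (%x. yw x t)" "continuous_on S (%x. alt x t)" "continuous_on S (%x. xit x t)" "continuous_on S (%x. ew x t)"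
proof -
 have e: "continuous_on S eta" "continuous_on S eta'" "continuous_on S eta''" using eta_cont continuous_on_subset by blast+
 show E: "continuous_on S (%x. Ef x)" unfolding Ef_def by (intro continuous_intros e)
 show A: "continuous_on S (%x. Af x)" unfolding Af_def by (intro continuous_intros E)
 show "continuous_on S eta'" "continuous_on S eta''" by fact+
 have d: "continuous_on S (%x. f x / c)" if "continuous_on S f" for f :: "real => real" and c using continuous_on_mult_right[OF that, of "1 / c"] by simp
 show "continuous_on S (%x. xiw x t)" unfolding xiw_def by (rule d[OF E])
 then show "continuous_on S (%x. yw x t)" unfolding yw_def by (intro continuous_intros)
 show "continuous_on S (%x. alt x t)" unfolding alt_def by (intro continuous_intros d A)
 show "continuous_on S (%x. xit x t)" unfolding xit_def by (intro continuous_intros d E)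
 have "continuous_on S (%x. alw x t)" unfolding alw_def by (rule d[OF A])
 then show "continuous_on S (%x. ew x t)" unfolding ew_def by (cases "0 < t & t < T") (auto intro!: continuous_intros)
qed

lemma cont_t: "continuous_on {0<..<T} (xiw x)" "continuous_on {0<..<T} (yw x)" "continuous_on {0<..<T} (alt x)" "continuous_on {0<..<T} (altt x)" "continuous_on {0<..<T} (xit x)" "continuous_on {0<..<T} (ew x)"
proof -
 have th: "continuous_on {0<..<T} th" "continuous_on {0<..<T} dth" unfolding th_def[abs_def] dth_def[abs_def] by (intro continuous_intros)+
 have nz: "\<forall>t\<in>{0<..<T}. th t ~= 0" using th_pos by fastforce
 show 1: "continuous_on {0<..<T} (xiw x)" unfolding xiw_def[abs_def] using nz by (intro continuous_intros th) auto
 then show "continuous_on {0<..<T} (yw x)" unfolding yw_def[abs_def] by (intro continuous_intros)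
 show "continuous_on {0<..<T} (alt x)" unfolding alt_def[abs_def] using nz by (intro continuous_intros th) auto
 show "continuous_on {0<..<T} (altt x)" unfolding altt_def[abs_def] using nz by (intro continuous_intros th) auto
 show "continuous_on {0<..<T} (xit x)" unfolding xit_def[abs_def] using nz by (intro continuous_intros th) auto
 show "continuous_on {0<..<T} (ew x)" using ew_deriv_t by (meson DERIV_isCont continuous_at_imp_continuous_on)
qed

text \<open>The sum of \<open>Af\<close> and \<open>Ef\<close> does not depend on x, so passing from
  x0 to x multiplies \<open>ew\<close> exactly by \<open>exp (yw x t - yw x0 t)\<close>. The last
  inequality is the monotonicity of \<open>exp (2 r) / r\<close> for
  \<open>2 r >= 1\<close>.\<close>

lemma weight_compare:
 assumes t: "t : {0<..<T}" and le: "eta x0 <= eta x" and y: "2 * yw x0 t >= 1"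
 shows "yw x0 t <= yw x t" "ew x0 t <= ew x t" "(ew x0 t)^2 / yw x0 t <= (ew x t)^2 / yw x t"
proof -
 note p = th_pos[OF t]
 have E: "Ef x0 <= Ef x" using le lam by (simp add: Ef_def)
 have xi: "xiw x0 t <= xiw x t" using E p by (simp add: xiw_def divide_right_mono)
 then show yle: "yw x0 t <= yw x t" using s by (simp add: yw_def)
 have dif: "alw x0 t - alw x t = xiw x t - xiw x0 t" using p by (simp add: alw_def xiw_def Af_def field_simps)
 have ee: "ew x t = ew x0 t * exp (yw x t - yw x0 t)"
 proof -
  have "- s * alw x t = - s * alw x0 t + (yw x t - yw x0 t)" using dif by (simp add: yw_def algebra_simps) (metis distrib_left add.commute)
  then show ?thesis using t by (simp add: ew_def exp_add[symmetric])
 qed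
 show "ew x0 t <= ew x t" unfolding ee using ew_nonneg[of x0 t] yle by (simp add: mult_le_cancel_left1)
 have y0: "yw x0 t > 0" "yw x t > 0" using y yle by auto
 have "yw x t / yw x0 t = 1 + (yw x t - yw x0 t) / yw x0 t" using y0 by (simp add: field_simps)
 also have "... <= 1 + 2 * (yw x t - yw x0 t)"
 proof -
  have "(yw x t - yw x0 t) * 1 <= (yw x t - yw x0 t) * (2 * yw x0 t)" using y yle by (intro mult_left_mono) auto
  then have "(yw x t - yw x0 t) / yw x0 t <= 2 * (yw x t - yw x0 t)" by (simp only: pos_divide_le_eq[OF y0(1)]) (simp add: algebra_simps)
  then show ?thesis by linarith
 qed
 also have "... <= exp (2 * (yw x t - yw x0 t))" by (rule exp_ge_add_one_self)
 also have "... = (exp (yw x t - yw x0 t))^2" by (rule exp_double)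
 finally have "yw x t <= (exp (yw x t - yw x0 t))^2 * yw x0 t" using y0 by (simp add: divide_le_eq)
 then have "(ew x0 t)^2 * yw x t <= (ew x0 t)^2 * ((exp (yw x t - yw x0 t))^2 * yw x0 t)" by (intro mult_left_mono) auto
 also have "... = (ew x t)^2 * yw x0 t" by (simp add: ee power_mult_distrib)
 finally show "(ew x0 t)^2 / yw x0 t <= (ew x t)^2 / yw x t" using y0 by (simp add: field_simps)
qed

end

text \<open>F vanishes at both ends, so its extension by zero is again the primitive of f, and the
  difference quotient formula holds at all times without boundary corrections.\<close>

lemma ac_deriv_zero_extension:
 fixes F f :: "real => real"
 assumes T: "T > 0" and ac: "ac_deriv 0 T F f" and f: "integrable lborel f" "!!t. t ~: {0<..<T} ==> f t = 0"
  and F: "!!t. t ~: {0<..<T} ==> F t = 0" and h: "h > 0"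
 shows "F (t + h) - F t = h * avg h f t"
proof -
 define I where "I t = (LBINT r. indicator {..t} r * f r)" for t
 have fi: "integrable lborel (%r. indicator A r * f r)" if "A : sets borel" for A using integrable_mult_indicator[OF _ f(1), of A] that by simp
 have mid: "F t = I t" if "t : {0..T}" for t using ac_derivD[OF ac, of t] that F[of 0] integral_atMost_eq_set[of 0 f t] f(2) by (simp add: I_def)
 have FI: "F t = I t" for t
 proof -
  consider "t < 0" | "t : {0..T}" | "t > T" by fastforce
  then show ?thesis
  proof cases
   case 1
   have "I t = (\<integral>r. 0 \<partial>(lborel :: real measure))"
    unfolding I_def by (intro lint_cong) (use 1 f(2) in "auto split: split_indicator")
   then show ?thesis using F[of t] 1 by simp
  next
   case 2 then show ?thesis by (rule mid)
  next
   case 3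
   have "I t = I T" unfolding I_def by (intro lint_cong) (use 3 f(2) in "auto split: split_indicator")
   then show ?thesis using F[of t] F[of T] mid[of T] 3 T by simp
  qed
 qed
 have "F (t + h) - F t = (LBINT r. indicator {..t+h} r * f r - indicator {..t} r * f r)"
  unfolding FI I_def using fi by simp
 also have "... = (LBINT r. indicator {t..t+h} r * f r)"
 proof (rule integral_cong_AE)
  show "AE r in lborel. indicator {..t+h} r * f r - indicator {..t} r * f r = indicator {t..t+h} r * f r"
   using AE_lborel_singleton[of t] by eventually_elim (use h in "auto split: split_indicator")
 qed (use fi[THEN borel_measurable_integrable] in auto)
 also have "... = (LBINT sg. indicator {t..t+h} (sg + t) * f (sg + t))" by (rule integral_shift[symmetric])
 also have "... = (LBINT sg. indicator {0..h} sg * f (t + sg))" by (intro lint_cong) (auto simp: add.commute split: split_indicator)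
 finally show ?thesis using h by (simp add: avg_def)
qed

section \<open>The Carleman inequality for the conjugated function\<close>

text \<open>No equation is assumed here: what follows is an inequality for any phi of strong
  regularity with zero value at x = -1 and an absolutely continuous value at x = 1. \<open>K\<close>
  bounds all data and \<open>dl\<close> is the smallness parameter.\<close>

locale carleman_solution = carleman_weights +
 fixes q qt :: "real => real" and K c0 dl :: real and rho rho' :: "real => real" and omega :: "real set"
  and phi d fxx ft :: "real \<times> real => real" and h1 :: "real => real"
 assumes K: "K >= 1" "T <= K" "T^2 <= K"
  and eta_K: "!!x. \<bar>eta' x\<bar> <= K" "!!x. \<bar>eta'' x\<bar> <= K"
  and q_cont: "continuous_on UNIV q" and q_bd: "!!t. 1 / K <= q t" "!!t. q t <= K"
  and q_lip: "!!r t. \<bar>q r - q t\<bar> <= K * \<bar>r - t\<bar>" and q_ac: "ac_deriv 0 T q qt"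
  and qt: "qt : borel_measurable borel" "!!t. \<bar>qt t\<bar> <= K"
  and c0: "c0 > 0" "eta' 1 <= - c0" "c0 <= eta' (-1)"
  and rho_deriv: "!!x. x : {-1..1} ==> (rho has_real_derivative rho' x) (at x within {-1..1})"
  and rho_cont: "continuous_on UNIV rho" "continuous_on UNIV rho'"
  and rho_bd: "!!x. 0 <= rho x" "!!x. rho x <= K" "!!x. \<bar>rho' x\<bar> <= K"
  and rho_supp: "!!x. x ~: omega ==> rho x = 0" and omega: "omega : sets borel" "1 ~: omega" "-1 ~: omega"
  and dich: "!!x. x : {-1..1} ==> c0 <= \<bar>eta' x\<bar> \<or> (1 <= rho x & x : omega)"
  and delta: "0 < dl" "dl <= 1" "1 <= dl * lam" "1 <= dl * s" "!!x t. t : {0<..<T} ==> 1 <= dl * yw x t"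
  and phi: "continuous_on ({-1..1} \<times> {0..T}) phi"
  and sq: "sqint lb2 d" "sqint lb2 fxx" "sqint lb2 ft"
  and supp: "!!z. z ~: {-1..1} \<times> {0<..<T} ==> d z = 0" "!!z. z ~: Qset T ==> fxx z = 0" "!!z. z ~: Qset T ==> ft z = 0"
  and acx: "AE t in lborel. t : {0<..<T} --> ac_deriv (-1) 1 (%x. phi (x, t)) (%x. d (x, t)) \<and>
    ac_deriv (-1) 1 (%x. d (x, t)) (%x. fxx (x, t))"
  and act: "AE x in lborel. x : {-1<..<1} --> ac_deriv 0 T (%t. phi (x, t)) (%t. ft (x, t))"
  and tr: "sqint lborel (%t. d (1, t))" "sqint lborel (%t. d (-1, t))"
  and h1: "sqint lborel h1" "!!t. t ~: {0<..<T} ==> h1 t = 0" "ac_deriv 0 T (%t. phi (1, t)) h1"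
  and left: "!!t. t : {0<..<T} ==> phi (-1, t) = 0"
begin

definition "pb z = indicator ({-1..1} \<times> {0..T}) z * phi z" for z
text \<open>This is minus \<open>s alpha_x\<close>; its x-derivative is \<open>axy\<close>.\<close>

definition "ay x t = lam * eta' x * yw x t" for x t
definition "axy x t = lam * eta'' x * yw x t + lam^2 * (eta' x)^2 * yw x t" for x t
definition "kk x t = lam^2 * (eta' x)^2 * yw x t" for x t
definition "kkx x t = lam^2 * yw x t * (2 * eta' x * eta'' x + lam * (eta' x) ^ 3)" for x t
text \<open>The zero-order coefficient of P1: \<open>s^2 alpha_x^2 + s q alpha_t\<close>.\<close>

definition "VV x t = (ay x t)^2 + s * q t * alt x t" for x t
definition "VVx x t = 2 * ay x t * axy x t - s * q t * (lam * eta' x * xit x t)" for x t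
definition "VVt x t = 2 * ay x t * (lam * eta' x * s * xit x t) + s * qt t * alt x t + s * q t * altt x t" for x t
definition "w z = ew (fst z) (snd z) * pb z" for z
definition "wx z = ew (fst z) (snd z) * d z + ay (fst z) (snd z) * w z" for z
definition "wxx z = ew (fst z) (snd z) * fxx z + 2 * ay (fst z) (snd z) * (ew (fst z) (snd z) * d z)
  + ((ay (fst z) (snd z))^2 + axy (fst z) (snd z)) * w z" for z
definition "wt z = ew (fst z) (snd z) * ft z - s * alt (fst z) (snd z) * w z" for z
text \<open>At x = 1 the function \<open>wt\<close> is of no use, as \<open>ft\<close> is 0 outside
  the open rectangle; \<open>h1\<close> takes the place of the missing trace of
  \<open>phi_t\<close>.\<close>

definition "wt1 t = ew 1 t * h1 t - s * alt 1 t * w (1, t)" for t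
text \<open>The time derivative of \<open>q V w^2\<close>.\<close>

definition "JJ z = (qt (snd z) * VV (fst z) (snd z) + q (snd z) * VVt (fst z) (snd z)) * (w z * w z)
  + q (snd z) * VV (fst z) (snd z) * (wt z * w z + w z * wt z)" for z
definition "rl x t = rho x * (lam^2 * yw x t)" for x t
definition "rlx x t = rho' x * (lam^2 * yw x t) + rho x * (lam^2 * (lam * eta' x * yw x t))" for x t
text \<open>The flux: what integration by parts in x of \<open>2 P1 P2\<close> puts on the boundary,
  together with the cutoff term \<open>- rho lam^2 s xi w w_x\<close>. Its x-derivative is
  \<open>Dv\<close>.\<close>

definition "Hf z = - 2 * (ay (fst z) (snd z) * (wx z * wx z)) + - 4 * (kk (fst z) (snd z) * (w z * wx z))
  + - 2 * (ay (fst z) (snd z) * VV (fst z) (snd z) * (w z * w z)) + - 1 * (rl (fst z) (snd z) * (w z * wx z))" for z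
definition "Dv z = - 2 * (axy (fst z) (snd z) * (wx z * wx z) + ay (fst z) (snd z) * (wxx z * wx z + wx z * wxx z))
  + - 4 * (kkx (fst z) (snd z) * (w z * wx z) + kk (fst z) (snd z) * (wx z * wx z + w z * wxx z))
  + - 2 * ((axy (fst z) (snd z) * VV (fst z) (snd z) + ay (fst z) (snd z) * VVx (fst z) (snd z)) * (w z * w z)
    + ay (fst z) (snd z) * VV (fst z) (snd z) * (wx z * w z + w z * wx z))
  + - 1 * (rlx (fst z) (snd z) * (w z * wx z) + rl (fst z) (snd z) * (wx z * wx z + w z * wxx z))" for z
definition "P1 z = wxx z + VV (fst z) (snd z) * w z" for z
text \<open>Conjugation gives the zero-order term \<open>- axy w\<close>, where \<open>axy\<close>
  contains \<open>eta''\<close> and cannot be differentiated in x. It is replaced by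
  \<open>- 2 kk w\<close> with a coefficient of class C^1, and the difference
  \<open>(axy - 2 kk) w\<close> is moved to the source.\<close>

definition "P2 z = q (snd z) * wt z - 2 * ay (fst z) (snd z) * wx z - 2 * kk (fst z) (snd z) * w z" for z
text \<open>The constant produced by \<open>coefficient_bounds\<close>, used from here on for all
  coefficients.\<close>

definition "K2 = 40 * K ^ 5"
definition "XX z = lam^2 * yw (fst z) (snd z) * (wx z)^2" for z
definition "WW z = lam ^ 4 * yw (fst z) (snd z) ^ 3 * (w z)^2" for z
definition "cc = min (min (6 * c0^2) 1) (2 * c0 ^ 4)"

section \<open>Integrability of the conjugated function and of its derivatives\<close>

lemma pb_facts: "pb : borel_measurable bor2" "\<exists>C. \<forall>z. \<bar>pb z\<bar> <= C" "sqint lb2 pb"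
proof -
 let ?R = "{-1..1::real} \<times> {0..T}"
 have R: "?R : sets borel" by (intro borel_closed closed_Times closed_real_atLeastAtMost)
 have "(%z. indicator ?R z *\<^sub>R phi z) : borel_measurable borel" by (rule borel_measurable_continuous_on_indicator[OF R phi])
 then show m: "pb : borel_measurable bor2" unfolding borel_prod by (simp add: pb_def[abs_def])
 have "bounded (phi ` ?R)" by (intro compact_imp_bounded compact_continuous_image phi compact_Times) auto
 then obtain C where "\<forall>y\<in>phi ` ?R. norm y <= C" unfolding bounded_iff by blast
 then have C: "\<bar>phi z\<bar> <= C" if "z : ?R" for z using that by auto
 have C0: "C >= 0" using C[of "(0, 0)"] T by auto
 have bd: "\<bar>pb z\<bar> <= C * \<bar>indicator ?R z\<bar>" for z using C[of z] C0 by (auto simp: pb_def split: split_indicator)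
 moreover have "C * \<bar>indicator ?R z\<bar> <= C" for z using C0 by (auto split: split_indicator)
 ultimately show "\<exists>C. \<forall>z. \<bar>pb z\<bar> <= C" by (meson order_trans)
 have "sqint lb2 (indicator ?R :: real \<times> real => real)"
  by (rule sqint_indicator) (auto simp: lborel.emeasure_pair_measure_Times emeasure_lborel_Icc_eq ennreal_mult_less_top)
 then show "sqint lb2 pb" by (rule sqint_bound[where C = C]) (use bd m in "auto cong: measurable_cong_sets")
qed

lemma pb_eq: "x : {-1..1} ==> t : {0..T} ==> pb (x, t) = phi (x, t)" by (simp add: pb_def)

lemma pb_zero: "x ~: {-1..1} ==> pb (x, t) = 0" by (auto simp: pb_def)

lemma mild_q: "mild (%z. q (snd z))"
proof (rule mild_bounded[of _ K])
 show "\<bar>q (snd (x, t))\<bar> <= K" for x t :: real using q_bd[of t] K by (smt (verit) divide_nonneg_nonneg snd_conv)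
 have [measurable]: "q : borel_measurable borel" by (rule borel_measurable_continuous_onI[OF q_cont])
 show "(%z. q (snd z)) : borel_measurable bor2" by measurable
qed

lemma mild_qt: "mild (%z. qt (snd z))"
proof (rule mild_bounded[of _ K])
 note [measurable] = qt(1)
 show "(%z. qt (snd z)) : borel_measurable bor2" by measurable
qed (use qt in simp)

lemma mild_rho: "mild (%z. rho (fst z))" "mild (%z. rho' (fst z))"
proof -
 have [measurable]: "rho : borel_measurable borel" "rho' : borel_measurable borel" using rho_cont by (auto intro: borel_measurable_continuous_onI)
 have "\<bar>rho x\<bar> <= K" for x using rho_bd[of x] by simp
 then show "mild (%z. rho (fst z))" by (intro mild_bounded[of _ K]) auto
 show "mild (%z. rho' (fst z))" using rho_bd(3) by (intro mild_bounded[of _ K]) auto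
qed

lemmas mild_basic = mild_const mild_mult mild_add mild_diff mild_power mild_minus mild_eta mild_yw mild_alt mild_xit mild_altt mild_q mild_qt mild_rho mild_inverse_yw

lemma mild_ay: "mild (%z. ay (fst z) (snd z))" unfolding ay_def by (intro mild_basic)
lemma mild_axy: "mild (%z. axy (fst z) (snd z))" unfolding axy_def by (intro mild_basic)
lemma mild_kk: "mild (%z. kk (fst z) (snd z))" unfolding kk_def by (intro mild_basic)
lemma mild_kkx: "mild (%z. kkx (fst z) (snd z))" unfolding kkx_def by (intro mild_basic)
lemma mild_VV: "mild (%z. VV (fst z) (snd z))" unfolding VV_def by (intro mild_basic mild_ay)
lemma mild_VVx: "mild (%z. VVx (fst z) (snd z))" unfolding VVx_def by (intro mild_basic mild_ay mild_axy)
lemma mild_VVt: "mild (%z. VVt (fst z) (snd z))" unfolding VVt_def by (intro mild_basic mild_ay)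
lemma mild_rl: "mild (%z. rl (fst z) (snd z))" unfolding rl_def by (intro mild_basic)
lemma mild_rlx: "mild (%z. rlx (fst z) (snd z))" unfolding rlx_def by (intro mild_basic)

lemmas mild_all = mild_ay mild_axy mild_kk mild_kkx mild_VV mild_VVx mild_VVt mild_rl mild_rlx mild_basic

lemma damped_w: "damped w" unfolding w_def[abs_def] by (rule damped_ew[OF pb_facts(3)])
lemma damped_wx: "damped wx" unfolding wx_def[abs_def] by (intro damped_add damped_mult damped_ew sq damped_w mild_all)
lemma damped_wxx: "damped wxx" unfolding wxx_def[abs_def] by (intro damped_add damped_mult damped_ew sq damped_w mild_all)
lemma damped_wt: "damped wt"
 unfolding wt_def[abs_def] by (intro damped_diff damped_mult damped_ew sq damped_w mild_all)
lemma damped_P1: "damped P1" unfolding P1_def[abs_def] by (intro damped_add damped_mult damped_w damped_wxx mild_all)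
lemma damped_P2: "damped P2" unfolding P2_def[abs_def] by (intro damped_diff damped_mult damped_w damped_wx damped_wt mild_all)

lemmas damped_all = damped_w damped_wx damped_wxx damped_wt damped_P1 damped_P2

lemma pb_trace: "sqint lborel (%t. pb (x0, t))"
proof -
 obtain C where C: "!!z. \<bar>pb z\<bar> <= C" using pb_facts(2) by blast
 note [measurable] = pb_facts(1)
 have C0: "C >= 0" using C[of "(0, 0)"] by linarith
 show ?thesis
 proof (rule sqint_bound[OF sqint_indicator_Icc[of 0 T], where C = C])
  show "\<bar>pb (x0, t)\<bar> <= C * \<bar>indicator {0..T} t\<bar>" for t using C[of "(x0, t)"] C0 by (auto simp: pb_def split: split_indicator)
 qed measurable
qed

lemma damped1_w: "damped1 x0 (%t. w (x0, t))" using damped1_ew[OF pb_trace, of x0] by (simp add: w_def)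

lemma damped1_wx: "x0 : {-1, 1} ==> damped1 x0 (%t. wx (x0, t))"
 using damped1_add[OF damped1_ew[of "%t. d (x0, t)" x0] damped1_mult[OF mild_ay damped1_w[of x0]]] tr by (auto simp: wx_def)

lemma damped1_wt1: "damped1 1 wt1"
proof -
 have "mild (%z. s * alt (fst z) (snd z))" by (intro mild_all)
 from damped1_diff[OF damped1_ew[OF h1(1), of 1] damped1_mult[OF this damped1_w[of 1]]]
 show ?thesis by (simp add: wt1_def[abs_def])
qed

lemma outside: "x ~: {-1..1} \<or> t ~: {0<..<T} ==> w (x, t) = 0 & wx (x, t) = 0 & wxx (x, t) = 0 & wt (x, t) = 0"
proof -
 assume a: "x ~: {-1..1} \<or> t ~: {0<..<T}"
 have e: "ew x t = 0 \<or> (x ~: {-1..1} & pb (x, t) = 0)" using a pb_zero by (auto simp: ew_def)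
 then have "w (x, t) = 0" by (auto simp: w_def)
 moreover have "d (x, t) = 0" "fxx (x, t) = 0" "ft (x, t) = 0" using a supp(1)[of "(x, t)"] supp(2)[of "(x, t)"] supp(3)[of "(x, t)"] by (auto simp: Qset_def)
 ultimately show ?thesis by (simp add: wx_def wxx_def wt_def)
qed

lemma left_w: "w (-1, t) = 0"
proof (cases "t : {0<..<T}")
 case True
 then show ?thesis using left[OF True] by (simp add: w_def pb_def)
next
 case False
 then show ?thesis using outside[of "-1" t] by simp
qed

section \<open>Absolute continuity of w in x and in t, and the energy inequality for w\<close>

lemma ac_x:
 assumes t: "t : {0<..<T}" and a: "ac_deriv (-1) 1 (%x. phi (x, t)) (%x. d (x, t))" "ac_deriv (-1) 1 (%x. d (x, t)) (%x. fxx (x, t))"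
 shows "ac_deriv (-1) 1 (%x. w (x, t)) (%x. wx (x, t))" "ac_deriv (-1) 1 (%x. wx (x, t)) (%x. wxx (x, t))"
  "ac_deriv (-1) 1 (%x. ay x t) (%x. axy x t)"
proof -
 have e: "ac_deriv (-1) 1 (%x. ew x t) (%x. (lam * eta' x * yw x t) * ew x t)" using t by (intro ac_deriv_C1 ew_deriv_x continuous_intros cont_x) auto
 have yd: "((%x. yw x t) has_real_derivative lam * eta' x * yw x t) (at x within {-1..1})" if "x : {-1..1}" for x
  unfolding yw_def using DERIV_cmult[OF xiw_deriv_x[OF that], of s t] by (simp add: mult_ac)
 show A: "ac_deriv (-1) 1 (%x. ay x t) (%x. axy x t)"
 proof (rule ac_deriv_C1)
  show "((%x. ay x t) has_real_derivative axy x t) (at x within {-1..1})" if x: "x : {-1..1}" for x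
   using DERIV_mult[OF DERIV_cmult[OF eta_deriv(2)[OF x], of lam] yd[OF x]]
   unfolding ay_def axy_def by (simp add: power2_eq_square mult_ac add.commute)
  show "continuous_on {-1..1} (%x. axy x t)" unfolding axy_def by (intro continuous_intros cont_x)
 qed
 show W: "ac_deriv (-1) 1 (%x. w (x, t)) (%x. wx (x, t))"
  by (rule ac_deriv_cong'[OF ac_deriv_mult[OF e a(1)]]) (use t in "auto simp: w_def wx_def pb_eq ay_def")
 show "ac_deriv (-1) 1 (%x. wx (x, t)) (%x. wxx (x, t))" by (rule ac_deriv_cong'[OF ac_deriv_add[OF ac_deriv_mult[OF e a(2)] ac_deriv_mult[OF A W]]])
   (auto simp: wx_def wxx_def ay_def algebra_simps power2_eq_square)
qed

lemma ac_x_AE: "AE t in lborel. ac_deriv (-1) 1 (%x. w (x, t)) (%x. wx (x, t)) & ac_deriv (-1) 1 (%x. wx (x, t)) (%x. wxx (x, t))" using acx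
proof eventually_elim
 case (elim t)
 show ?case
 proof (cases "t : {0<..<T}")
  case True
  then show ?thesis using ac_x[OF True] elim by blast
 next
  case False
  have "ac_deriv (-1) 1 (%x. 0) (%x. 0)" by (rule ac_deriv_C1) auto
  then show ?thesis using outside False by simp
 qed
qed

lemma w_continuous_t:
 assumes x: "x : {-1..1}"
 shows "continuous_on {0..T} (%t. w (x, t))"
proof -
 have p: "continuous_on {0..T} (%t. phi (x, t))" by (rule continuous_on_compose2[OF phi]) (use x in "auto intro!: continuous_intros")
 have "continuous_on {0..T} (%t. (%_. 1) (x, t) * (ew x t * phi (x, t)))" by (rule continuous_on_damped_product[OF mild_const _ p]) auto
 then show ?thesis by (rule continuous_on_eq) (use x in "auto simp: w_def pb_eq")
qed

lemma ac_t_inner: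
 assumes x: "x : {-1..1}" and p: "ac_deriv 0 T (%t. phi (x, t)) f" and cd: "0 < c" "c <= e" "e < T"
 shows "ac_deriv c e (%t. w (x, t)) (%t. ew x t * f t - s * alt x t * w (x, t))"
proof -
 have sub: "{c..e} \<subseteq> {0<..<T}" using cd by auto
 have "ac_deriv c e (ew x) (%t. - s * alt x t * ew x t)"
 proof (rule ac_deriv_C1)
  show "(ew x has_real_derivative - s * alt x t * ew x t) (at t within {c..e})" if "t : {c..e}" for t
   using has_field_derivative_at_within[OF ew_deriv_t[of t x], of "{c..e}"] sub that by auto
  show "continuous_on {c..e} (%t. - s * alt x t * ew x t)"
   by (intro continuous_intros continuous_on_subset[OF cont_t(3) sub] continuous_on_subset[OF cont_t(6) sub])
 qed
 from ac_deriv_mult[OF this ac_deriv_subinterval[OF p, of c e]]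
 have "ac_deriv c e (%t. ew x t * phi (x, t)) (%t. (- s * alt x t * ew x t) * phi (x, t) + ew x t * f t)" using cd by simp
 then show ?thesis by (rule ac_deriv_cong') (use cd x in "auto simp: w_def pb_eq")
qed

lemma ac_t_closed:
 assumes x: "x : {-1..1}" and p: "ac_deriv 0 T (%t. phi (x, t)) f"
  and i: "set_integrable lborel {0..T} (%t. ew x t * f t - s * alt x t * w (x, t))"
 shows "ac_deriv 0 T (%t. w (x, t)) (%t. ew x t * f t - s * alt x t * w (x, t))"
 by (rule ac_deriv_closed_interval[OF T w_continuous_t[OF x] i]) (rule ac_t_inner[OF x p])

lemma finite_strip: "{-1..1} \<times> {0<..<T} : sets lb2" "emeasure lb2 ({-1..1} \<times> {0<..<T}) < \<infinity>"
 using T by (auto simp: lborel.emeasure_pair_measure_Times ennreal_mult_less_top emeasure_lborel_Icc_eq)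

lemma wt_integrable: "integrable lb2 wt"
proof (rule sqint_support_integrable[OF damped_sqint[OF damped_wt] finite_strip])
 show "wt z = 0" if "z ~: {-1..1} \<times> {0<..<T}" for z using outside[of "fst z" "snd z"] that by (cases z) auto
qed

lemma ac_t_AE: "AE x in lborel. x : {-1..1} --> ac_deriv 0 T (%t. w (x, t)) (%t. wt (x, t)) & integrable lborel (%t. wt (x, t))"
 using act slice_Fubini(4)[OF wt_integrable] AE_not_endpoint
proof eventually_elim
 case (elim x)
 show ?case
 proof
  assume x: "x : {-1..1}"
  then have p: "ac_deriv 0 T (%t. phi (x, t)) (%t. ft (x, t))" using elim by auto
  have "set_integrable lborel {0..T} (%t. wt (x, t))" using integrable_mult_indicator[OF _ elim(2), of "{0..T}"] by (simp add: set_integrable_def)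
  then show "ac_deriv 0 T (%t. w (x, t)) (%t. wt (x, t)) & integrable lborel (%t. wt (x, t))" using ac_t_closed[OF x p] elim(2) by (simp add: wt_def)
 qed
qed

lemma wt1_ac: "ac_deriv 0 T (%t. w (1, t)) wt1" "integrable lborel wt1" "!!t. t ~: {0<..<T} ==> wt1 t = 0"
proof -
 show z: "wt1 t = 0" if "t ~: {0<..<T}" for t using outside[of 1 t] that h1(2)[OF that] by (simp add: wt1_def)
 show i: "integrable lborel wt1" by (rule sqint_support_integrable[OF damped1_sqint[OF damped1_wt1], of "{0<..<T}"]) (use T z in auto)
 have "set_integrable lborel {0..T} wt1" using integrable_mult_indicator[OF _ i, of "{0..T}"] by (simp add: set_integrable_def)
 then show "ac_deriv 0 T (%t. w (1, t)) wt1" using ac_t_closed[OF _ h1(3)] by (simp add: wt1_def[abs_def])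
qed

lemma q_pos: "q t >= 0" using q_bd(1)[of t] K by (smt (verit) divide_nonneg_nonneg)

lemma energy_w:
 "2 * (LBINT t. q t * wx (1, t) * wt1 t) - K * (LINT z|lb2. (wx z)^2) <= 2 * (LINT z|lb2. q (snd z) * wxx z * wt z)"
proof (rule energy_inequality[where w = w and Q = K])
 show "sqint lb2 wx" "sqint lb2 wxx" "sqint lb2 wt" by (intro damped_sqint damped_all)+
 show "sqint lborel wt1" "sqint lborel (%t. wx (1, t))" using damped1_sqint[OF damped1_wt1] damped1_sqint[OF damped1_wx[of 1]] by simp_all
 show "q : borel_measurable borel" by (rule borel_measurable_continuous_onI[OF q_cont])
 show "AE t in lborel. ac_deriv (-1) 1 (%x. w (x, t)) (%x. wx (x, t)) & ac_deriv (-1) 1 (%x. wx (x, t)) (%x. wxx (x, t))" by (rule ac_x_AE)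
 show "AE x in lborel. x : {-1..1} --> (\<forall>t h. h > 0 --> w (x, t + h) - w (x, t) = h * avg h (%t. wt (x, t)) t)" using ac_t_AE
 proof eventually_elim
  case (elim x)
  show ?case
  proof (intro impI allI)
   fix t h :: real assume "x : {-1..1}" and h: "h > 0"
   then show "w (x, t + h) - w (x, t) = h * avg h (%t. wt (x, t)) t" using elim outside by (intro ac_deriv_zero_extension[OF T]) auto
  qed
 qed
 show "w (1, t + h) - w (1, t) = h * avg h wt1 t" if "h > 0" for t h by (rule ac_deriv_zero_extension[OF T wt1_ac(1,2) wt1_ac(3) _ that]) (use outside in auto)
qed (use outside left_w q_pos q_bd q_lip in auto)

section \<open>Integrals of the exact derivatives\<close>

lemma JJ_integrable: "integrable lb2 JJ"
proof -
 have "integrable lb2 (%z. (qt (snd z) * VV (fst z) (snd z) + q (snd z) * VVt (fst z) (snd z)) * (w z * w z)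
   + (q (snd z) * VV (fst z) (snd z) * (wt z * w z) + q (snd z) * VV (fst z) (snd z) * (w z * wt z)))" by (intro lint_add damped_integrable damped_all mild_all)
 then show ?thesis unfolding JJ_def[abs_def] distrib_left .
qed

text \<open>\<open>q V w^2\<close> vanishes at both end times although V blows up there, because one
  factor w still carries the exponential weight. The product rule holds on compact subintervals of
  (0,T) and is carried to the closed interval by continuity.\<close>

lemma JJ_slice_zero:
 assumes x: "x : {-1..1}" and W: "ac_deriv 0 T (%t. w (x, t)) (%t. wt (x, t))"
  and i: "integrable lborel (%t. JJ (x, t))"
 shows "(LBINT t. JJ (x, t)) = 0"
proof -
 let ?F = "%t. q t * VV x t * (w (x, t) * w (x, t))"
 have VVt: "ac_deriv c e (VV x) (VVt x)" if cd: "0 < c" "c <= e" "e < T" for c e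
 proof -
  have sub: "{c..e} \<subseteq> {0<..<T}" using cd by auto
  have a: "ac_deriv c e (%t. ay x t) (%t. lam * eta' x * s * xit x t)"
  proof (rule ac_deriv_C1)
   show "((%t. ay x t) has_real_derivative lam * eta' x * s * xit x t) (at t within {c..e})" if "t : {c..e}" for t
    using DERIV_cmult[OF xiw_deriv_t[of t x "{c..e}"], of "lam * eta' x * s"] sub that
    unfolding ay_def yw_def by (auto simp: mult_ac)
   show "continuous_on {c..e} (%t. lam * eta' x * s * xit x t)" by (intro continuous_intros continuous_on_subset[OF cont_t(5) sub])
  qed
  have b: "ac_deriv c e (%t. s * alt x t) (%t. s * altt x t)"
  proof (rule ac_deriv_C1)
   show "((%t. s * alt x t) has_real_derivative s * altt x t) (at t within {c..e})" if "t : {c..e}" for t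
    using DERIV_cmult[OF alt_deriv_t[of t x "{c..e}"], of s] sub that by auto
   show "continuous_on {c..e} (%t. s * altt x t)" by (intro continuous_intros continuous_on_subset[OF cont_t(4) sub])
  qed
  have qa: "ac_deriv c e q qt" by (rule ac_deriv_subinterval[OF q_ac]) (use cd in auto)
  show ?thesis by (rule ac_deriv_cong'[OF ac_deriv_add[OF ac_deriv_mult[OF a a] ac_deriv_mult[OF qa b]]])
    (auto simp: VV_def VVt_def power2_eq_square algebra_simps)
 qed
 have ac: "ac_deriv c e ?F (%t. JJ (x, t))" if cd: "0 < c" "c <= e" "e < T" for c e
 proof -
  have qa: "ac_deriv c e q qt" by (rule ac_deriv_subinterval[OF q_ac]) (use cd in auto)
  have wa: "ac_deriv c e (%t. w (x, t)) (%t. wt (x, t))" by (rule ac_deriv_subinterval[OF W]) (use cd in auto)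
  show ?thesis by (rule ac_deriv_cong'[OF ac_deriv_mult[OF ac_deriv_mult[OF qa VVt[OF cd]] ac_deriv_mult[OF wa wa]]])
    (auto simp: JJ_def)
 qed
 have "ac_deriv 0 T ?F (%t. JJ (x, t))"
 proof (rule ac_deriv_closed_interval[OF T])
  have p: "continuous_on {0..T} (%t. phi (x, t))" by (rule continuous_on_compose2[OF phi]) (use x in "auto intro!: continuous_intros")
  have "continuous_on {0..T} (%t. (%z. q (snd z) * VV (fst z) (snd z)) (x, t) * (ew x t * (phi (x, t) * w (x, t))))"
  proof (rule continuous_on_damped_product)
   show "mild (%z. q (snd z) * VV (fst z) (snd z))" by (intro mild_all)
   show "continuous_on {0<..<T} (%t. q (snd (x, t)) * VV (fst (x, t)) (snd (x, t)))"
    unfolding VV_def ay_def fst_conv snd_conv by (intro continuous_intros cont_t continuous_on_subset[OF q_cont]) auto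
   show "continuous_on {0..T} (%t. phi (x, t) * w (x, t))" by (intro continuous_intros p w_continuous_t[OF x])
  qed
  then show "continuous_on {0..T} ?F" by (rule continuous_on_eq) (use x in "auto simp: w_def pb_eq")
  show "set_integrable lborel {0..T} (%t. JJ (x, t))" using integrable_mult_indicator[OF _ i, of "{0..T}"] by (simp add: set_integrable_def)
 qed (rule ac)
 from ac_derivD[OF this, of T] T have "(LBINT t:{0..T}. JJ (x, t)) = ?F T - ?F 0" by simp
 also have "... = 0" using outside[of x 0] outside[of x T] by simp
 finally have "(LBINT t:{0..T}. JJ (x, t)) = 0" .
 moreover have "(LBINT t:{0..T}. JJ (x, t)) = (LBINT t. JJ (x, t))"
  unfolding set_lebesgue_integral_def
 proof (intro lint_cong refl)
  fix t show "indicator {0..T} t *\<^sub>R JJ (x, t) = JJ (x, t)" using outside[of x t] by (auto simp: JJ_def split: split_indicator)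
 qed
 ultimately show ?thesis by simp
qed

lemma JJ_integral_zero: "(LINT z|lb2. JJ z) = 0"
proof -
 have "AE x in lborel. (LBINT t. JJ (x, t)) = 0" using ac_t_AE slice_Fubini(4)[OF JJ_integrable]
 proof eventually_elim
  case (elim x)
  show ?case
  proof (cases "x : {-1..1}")
   case True then show ?thesis using JJ_slice_zero[OF True] elim by blast
  next
   case False
   then have "(%t. JJ (x, t)) = (%t. 0)" using outside[of x] by (auto simp: JJ_def fun_eq_iff)
   then show ?thesis by simp
  qed
 qed
 then have "(LBINT x. (LBINT t. JJ (x, t))) = 0" by (rule integral_eq_zero_AE)
 then show ?thesis using slice_Fubini(6)[OF JJ_integrable] by simp
qed

lemma Dv_integrable: "integrable lb2 Dv"
proof -
 have "integrable lb2 (%z. - 2 * (axy (fst z) (snd z) * (wx z * wx z) + (ay (fst z) (snd z) * (wxx z * wx z) + ay (fst z) (snd z) * (wx z * wxx z)))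
  + - 4 * (kkx (fst z) (snd z) * (w z * wx z) + (kk (fst z) (snd z) * (wx z * wx z) + kk (fst z) (snd z) * (w z * wxx z)))
  + - 2 * ((axy (fst z) (snd z) * VV (fst z) (snd z) + ay (fst z) (snd z) * VVx (fst z) (snd z)) * (w z * w z)
    + (ay (fst z) (snd z) * VV (fst z) (snd z) * (wx z * w z) + ay (fst z) (snd z) * VV (fst z) (snd z) * (w z * wx z)))
  + - 1 * (rlx (fst z) (snd z) * (w z * wx z) + (rl (fst z) (snd z) * (wx z * wx z) + rl (fst z) (snd z) * (w z * wxx z))))"
  by (intro lint_add integrable_mult_right damped_integrable damped_all mild_all)
 moreover have "Dv = (%z. - 2 * (axy (fst z) (snd z) * (wx z * wx z) + (ay (fst z) (snd z) * (wxx z * wx z) + ay (fst z) (snd z) * (wx z * wxx z)))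
  + - 4 * (kkx (fst z) (snd z) * (w z * wx z) + (kk (fst z) (snd z) * (wx z * wx z) + kk (fst z) (snd z) * (w z * wxx z)))
  + - 2 * ((axy (fst z) (snd z) * VV (fst z) (snd z) + ay (fst z) (snd z) * VVx (fst z) (snd z)) * (w z * w z)
    + (ay (fst z) (snd z) * VV (fst z) (snd z) * (wx z * w z) + ay (fst z) (snd z) * VV (fst z) (snd z) * (w z * wx z)))
  + - 1 * (rlx (fst z) (snd z) * (w z * wx z) + (rl (fst z) (snd z) * (wx z * wx z) + rl (fst z) (snd z) * (w z * wxx z))))"
  by (simp only: Dv_def[abs_def] distrib_left[of "ay _ _"] distrib_left[of "kk _ _"] distrib_left[of "rl _ _"] distrib_left[of "ay _ _ * VV _ _"])
 ultimately show ?thesis by simp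
qed

lemma Dv_slice:
 assumes t: "t : {0<..<T}" and a: "ac_deriv (-1) 1 (%x. phi (x, t)) (%x. d (x, t))" "ac_deriv (-1) 1 (%x. d (x, t)) (%x. fxx (x, t))"
 shows "(LBINT x. Dv (x, t)) = Hf (1, t) - Hf (-1, t)"
proof -
 note A = ac_x(3)[OF t a] and W = ac_x(1)[OF t a] and X = ac_x(2)[OF t a]
 have yd: "((%x. yw x t) has_real_derivative lam * eta' x * yw x t) (at x within {-1..1})" if "x : {-1..1}" for x
  unfolding yw_def using DERIV_cmult[OF xiw_deriv_x[OF that], of s t] by (simp add: mult_ac)
 have Y: "ac_deriv (-1) 1 (%x. yw x t) (%x. lam * eta' x * yw x t)" by (intro ac_deriv_C1 yd continuous_intros cont_x) auto
 have E: "ac_deriv (-1) 1 eta' eta''" by (intro ac_deriv_C1 eta_deriv cont_x) auto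
 have R: "ac_deriv (-1) 1 rho rho'" using rho_cont by (intro ac_deriv_C1 rho_deriv) (auto intro: continuous_on_subset)
 have kk: "ac_deriv (-1) 1 (%x. kk x t) (%x. kkx x t)" by (rule ac_deriv_cong'[OF ac_deriv_cmult[OF ac_deriv_mult[OF ac_deriv_mult[OF E E] Y], of "lam^2"]])
   (auto simp: kk_def kkx_def power2_eq_square power3_eq_cube algebra_simps)
 have al: "ac_deriv (-1) 1 (%x. alt x t) (%x. - (lam * eta' x * xit x t))" by (intro ac_deriv_C1 alt_deriv_x continuous_intros cont_x) auto
 have V: "ac_deriv (-1) 1 (%x. VV x t) (%x. VVx x t)" by (rule ac_deriv_cong'[OF ac_deriv_add[OF ac_deriv_mult[OF A A] ac_deriv_cmult[OF al, of "s * q t"]]])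
   (auto simp: VV_def VVx_def power2_eq_square algebra_simps)
 have rl: "ac_deriv (-1) 1 (%x. rl x t) (%x. rlx x t)"
  by (rule ac_deriv_cong'[OF ac_deriv_mult[OF R ac_deriv_cmult[OF Y, of "lam^2"]]]) (auto simp: rl_def rlx_def)
 have H: "ac_deriv (-1) 1 (%x. Hf (x, t)) (%x. Dv (x, t))" by (rule ac_deriv_cong'[OF ac_deriv_add[OF ac_deriv_add[OF ac_deriv_add[OF
    ac_deriv_cmult[OF ac_deriv_mult[OF A ac_deriv_mult[OF X X]], of "-2"]
    ac_deriv_cmult[OF ac_deriv_mult[OF kk ac_deriv_mult[OF W X]], of "-4"]]
    ac_deriv_cmult[OF ac_deriv_mult[OF ac_deriv_mult[OF A V] ac_deriv_mult[OF W W]], of "-2"]]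
    ac_deriv_cmult[OF ac_deriv_mult[OF rl ac_deriv_mult[OF W X]], of "-1"]]])
   (auto simp: Hf_def Dv_def)
 have "(LBINT x. Dv (x, t)) = (LBINT x:{-1..1}. Dv (x, t))"
  unfolding set_lebesgue_integral_def
 proof (intro lint_cong refl)
  fix x show "Dv (x, t) = indicator {-1..1} x *\<^sub>R Dv (x, t)" using outside[of x t] by (auto simp: Dv_def split: split_indicator)
 qed
 then show ?thesis using ac_derivD[OF H, of 1] by simp
qed

lemma Dv_integral: "(LINT z|lb2. Dv z) = (LBINT t. Hf (1, t) - Hf (-1, t))"
proof -
 have Hm: "(%t. Hf (1, t) - Hf (-1, t)) : borel_measurable lborel"
 proof -
  have mm: "c : borel_measurable bor2" if "mild c" for c using that by (simp add: mild_def)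
  have dm: "u : borel_measurable bor2" if "damped u" for u using sqint_measurable[OF damped_sqint[OF that]] by (simp cong: measurable_cong_sets)
  note [measurable] = mm[OF mild_ay] mm[OF mild_kk] mm[OF mild_VV] mm[OF mild_rl] dm[OF damped_w] dm[OF damped_wx]
  have "Hf : borel_measurable bor2" unfolding Hf_def[abs_def] by measurable
  then show ?thesis by measurable
 qed
 have "(LINT z|lb2. Dv z) = (LBINT t. (LBINT x. Dv (x, t)))" using slice_Fubini(3)[OF Dv_integrable] by simp
 also have "... = (LBINT t. Hf (1, t) - Hf (-1, t))"
 proof (rule integral_cong_AE)
  show "AE t in lborel. (LBINT x. Dv (x, t)) = Hf (1, t) - Hf (-1, t)" using acx
  proof eventually_elim
   case (elim t)
   show ?case
   proof (cases "t : {0<..<T}")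
    case True then show ?thesis using Dv_slice[OF True] elim by blast
   next
    case False
    then have "(%x. Dv (x, t)) = (%x. 0)" using outside[of _ t] by (auto simp: Dv_def fun_eq_iff)
    then show ?thesis using outside[of 1 t] outside[of "-1" t] False by (simp add: Hf_def)
   qed
  qed
  show "(%t. \<integral>x. Dv (x, t) \<partial>lborel) : borel_measurable lborel" using borel_measurable_integrable[OF slice_Fubini(2)[OF Dv_integrable]] .
 qed (rule Hm)
 finally show ?thesis .
qed

end

lemma abs_mult_mono: "\<bar>a\<bar> <= A ==> \<bar>b\<bar> <= B ==> \<bar>a * b\<bar> <= A * (B::real)"
 unfolding abs_mult by (intro mult_mono) auto

context carleman_solution begin

section \<open>The inequality for the conjugated function\<close>

lemma yw_bounds:
 assumes t: "t : {0<..<T}"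
 shows "yw x t >= 1" "yw x t > 0" "1 / yw x t <= dl" "xiw x t > 0"
proof -
 have p: "yw x t > 0" using xiw_pos[OF t] s by (simp add: yw_def)
 then have "dl * yw x t <= 1 * yw x t" using delta by (intro mult_right_mono) auto
 then show "yw x t >= 1" using delta(5)[OF t, of x] by simp
 show "1 / yw x t <= dl" using delta(5)[OF t, of x] p by (simp add: pos_divide_le_eq)
qed (use xiw_pos[OF t] s in "simp_all add: yw_def")

lemma s_xiw:
 assumes t: "t : {0<..<T}"
 shows "s * (xiw x t)^2 <= dl * (yw x t)^2" "s * xiw x t ^ 3 <= dl * yw x t ^ 3"
proof -
 note xp = yw_bounds(4)[OF t, of x]
 have "1 * (s * (xiw x t)^2) <= (dl * s) * (s * (xiw x t)^2)" using delta(4) s by (intro mult_right_mono) auto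
 then show "s * (xiw x t)^2 <= dl * (yw x t)^2" by (simp add: yw_def power2_eq_square mult_ac)
 have "1 * 1 <= (dl * s) * s" using delta(4) s by (intro mult_mono) auto
 then have "1 * (s * xiw x t ^ 3) <= ((dl * s) * s) * (s * xiw x t ^ 3)" using xp s by (intro mult_right_mono) auto
 then show "s * xiw x t ^ 3 <= dl * yw x t ^ 3" by (simp add: yw_def power3_eq_cube mult_ac)
qed

lemma time_derivative_bounds:
 assumes t: "t : {0<..<T}"
 shows "\<bar>s * alt x t\<bar> <= K * (dl * (yw x t)^2)" "\<bar>s * xit x t\<bar> <= K * (dl * (yw x t)^2)" "\<bar>s * altt x t\<bar> <= 3 * K * (dl * yw x t ^ 3)"
proof -
 have gen: "\<bar>s * v\<bar> <= B" if "\<bar>v\<bar> <= C" "s * C <= B" for v B C using mult_left_mono[OF that(1), of s] that(2) s by (subst abs_mult) linarith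
 have "T * (s * (xiw x t)^2) <= K * (dl * (yw x t)^2)" using K T s by (intro mult_mono s_xiw[OF t]) auto
 then have *: "s * (T * (xiw x t)^2) <= K * (dl * (yw x t)^2)" by (simp only: mult.left_commute)
 show "\<bar>s * alt x t\<bar> <= K * (dl * (yw x t)^2)" by (rule gen[OF alt_le[OF t] *])
 show "\<bar>s * xit x t\<bar> <= K * (dl * (yw x t)^2)" by (rule gen[OF xit_le[OF t] *])
 have "T^2 * (s * xiw x t ^ 3) <= K * (dl * yw x t ^ 3)" using K T s yw_bounds[OF t, of x] by (intro mult_mono s_xiw[OF t]) auto
 then have "s * (3 * T^2 * xiw x t ^ 3) <= 3 * K * (dl * yw x t ^ 3)" by (simp only: mult.left_commute mult.assoc)
 then show "\<bar>s * altt x t\<bar> <= 3 * K * (dl * yw x t ^ 3)" by (rule gen[OF altt_le[OF t]])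
qed

lemma q_abs: "\<bar>q t\<bar> <= K" using q_pos[of t] q_bd(2)[of t] by simp

lemma K2_bounds: "K2 >= 1" "2 * K^2 <= K2" "K <= K2" "2 * K <= K2"
proof -
 have "K ^ 1 <= K ^ 5" "K^2 <= K ^ 5" using K by (intro power_increasing; simp)+
 then show "K2 >= 1" "2 * K^2 <= K2" "K <= K2" "2 * K <= K2" using K(1) unfolding K2_def by auto
qed

lemma VV_bound:
 assumes t: "t : {0<..<T}"
 shows "\<bar>VV x t\<bar> <= K2 * (lam^2 * (yw x t)^2)"
proof -
 have 1: "(ay x t)^2 <= K^2 * (lam^2 * (yw x t)^2)"
  using mult_right_mono[OF power_mono[OF eta_K(1)[of x], of 2], of "lam^2 * (yw x t)^2"] by (simp add: ay_def power_mult_distrib mult_ac)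
 have "\<bar>q t * (s * alt x t)\<bar> <= K * (K * (dl * (yw x t)^2))" by (intro abs_mult_mono q_abs time_derivative_bounds t)
 also have "... = K^2 * (dl * (yw x t)^2)" by (simp add: power2_eq_square)
 also have "... <= K^2 * (lam^2 * (yw x t)^2)" using delta one_le_power[OF lam, of 2] by (intro mult_left_mono mult_right_mono) auto
 finally have 2: "\<bar>s * q t * alt x t\<bar> <= K^2 * (lam^2 * (yw x t)^2)" by (simp add: mult_ac)
 have "\<bar>VV x t\<bar> <= 2 * K^2 * (lam^2 * (yw x t)^2)" using 1 2 zero_le_power2[of "ay x t"] unfolding VV_def by linarith
 also have "... <= K2 * (lam^2 * (yw x t)^2)" using K2_bounds by (intro mult_right_mono) auto
 finally show ?thesis .
qed

text \<open>In the expansion of \<open>(P1 + P2)^2\<close> the product of \<open>wxx\<close> and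
  \<open>wt\<close> is left untouched, the rest of \<open>2 P1 P2\<close> is \<open>JJ\<close>, the
  divergence without its cutoff part, and a quadratic form. The cutoff part contributes
  \<open>rl (w_x)^2\<close> and, through \<open>wxx = P1 - V w\<close>, terms in w and P1. The
  summand \<open>- K (w_x)^2\<close> is the price of applying \<open>energy_w\<close> after
  integration.\<close>

lemma interior_pointwise:
 assumes x: "x : {-1..1}" and t: "t : {0<..<T}" and small: "K2^2 * dl * 8 <= cc"
 defines "z \<equiv> (x, t)"
 shows "1 / 2 * (P1 z)^2 + (P2 z)^2 + cc / 2 * (XX z + WW z) \<le>
  (P1 z + P2 z)^2 - 2 * (q t * wxx z * wt z) - JJ z - Dv z - K * (wx z)^2 + 2 * K2^2 * (indicator omega x * WW z)"
proof -
 define y D D2 where "y = yw x t" and "D = eta' x" and "D2 = eta'' x"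
 define u1 u2 u3 u4 u5 where "u1 = s * q t * alt x t" and "u2 = - (s * q t * (lam * eta' x * xit x t))"
  and "u3 = lam * eta' x * s * xit x t" and "u4 = s * qt t * alt x t" and "u5 = s * q t * altt x t"
 note yb = yw_bounds[OF t, of x, folded y_def] and tb = time_derivative_bounds[OF t, of x, folded y_def]
 have Dk: "\<bar>D\<bar> <= K" "\<bar>D2\<bar> <= K" using eta_K by (simp_all add: D_def D2_def)
 have dy: "1 <= dl * y" using delta(5)[OF t, of x] by (simp add: y_def)
 have b1: "\<bar>u1\<bar> <= K^2 * dl * y^2" using abs_mult_mono[OF q_abs tb(1), of t] by (simp add: u1_def power2_eq_square mult_ac)
 have b4: "\<bar>u4\<bar> <= K^2 * dl * y^2" using abs_mult_mono[OF qt(2) tb(1), of t] by (simp add: u4_def power2_eq_square mult_ac)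
 have b5: "\<bar>u5\<bar> <= 3 * K^2 * dl * y ^ 3" using abs_mult_mono[OF q_abs tb(3), of t] by (simp add: u5_def power2_eq_square mult_ac)
 have lam': "\<bar>lam\<bar> <= lam" using lam by simp
 have b3: "\<bar>u3\<bar> <= K^2 * dl * (lam * y^2)"
  using abs_mult_mono[OF lam' abs_mult_mono[OF eta_K(1)[of x] tb(2)]] by (simp add: u3_def power2_eq_square mult_ac)
 have b2: "\<bar>u2\<bar> <= K ^ 3 * dl * (lam * y^2)" using abs_mult_mono[OF q_abs[of t] abs_mult_mono[OF lam' abs_mult_mono[OF eta_K(1)[of x] tb(2)]]]
  by (simp add: u2_def power2_eq_square power3_eq_cube mult_ac)
 have KK: "\<bar>K\<bar> <= K" using K by simp
 note cb = coefficient_bounds[OF lam delta(3) yb(1) dy K(1) delta(2) Dk q_abs[of t] qt(2)[of t] KK b1 b2 b3 b4 b5]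
 have sig: "\<bar>rlx x t\<bar> <= K2 * (lam ^ 3 * y)"
 proof -
  have "\<bar>rho' x * (lam^2 * y)\<bar> <= K * (lam ^ 3 * y)" using yb lam power_increasing[of 2 3 lam] by (intro abs_mult_mono rho_bd) auto
  moreover have "\<bar>rho x * (D * (lam ^ 3 * y))\<bar> <= K * (K * (lam ^ 3 * y))" using yb lam rho_bd[of x] by (intro abs_mult_mono Dk) auto
  moreover have "rlx x t = rho' x * (lam^2 * y) + rho x * (D * (lam ^ 3 * y))" by (simp add: rlx_def y_def D_def power2_eq_square power3_eq_cube mult_ac)
  moreover have "K * (lam ^ 3 * y) + K * (K * (lam ^ 3 * y)) <= K2 * (lam ^ 3 * y)"
  proof -
   have "K * 1 <= K * K" using K by (intro mult_left_mono) auto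
   then have "(K + K * K) * (lam ^ 3 * y) <= K2 * (lam ^ 3 * y)" using K2_bounds yb lam by (intro mult_right_mono) (auto simp: power2_eq_square)
   then show ?thesis by (simp add: algebra_simps)
  qed
  ultimately show ?thesis by linarith
 qed
 have rho: "0 <= rho x" "rho x <= K2 * indicator omega x" using rho_bd[of x] rho_supp[of x] K2_bounds by (auto split: split_indicator)
 have dich': "\<bar>D\<bar> >= c0 \<or> (rho x >= 1 & indicator omega x = (1::real))" using dich[OF x] by (auto simp: D_def)
 have V: "\<bar>VV x t\<bar> <= K2 * (lam^2 * y^2)" using VV_bound[OF t] by (simp add: y_def)
 have small': "K2^2 * dl * 8 <= min (min (6 * c0^2) 1) (2 * c0 ^ 4)" using small by (simp add: cc_def)
 define rx where "rx = 2 * (lam * D2 * y) - K"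
 define rw where "rw = 6 * (lam ^ 3 * D^2 * D2 * y ^ 3) + 2 * ((lam * D2 * y + lam^2 * D^2 * y) * u1) + 2 * (lam * D * y * u2)
    - 4 * (lam^2 * D^2 * y * u1) - qt t * (lam^2 * D^2 * y^2 + u1) - q t * (2 * (lam * D * y) * u3 + u4 + u5)"
 have kx: "4 * (lam^2 * y * (2 * D * D2 + lam * D ^ 3)) = 4 * kkx x t" by (simp add: kkx_def y_def D_def D2_def)
 have main: "P1 z ^ 2 + P2 z ^ 2 + (6 * (lam^2 * D^2 * y) + rx) * (wx z)^2 + 4 * kkx x t * (w z * wx z) + (2 * (lam ^ 4 * D ^ 4 * y ^ 3) + rw) * (w z)^2
   + rlx x t * (w z * wx z) + rho x * (lam^2 * y) * (wx z)^2 + rho x * (lam^2 * y) * (w z * (P1 z - VV x t * w z)) + 2 * K2^2 * indicator omega x * (lam ^ 4 * y ^ 3 * (w z)^2)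
  >= 1 / 2 * (P1 z)^2 + (P2 z)^2 + min (min (6 * c0^2) 1) (2 * c0 ^ 4) / 2 * (lam^2 * y * (wx z)^2 + lam ^ 4 * y ^ 3 * (w z)^2)"
  by (rule pointwise_interior[OF lam yb(1) yb(3) K2_bounds(1) c0(1) _ sig _ _ rho _ _ V dich' small'])
   (use cb[folded K2_def] in "simp_all add: rx_def rw_def kx")
 \<comment> \<open>The leading part is \<open>2 kk\<close> from \<open>axy\<close> plus
   \<open>4 kk\<close>, hence 6.\<close>
 have e1: "6 * (lam^2 * D^2 * y) + rx = 2 * axy x t + 4 * kk x t - K" by (simp add: rx_def axy_def kk_def y_def D_def D2_def algebra_simps)
 \<comment> \<open>Leading parts in units of \<open>lam^4 D^4 y^3\<close>: 2 from
   \<open>axy VV\<close>, 4 from \<open>ay VVx\<close>, and -4 from \<open>kk VV\<close>; what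
   remains is 2.\<close>
 have e2: "2 * (lam ^ 4 * D ^ 4 * y ^ 3) + rw = 2 * (axy x t * VV x t + ay x t * VVx x t) - 4 * kk x t * VV x t - (qt t * VV x t + q t * VVt x t)"
  unfolding rw_def VV_def VVx_def VVt_def axy_def ay_def kk_def u1_def[symmetric] u4_def[symmetric] u5_def[symmetric] D_def[symmetric] D2_def[symmetric] y_def[symmetric]
   u3_def[folded D_def, symmetric] using u2_def[folded D_def] by algebra
 have P: "P1 z = wxx z + VV x t * w z" "P2 z = q t * wt z - 2 * ay x t * wx z - 2 * kk x t * w z" by (simp_all add: P1_def P2_def z_def)
 have J: "JJ z = (qt t * VV x t + q t * VVt x t) * (w z * w z) + q t * VV x t * (wt z * w z + w z * wt z)" by (simp add: JJ_def z_def)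
 have DD: "Dv z = - 2 * (axy x t * (wx z * wx z) + ay x t * (wxx z * wx z + wx z * wxx z))
  + - 4 * (kkx x t * (w z * wx z) + kk x t * (wx z * wx z + w z * wxx z))
  + - 2 * ((axy x t * VV x t + ay x t * VVx x t) * (w z * w z) + ay x t * VV x t * (wx z * w z + w z * wx z))
  + - 1 * (rlx x t * (w z * wx z) + rl x t * (wx z * wx z + w z * wxx z))" by (simp add: Dv_def z_def)
 have rl: "rho x * (lam^2 * y) = rl x t" by (simp add: rl_def y_def)
 \<comment> \<open>The exact identity behind the lemma; only after it are the coefficients
   estimated.\<close>
 have "P1 z ^ 2 + P2 z ^ 2 + (2 * axy x t + 4 * kk x t - K) * (wx z)^2 + 4 * kkx x t * (w z * wx z)
   + (2 * (axy x t * VV x t + ay x t * VVx x t) - 4 * kk x t * VV x t - (qt t * VV x t + q t * VVt x t)) * (w z)^2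
   + rlx x t * (w z * wx z) + rl x t * (wx z)^2 + rl x t * (w z * (P1 z - VV x t * w z))
   = (P1 z + P2 z)^2 - 2 * (q t * wxx z * wt z) - JJ z - Dv z - K * (wx z)^2"
  unfolding J DD P by algebra
 moreover have "XX z = lam^2 * y * (wx z)^2" "WW z = lam ^ 4 * y ^ 3 * (w z)^2" by (simp_all add: XX_def WW_def z_def y_def)
 ultimately show ?thesis using main unfolding e1 e2 rl cc_def by (simp add: mult.assoc)
qed

text \<open>At x = -1 w is 0, so only the square of \<open>w_x\<close> survives in the flux, with
  the right sign since \<open>eta' (-1) >= c0\<close>. At x = 1 the cutoff vanishes, and the product
  of \<open>w_x\<close> and \<open>wt1\<close> coming from the energy inequality joins the
  flux.\<close>

lemma boundary_pointwise:
 assumes t: "t : {0<..<T}" and small: "2 * K2^2 * dl + 8 * K2 ^ 4 / c0 * dl <= c0 ^ 3"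
 shows "c0 * (lam * yw 1 t * (wx (1, t))^2) + c0 ^ 3 * (lam ^ 3 * yw 1 t ^ 3 * (w (1, t))^2) + c0 * (lam * yw (-1) t * (wx (-1, t))^2)
  - 2 * K2^2 / c0 * ((wt1 t)^2 / (lam * yw 1 t)) <= Hf (1, t) - Hf (-1, t) + 2 * (q t * wx (1, t) * wt1 t)"
proof -
 define y where "y = yw 1 t"
 note yb = yw_bounds[OF t, of 1, folded y_def] and tb = time_derivative_bounds[OF t, of 1, folded y_def]
 have v: "\<bar>s * q t * alt 1 t\<bar> <= K2 * dl * y^2"
 proof -
  have "\<bar>s * q t * alt 1 t\<bar> <= K^2 * (dl * y^2)" using abs_mult_mono[OF q_abs tb(1), of t] by (simp add: power2_eq_square mult_ac)
  also have "... <= K2 * (dl * y^2)" using K2_bounds delta yb K by (intro mult_right_mono) auto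
  finally show ?thesis by (simp add: mult.assoc)
 qed
 have D: "\<bar>eta' 1\<bar> <= K2" and Q: "\<bar>q t\<bar> <= K2" using eta_K(1)[of 1] q_abs[of t] K2_bounds by auto
 have rho1: "rho 1 = 0" using rho_supp omega by blast
 have H1: "Hf (1, t) = 2 * (- (lam * eta' 1 * y) * (wx (1, t))^2 - 2 * (lam^2 * (eta' 1)^2 * y) * (w (1, t) * wx (1, t))
   - (lam * eta' 1 * y) * ((lam^2 * (eta' 1)^2 * y^2 + s * q t * alt 1 t) * (w (1, t))^2))"
  unfolding Hf_def fst_conv snd_conv ay_def kk_def VV_def rl_def rho1 y_def by (simp add: power2_eq_square algebra_simps)
 have "c0 * (lam * yw (-1) t * (wx (-1, t))^2) <= - Hf (-1, t)"
 proof -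
  have p: "0 <= lam * yw (-1) t * (wx (-1, t))^2" using lam yw_bounds[OF t, of "-1"] by simp
  have "- Hf (-1, t) = 2 * (eta' (-1) * (lam * yw (-1) t * (wx (-1, t))^2))"
   unfolding Hf_def fst_conv snd_conv ay_def left_w by (simp add: power2_eq_square)
  moreover have "c0 * (lam * yw (-1) t * (wx (-1, t))^2) <= eta' (-1) * (lam * yw (-1) t * (wx (-1, t))^2)" by (rule mult_right_mono[OF c0(3) p])
  moreover have "0 <= c0 * (lam * yw (-1) t * (wx (-1, t))^2)" using c0(1) p by simp
  ultimately show ?thesis by linarith
 qed
 then show ?thesis using pointwise_boundary[OF lam yb(1) yb(3) K2_bounds(1) c0(1) c0(2) D v Q small, of "wx (1, t)" "w (1, t)" "wt1 t"]
  unfolding H1 y_def by linarith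
qed

lemma quadratic_integrable:
 "integrable lb2 (%z. (P1 z)^2)" "integrable lb2 (%z. (P2 z)^2)" "integrable lb2 (%z. (P1 z + P2 z)^2)"
 "integrable lb2 XX" "integrable lb2 WW" "integrable lb2 (%z. (wx z)^2)" "integrable lb2 (%z. q (snd z) * wxx z * wt z)"
 "integrable lb2 (%z. indicator omega (fst z) * WW z)" "integrable lb2 (%z. ((wt z)^2 + (wxx z)^2) / yw (fst z) (snd z))"
proof -
 have 1: "integrable lb2 (%z. (u z)^2)" if "damped u" for u using damped_integrable[OF mild_const[of 1] that that] by (simp add: power2_eq_square)
 show "integrable lb2 (%z. (P1 z)^2)" "integrable lb2 (%z. (P2 z)^2)" "integrable lb2 (%z. (P1 z + P2 z)^2)" "integrable lb2 (%z. (wx z)^2)"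
  by (intro 1 damped_all damped_add)+
 have 2: "integrable lb2 (%z. c z * (u z)^2)" if "mild c" "damped u" for c u using damped_integrable[OF that(1) that(2) that(2)] by (simp add: power2_eq_square)
 show "integrable lb2 XX" unfolding XX_def[abs_def] by (intro 2 damped_all mild_all)
 show W: "integrable lb2 WW" unfolding WW_def[abs_def] by (intro 2 damped_all mild_all)
 show "integrable lb2 (%z. q (snd z) * wxx z * wt z)" using damped_integrable[OF mild_q damped_wxx damped_wt] by (simp add: mult.assoc)
 have "integrable lb2 (%z. 1 / yw (fst z) (snd z) * (wt z)^2 + 1 / yw (fst z) (snd z) * (wxx z)^2)" by (intro lint_add 2 damped_all mild_all)
 then show "integrable lb2 (%z. ((wt z)^2 + (wxx z)^2) / yw (fst z) (snd z))" by (simp add: add_divide_distrib)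
 have "omega \<times> UNIV : sets lb2" using omega by auto
 from integrable_mult_indicator[OF this W]
 show "integrable lb2 (%z. indicator omega (fst z) * WW z)" by (rule lint_cong_iff[THEN iffD1, rotated 2]) (auto split: split_indicator)
qed

lemma trace_integrable:
 "integrable lborel (%t. lam * yw 1 t * (wx (1, t))^2)" "integrable lborel (%t. lam ^ 3 * yw 1 t ^ 3 * (w (1, t))^2)"
 "integrable lborel (%t. lam * yw (-1) t * (wx (-1, t))^2)" "integrable lborel (%t. (wt1 t)^2 / (lam * yw 1 t))"
 "integrable lborel (%t. q t * wx (1, t) * wt1 t)" "integrable lborel (%t. Hf (1, t) - Hf (-1, t))"
proof -
 have 1: "integrable lborel (%t. c x0 t * (u t * v t))" if "mild (%z. c (fst z) (snd z))" "damped1 x0 u" "damped1 x0 v" for c x0 u v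
  using damped1_integrable[OF that] by simp
 have 2: "integrable lborel (%t. c x0 t * (u t)^2)" if "mild (%z. c (fst z) (snd z))" "damped1 x0 u" for c x0 u
  using 1[OF that that(2)] by (simp add: power2_eq_square)
 have X: "damped1 1 (%t. wx (1, t))" "damped1 (-1) (%t. wx (-1, t))" using damped1_wx by auto
 show "integrable lborel (%t. lam * yw 1 t * (wx (1, t))^2)" by (rule 2[of "%x t. lam * yw x t"]) (intro mild_all, rule X)
 show "integrable lborel (%t. lam ^ 3 * yw 1 t ^ 3 * (w (1, t))^2)" by (rule 2[of "%x t. lam ^ 3 * yw x t ^ 3"]) (intro mild_all, rule damped1_w)
 show "integrable lborel (%t. lam * yw (-1) t * (wx (-1, t))^2)" by (rule 2[of "%x t. lam * yw x t"]) (intro mild_all, rule X)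
 have "integrable lborel (%t. 1 / lam * (1 / yw 1 t) * (wt1 t)^2)" by (rule 2[of "%x t. 1 / lam * (1 / yw x t)"]) (intro mild_all, rule damped1_wt1)
 then show "integrable lborel (%t. (wt1 t)^2 / (lam * yw 1 t))" by simp
 have "integrable lborel (%t. q t * (wx (1, t) * wt1 t))" by (rule 1[of "%x t. q t"]) (rule mild_q, rule X, rule damped1_wt1)
 then show "integrable lborel (%t. q t * wx (1, t) * wt1 t)" by (simp add: mult.assoc)
 have H: "integrable lborel (%t. Hf (x0, t))" if "damped1 x0 (%t. wx (x0, t))" for x0
  unfolding Hf_def fst_conv snd_conv by (intro lint_add integrable_mult_right 1[of ay] 1[of kk] 1[of rl] 1[of "%x t. ay x t * VV x t"] mild_all that damped1_w)
 show "integrable lborel (%t. Hf (1, t) - Hf (-1, t))" using H[OF X(1)] H[OF X(2)] by simp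
qed

text \<open>Integrate the interior inequality: the time derivative contributes 0, the divergence
  contributes the fluxes, and the energy inequality trades the integral of \<open>q wxx wt\<close>
  for the boundary product of \<open>w_x\<close> and \<open>wt1\<close>. The price is the last term
  on the right.\<close>

lemma conjugated_inequality:
 assumes small: "K2^2 * dl * 8 <= cc" "2 * K2^2 * dl + 8 * K2 ^ 4 / c0 * dl <= c0 ^ 3"
 shows "1 / 2 * (LINT z|lb2. (P1 z)^2) + (LINT z|lb2. (P2 z)^2) + cc / 2 * ((LINT z|lb2. XX z) + (LINT z|lb2. WW z))
  + c0 * (LBINT t. lam * yw 1 t * (wx (1, t))^2) + c0 ^ 3 * (LBINT t. lam ^ 3 * yw 1 t ^ 3 * (w (1, t))^2)
  + c0 * (LBINT t. lam * yw (-1) t * (wx (-1, t))^2)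
  <= (LINT z|lb2. (P1 z + P2 z)^2) + 2 * K2^2 * (LINT z|lb2. indicator omega (fst z) * WW z)
   + 2 * K2^2 / c0 * (LBINT t. (wt1 t)^2 / (lam * yw 1 t))"
proof -
 note qi = quadratic_integrable and ti = trace_integrable
 define k where "k = 2 * K2^2 / c0"
 have "(LINT z|lb2. 1 / 2 * (P1 z)^2 + (P2 z)^2 + cc / 2 * (XX z + WW z)) \<le>
  (LINT z|lb2. (P1 z + P2 z)^2 - 2 * (q (snd z) * wxx z * wt z) - JJ z - Dv z - K * (wx z)^2 + 2 * K2^2 * (indicator omega (fst z) * WW z))"
 proof (rule integral_mono)
  show "1 / 2 * (P1 z)^2 + (P2 z)^2 + cc / 2 * (XX z + WW z) \<le>
   (P1 z + P2 z)^2 - 2 * (q (snd z) * wxx z * wt z) - JJ z - Dv z - K * (wx z)^2 + 2 * K2^2 * (indicator omega (fst z) * WW z)" for z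
  proof (cases "fst z : {-1..1} & snd z : {0<..<T}")
   case True
   then show ?thesis using interior_pointwise[of "fst z" "snd z", OF _ _ small(1)] by (simp only: prod.collapse)
  next
   case False
   then have "w z = 0" "wx z = 0" "wxx z = 0" "wt z = 0" using outside[of "fst z" "snd z"] by auto
   then show ?thesis by (simp add: P1_def P2_def XX_def WW_def JJ_def Dv_def)
  qed
 qed (intro lint_add lint_diff integrable_mult_right qi JJ_integrable Dv_integrable)+
 also have "... = (LINT z|lb2. (P1 z + P2 z)^2) - 2 * (LINT z|lb2. q (snd z) * wxx z * wt z) - (LINT z|lb2. JJ z) - (LINT z|lb2. Dv z)
   - K * (LINT z|lb2. (wx z)^2) + 2 * K2^2 * (LINT z|lb2. indicator omega (fst z) * WW z)" using qi JJ_integrable Dv_integrable by simp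
 also have "(LINT z|lb2. 1 / 2 * (P1 z)^2 + (P2 z)^2 + cc / 2 * (XX z + WW z))
  = 1 / 2 * (LINT z|lb2. (P1 z)^2) + (LINT z|lb2. (P2 z)^2) + cc / 2 * ((LINT z|lb2. XX z) + (LINT z|lb2. WW z))" using qi by simp
 finally have 1: "1 / 2 * (LINT z|lb2. (P1 z)^2) + (LINT z|lb2. (P2 z)^2) + cc / 2 * ((LINT z|lb2. XX z) + (LINT z|lb2. WW z))
  <= (LINT z|lb2. (P1 z + P2 z)^2) - 2 * (LBINT t. q t * wx (1, t) * wt1 t) - (LBINT t. Hf (1, t) - Hf (-1, t))
   + 2 * K2^2 * (LINT z|lb2. indicator omega (fst z) * WW z)" using energy_w unfolding JJ_integral_zero Dv_integral by linarith
 have "(LBINT t. c0 * (lam * yw 1 t * (wx (1, t))^2) + c0 ^ 3 * (lam ^ 3 * yw 1 t ^ 3 * (w (1, t))^2) + c0 * (lam * yw (-1) t * (wx (-1, t))^2)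
  - k * ((wt1 t)^2 / (lam * yw 1 t))) <= (LBINT t. (Hf (1, t) - Hf (-1, t)) + 2 * (q t * wx (1, t) * wt1 t))"
 proof (rule integral_mono)
  show "c0 * (lam * yw 1 t * (wx (1, t))^2) + c0 ^ 3 * (lam ^ 3 * yw 1 t ^ 3 * (w (1, t))^2) + c0 * (lam * yw (-1) t * (wx (-1, t))^2)
   - k * ((wt1 t)^2 / (lam * yw 1 t)) <= Hf (1, t) - Hf (-1, t) + 2 * (q t * wx (1, t) * wt1 t)" for t
  proof (cases "t : {0<..<T}")
   case True then show ?thesis unfolding k_def by (rule boundary_pointwise[OF _ small(2)])
  next
   case False
   then show ?thesis using outside[of 1 t] outside[of "-1" t] wt1_ac(3)[OF False] by (simp add: Hf_def)
  qed
 qed (intro lint_add lint_diff[of _ "%t. _ t + _ t"] lint_diff[of _ "%t. _ t + _ t + _ t"] integrable_mult_right ti)+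
 then show ?thesis using 1 ti unfolding k_def[symmetric] by (simp del: times_divide_eq_right)
qed

end

section \<open>The coupled system: source term and nonlocal boundary relations\<close>

lemma square_mult_bound: "\<bar>a\<bar> <= A ==> (a * X)^2 <= A^2 * (X::real)^2"
 using power_mono[of "\<bar>a\<bar>" A 2] by (simp add: power_mult_distrib mult_right_mono)

lemma square_add3_le: "(a + b + c)^2 <= 3 * a^2 + 3 * b^2 + 3 * (c::real)^2"
proof -
 have "0 <= (a - b)^2 + (b - c)^2 + (a - c)^2" by simp
 then show ?thesis by (simp add: power2_eq_square algebra_simps)
qed

text \<open>The weighted derivatives of phi are those of w plus lower-order terms. The assumed sizes
  of a, a2 and v are such that these terms, squared and weighted, are multiples of the energy terms
  in \<open>w_x\<close> and w.\<close>

lemma unconjugate_pointwise: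
 fixes lam y K a a2 v X W wt wxx :: real
 assumes lam: "lam >= 1" and y: "y >= 1" and K: "K >= 1" and a: "\<bar>a\<bar> <= K * (lam * y)" and a2: "\<bar>a2\<bar> <= 3 * K^2 * (lam^2 * y^2)" and v: "\<bar>v\<bar> <= K * y^2"
 shows "((wt + v * W)^2 + (wxx + (- 2 * a) * X + a2 * W)^2) / y + lam^2 * y * (X + (- a) * W)^2 + lam ^ 4 * y ^ 3 * W^2
  <= 3 * ((wt^2 + wxx^2) / y) + 32 * K ^ 4 * (lam^2 * y * X^2 + lam ^ 4 * y ^ 3 * W^2)"
  and "(wt + v * W)^2 / y <= 2 * (wt^2 / y) + 2 * K^2 * (lam ^ 4 * y ^ 3 * W^2)"
proof -
 define XX WW where "XX = lam^2 * y * X^2" and "WW = lam ^ 4 * y ^ 3 * W^2"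
 have nn: "XX >= 0" "WW >= 0" using lam y by (auto simp: XX_def WW_def)
 have yW: "y ^ 3 * W^2 <= WW" using mult_right_mono[OF one_le_power[OF lam, of 4], of "y ^ 3 * W^2"] y by (simp add: WW_def mult.assoc)
 have 1: "(wt + v * W)^2 / y <= 2 * (wt^2 / y) + 2 * K^2 * WW"
 proof -
  have "(wt + v * W)^2 <= 2 * wt^2 + 2 * ((K * y^2)^2 * W^2)" using square_add_le[of wt "v * W"] square_mult_bound[OF v, of W] by linarith
  then have "(wt + v * W)^2 / y <= (2 * wt^2 + 2 * ((K * y^2)^2 * W^2)) / y" using y by (intro divide_right_mono) auto
  also have "... = 2 * (wt^2 / y) + 2 * K^2 * (y ^ 3 * W^2)" using y by (simp add: field_simps power2_eq_square power3_eq_cube)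
  also have "2 * K^2 * (y ^ 3 * W^2) <= 2 * K^2 * WW" using yW by (intro mult_left_mono) auto
  finally show ?thesis by simp
 qed
 then show "(wt + v * W)^2 / y <= 2 * (wt^2 / y) + 2 * K^2 * (lam ^ 4 * y ^ 3 * W^2)" by (simp add: WW_def)
 have 2: "(wxx + (- 2 * a) * X + a2 * W)^2 / y <= 3 * (wxx^2 / y) + 12 * K^2 * XX + 27 * K ^ 4 * WW"
 proof -
  have "\<bar>- 2 * a\<bar> <= 2 * (K * (lam * y))" using a by simp
  from square_mult_bound[OF this, of X] square_mult_bound[OF a2, of W] square_add3_le[of wxx "- 2 * a * X" "a2 * W"]
  have "(wxx + (- 2 * a) * X + a2 * W)^2 <= 3 * wxx^2 + 3 * ((2 * (K * (lam * y)))^2 * X^2) + 3 * ((3 * K^2 * (lam^2 * y^2))^2 * W^2)" by linarith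
  then have "(wxx + (- 2 * a) * X + a2 * W)^2 / y <= (3 * wxx^2 + 3 * ((2 * (K * (lam * y)))^2 * X^2) + 3 * ((3 * K^2 * (lam^2 * y^2))^2 * W^2)) / y"
   using y by (intro divide_right_mono) auto
  also have "... = 3 * (wxx^2 / y) + 12 * K^2 * XX + 27 * K ^ 4 * WW"
   using y by (simp add: XX_def WW_def field_simps power2_eq_square power3_eq_cube power4_eq_xxxx)
  finally show ?thesis .
 qed
 have 3: "lam^2 * y * (X + (- a) * W)^2 <= 2 * XX + 2 * K^2 * WW"
 proof -
  have "\<bar>- a\<bar> <= K * (lam * y)" using a by simp
  then have "(X + (- a) * W)^2 <= 2 * X^2 + 2 * ((K * (lam * y))^2 * W^2)"
   using square_add_le[of X "- a * W"] square_mult_bound[of "- a" "K * (lam * y)" W] by linarith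
  then have "lam^2 * y * (X + (- a) * W)^2 <= lam^2 * y * (2 * X^2 + 2 * ((K * (lam * y))^2 * W^2))" using y by (intro mult_left_mono) auto
  also have "... = 2 * XX + 2 * K^2 * WW" by (simp add: XX_def WW_def power2_eq_square power3_eq_cube power4_eq_xxxx algebra_simps)
  finally show ?thesis .
 qed
 have K4: "1 <= K ^ 4" "K^2 <= K ^ 4" using K by (auto intro: power_increasing one_le_power)
 have "2 * K^2 * WW + 27 * K ^ 4 * WW + 2 * K^2 * WW + WW <= 32 * K ^ 4 * WW"
  using mult_right_mono[OF K4(1) nn(2)] mult_right_mono[OF K4(2) nn(2)] unfolding mult.assoc by linarith
 moreover have "12 * K^2 * XX + 2 * XX <= 32 * K ^ 4 * XX"
  using mult_right_mono[OF K4(1) nn(1)] mult_right_mono[OF K4(2) nn(1)] nn(1) unfolding mult.assoc by linarith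
 moreover have "3 * ((wt^2 + wxx^2) / y) = 3 * (wt^2 / y) + 3 * (wxx^2 / y)" by (simp add: add_divide_distrib)
 moreover have "0 <= wt^2 / y" using y by simp
 moreover have "((wt + v * W)^2 + (wxx + (- 2 * a) * X + a2 * W)^2) / y = (wt + v * W)^2 / y + (wxx + (- 2 * a) * X + a2 * W)^2 / y" by (rule add_divide_distrib)
 ultimately show "((wt + v * W)^2 + (wxx + (- 2 * a) * X + a2 * W)^2) / y + lam^2 * y * (X + (- a) * W)^2 + lam ^ 4 * y ^ 3 * W^2
  <= 3 * ((wt^2 + wxx^2) / y) + 32 * K ^ 4 * (lam^2 * y * X^2 + lam ^ 4 * y ^ 3 * W^2)"
  using 1 2 3 unfolding XX_def[symmetric] WW_def[symmetric] distrib_left by linarith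
qed

lemma AE_lb2_snd: "AE t in lborel. P t ==> AE z in lb2. P (snd z)"
proof -
 assume "AE t in lborel. P t"
 then obtain A where A: "{t : space lborel. \<not> P t} \<subseteq> A" "emeasure lborel A = 0" "A : sets lborel" by (rule AE_E)
 have "UNIV \<times> A : null_sets lb2" using A by (auto simp: null_sets_def lborel.emeasure_pair_measure_Times)
 then show ?thesis by (rule AE_I') (use A(1) in auto)
qed

text \<open>b stands for \<open>pbar_x(1,.) / beta\<close>. The nonlocal relations enter only
  through the three slice inequalities for \<open>h1\<close>, \<open>gt\<close> and
  \<open>gamma\<close>.\<close>

locale carleman_system = carleman_solution +
 fixes b gt g2 gamma :: "real => real" and g1 :: "real \<times> real => real"
 assumes eta_min: "!!x. x : {-1..1} ==> eta 1 <= eta x" "eta (-1) = eta 1"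
  and small: "K2^2 * dl * 8 <= cc" "2 * K2^2 * dl + 8 * K2 ^ 4 / c0 * dl <= c0 ^ 3" "dl * (48 * K2 ^ 4 + 136 * K2 ^ 9 / c0) <= cc / 4"
  and b: "AE t in lborel. \<bar>b t\<bar> <= K"
  and g: "sqint lb2 g1" "sqint lborel g2" "sqint lborel gt" "sqint lborel gamma"
  and eq: "AE z in lb2. z : Qset T --> q (snd z) * ft z + fxx z = - g1 z - fst z * b (snd z) * d z + b (snd z) * phi z"
  and h1_bd: "AE t in lborel. t : {0<..<T} --> (h1 t)^2 <= 3 * (gt t)^2 + K * ((LBINT x. indicator {-1<..<1} x * (phi (x, t))^2) + (LBINT x. (ft (x, t))^2))"
  and gt_bd: "AE t in lborel. t : {0<..<T} --> (gt t)^2 <= K * (LBINT x. indicator {-1<..<1} x * (phi (x, t))^2) + 2 * (g2 t)^2"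
  and gamma_bd: "AE t in lborel. t : {0<..<T} --> (gamma t)^2 <= 2 * (phi (1, t))^2 + K * (LBINT x. indicator {-1<..<1} x * (phi (x, t))^2)"
begin

definition "S0 t = (LBINT x. indicator {-1<..<1} x * (phi (x, t))^2)" for t
definition "R z = ((wt z)^2 + (wxx z)^2) / yw (fst z) (snd z)" for z
definition "SW t = (LBINT x. WW (x, t))" for t
definition "SR t = (LBINT x. R (x, t))" for t

lemma R_integrable: "integrable lb2 R" using quadratic_integrable(9) by (simp add: R_def[abs_def])

lemma WW_nonneg: "WW z >= 0" "XX z >= 0" "R z >= 0"
proof -
 have "WW z >= 0 & XX z >= 0 & R z >= 0"
 proof (cases "snd z : {0<..<T}")
  case True
  then show ?thesis using yw_bounds(2)[OF True, of "fst z"] lam by (simp add: WW_def XX_def R_def)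
 next
  case False
  then show ?thesis using outside[of "fst z" "snd z"] by (simp add: WW_def XX_def R_def)
 qed
 then show "WW z >= 0" "XX z >= 0" "R z >= 0" by auto
qed

lemma slice_nonneg: "SW t >= 0" "SR t >= 0" "S0 t >= 0"
 unfolding SW_def SR_def S0_def using WW_nonneg by (intro integral_nonneg_AE; auto)+

lemma recover: "integral\<^sup>L lb2 R <= 14 * K2 ^ 6 * ((LINT z|lb2. (P1 z)^2) + (LINT z|lb2. (P2 z)^2) + integral\<^sup>L lb2 XX + integral\<^sup>L lb2 WW)"
proof -
 have "integral\<^sup>L lb2 R <= (LINT z|lb2. 14 * K2 ^ 6 * ((P1 z)^2 + (P2 z)^2 + XX z + WW z))"
 proof (rule integral_mono[OF R_integrable])
  show "integrable lb2 (%z. 14 * K2 ^ 6 * ((P1 z)^2 + (P2 z)^2 + XX z + WW z))" using quadratic_integrable by simp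
  show "R z <= 14 * K2 ^ 6 * ((P1 z)^2 + (P2 z)^2 + XX z + WW z)" for z
  proof (cases "snd z : {0<..<T}")
   case True
   have "\<bar>eta' (fst z)\<bar> <= K2" using eta_K(1)[of "fst z"] K2_bounds by simp
   moreover have "1 / K2 <= q (snd z)" using q_bd(1)[of "snd z"] K2_bounds K frac_le[of 1 1 K K2] by simp
   ultimately show ?thesis
    using pointwise_recover[OF lam yw_bounds(1)[OF True, of "fst z"] K2_bounds(1) VV_bound[OF True, of "fst z"], of "eta' (fst z)" "q (snd z)" "P1 z" "wxx z" "w z" "P2 z" "wt z" "wx z"]
    by (simp add: R_def P1_def P2_def ay_def kk_def XX_def WW_def)
  next
   case False
   then show ?thesis using outside[of "fst z" "snd z"] WW_nonneg[of z] by (simp add: R_def P1_def P2_def)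
  qed
 qed
 then show ?thesis using quadratic_integrable by simp
qed

lemma AE_interior: "AE z in lb2. z : {-1..1} \<times> {0<..<T} --> z : Qset T"
proof (rule AE_I')
 show "{-1, 1} \<times> UNIV : null_sets lb2" by (auto simp: null_sets_def lborel.emeasure_pair_measure_Times intro!: emeasure_lborel_countable)
qed (auto simp: Qset_def)

text \<open>The convection term has a square of order \<open>(w_x)^2\<close>, and the zero-order
  terms, among them \<open>(axy - 2 kk) w\<close>, one of order \<open>lam^4 y^2 w^2\<close>. Each
  lacks a factor y compared with \<open>XX\<close> or \<open>WW\<close>, and this factor is worth
  \<open>dl\<close>.\<close>

lemma source_bound:
 "(LINT z|lb2. (P1 z + P2 z)^2) <= 3 * (LINT z|lb2. (ew (fst z) (snd z) * g1 z)^2) + 48 * K ^ 4 * dl * (integral\<^sup>L lb2 XX + integral\<^sup>L lb2 WW)"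
proof -
 have bz: "AE z in lb2. \<bar>b (snd z)\<bar> <= K" by (rule AE_lb2_snd[OF b])
 have i1: "integrable lb2 (%z. (ew (fst z) (snd z) * g1 z)^2)" using sqintD[OF damped_sqint[OF damped_ew[OF g(1)]]] by simp
 have "(LINT z|lb2. (P1 z + P2 z)^2) <= (LINT z|lb2. 3 * (ew (fst z) (snd z) * g1 z)^2 + 48 * K ^ 4 * dl * (XX z + WW z))"
 proof (rule integral_mono_AE)
  show "AE z in lb2. (P1 z + P2 z)^2 <= 3 * (ew (fst z) (snd z) * g1 z)^2 + 48 * K ^ 4 * dl * (XX z + WW z)" using eq bz AE_interior
  proof eventually_elim
   case (elim z)
   obtain x t where z: "z = (x, t)" by fastforce
   have Kd: "0 <= 48 * K ^ 4 * dl" using K delta by simp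
   show ?case
   proof (cases "x : {-1..1} & t : {0<..<T}")
    case True
    then have xt: "x : {-1..1}" "t : {0<..<T}" and zQ: "z : Qset T" using elim(3) by (auto simp: z)
    define y where "y = yw x t"
    note yb = yw_bounds[OF xt(2), of x, folded y_def]
    have E: "q t * ft z + fxx z = - g1 z - x * b t * d z + b t * phi z" using elim(1) zQ by (simp add: z)
    have ph: "ew x t * phi z = w z" using xt by (simp add: z w_def pb_eq)
    have "P1 z + P2 z = ew x t * (q t * ft z + fxx z) + (axy x t - 2 * kk x t) * w z"
     by (simp add: z P1_def P2_def wxx_def wt_def wx_def VV_def power2_eq_square algebra_simps)
    also have "... = - (ew x t * g1 z) + (- x * b t) * wx z + (x * b t * ay x t + b t + axy x t - 2 * kk x t) * w z"
    proof -
     have wxz: "wx z = ew x t * d z + ay x t * w z" by (simp add: z wx_def)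
     show ?thesis unfolding E wxz ph[symmetric] by (simp add: algebra_simps)
    qed
    finally have F: "P1 z + P2 z = - (ew x t * g1 z) + (- x * b t) * wx z + (x * b t * ay x t + b t + axy x t - 2 * kk x t) * w z" .
    have bt: "\<bar>b t\<bar> <= K" using elim(2) by (simp add: z)
    have xb: "\<bar>x\<bar> <= 1" using xt by auto
    have c1: "\<bar>- x * b t\<bar> <= K" using abs_mult_mono[of "- x" 1 "b t" K] xb bt by simp
    have ly: "lam <= lam^2" "1 <= lam^2" using lam power_increasing[of 1 2 lam] by auto
    have c2: "\<bar>x * b t * ay x t + b t + axy x t - 2 * kk x t\<bar> <= 4 * K^2 * (lam^2 * y)"
    proof -
     have lyy: "lam * y <= lam^2 * y" "1 <= lam^2 * y" "0 <= lam^2 * y" using ly yb lam mult_mono[of 1 "lam^2" 1 y] by (auto intro: mult_right_mono)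
     have KK: "K <= K^2" "0 <= K^2" using K power_increasing[of 1 2 K] by auto
     have e: "\<bar>x * b t\<bar> <= K" using c1 by simp
     have l1: "\<bar>lam * y\<bar> <= lam^2 * y" using lyy yb lam by simp
     have "\<bar>(x * b t) * (eta' x * (lam * y))\<bar> <= K * (K * (lam^2 * y))" by (intro abs_mult_mono e eta_K l1)
     then have 1: "\<bar>x * b t * ay x t\<bar> <= K^2 * (lam^2 * y)" by (simp add: ay_def y_def power2_eq_square mult_ac)
     have "K * 1 <= K^2 * (lam^2 * y)" using KK lyy K by (intro mult_mono) auto
     then have 2: "\<bar>b t\<bar> <= K^2 * (lam^2 * y)" using bt by simp
     have "\<bar>eta'' x * (lam * y)\<bar> <= K * (lam^2 * y)" by (intro abs_mult_mono eta_K l1)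
     also have "... <= K^2 * (lam^2 * y)" using KK lyy by (intro mult_right_mono) auto
     finally have 3: "\<bar>lam * eta'' x * y\<bar> <= K^2 * (lam^2 * y)" by (simp add: mult_ac)
     have "(eta' x)^2 * (lam^2 * y) <= K^2 * (lam^2 * y)" using power_mono[OF eta_K(1)[of x], of 2] lyy by (intro mult_right_mono) auto
     moreover have "0 <= (eta' x)^2 * (lam^2 * y)" using lyy by simp
     ultimately have 4: "\<bar>kk x t\<bar> <= K^2 * (lam^2 * y)" by (simp add: kk_def y_def mult_ac)
     have "x * b t * ay x t + b t + axy x t - 2 * kk x t = x * b t * ay x t + b t + lam * eta'' x * y - kk x t" by (simp add: axy_def kk_def y_def)
     then show ?thesis using 1 2 3 4 by linarith
    qed
    have "(P1 z + P2 z)^2 <= 3 * (ew x t * g1 z)^2 + 3 * (K^2 * (wx z)^2) + 3 * ((4 * K^2 * (lam^2 * y))^2 * (w z)^2)"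
     unfolding F using square_add3_le[of "- (ew x t * g1 z)" "(- x * b t) * wx z" "(x * b t * ay x t + b t + axy x t - 2 * kk x t) * w z"]
      square_mult_bound[OF c1, of "wx z"] square_mult_bound[OF c2, of "w z"] by (simp only: power2_minus)
    moreover have "K^2 * (wx z)^2 <= K ^ 4 * (dl * XX z)"
    proof (intro mult_mono)
     have "1 * 1 <= lam^2 * (dl * y)" using ly delta(5)[OF xt(2), of x] by (intro mult_mono) (auto simp: y_def)
     from mult_right_mono[OF this, of "(wx z)^2"] show "(wx z)^2 <= dl * XX z" by (simp add: XX_def z y_def mult_ac)
    qed (use K in "auto intro: power_increasing")
    moreover have "(4 * K^2 * (lam^2 * y))^2 * (w z)^2 <= 16 * K ^ 4 * (dl * WW z)"
    proof -
     have "1 * (lam ^ 4 * y^2 * (w z)^2) <= (dl * y) * (lam ^ 4 * y^2 * (w z)^2)" using delta(5)[OF xt(2), of x] by (intro mult_right_mono) (auto simp: y_def)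
     then have "lam ^ 4 * y^2 * (w z)^2 <= dl * WW z" by (simp add: WW_def z y_def power2_eq_square power3_eq_cube mult_ac)
     then have "16 * K ^ 4 * (lam ^ 4 * y^2 * (w z)^2) <= 16 * K ^ 4 * (dl * WW z)" by (intro mult_left_mono) auto
     moreover have "(4 * K^2 * (lam^2 * y))^2 * (w z)^2 = 16 * K ^ 4 * (lam ^ 4 * y^2 * (w z)^2)" by (simp add: power2_eq_square power4_eq_xxxx)
     ultimately show ?thesis by linarith
    qed
    moreover have "48 * K ^ 4 * dl * (XX z + WW z) = 48 * (K ^ 4 * (dl * XX z)) + 3 * (16 * K ^ 4 * (dl * WW z))" by (simp add: algebra_simps)
    moreover have "0 <= K ^ 4 * (dl * XX z)" using K delta WW_nonneg by simp
    ultimately show ?thesis unfolding z fst_conv snd_conv by linarith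
   next
    case False
    then have "P1 z + P2 z = 0" using outside[of x t] by (auto simp: z P1_def P2_def)
    then show ?thesis using Kd WW_nonneg[of z] by simp
   qed
  qed
 qed (use quadratic_integrable i1 in simp_all)
 also have "... = 3 * (LINT z|lb2. (ew (fst z) (snd z) * g1 z)^2) + 48 * K ^ 4 * dl * (integral\<^sup>L lb2 XX + integral\<^sup>L lb2 WW)"
  using quadratic_integrable i1 by simp
 finally show ?thesis .
qed

section \<open>Boundary terms controlled through interior terms\<close>

lemma hat_compare:
 assumes t: "t : {0<..<T}" and x: "x : {-1..1}"
 shows "yw 1 t <= yw x t" "ew 1 t <= ew x t" "(ew 1 t)^2 / yw 1 t <= (ew x t)^2 / yw x t"
 using weight_compare[OF t eta_min(1)[OF x]] yw_bounds(1)[OF t, of 1] by auto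

text \<open>\<open>eta\<close> is smallest at x = 1, so a weight taken there may be moved under the
  integral over x and compared pointwise with the interior weight. The second bound also pays for
  undoing the conjugation in \<open>ft\<close>.\<close>

lemma slice_bounds:
 "AE t in lborel. t : {0<..<T} --> lam ^ 3 * yw 1 t ^ 3 * (ew 1 t)^2 * S0 t <= SW t & (ew 1 t)^2 / yw 1 t * (LBINT x. (ft (x, t))^2) <= 2 * SR t + 2 * K^2 * SW t"
 using slice_Fubini(1)[OF quadratic_integrable(5)] slice_Fubini(1)[OF R_integrable]
proof eventually_elim
 case (elim t)
 show ?case
 proof
  assume t: "t : {0<..<T}"
  note y1 = yw_bounds[OF t, of 1]
  have "lam ^ 3 * yw 1 t ^ 3 * (ew 1 t)^2 * S0 t = (LBINT x. lam ^ 3 * yw 1 t ^ 3 * (ew 1 t)^2 * (indicator {-1<..<1} x * (phi (x, t))^2))"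
   unfolding S0_def by simp
  also have "... <= SW t" unfolding SW_def
  proof (rule integral_mono'[OF elim(1)])
   show "lam ^ 3 * yw 1 t ^ 3 * (ew 1 t)^2 * (indicator {-1<..<1} x * (phi (x, t))^2) <= WW (x, t)" for x
   proof (cases "x : {-1<..<1}")
    case True
    then have x: "x : {-1..1}" by auto
    note hc = hat_compare[OF t x]
    have "lam ^ 3 * yw 1 t ^ 3 * (ew 1 t)^2 <= lam ^ 4 * yw x t ^ 3 * (ew x t)^2"
     using hc y1 ew_nonneg lam by (intro mult_mono power_mono power_increasing) auto
    then show ?thesis using True x t by (simp add: WW_def w_def pb_eq power_mult_distrib mult.assoc[symmetric] mult_right_mono)
   qed (use WW_nonneg in auto)
  qed (use WW_nonneg in auto)
  finally have 1: "lam ^ 3 * yw 1 t ^ 3 * (ew 1 t)^2 * S0 t <= SW t" .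
  have "(ew 1 t)^2 / yw 1 t * (LBINT x. (ft (x, t))^2) = (LBINT x. (ew 1 t)^2 / yw 1 t * (ft (x, t))^2)" by simp
  also have "... <= (LBINT x. 2 * R (x, t) + 2 * K^2 * WW (x, t))"
  proof (rule integral_mono')
   show "integrable lborel (%x. 2 * R (x, t) + 2 * K^2 * WW (x, t))" using elim by simp
   show nn: "0 <= 2 * R (x, t) + 2 * K^2 * WW (x, t)" for x using WW_nonneg by simp
   show "(ew 1 t)^2 / yw 1 t * (ft (x, t))^2 <= 2 * R (x, t) + 2 * K^2 * WW (x, t)" for x
   proof (cases "x : {-1..1}")
    case True
    note yb = yw_bounds[OF t, of x]
    have v: "\<bar>s * alt x t\<bar> <= K * (yw x t)^2"
    proof -
     have "K * (dl * (yw x t)^2) <= K * (1 * (yw x t)^2)" using delta K by (intro mult_left_mono mult_right_mono) auto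
     then show ?thesis using time_derivative_bounds(1)[OF t, of x] by simp
    qed
    have "(ew 1 t)^2 / yw 1 t * (ft (x, t))^2 <= (ew x t)^2 / yw x t * (ft (x, t))^2" by (rule mult_right_mono[OF hat_compare(3)[OF t True]]) simp
    also have "... = (wt (x, t) + s * alt x t * w (x, t))^2 / yw x t" by (simp add: wt_def power_mult_distrib)
    also have "... <= 2 * ((wt (x, t))^2 / yw x t) + 2 * K^2 * (lam ^ 4 * yw x t ^ 3 * (w (x, t))^2)"
     by (rule unconjugate_pointwise(2)[OF lam yb(1) K(1) _ _ v, of 0 0]) (use K lam yb in auto)
    also have "... <= 2 * R (x, t) + 2 * K^2 * WW (x, t)" using yb by (simp add: R_def WW_def divide_right_mono)
    finally show ?thesis .
   next
    case False
    then have "ft (x, t) = 0" using supp(3)[of "(x, t)"] by (auto simp: Qset_def)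
    then show ?thesis using nn[of x] by simp
   qed
  qed
  also have "... = 2 * SR t + 2 * K^2 * SW t" using elim by (simp add: SR_def SW_def)
  finally show "lam ^ 3 * yw 1 t ^ 3 * (ew 1 t)^2 * S0 t <= SW t & (ew 1 t)^2 / yw 1 t * (LBINT x. (ft (x, t))^2) <= 2 * SR t + 2 * K^2 * SW t" using 1 by blast
 qed
qed

lemma slice_integrals: "integrable lborel SW" "integrable lborel SR" "integral\<^sup>L lborel SW = integral\<^sup>L lb2 WW" "integral\<^sup>L lborel SR = integral\<^sup>L lb2 R"
 using slice_Fubini(2,3)[OF quadratic_integrable(5)] slice_Fubini(2,3)[OF R_integrable] unfolding SW_def[abs_def] SR_def[abs_def] by auto

lemma hat_weight_S0:
 assumes t: "t : {0<..<T}" and 1: "lam ^ 3 * yw 1 t ^ 3 * (ew 1 t)^2 * S0 t <= SW t"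
 shows "(ew 1 t)^2 * S0 t <= SW t" "(ew 1 t)^2 / yw 1 t * S0 t <= SW t"
proof -
 note yb = yw_bounds[OF t, of 1]
 have p: "0 <= (ew 1 t)^2 * S0 t" using slice_nonneg(3)[of t] by simp
 have "1 * 1 <= lam ^ 3 * yw 1 t ^ 3" using lam yb(1) by (intro mult_mono one_le_power) auto
 from mult_right_mono[OF this p] show 2: "(ew 1 t)^2 * S0 t <= SW t" using 1 by (simp add: mult.assoc)
 have "((ew 1 t)^2 * S0 t) / yw 1 t <= (ew 1 t)^2 * S0 t" using p yb by (simp add: divide_le_eq mult_le_cancel_left1)
 then show "(ew 1 t)^2 / yw 1 t * S0 t <= SW t" using 2 by simp
qed

lemma g2_integrable: "integrable lborel (%t. (ew 1 t * g2 t)^2)" "integrable lborel (%t. (ew 1 t * gt t)^2)"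
 using sqintD[OF damped1_sqint[OF damped1_ew[OF g(2)]]] sqintD[OF damped1_sqint[OF damped1_ew[OF g(3)]]] by simp_all

text \<open>By the nonlocal condition \<open>h1^2\<close> is bounded by \<open>g2^2\<close> and by
  slice norms of phi and \<open>phi_t\<close>. These norms are as strong as the left-hand side of
  the estimate; only the factor \<open>1 / lam <= dl\<close> makes them absorbable.\<close>

lemma trace_derivative_bound:
 "(LBINT t. (wt1 t)^2 / (lam * yw 1 t)) <= 2 * K^2 * dl * (LBINT t. lam ^ 3 * yw 1 t ^ 3 * (w (1, t))^2)
  + 12 * (LBINT t. (ew 1 t * g2 t)^2) + dl * (12 * K ^ 3 * integral\<^sup>L lb2 WW + 4 * K * integral\<^sup>L lb2 R)"
proof -
 have "(LBINT t. (wt1 t)^2 / (lam * yw 1 t)) <= (LBINT t. 2 * K^2 * dl * (lam ^ 3 * yw 1 t ^ 3 * (w (1, t))^2)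
  + 12 * (ew 1 t * g2 t)^2 + dl * (12 * K ^ 3 * SW t + 4 * K * SR t))"
 proof (rule integral_mono_AE[OF trace_integrable(4)])
  show "integrable lborel (%t. 2 * K^2 * dl * (lam ^ 3 * yw 1 t ^ 3 * (w (1, t))^2) + 12 * (ew 1 t * g2 t)^2 + dl * (12 * K ^ 3 * SW t + 4 * K * SR t))"
   by (intro lint_add integrable_mult_right trace_integrable g2_integrable slice_integrals)
  show "AE t in lborel. (wt1 t)^2 / (lam * yw 1 t) <= 2 * K^2 * dl * (lam ^ 3 * yw 1 t ^ 3 * (w (1, t))^2) + 12 * (ew 1 t * g2 t)^2 + dl * (12 * K ^ 3 * SW t + 4 * K * SR t)"
   using slice_bounds h1_bd gt_bd
  proof eventually_elim
   case (elim t)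
   have Kn: "0 <= K" "1 <= K" "0 <= dl" using K delta by auto
   show ?case
   proof (cases "t : {0<..<T}")
    case False
    then show ?thesis using wt1_ac(3)[OF False] outside[of 1 t] slice_nonneg[of t] Kn by simp
   next
    case t: True
    define y where "y = yw 1 t"
    define A where "A = (ew 1 t)^2 / y"
    define Fq where "Fq = (LBINT x. (ft (x, t))^2)"
    note yb = yw_bounds[OF t, of 1, folded y_def]
    have A0: "A >= 0" using yb by (simp add: A_def)
    have s1: "A * S0 t <= SW t" using hat_weight_S0(2)[OF t] elim(1) t by (simp add: A_def y_def)
    have s2: "A * Fq <= 2 * SR t + 2 * K^2 * SW t" using elim(1) t by (simp add: A_def y_def Fq_def)
    have s3: "A * (g2 t)^2 <= (ew 1 t * g2 t)^2"
    proof -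
     have "(ew 1 t * g2 t)^2 / y <= (ew 1 t * g2 t)^2 / 1" using yb by (intro divide_left_mono) auto
     then show ?thesis by (simp add: A_def power_mult_distrib)
    qed
    \<comment> \<open>Insert the bound for \<open>gt\<close> into the one for \<open>h1\<close>,
      where 3 times its K becomes one of the constants hidden in the next simplification; K is at
      least 1, so all that matters downstream is a fixed power of it.\<close>
    have "(h1 t)^2 <= 6 * (g2 t)^2 + 4 * (K * S0 t) + K * Fq" using elim(2,3) t by (simp add: S0_def[symmetric] Fq_def[symmetric] algebra_simps)
    from mult_left_mono[OF this A0] have h: "A * (h1 t)^2 <= 6 * (A * (g2 t)^2) + 4 * K * (A * S0 t) + K * (A * Fq)" by (simp add: algebra_simps)
    also have "... <= 6 * (ew 1 t * g2 t)^2 + 4 * K * SW t + K * (2 * SR t + 2 * K^2 * SW t)" using s1 s2 s3 Kn by (intro add_mono mult_left_mono) auto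
    also have "... <= 6 * (ew 1 t * g2 t)^2 + (6 * K ^ 3 * SW t + 2 * K * SR t)"
    proof -
     have "K ^ 1 <= K ^ 3" using K by (intro power_increasing) auto
     then have "K * SW t <= K ^ 3 * SW t" using slice_nonneg[of t] by (intro mult_right_mono) auto
     moreover have "K * (2 * SR t + 2 * K^2 * SW t) = 2 * (K * SR t) + 2 * (K ^ 3 * SW t)" by (simp add: algebra_simps power2_eq_square power3_eq_cube)
     ultimately show ?thesis unfolding mult.assoc by linarith
    qed
    finally have h: "A * (h1 t)^2 <= 6 * (ew 1 t * g2 t)^2 + (6 * K ^ 3 * SW t + 2 * K * SR t)" .
    have l: "1 / lam <= dl" "0 <= 1 / lam" using delta(3) lam by (auto simp: pos_divide_le_eq)
    have "(wt1 t)^2 <= 2 * (ew 1 t * h1 t)^2 + 2 * ((K * (dl * y^2))^2 * (w (1, t))^2)"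
     using square_add_le[of "ew 1 t * h1 t" "- (s * alt 1 t) * w (1, t)"] square_mult_bound[of "- (s * alt 1 t)" "K * (dl * y^2)" "w (1, t)"]
      time_derivative_bounds(1)[OF t, of 1] by (simp add: wt1_def y_def)
    then have "(wt1 t)^2 / (lam * y) <= (2 * (ew 1 t * h1 t)^2 + 2 * ((K * (dl * y^2))^2 * (w (1, t))^2)) / (lam * y)"
     using lam yb by (intro divide_right_mono) auto
    also have "... = 2 * (1 / lam * (A * (h1 t)^2)) + 2 * (K^2 * (dl^2 / lam * (y ^ 3 * (w (1, t))^2)))"
     using lam yb by (simp add: A_def field_simps power2_eq_square power3_eq_cube)
    also have "1 / lam * (A * (h1 t)^2) <= 6 * (ew 1 t * g2 t)^2 + dl * (6 * K ^ 3 * SW t + 2 * K * SR t)"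
    proof -
     have "1 / lam * (A * (h1 t)^2) <= dl * (6 * (ew 1 t * g2 t)^2 + (6 * K ^ 3 * SW t + 2 * K * SR t))" using l h A0 Kn by (intro mult_mono) auto
     also have "... <= 1 * (6 * (ew 1 t * g2 t)^2) + dl * (6 * K ^ 3 * SW t + 2 * K * SR t)"
      unfolding distrib_left[of dl "6 * _"] using delta by (intro add_mono mult_right_mono order_refl) auto
     finally show ?thesis by simp
    qed
    also have "K^2 * (dl^2 / lam * (y ^ 3 * (w (1, t))^2)) <= K^2 * ((dl * lam ^ 3) * (y ^ 3 * (w (1, t))^2))"
    proof (intro mult_left_mono mult_right_mono)
     have "dl^2 / lam <= dl^2" using lam by (simp add: divide_le_eq mult_le_cancel_left1)
     also have "... <= dl * 1" using delta by (simp add: power2_eq_square)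
     also have "... <= dl * lam ^ 3" using Kn one_le_power[OF lam, of 3] by (intro mult_left_mono) auto
     finally show "dl^2 / lam <= dl * lam ^ 3" .
    qed (use yb in auto)
    finally show ?thesis unfolding y_def by (simp add: algebra_simps)
   qed
  qed
 qed
 also have "... = 2 * K^2 * dl * (LBINT t. lam ^ 3 * yw 1 t ^ 3 * (w (1, t))^2)
  + 12 * (LBINT t. (ew 1 t * g2 t)^2) + dl * (12 * K ^ 3 * integral\<^sup>L lb2 WW + 4 * K * integral\<^sup>L lb2 R)"
  using trace_integrable(2) g2_integrable slice_integrals by simp
 finally show ?thesis .
qed

section \<open>Absorption\<close>

definition "En = (LINT z|lb2. (P1 z)^2) + (LINT z|lb2. (P2 z)^2) + integral\<^sup>L lb2 XX + integral\<^sup>L lb2 WW"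
definition "BX = (LBINT t. lam * yw 1 t * (wx (1, t))^2)"
definition "BW = (LBINT t. lam ^ 3 * yw 1 t ^ 3 * (w (1, t))^2)"
definition "BL = (LBINT t. lam * yw (-1) t * (wx (-1, t))^2)"
definition "G1 = (LINT z|lb2. (ew (fst z) (snd z) * g1 z)^2)"
definition "G2 = (LBINT t. (ew 1 t * g2 t)^2)"
definition "IO = (LINT z|lb2. indicator omega (fst z) * WW z)"

lemma energy_nonneg: "0 <= (LINT z|lb2. (P1 z)^2)" "0 <= (LINT z|lb2. (P2 z)^2)" "0 <= integral\<^sup>L lb2 XX" "0 <= integral\<^sup>L lb2 WW"
 "0 <= integral\<^sup>L lb2 R" "0 <= G1" "0 <= G2" "0 <= IO" "0 <= BX" "0 <= BW" "0 <= BL"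
proof -
 show "0 <= (LINT z|lb2. (P1 z)^2)" "0 <= (LINT z|lb2. (P2 z)^2)" "0 <= integral\<^sup>L lb2 XX" "0 <= integral\<^sup>L lb2 WW" "0 <= integral\<^sup>L lb2 R" "0 <= G1" "0 <= G2" "0 <= IO"
  unfolding G1_def G2_def IO_def using WW_nonneg by (auto intro!: integral_nonneg_AE)
 have *: "0 <= yw x t * (f (x, t))^2 & 0 <= yw x t ^ 3 * (f (x, t))^2" if "f = w \<or> f = wx" for x t f
  using yw_bounds(2)[of t x] outside[of x t] that by (cases "t : {0<..<T}") auto
 have "0 <= lam * (yw x t * (wx (x, t))^2)" "0 <= lam ^ 3 * (yw x t ^ 3 * (w (x, t))^2)" for x t using *[of wx x t] *[of w x t] lam by auto
 then show "0 <= BX" "0 <= BW" "0 <= BL" unfolding BX_def BW_def BL_def by (intro integral_nonneg_AE AE_I2; simp only: mult.assoc)+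
qed

text \<open>\<open>recover\<close> bounds the part of the boundary debt containing \<open>wt\<close>
  and \<open>wxx\<close> by \<open>En\<close>, and its factor \<open>dl\<close> closes the loop:
  half of the coefficient of \<open>En\<close> and half of that of \<open>BW\<close> are given
  up.\<close>

lemma absorbed_inequality:
 "cc / 4 * En + c0 * BX + c0 ^ 3 / 2 * BW + c0 * BL <= 3 * G1 + 2 * K2^2 * IO + 24 * K2^2 / c0 * G2"
proof -
 define k where "k = 2 * K2^2 / c0"
 define IR where "IR = integral\<^sup>L lb2 R"
 note nn = energy_nonneg
 have k0: "k >= 0" using c0 by (simp add: k_def)
 have cc1: "cc <= 1" "cc > 0" using c0 by (auto simp: cc_def)
 have K20: "0 <= K2" "1 <= K2" using K2_bounds by auto
 have "cc / 2 * (LINT z|lb2. (P1 z)^2) <= 1 / 2 * (LINT z|lb2. (P1 z)^2)" "cc / 2 * (LINT z|lb2. (P2 z)^2) <= 1 * (LINT z|lb2. (P2 z)^2)"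
  using cc1 nn by (intro mult_right_mono; simp)+
 then have "cc / 2 * En <= 1 / 2 * (LINT z|lb2. (P1 z)^2) + (LINT z|lb2. (P2 z)^2) + cc / 2 * (integral\<^sup>L lb2 XX + integral\<^sup>L lb2 WW)"
  unfolding En_def distrib_left by linarith
 with conjugated_inequality[OF small(1,2)]
 have 1: "cc / 2 * En + c0 * BX + c0 ^ 3 * BW + c0 * BL <= (LINT z|lb2. (P1 z + P2 z)^2) + 2 * K2^2 * IO + k * (LBINT t. (wt1 t)^2 / (lam * yw 1 t))"
  by (simp only: BX_def BW_def BL_def IO_def k_def)
 have Eb: "integral\<^sup>L lb2 XX + integral\<^sup>L lb2 WW <= En" "integral\<^sup>L lb2 WW <= En" "0 <= En" using nn by (simp_all add: En_def)
 have K4: "K ^ 4 <= K2 ^ 4" using K2_bounds K by (intro power_mono) auto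
 have 2: "(LINT z|lb2. (P1 z + P2 z)^2) <= 3 * G1 + dl * (48 * K2 ^ 4) * En"
 proof -
  have "48 * K ^ 4 * dl * (integral\<^sup>L lb2 XX + integral\<^sup>L lb2 WW) <= 48 * K2 ^ 4 * dl * En" using K4 Eb nn delta K20 by (intro mult_mono) auto
  then show ?thesis using source_bound by (simp add: G1_def mult_ac)
 qed
 have 3: "(LBINT t. (wt1 t)^2 / (lam * yw 1 t)) <= 2 * K2^2 * dl * BW + 12 * G2 + dl * (68 * K2 ^ 7) * En"
 proof -
  have "12 * K ^ 3 * integral\<^sup>L lb2 WW <= 12 * K2 ^ 7 * En"
  proof (intro mult_mono)
   have "K ^ 3 <= K2 ^ 3" using K2_bounds K by (intro power_mono) auto
   also have "... <= K2 ^ 7" using K20 by (intro power_increasing) auto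
   finally show "K ^ 3 <= K2 ^ 7" .
  qed (use Eb nn K20 K in auto)
  moreover have "4 * K * IR <= 4 * K2 * (14 * K2 ^ 6 * En)" using recover nn K2_bounds K unfolding IR_def by (intro mult_mono) (auto simp: En_def)
  moreover have "4 * K2 * (14 * K2 ^ 6 * En) = 56 * K2 ^ 7 * En" by (simp add: power_numeral_reduce mult_ac)
  \<comment> \<open>68 = 12 + 4 * 14, the 14 coming from \<open>recover\<close>.\<close>
  ultimately have "12 * K ^ 3 * integral\<^sup>L lb2 WW + 4 * K * IR <= 68 * K2 ^ 7 * En" by linarith
  from mult_left_mono[OF this, of dl] delta(1)
  have "dl * (12 * K ^ 3 * integral\<^sup>L lb2 WW + 4 * K * IR) <= dl * (68 * K2 ^ 7) * En" by (simp add: mult.assoc)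
  moreover have "2 * K^2 * dl * BW <= 2 * K2^2 * dl * BW" using K2_bounds K delta nn by (intro mult_right_mono mult_left_mono power_mono) auto
  ultimately show ?thesis using trace_derivative_bound unfolding IR_def BW_def G2_def by linarith
 qed
 have "k * (LBINT t. (wt1 t)^2 / (lam * yw 1 t)) <= k * (2 * K2^2 * dl * BW + 12 * G2 + dl * (68 * K2 ^ 7) * En)" by (rule mult_left_mono[OF 3 k0])
 also have "... = (4 * K2 ^ 4 / c0 * dl) * BW + 24 * K2^2 / c0 * G2 + dl * (136 * K2 ^ 9 / c0) * En"
  using c0 by (simp add: k_def field_simps power_numeral_reduce)
 \<comment> \<open>Half of the second summand in \<open>small(2)\<close>.\<close>
 also have "(4 * K2 ^ 4 / c0 * dl) * BW <= c0 ^ 3 / 2 * BW"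
 proof (intro mult_right_mono nn)
  have "0 <= 2 * K2^2 * dl" using delta by simp
  then have "8 * K2 ^ 4 / c0 * dl <= c0 ^ 3" using small(2) by linarith
  then show "4 * K2 ^ 4 / c0 * dl <= c0 ^ 3 / 2" by simp
 qed
 finally have 4: "k * (LBINT t. (wt1 t)^2 / (lam * yw 1 t)) <= c0 ^ 3 / 2 * BW + 24 * K2^2 / c0 * G2 + dl * (136 * K2 ^ 9 / c0) * En" by simp
 have "dl * (48 * K2 ^ 4) * En + dl * (136 * K2 ^ 9 / c0) * En = dl * (48 * K2 ^ 4 + 136 * K2 ^ 9 / c0) * En" by (simp add: algebra_simps)
 also have "... <= cc / 4 * En" by (rule mult_right_mono[OF small(3) Eb(3)])
 finally have "dl * (48 * K2 ^ 4) * En + dl * (136 * K2 ^ 9 / c0) * En <= cc / 4 * En" .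
 moreover have "cc / 2 * En = cc / 4 * En + cc / 4 * En" "c0 ^ 3 * BW = c0 ^ 3 / 2 * BW + c0 ^ 3 / 2 * BW" by simp_all
 ultimately show ?thesis using 1 2 4 by linarith
qed

section \<open>Return to the original unknowns\<close>

definition "Zi z = (ew (fst z) (snd z))^2 * (((ft z)^2 + (fxx z)^2) / yw (fst z) (snd z) + lam^2 * yw (fst z) (snd z) * (d z)^2 + lam ^ 4 * yw (fst z) (snd z) ^ 3 * (pb z)^2)" for z
definition "Zb t = (ew 1 t)^2 * ((gt t)^2 + lam * yw 1 t * ((d (-1, t))^2 + (d (1, t))^2) + lam ^ 3 * yw 1 t ^ 3 * ((pb (1, t))^2 + (gamma t)^2))" for t
text \<open>The sum of the bounds for the energies in terms of the right-hand side: 74 from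
  \<open>interior_total\<close> and 2 from \<open>boundary_total\<close> times
  \<open>4 / cc\<close>, two copies of \<open>BX\<close> and one of \<open>BL\<close> at
  \<open>1 / c0\<close> each, and 5 K^2 copies of \<open>BW\<close> at
  \<open>2 / c0 ^ 3\<close>.\<close>

definition "Cf = 76 * K2 ^ 6 * (4 / cc) + 3 / c0 + 10 * K^2 / c0 ^ 3"

lemma Z_integrable: "integrable lb2 Zi" "integrable lborel Zb"
proof -
 have 2: "integrable lb2 (%z. c z * (ew (fst z) (snd z) * u z)^2)" if "mild c" "sqint lb2 u" for c u
  using damped_integrable[OF that(1) damped_ew[OF that(2)] damped_ew[OF that(2)]] by (simp add: power2_eq_square)
 have "integrable lb2 (%z. 1 / yw (fst z) (snd z) * (ew (fst z) (snd z) * ft z)^2 + 1 / yw (fst z) (snd z) * (ew (fst z) (snd z) * fxx z)^2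
   + lam^2 * yw (fst z) (snd z) * (ew (fst z) (snd z) * d z)^2 + lam ^ 4 * yw (fst z) (snd z) ^ 3 * (ew (fst z) (snd z) * pb z)^2)"
  by (intro lint_add 2 sq pb_facts mild_all)
 then show "integrable lb2 Zi" by (rule lint_cong_iff[THEN iffD1, OF refl, rotated]) (simp add: Zi_def power_mult_distrib add_divide_distrib algebra_simps)
 have 1: "integrable lborel (%t. c 1 t * (ew 1 t * u t)^2)" if "mild (%z. c (fst z) (snd z))" "sqint lborel u" for c u
  using damped1_integrable[OF that(1) damped1_ew[OF that(2)] damped1_ew[OF that(2)]] by (simp add: power2_eq_square)
 have l: "mild (%z. lam * yw (fst z) (snd z))" "mild (%z. lam ^ 3 * yw (fst z) (snd z) ^ 3)" by (intro mild_all)+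
 have "integrable lborel (%t. (ew 1 t * gt t)^2 + lam * yw 1 t * (ew 1 t * d (-1, t))^2 + lam * yw 1 t * (ew 1 t * d (1, t))^2
   + lam ^ 3 * yw 1 t ^ 3 * (ew 1 t * pb (1, t))^2 + lam ^ 3 * yw 1 t ^ 3 * (ew 1 t * gamma t)^2)"
  by (intro lint_add g2_integrable 1[of "%x t. lam * yw x t", OF l(1)] 1[of "%x t. lam ^ 3 * yw x t ^ 3", OF l(2)] tr pb_trace g)
 then show "integrable lborel Zb" by (rule lint_cong_iff[THEN iffD1, OF refl, rotated]) (simp add: Zb_def power_mult_distrib algebra_simps)
qed

lemma interior_total: "integral\<^sup>L lb2 Zi <= 74 * K2 ^ 6 * En"
proof -
 note nn = energy_nonneg
 have "integral\<^sup>L lb2 Zi <= (LINT z|lb2. 3 * R z + 32 * K ^ 4 * (XX z + WW z))"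
 proof (rule integral_mono[OF Z_integrable(1)])
  show "integrable lb2 (%z. 3 * R z + 32 * K ^ 4 * (XX z + WW z))" using R_integrable quadratic_integrable by simp
  show "Zi z <= 3 * R z + 32 * K ^ 4 * (XX z + WW z)" for z
  proof (cases "snd z : {0<..<T}")
   case False
   then have "Zi z = 0" by (auto simp: Zi_def ew_def)
   then show ?thesis using WW_nonneg[of z] K by simp
  next
   case t: True
   define x t y where "x = fst z" and "t = snd z" and "y = yw x t"
   note yb = yw_bounds[OF t, of x, folded t_def, folded y_def]
   have a: "\<bar>ay x t\<bar> <= K * (lam * y)" using abs_mult_mono[OF eta_K(1)[of x], of "lam * y" "lam * y"] lam yb by (simp add: ay_def y_def mult_ac)
   have a2: "\<bar>(ay x t)^2 - axy x t\<bar> <= 3 * K^2 * (lam^2 * y^2)"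
   proof -
    have yy: "y <= y^2" "lam <= lam^2" "K <= K^2" using yb lam K power_increasing[of 1 2 y] power_increasing[of 1 2 lam] power_increasing[of 1 2 K] by auto
    have 1: "(ay x t)^2 <= K^2 * (lam^2 * y^2)" using power_mono[OF a, of 2] by (simp add: power_mult_distrib)
    have "\<bar>eta'' x * (lam * y)\<bar> <= K^2 * (lam^2 * y^2)" using eta_K(2)[of x] yy lam yb by (intro abs_mult_mono) (auto intro!: mult_mono)
    then have 2: "\<bar>lam * eta'' x * y\<bar> <= K^2 * (lam^2 * y^2)" by (simp add: mult_ac)
    have "(eta' x)^2 * (lam^2 * y) <= K^2 * (lam^2 * y^2)" using power_mono[OF eta_K(1)[of x], of 2] yy yb by (intro mult_mono) auto
    moreover have "0 <= (eta' x)^2 * (lam^2 * y)" using yb by simp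
    moreover have "axy x t = lam * eta'' x * y + (eta' x)^2 * (lam^2 * y)" by (simp add: axy_def y_def)
    ultimately show ?thesis using 1 2 zero_le_power2[of "ay x t"] unfolding mult.assoc by linarith
   qed
   have v: "\<bar>s * alt x t\<bar> <= K * y^2"
   proof -
    have "K * (dl * y^2) <= K * (1 * y^2)" using delta K by (intro mult_left_mono mult_right_mono) auto
    then show ?thesis using time_derivative_bounds(1)[OF t, of x] by (simp add: y_def t_def)
   qed
   have e: "ew x t * ft z = wt z + s * alt x t * w z" "ew x t * fxx z = wxx z + (- 2 * ay x t) * wx z + ((ay x t)^2 - axy x t) * w z"
    "ew x t * d z = wx z + (- ay x t) * w z" "ew x t * pb z = w z" by (simp_all add: wt_def wxx_def wx_def w_def x_def t_def power2_eq_square algebra_simps)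
   have "Zi z = ((ew x t * ft z)^2 + (ew x t * fxx z)^2) / y + lam^2 * y * (ew x t * d z)^2 + lam ^ 4 * y ^ 3 * (ew x t * pb z)^2"
    by (simp add: Zi_def x_def t_def y_def power_mult_distrib distrib_left add_divide_distrib)
   also have "... <= 3 * (((wt z)^2 + (wxx z)^2) / y) + 32 * K ^ 4 * (lam^2 * y * (wx z)^2 + lam ^ 4 * y ^ 3 * (w z)^2)"
    unfolding e by (rule unconjugate_pointwise(1)[OF lam yb(1) K(1) a a2 v])
   finally show ?thesis by (simp add: R_def XX_def WW_def y_def x_def t_def)
  qed
 qed
 also have "... = 3 * integral\<^sup>L lb2 R + 32 * K ^ 4 * (integral\<^sup>L lb2 XX + integral\<^sup>L lb2 WW)" using R_integrable quadratic_integrable by simp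
 \<comment> \<open>Here 3 * 14 + 32 = 74.\<close>
 also have "... <= 3 * (14 * K2 ^ 6 * En) + 32 * K2 ^ 6 * En"
 proof (intro add_mono mult_mono)
  have "K ^ 4 <= K2 ^ 4" using K2_bounds K by (intro power_mono) auto
  also have "... <= K2 ^ 6" using K2_bounds by (intro power_increasing) auto
  finally show "K ^ 4 <= K2 ^ 6" .
  show "integral\<^sup>L lb2 R <= 14 * K2 ^ 6 * En" using recover by (simp add: En_def)
 qed (use nn K2_bounds in "auto simp: En_def")
 finally show ?thesis by simp
qed

lemma hat_symmetric: "yw (-1) t = yw 1 t" "ew (-1) t = ew 1 t" by (simp_all add: yw_def xiw_def ew_def alw_def Af_def Ef_def eta_min)

lemma boundary_total: "integral\<^sup>L lborel Zb <= 2 * K * En + 2 * G2 + 2 * BX + 5 * K^2 * BW + BL"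
proof -
 have "integral\<^sup>L lborel Zb <= (LBINT t. 2 * K * SW t + 2 * (ew 1 t * g2 t)^2 + 2 * (lam * yw 1 t * (wx (1, t))^2) + 5 * K^2 * (lam ^ 3 * yw 1 t ^ 3 * (w (1, t))^2)
  + lam * yw (-1) t * (wx (-1, t))^2)"
 proof (rule integral_mono_AE[OF Z_integrable(2)])
  show "integrable lborel (%t. 2 * K * SW t + 2 * (ew 1 t * g2 t)^2 + 2 * (lam * yw 1 t * (wx (1, t))^2) + 5 * K^2 * (lam ^ 3 * yw 1 t ^ 3 * (w (1, t))^2)
   + lam * yw (-1) t * (wx (-1, t))^2)"
   by (intro lint_add integrable_mult_right[of "2 * K"] integrable_mult_right[of 2] integrable_mult_right[of "5 * K^2"] trace_integrable g2_integrable slice_integrals)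
  show "AE t in lborel. Zb t <= 2 * K * SW t + 2 * (ew 1 t * g2 t)^2 + 2 * (lam * yw 1 t * (wx (1, t))^2) + 5 * K^2 * (lam ^ 3 * yw 1 t ^ 3 * (w (1, t))^2)
   + lam * yw (-1) t * (wx (-1, t))^2" using slice_bounds gt_bd gamma_bd
  proof eventually_elim
   case (elim t)
   show ?case
   proof (cases "t : {0<..<T}")
    case False
    then have "Zb t = 0" by (auto simp: Zb_def ew_def)
    then show ?thesis using outside[of 1 t] outside[of "-1" t] False slice_nonneg[of t] K by simp
   next
    case t: True
    define y e where "y = yw 1 t" and "e = ew 1 t"
    note yb = yw_bounds[OF t, of 1, folded y_def]
    define Y where "Y = lam ^ 3 * y ^ 3 * (w (1, t))^2"
    have Y0: "0 <= Y" using lam yb by (simp add: Y_def)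
    have ep: "e * phi (1, t) = w (1, t)" "e * pb (1, t) = w (1, t)" using t by (simp_all add: e_def w_def pb_eq)
    have s1: "lam ^ 3 * y ^ 3 * e^2 * S0 t <= SW t" using elim(1) t by (simp add: y_def e_def)
    have s2: "e^2 * S0 t <= SW t" using hat_weight_S0(1)[OF t] elim(1) t by (simp add: e_def)
    have "(gt t)^2 <= K * S0 t + 2 * (g2 t)^2" using elim(2) t by (simp add: S0_def)
    from mult_left_mono[OF this, of "e^2"]
    have "e^2 * (gt t)^2 <= K * (e^2 * S0 t) + 2 * (e * g2 t)^2" by (simp add: power_mult_distrib algebra_simps)
    also have "K * (e^2 * S0 t) <= K * SW t" using s2 K by (intro mult_left_mono) auto
    finally have 1: "e^2 * (gt t)^2 <= K * SW t + 2 * (e * g2 t)^2" by simp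
    have "(gamma t)^2 <= 2 * (phi (1, t))^2 + K * S0 t" using elim(3) t by (simp add: S0_def)
    from mult_left_mono[OF this, of "lam ^ 3 * y ^ 3 * e^2"] lam yb
    have "lam ^ 3 * y ^ 3 * e^2 * (gamma t)^2 <= lam ^ 3 * y ^ 3 * e^2 * (2 * (phi (1, t))^2 + K * S0 t)" by simp
    also have "... = 2 * (lam ^ 3 * y ^ 3 * (e * phi (1, t))^2) + K * (lam ^ 3 * y ^ 3 * e^2 * S0 t)" by (simp add: power_mult_distrib algebra_simps)
    also have "... <= 2 * Y + K * SW t" unfolding ep Y_def using s1 K by (intro add_mono mult_left_mono[OF s1] order_refl) auto
    finally have 2: "lam ^ 3 * y ^ 3 * e^2 * (gamma t)^2 <= 2 * Y + K * SW t" .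
    have a: "\<bar>- ay 1 t\<bar> <= K * (lam * y)" using abs_mult_mono[OF eta_K(1)[of 1], of "lam * y" "lam * y"] lam yb by (simp add: ay_def y_def mult_ac)
    have ed: "e * d (1, t) = wx (1, t) + (- ay 1 t) * w (1, t)" "e * d (-1, t) = wx (-1, t)" using left_w[of t] by (simp_all add: wx_def e_def hat_symmetric)
    have "(e * d (1, t))^2 <= 2 * (wx (1, t))^2 + 2 * ((K * (lam * y))^2 * (w (1, t))^2)"
     unfolding ed using square_add_le[of "wx (1, t)" "- ay 1 t * w (1, t)"] square_mult_bound[OF a, of "w (1, t)"] by linarith
    from mult_left_mono[OF this, of "lam * y"] lam yb
    have "lam * y * (e * d (1, t))^2 <= lam * y * (2 * (wx (1, t))^2 + 2 * ((K * (lam * y))^2 * (w (1, t))^2))" by simp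
    also have "... = 2 * (lam * y * (wx (1, t))^2) + 2 * K^2 * Y" by (simp add: Y_def power2_eq_square power3_eq_cube algebra_simps)
    finally have 3: "lam * y * (e * d (1, t))^2 <= 2 * (lam * y * (wx (1, t))^2) + 2 * K^2 * Y" .
    have Z: "Zb t = e^2 * (gt t)^2 + lam * y * (e * d (-1, t))^2 + lam * y * (e * d (1, t))^2 + lam ^ 3 * y ^ 3 * (e * pb (1, t))^2 + lam ^ 3 * y ^ 3 * e^2 * (gamma t)^2"
     by (simp add: Zb_def y_def e_def power_mult_distrib algebra_simps)
    \<comment> \<open>The factor \<open>5 * K^2\<close> collects \<open>2 * K^2\<close> from
      \<open>d (1, t)\<close>, 1 from the value of phi at x = 1 and 2 from gamma.\<close>
    have K1: "1 * Y <= K^2 * Y" using K Y0 by (intro mult_right_mono one_le_power) auto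
    have "Zb t <= 2 * K * SW t + 2 * (e * g2 t)^2 + 2 * (lam * y * (wx (1, t))^2) + 5 * K^2 * Y + lam * y * (wx (-1, t))^2"
     unfolding Z ed(2) ep(2) Y_def[symmetric] using 1 2 3 K1 unfolding mult.assoc by linarith
    then show ?thesis by (simp add: Y_def y_def e_def hat_symmetric)
   qed
  qed
 qed
 also have "... = 2 * K * integral\<^sup>L lb2 WW + 2 * G2 + 2 * BX + 5 * K^2 * BW + BL"
  unfolding slice_integrals(3)[symmetric] G2_def BX_def BW_def BL_def using slice_integrals g2_integrable trace_integrable by simp
 also have "... <= 2 * K * En + 2 * G2 + 2 * BX + 5 * K^2 * BW + BL" using energy_nonneg K by (simp add: En_def)
 finally show ?thesis .
qed

lemma carleman_estimate:
 "integral\<^sup>L lb2 Zi + integral\<^sup>L lborel Zb <= (Cf * (3 + 2 * K2^2 + 24 * K2^2 / c0) + 2) * (G1 + G2 + IO)"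
proof -
 define H where "H = 3 * G1 + 2 * K2^2 * IO + 24 * K2^2 / c0 * G2"
 note nn = energy_nonneg
 have c: "cc > 0" using c0 by (auto simp: cc_def)
 have E0: "0 <= En" using nn by (simp add: En_def)
 note ai = absorbed_inequality[folded H_def]
 have pos: "0 <= cc / 4 * En" "0 <= c0 * BX" "0 <= c0 ^ 3 / 2 * BW" "0 <= c0 * BL" using c c0 nn E0 by auto
 have "cc / 4 * En <= H" "c0 * BX <= H" "c0 ^ 3 / 2 * BW <= H" "c0 * BL <= H" using ai pos by linarith+
 then have b: "En <= 4 / cc * H" "BX <= 1 / c0 * H" "BW <= 2 / c0 ^ 3 * H" "BL <= 1 / c0 * H" using c c0 by (auto simp: field_simps)
 have "K <= K2 ^ 6"
 proof -
  have "K <= K2 ^ 1" using K2_bounds by simp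
  also have "... <= K2 ^ 6" using K2_bounds by (intro power_increasing) auto
  finally show ?thesis .
 qed
 then have "2 * K * En <= 2 * K2 ^ 6 * En" using E0 by (intro mult_right_mono) auto
 then have "integral\<^sup>L lb2 Zi + integral\<^sup>L lborel Zb <= 76 * K2 ^ 6 * En + 2 * BX + 5 * K^2 * BW + BL + 2 * G2"
  using interior_total boundary_total by linarith
 also have "... <= 76 * K2 ^ 6 * (4 / cc * H) + 2 * (1 / c0 * H) + 5 * K^2 * (2 / c0 ^ 3 * H) + 1 / c0 * H + 2 * G2"
  using b K2_bounds by (intro add_mono mult_left_mono) auto
 also have "... = Cf * H + 2 * G2" by (simp add: Cf_def algebra_simps)
 also have "... <= Cf * ((3 + 2 * K2^2 + 24 * K2^2 / c0) * (G1 + G2 + IO)) + 2 * (G1 + G2 + IO)"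
 proof (intro add_mono mult_left_mono)
  have k: "0 <= K2^2 / c0" "0 <= K2^2" using c0 by simp_all
  have "0 <= 3 * (G2 + IO)" "0 <= 2 * K2^2 * (G1 + G2)" "0 <= 24 * (K2^2 / c0) * (G1 + IO)" using nn k by (auto intro!: mult_nonneg_nonneg simp del: times_divide_eq_right times_divide_eq_left)
  moreover have "(3 + 2 * K2^2 + 24 * K2^2 / c0) * (G1 + G2 + IO) = H + 3 * (G2 + IO) + 2 * K2^2 * (G1 + G2) + 24 * (K2^2 / c0) * (G1 + IO)"
   by (simp add: H_def algebra_simps)
  ultimately show "H <= (3 + 2 * K2^2 + 24 * K2^2 / c0) * (G1 + G2 + IO)" by linarith
  show "0 <= Cf" using c c0 K2_bounds by (simp add: Cf_def)
 qed (use nn in auto)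
 finally show ?thesis by (simp only: distrib_right mult.assoc)
qed

end

section \<open>Cutoffs, extensions and Borel versions\<close>

lemma smooth_fun_sum: "finite A ==> (!!i. i : A ==> smooth_fun (f i)) ==> smooth_fun (%x. \<Sum>i\<in>A. f i x)"
proof (induction A rule: finite_induct)
 case empty
 then show ?case using smooth_const[of 0] by simp
next
 case (insert i A)
 then show ?case using smooth_add[of "f i" "%x. \<Sum>i\<in>A. f i x"] by simp
qed

text \<open>Finitely many intervals contained in the open set cover C. The sum of their bumps is
  positive on C and is divided by its minimum there. Values above 1 are allowed, which avoids any
  partition of unity.\<close>

lemma smooth_cutoff:
 assumes C: "compact C" "C ~= {}" and O: "open \<Omega>" "C \<subseteq> \<Omega>"
 obtains \<rho> where "smooth_fun \<rho>" "!!x. 0 <= \<rho> x" "!!x. x : C ==> 1 <= \<rho> x" "!!x. x ~: \<Omega> ==> \<rho> x = 0"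
proof -
 define bump where "bump i x = flat_exp 0 (1 * x + - fst i) * flat_exp 0 (- 1 * x + snd i)" for i :: "real \<times> real" and x
 have bs: "smooth_fun (bump i)" for i unfolding bump_def[abs_def] by (intro smooth_mult smooth_flat)
 have bnn: "0 <= bump i x" for i x unfolding bump_def by (intro mult_nonneg_nonneg flat_exp_nonneg)
 have bpos: "0 < bump i x" if "x : {fst i<..<snd i}" for i x
  unfolding bump_def using that by (intro mult_pos_pos flat_exp_pos) auto
 have bz: "bump i x = 0" if "x ~: {fst i<..<snd i}" for i x
  using that flat_exp_zero[of "x - fst i" 0] flat_exp_zero[of "snd i - x" 0] by (auto simp: bump_def not_less)
 have ex: "\<exists>i. x : {fst i<..<snd i} & {fst i<..<snd i} \<subseteq> \<Omega>" if xC: "x : C" for x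
 proof -
  have "x : \<Omega>" using O(2) xC by blast
  then obtain e where e: "e > 0" "ball x e \<subseteq> \<Omega>" using openE[OF O(1)] by blast
  have "{x - e<..<x + e} \<subseteq> \<Omega>" using e(2) by (auto simp: ball_eq_greaterThanLessThan)
  then show ?thesis using e(1) by (intro exI[of _ "(x - e, x + e)"]) auto
 qed
 define I where "I = {i. {fst i<..<snd i} \<subseteq> \<Omega>}"
 obtain D where D: "D \<subseteq> I" "finite D" "C \<subseteq> (\<Union>i\<in>D. {fst i<..<snd i})"
 proof (rule compactE_image[OF C(1), of I "%i. {fst i<..<snd i}"])
  show "C \<subseteq> (\<Union>i\<in>I. {fst i<..<snd i})" using ex unfolding I_def by blast
 qed auto
 define r where "r x = (\<Sum>i\<in>D. bump i x)" for x
 have rs: "smooth_fun r" unfolding r_def[abs_def] by (intro smooth_fun_sum D bs)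
 have rp: "r x > 0" if "x : C" for x
 proof -
  obtain i where i: "i : D" "x : {fst i<..<snd i}" using D(3) \<open>x : C\<close> by blast
  then show ?thesis unfolding r_def using bpos[OF i(2)] bnn D(2) by (intro sum_pos2[of D i]) auto
 qed
 obtain x0 where x0: "x0 : C" "!!x. x : C ==> r x0 <= r x" using continuous_attains_inf[OF C continuous_on_subset[OF smooth_fun_continuous[OF rs]]] by auto
 show ?thesis
 proof (rule that[of "%x. 1 / r x0 * r x"])
  show "smooth_fun (%x. 1 / r x0 * r x)" by (intro smooth_mult smooth_const rs)
  show "0 <= 1 / r x0 * r x" for x using rp[OF x0(1)] bnn by (auto simp: r_def intro!: divide_nonneg_pos sum_nonneg)
  show "1 <= 1 / r x0 * r x" if "x : C" for x using rp[OF x0(1)] x0(2)[OF that] by simp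
  show "1 / r x0 * r x = 0" if "x ~: \<Omega>" for x
  proof -
   have "bump i x = 0" if "i : D" for i
   proof (rule bz)
    have "{fst i<..<snd i} \<subseteq> \<Omega>" using D(1) that unfolding I_def by blast
    then show "x ~: {fst i<..<snd i}" using \<open>x ~: \<Omega>\<close> by blast
   qed
   then show ?thesis by (simp add: r_def)
  qed
 qed
qed

text \<open>The nearest-point projection onto [a,b]. Composition with it extends a function by
  constants, preserving continuity and bounds on the whole line.\<close>

definition clip :: "real => real => real => real" where "clip a b x = max a (min b x)"

lemma clip_in: "a <= b ==> clip a b x : {a..b}"
 and clip_id: "x : {a..b} ==> clip a b x = x"
 and continuous_on_clip: "continuous_on S (clip a b)" by (auto simp: clip_def[abs_def] intro!: continuous_intros)

lemma continuous_on_compose_clip: "a <= b ==> continuous_on {a..b} f ==> continuous_on UNIV (%x. f (clip a b x))"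
 by (rule continuous_on_compose2[OF _ continuous_on_clip]) (use clip_in in auto)

lemma bounded_compose_clip:
 assumes "a <= b" "continuous_on {a..b} (f :: real => real)"
 obtains C where "!!x. \<bar>f (clip a b x)\<bar> <= C"
proof -
 have "bounded (f ` {a..b})" by (intro compact_imp_bounded compact_continuous_image assms) auto
 then obtain C where "\<forall>y\<in>f ` {a..b}. norm y <= C" unfolding bounded_iff by blast
 then have "\<bar>f x\<bar> <= C" if "x : {a..b}" for x using that by auto
 then show ?thesis using that clip_in[OF assms(1)] by blast
qed

lemma has_derivative_compose_clip:
 "x : {a..b} ==> (f has_real_derivative D) (at x within {a..b}) ==> ((%x. f (clip a b x)) has_real_derivative D) (at x within {a..b})"
 unfolding has_field_derivative_def by (rule has_derivative_transform[where f = f]) (auto simp: clip_id)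

lemma set_integral_lebesgue_cong:
 fixes f g :: "real => real"
 assumes ae: "AE x in lborel. x : S --> f x = g x" and S: "S : sets borel" and g: "g : borel_measurable borel"
 shows "(LINT x:S|lebesgue. f x) = (LBINT x. indicator S x * g x)"
proof -
 have gm: "(%x. indicator S x * g x) : borel_measurable lborel" using S g by measurable
 then have gl: "(%x. indicator S x * g x) : borel_measurable lebesgue" by (rule measurable_completion)
 have ae': "AE x in lebesgue. indicator S x * g x = indicator S x * f x" using AE_completion[OF ae] by eventually_elim (auto split: split_indicator)
 have "(LINT x:S|lebesgue. f x) = (\<integral>x. indicator S x * f x \<partial>lebesgue)" by (simp add: set_lebesgue_integral_def)
 also have "... = (\<integral>x. indicator S x * g x \<partial>lebesgue)"
 proof (rule integral_cong_AE)
  show "(%x. indicator S x * f x) : borel_measurable lebesgue" by (rule borel_measurable_AE[OF gl ae'])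
  show "AE x in lebesgue. indicator S x * f x = indicator S x * g x" using ae' by eventually_elim (rule sym)
 qed (rule gl)
 also have "... = (LBINT x. indicator S x * g x)" by (rule integral_completion[OF gm])
 finally show ?thesis .
qed

text \<open>Cauchy-Schwarz on almost every slice. The identity is recorded as well because the
  nonlocal terms are Lebesgue integrals of the given derivatives, whereas the estimates use Borel
  versions.\<close>

lemma slice_product_bound:
 fixes u f phi :: "real \<times> real => real"
 assumes T: "T > 0" and phi: "continuous_on ({-1..1} \<times> {0..T}) phi"
  and f: "sqint lb2 f" and ae: "AE z in lborel. z : Qset T --> u z = f z"
  and M: "AE t in lborel. (LBINT x. (f (x, t))^2) <= M"
  and c: "c : borel_measurable borel" "!!x. x : {-1<..<1} ==> \<bar>c x\<bar> <= B"
 shows "AE t in lborel. t : {0<..<T} -->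
   (LINT x:{-1<..<1}|lebesgue. c x * u (x, t) * phi (x, t)) = (LBINT x. indicator {-1<..<1} x * (c x * f (x, t) * phi (x, t)))
   & (LINT x:{-1<..<1}|lebesgue. c x * u (x, t) * phi (x, t))^2 <= B^2 * M * (LBINT x. indicator {-1<..<1} x * (phi (x, t))^2)"
 using AE_lb2_slices(1)[OF ae[folded lborel_prod]] sqint_slices(1)[OF f] M
proof eventually_elim
 case (elim t)
 show ?case
 proof
  assume t: "t : {0<..<T}"
  define ps where "ps x = indicator {-1..1} x * phi (x, t)" for x
  have pc: "continuous_on {-1..1} (%x. phi (x, t))" by (rule continuous_on_compose2[OF phi]) (use t in "auto intro!: continuous_intros")
  have "(%x. indicator {-1..1} x *\<^sub>R phi (x, t)) : borel_measurable borel" by (rule borel_measurable_continuous_on_indicator[OF _ pc]) simp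
  then have psm[measurable]: "ps : borel_measurable borel" by (simp add: ps_def[abs_def])
  have fm[measurable]: "(%x. f (x, t)) : borel_measurable borel" using sqint_measurable[OF elim(2)] by simp
  note [measurable] = c(1)
  have "bounded ((%x. phi (x, t)) ` {-1..1})" by (intro compact_imp_bounded compact_continuous_image pc) auto
  then obtain Cp where "\<forall>y\<in>(%x. phi (x, t)) ` {-1..1}. norm y <= Cp" unfolding bounded_iff by blast
  then have Cp: "\<bar>phi (x, t)\<bar> <= Cp" if "x : {-1..1}" for x using that by auto
  define ph where "ph x = indicator {-1<..<1} x * ps x" for x
  have phm[measurable]: "ph : borel_measurable borel" unfolding ph_def by measurable
  have Cp0: "0 <= Cp" using Cp[of 0] by auto
  have phs: "sqint lborel ph" by (rule sqint_bound[OF sqint_indicator_Icc[of "-1" 1], where C = Cp])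
    (use Cp Cp0 in "auto simp: ph_def ps_def split: split_indicator")
  have eq: "(LINT x:{-1<..<1}|lebesgue. c x * u (x, t) * phi (x, t)) = (LBINT x. indicator {-1<..<1} x * (c x * f (x, t) * ps x))"
  proof (rule set_integral_lebesgue_cong)
   show "AE x in lborel. x : {-1<..<1} --> c x * u (x, t) * phi (x, t) = c x * f (x, t) * ps x"
    using elim(1) by eventually_elim (use t in "auto simp: Qset_def ps_def")
  qed auto
  also have "... = (LBINT x. indicator {-1<..<1} x * (c x * f (x, t) * phi (x, t)))" by (intro lint_cong) (auto simp: ps_def split: split_indicator)
  finally have e1: "(LINT x:{-1<..<1}|lebesgue. c x * u (x, t) * phi (x, t)) = (LBINT x. indicator {-1<..<1} x * (c x * f (x, t) * phi (x, t)))" .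
  define cf where "cf x = indicator {-1<..<1} x * c x * f (x, t)" for x
  have cfm: "cf : borel_measurable borel" unfolding cf_def by measurable
  have B0: "0 <= B" using c(2)[of 0] by auto
  have cfs: "sqint lborel cf" by (rule sqint_bound[OF elim(2), where C = B])
    (use c(2) B0 cfm in "auto simp: cf_def abs_mult split: split_indicator intro!: mult_right_mono")
  have "(LBINT x. indicator {-1<..<1} x * (c x * f (x, t) * ps x)) = (LBINT x. cf x * ph x)"
   by (intro lint_cong) (auto simp: cf_def ph_def split: split_indicator)
  then have "(LINT x:{-1<..<1}|lebesgue. c x * u (x, t) * phi (x, t))^2 <= (LBINT x. (cf x)^2) * (LBINT x. (ph x)^2)"
   using Cauchy_Schwarz_integral[OF cfs phs] eq by simp
  also have "(LBINT x. (ph x)^2) = (LBINT x. indicator {-1<..<1} x * (phi (x, t))^2)" by (intro lint_cong) (auto simp: ph_def ps_def split: split_indicator)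
  also have "(LBINT x. (cf x)^2) * (LBINT x. indicator {-1<..<1} x * (phi (x, t))^2) <= B^2 * M * (LBINT x. indicator {-1<..<1} x * (phi (x, t))^2)"
  proof (rule mult_right_mono)
   have "(LBINT x. (cf x)^2) <= (LBINT x. B^2 * (f (x, t))^2)"
   proof (rule integral_mono)
    show "(cf x)^2 <= B^2 * (f (x, t))^2" for x
     using square_mult_bound[of "indicator {-1<..<1} x * c x" B "f (x, t)"] c(2)[of x] B0 by (auto simp: cf_def split: split_indicator)
   qed (use sqintD[OF cfs] sqintD[OF elim(2)] in auto)
   also have "... = B^2 * (LBINT x. (f (x, t))^2)" by simp
   also have "... <= B^2 * M" using elim(3) by (intro mult_left_mono) auto
   finally show "(LBINT x. (cf x)^2) <= B^2 * M" .
  qed (auto intro!: integral_nonneg_AE)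
  finally show "(LINT x:{-1<..<1}|lebesgue. c x * u (x, t) * phi (x, t)) = (LBINT x. indicator {-1<..<1} x * (c x * f (x, t) * phi (x, t)))
   & (LINT x:{-1<..<1}|lebesgue. c x * u (x, t) * phi (x, t))^2 <= B^2 * M * (LBINT x. indicator {-1<..<1} x * (phi (x, t))^2)" using e1 by blast
 qed
qed

lemma lipschitz_of_bounded_derivative:
 assumes T: "T > 0" and ac: "ac_deriv 0 T q q'" and bd: "!!t. \<bar>q' t\<bar> <= K" and r: "r : {0..T}" and t: "t : {0..T}"
 shows "\<bar>q r - q t\<bar> <= K * \<bar>r - t\<bar>"
proof -
 have *: "\<bar>q b - q a\<bar> <= K * (b - a)" if ab: "a : {0..T}" "b : {0..T}" "a <= b" for a b
 proof -
  have sub: "ac_deriv a b q q'" by (rule ac_deriv_subinterval[OF ac]) (use ab in auto)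
  have "q b - q a = (LBINT y:{a..b}. q' y)" using ac_derivD[OF sub, of b] ab by simp
  also have "\<bar>...\<bar> <= (LBINT y:{a..b}. K)"
   unfolding set_lebesgue_integral_def
  proof (rule integral_abs_bound_integral)
   show "integrable lborel (%y. indicator {a..b} y *\<^sub>R q' y)" using ac_deriv_integrable[OF sub] by (simp add: set_integrable_def)
   show "integrable lborel (%y. indicator {a..b} y *\<^sub>R K)" using integrable_indicator_Icc[of a b] by simp
   show "\<bar>indicator {a..b} y *\<^sub>R q' y\<bar> <= indicator {a..b} y *\<^sub>R K" for y using bd[of y] by (auto split: split_indicator)
  qed
  also have "... = K * (b - a)" using ab by (simp add: set_lebesgue_integral_def)
  finally show ?thesis .
 qed
 show ?thesis using *[of r t] *[of t r] r t by (cases "r <= t") (auto simp: abs_minus_commute)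
qed

lemma hat_weights:
 assumes eta: "!!x. x : {-1..1} ==> eta 1 <= eta x" and lam: "lam >= 0" and t: "t : {0<..<T}"
 shows "alpha_hat eta m lam T t = alpha eta m lam T 1 t" "xi_hat eta m lam T t = xi eta m lam T 1 t"
proof -
 have tp: "0 < t * (T - t)" using t by simp
 have le: "exp (lam * (m * eta_norm eta + eta 1)) <= exp (lam * (m * eta_norm eta + eta x))" if "x : {-1..1}" for x
  using eta[OF that] lam by (simp add: mult_left_mono)
 show "alpha_hat eta m lam T t = alpha eta m lam T 1 t"
  unfolding alpha_hat_def
 proof (rule cSup_eq_maximum)
  show "y <= alpha eta m lam T 1 t" if "y : (%x. alpha eta m lam T x t) ` {-1..1}" for y using that le tp by (auto simp: alpha_def intro!: divide_right_mono)
 qed auto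
 show "xi_hat eta m lam T t = xi eta m lam T 1 t"
  unfolding xi_hat_def
 proof (rule cInf_eq_minimum)
  show "xi eta m lam T 1 t <= y" if "y : (%x. xi eta m lam T x t) ` {-1..1}" for y using that le tp by (auto simp: xi_def intro!: divide_right_mono)
 qed auto
qed

text \<open>A one-sided derivative of the wrong sign would give smaller values next to the endpoint.
  Together with the lower bound for |eta'| this fixes the signs of the boundary fluxes.\<close>

lemma endpoint_minimum_derivative:
 assumes d: "\<forall>x\<in>{-1..1}. (eta has_real_derivative eta' x) (at x within {-1..1})"
  and mn: "!!x. x : {-1..1} ==> eta 1 <= eta x" "!!x. x : {-1..1} ==> eta (-1) <= eta x"
 shows "eta' 1 <= 0" "0 <= eta' (-1)"
proof -
 show "eta' 1 <= 0"
 proof (rule ccontr)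
  assume "\<not> eta' 1 <= 0"
  then obtain r where r: "r > 0" "!!h. h > 0 ==> 1 - h : {-1..1} ==> h < r ==> eta (1 - h) < eta 1"
   using has_real_derivative_pos_inc_left[of eta "eta' 1" 1 "{-1..1}"] d by fastforce
  define h where "h = min (r / 2) 1"
  have "h > 0" "h < r" "1 - h : {-1..1}" using r(1) by (auto simp: h_def)
  then show False using r(2)[of h] mn(1)[of "1 - h"] by simp
 qed
 show "0 <= eta' (-1)"
 proof (rule ccontr)
  assume "\<not> 0 <= eta' (-1)"
  then obtain r where r: "r > 0" "!!h. h > 0 ==> -1 + h : {-1..1} ==> h < r ==> eta (-1 + h) < eta (-1)"
   using has_real_derivative_neg_dec_right[of eta "eta' (-1)" "-1" "{-1..1}"] d by fastforce
  define h where "h = min (r / 2) 1"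
  have "h > 0" "h < r" "-1 + h : {-1..1}" using r(1) by (auto simp: h_def)
  then show False using r(2)[of h] mn(2)[of "-1 + h"] by simp
 qed
qed

text \<open>Clipping the Borel version of the derivative makes its bound hold at every time and
  alters it only on a null set within (0,T).\<close>

lemma lipschitz_coefficient_version:
 assumes T: "T > 0" and q: "continuous_on {0..T} q" "weak_deriv1 {0<..<T} q qt" "set_borel_measurable lebesgue {0<..<T} qt"
  and M: "AE t in lebesgue. t : {0<..<T} --> \<bar>qt t\<bar> <= M"
 obtains q' where "q' : borel_measurable borel" "!!t. \<bar>q' t\<bar> <= \<bar>M\<bar>" "ac_deriv 0 T q q'"
proof -
 have L: "L2_on {0<..<T} qt"
  unfolding L2_on_def
 proof
  show m: "set_borel_measurable lebesgue {0<..<T} qt" by (rule q(3))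
  have m': "(%t. indicator {0<..<T} t *\<^sub>R qt t) : borel_measurable lebesgue" using m by (simp add: set_borel_measurable_def)
  have fin: "integrable lebesgue (%t. M^2 * indicator {0<..<T} t :: real)"
   using T by (intro integrable_mult_right integrable_real_indicator) (auto simp: emeasure_completion)
  show "set_integrable lebesgue {0<..<T} (%t. (qt t)^2)" unfolding set_integrable_def
  proof (rule lint_bound[OF fin])
   have "(%t. indicator {0<..<T} t *\<^sub>R (qt t)^2) = (%t. (indicator {0<..<T} t *\<^sub>R qt t)^2)" by (auto split: split_indicator)
   then show "(%t. indicator {0<..<T} t *\<^sub>R (qt t)^2) : borel_measurable lebesgue" using m' by simp
   show "AE t in lebesgue. norm (indicator {0<..<T} t *\<^sub>R (qt t)^2) <= norm (M^2 * indicator {0<..<T} t)" using M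
   proof eventually_elim
    case (elim t)
    then show ?case using power_mono[of "\<bar>qt t\<bar>" M 2] by (auto split: split_indicator)
   qed
  qed
 qed
 obtain v where v: "sqint lborel v" "!!t. t ~: {0<..<T} ==> v t = 0" "AE t in lborel. t : {0<..<T} --> qt t = v t" by (rule L2_on_borel_version[OF L]) auto
 define w where "w t = clip (- \<bar>M\<bar>) \<bar>M\<bar> (v t)" for t
 note [measurable] = sqint_measurable[OF v(1)]
 have wm: "w : borel_measurable borel" unfolding w_def[abs_def] clip_def[abs_def] by measurable
 have wb: "\<bar>w t\<bar> <= \<bar>M\<bar>" for t using clip_in[of "- \<bar>M\<bar>" "\<bar>M\<bar>" "v t"] by (simp add: w_def abs_le_iff)
 have "ac_deriv 0 T q w"
 proof (rule weak_deriv1_ac_deriv[OF T q(2,1) L])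
  show "sqint lborel w" by (rule sqint_bound[OF v(1), where C = 1]) (use wm in "auto simp: w_def clip_def")
  show "w t = 0" if "t ~: {0<..<T}" for t using v(2)[OF that] by (simp add: w_def clip_def)
  show "AE t in lborel. t : {0<..<T} --> qt t = w t" using v(3) M[unfolded AE_completion_iff]
  proof eventually_elim
   case (elim t)
   then show ?case by (auto simp: w_def clip_def)
  qed
 qed
 then show ?thesis using that wm wb by blast
qed

context carleman_system begin

lemma carleman_estimate_nn:
 "(\<integral>\<^sup>+z. ennreal (Zi z) \<partial>lebesgue) + (\<integral>\<^sup>+t. ennreal (Zb t) \<partial>lebesgue) <= ennreal (Cf * (3 + 2 * K2^2 + 24 * K2^2 / c0) + 2) *
  ((\<integral>\<^sup>+z. ennreal ((ew (fst z) (snd z) * g1 z)^2) \<partial>lebesgue) + (\<integral>\<^sup>+t. ennreal ((ew 1 t * g2 t)^2) \<partial>lebesgue)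
   + (\<integral>\<^sup>+z. ennreal (indicator omega (fst z) * WW z) \<partial>lebesgue))"
proof -
 have y: "0 <= yw x t" if "t : {0<..<T}" for x t using yw_bounds(2)[OF that, of x] by simp
 have Zi0: "0 <= Zi z" for z using y[of "snd z" "fst z"] lam by (cases "snd z : {0<..<T}") (auto simp: Zi_def ew_def)
 have Zb0: "0 <= Zb t" for t using y[of t 1] lam by (cases "t : {0<..<T}") (auto simp: Zb_def ew_def)
 have cv2: "(\<integral>\<^sup>+z. ennreal (f z) \<partial>lebesgue) = ennreal (integral\<^sup>L lb2 f)" if "integrable lb2 f" "!!z. 0 <= f z" for f
  unfolding nn_integral_completion using nn_integral_eq_integral[of lb2 f] that by (simp add: lborel_prod)
 have cv1: "(\<integral>\<^sup>+t. ennreal (f t) \<partial>lebesgue) = ennreal (integral\<^sup>L lborel f)" if "integrable lborel f" "!!z. 0 <= f z" for f :: "real => real"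
  unfolding nn_integral_completion using nn_integral_eq_integral[of lborel f] that by simp
 have i1: "integrable lb2 (%z. (ew (fst z) (snd z) * g1 z)^2)" using sqintD[OF damped_sqint[OF damped_ew[OF g(1)]]] by simp
 have "(\<integral>\<^sup>+z. ennreal (Zi z) \<partial>lebesgue) + (\<integral>\<^sup>+t. ennreal (Zb t) \<partial>lebesgue) = ennreal (integral\<^sup>L lb2 Zi + integral\<^sup>L lborel Zb)"
  using Zi0 Zb0 by (simp add: cv2 cv1 Z_integrable ennreal_plus integral_nonneg_AE)
 also have "... <= ennreal ((Cf * (3 + 2 * K2^2 + 24 * K2^2 / c0) + 2) * (G1 + G2 + IO))" by (rule ennreal_leI[OF carleman_estimate])
 also have "... = ennreal (Cf * (3 + 2 * K2^2 + 24 * K2^2 / c0) + 2) * (ennreal G1 + ennreal G2 + ennreal IO)"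
  using energy_nonneg by (simp add: ennreal_mult'' ennreal_plus)
 also have "ennreal G1 = (\<integral>\<^sup>+z. ennreal ((ew (fst z) (snd z) * g1 z)^2) \<partial>lebesgue)" using i1 by (simp add: cv2 G1_def)
 also have "ennreal G2 = (\<integral>\<^sup>+t. ennreal ((ew 1 t * g2 t)^2) \<partial>lebesgue)" using g2_integrable by (simp add: cv1 G2_def)
 also have "ennreal IO = (\<integral>\<^sup>+z. ennreal (indicator omega (fst z) * WW z) \<partial>lebesgue)" using quadratic_integrable(8) WW_nonneg by (simp add: cv2 IO_def)
 finally show ?thesis .
qed

end

section \<open>Choice of the constants and assembly of the estimate\<close>

theorem theorem3p1:
  fixes T beta qs m :: real
    and omega omega0 :: "real set"
    and eta eta' eta'' :: "real \<Rightarrow> real"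
    and p px pxx pt pxt :: "real \<times> real \<Rightarrow> real"
    and pxT :: "real \<Rightarrow> real"
    and q qt :: "real \<Rightarrow> real"
  assumes T_pos: "T > 0" and beta_pos: "beta > 0" and qs_pos: "qs > 0"
    and omega: "open omega" "omega \<noteq> {}" "closure omega \<subseteq> {-1<..<0}"
    and omega0: "open omega0" "omega0 \<noteq> {}" "closure omega0 \<subseteq> omega"
    and eta_C2: "\<forall>x\<in>{-1..1}. (eta has_real_derivative eta' x) (at x within {-1..1})"
      "\<forall>x\<in>{-1..1}. (eta' has_real_derivative eta'' x) (at x within {-1..1})"
      "continuous_on {-1..1} eta''"
    and eta_pos: "\<forall>x\<in>{-1..1}. eta x > 0"
    and eta_grad: "Inf ((\<lambda>x. \<bar>eta' x\<bar>) ` ({-1..1} - omega0)) > 0"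
    and eta_bdry: "eta (-1) = Inf (eta ` {-1..1})" "eta 1 = Inf (eta ` {-1..1})"
    and m_gt: "m > 1"
    \<comment> \<open>pbar in H^{1,2}_0(Q) (continuous representative on the closure of Q)\<close>
    and p_cont: "continuous_on ({-1..1} \<times> {0..T}) p"
    and p_L2: "L2_on (Qset T) p" "L2_on (Qset T) px" "L2_on (Qset T) pxx" "L2_on (Qset T) pt"
    and p_weak: "weak_dx (Qset T) p px" "weak_dx (Qset T) px pxx" "weak_dt (Qset T) p pt"
    and p_bdry: "\<forall>t\<in>{0..T}. p (-1, t) = 0 \<and> p (1, t) = 0"
    \<comment> \<open>pbar in W^{1,infinity}(0,T;H^1(-1,1))\<close>
    and p_W1inf: "weak_dx (Qset T) pt pxt" "L2_on (Qset T) pxt"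
      "\<exists>M. AE t in lebesgue. t \<in> {0<..<T} \<longrightarrow>
         set_nn_integral lebesgue {-1<..<1} (\<lambda>x. ennreal ((p (x, t))\<^sup>2 + (px (x, t))\<^sup>2)) \<le> ennreal M"
      "\<exists>M. AE t in lebesgue. t \<in> {0<..<T} \<longrightarrow>
         set_nn_integral lebesgue {-1<..<1} (\<lambda>x. ennreal ((pt (x, t))\<^sup>2 + (pxt (x, t))\<^sup>2)) \<le> ennreal M"
    \<comment> \<open>pxT is the x-derivative of pbar(.,T)\<close>
    and pxT: "L2_on {-1<..<1} pxT" "weak_deriv1 {-1<..<1} (\<lambda>x. p (x, T)) pxT"
    \<comment> \<open>qbar in W^{1,infinity}(0,T) (continuous representative), qbar > q_* on [0,T]\<close>
    and q_cont: "continuous_on {0..T} q"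
    and q_W1inf: "weak_deriv1 {0<..<T} q qt" "set_borel_measurable lebesgue {0<..<T} qt"
      "\<exists>M. AE t in lebesgue. t \<in> {0<..<T} \<longrightarrow> \<bar>qt t\<bar> \<le> M"
    and q_lower: "\<forall>t\<in>{0..T}. q t > qs"
  shows "\<exists>lam0 s0 C0. lam0 \<ge> 1 \<and> s0 \<ge> 1 \<and> C0 > 0 \<and>
    (\<forall>lam s phiT gammaT g1 g2 phi phix phixx phit gamma gammat.
      lam \<ge> lam0 \<longrightarrow> s \<ge> s0 * (T + T\<^sup>2) \<longrightarrow>
      \<comment> \<open>final data\<close>
      (\<exists>phiTx. continuous_on {-1..1} phiT \<and> L2_on {-1<..<1} phiT \<and> L2_on {-1<..<1} phiTx \<and>
               weak_deriv1 {-1<..<1} phiT phiTx) \<longrightarrow>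
      phiT (-1) = 0 \<longrightarrow>
      phiT 1 = gammaT + 1 / beta * (LINT x:{-1<..<1}|lebesgue. pxT x * x * phiT x) \<longrightarrow>
      \<comment> \<open>source terms\<close>
      L2_on (Qset T) g1 \<longrightarrow> L2_on {0<..<T} g2 \<longrightarrow>
      \<comment> \<open>(phi,gamma) strong solution: regularity\<close>
      continuous_on ({-1..1} \<times> {0..T}) phi \<longrightarrow>
      L2_on (Qset T) phi \<longrightarrow> L2_on (Qset T) phix \<longrightarrow> L2_on (Qset T) phixx \<longrightarrow> L2_on (Qset T) phit \<longrightarrow>
      weak_dx (Qset T) phi phix \<longrightarrow> weak_dx (Qset T) phix phixx \<longrightarrow> weak_dt (Qset T) phi phit \<longrightarrow>
      continuous_on {0..T} gamma \<longrightarrow> L2_on {0<..<T} gamma \<longrightarrow> L2_on {0<..<T} gammat \<longrightarrow>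
      weak_deriv1 {0<..<T} gamma gammat \<longrightarrow>
      \<comment> \<open>(phi,gamma) strong solution: equations\<close>
      (AE z in lebesgue. z \<in> Qset T \<longrightarrow>
         - q (snd z) * phit z - phixx z - fst z / beta * bdx p 1 (snd z) * phix z
         + 1 / beta * bdx p 1 (snd z) * phi z = g1 z) \<longrightarrow>
      (\<forall>t\<in>{0<..<T}. phi (-1, t) = 0) \<longrightarrow>
      (AE t in lebesgue. t \<in> {0<..<T} \<longrightarrow>
         phi (1, t) = gamma t + (LINT x:{-1<..<1}|lebesgue. x / beta * px (x, t) * phi (x, t))) \<longrightarrow>
      (\<forall>x\<in>{-1<..<1}. phi (x, T) = phiT x) \<longrightarrow>
      (AE t in lebesgue. t \<in> {0<..<T} \<longrightarrow>
         gammat t = (LINT x:{-1<..<1}|lebesgue. 2 / beta * pt (x, t) * phi (x, t)) + g2 t) \<longrightarrow>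
      gamma T = gammaT \<longrightarrow>
      \<comment> \<open>Carleman estimate\<close>
      set_nn_integral lebesgue (Qset T) (\<lambda>z. ennreal (
          (((phit z)\<^sup>2 + (phixx z)\<^sup>2) / (s * xi eta m lam T (fst z) (snd z))
           + lam\<^sup>2 * (s * xi eta m lam T (fst z) (snd z)) * (phix z)\<^sup>2
           + lam ^ 4 * (s * xi eta m lam T (fst z) (snd z)) ^ 3 * (phi z)\<^sup>2)
          * exp (- 2 * s * alpha eta m lam T (fst z) (snd z))))
      + set_nn_integral lebesgue {0<..<T} (\<lambda>t. ennreal (
          ((gammat t)\<^sup>2
           + lam * (s * xi_hat eta m lam T t) * ((bdx phi (-1) t)\<^sup>2 + (bdx phi 1 t)\<^sup>2)
           + lam ^ 3 * (s * xi_hat eta m lam T t) ^ 3 * ((phi (1, t))\<^sup>2 + (gamma t)\<^sup>2))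
          * exp (- 2 * s * alpha_hat eta m lam T t)))
      \<le> ennreal C0 * (
          set_nn_integral lebesgue (Qset T) (\<lambda>z. ennreal ((g1 z)\<^sup>2 * exp (- 2 * s * alpha eta m lam T (fst z) (snd z))))
        + set_nn_integral lebesgue {0<..<T} (\<lambda>t. ennreal ((g2 t)\<^sup>2 * exp (- 2 * s * alpha_hat eta m lam T t)))
        + ennreal (s ^ 3 * lam ^ 4) *
          set_nn_integral lebesgue (omega \<times> {0<..<T}) (\<lambda>z. ennreal (
            (xi eta m lam T (fst z) (snd z)) ^ 3 * (phi z)\<^sup>2 * exp (- 2 * s * alpha eta m lam T (fst z) (snd z))))))"
proof -
 define N where "N = eta_norm eta"
 define e e1 e2 where "e = (%x. eta (clip (-1) 1 x))" and "e1 = (%x. eta' (clip (-1) 1 x))" and "e2 = (%x. eta'' (clip (-1) 1 x))"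
 have ec: "continuous_on {-1..1} eta" "continuous_on {-1..1} eta'" using eta_C2 by (auto intro!: DERIV_continuous_on)
 obtain k1 where k1: "!!x. \<bar>e1 x\<bar> <= k1" using bounded_compose_clip[of "-1" 1 eta', OF _ ec(2)] unfolding e1_def by auto
 obtain k2 where k2: "!!x. \<bar>e2 x\<bar> <= k2" using bounded_compose_clip[of "-1" 1 eta'', OF _ eta_C2(3)] unfolding e2_def by auto
 have e_cont: "continuous_on UNIV e" "continuous_on UNIV e1" "continuous_on UNIV e2"
  unfolding e_def e1_def e2_def using ec eta_C2(3) by (auto intro: continuous_on_compose_clip)
 have cl: "clip (-1) 1 x : {-1..1}" for x by (rule clip_in) simp
 have bdd: "bdd_above ((%x. \<bar>eta x\<bar>) ` {-1..1})" "bdd_below (eta ` {-1..1})"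
  using ec(1) by (auto intro!: bounded_imp_bdd_above bounded_imp_bdd_below compact_imp_bounded compact_continuous_image continuous_intros)
 have etaN: "eta x <= N" if "x : {-1..1}" for x using cSup_upper[OF imageI[OF that] bdd(1)] unfolding N_def eta_norm_def by linarith
 have e_bd: "0 < e x" "e x <= N" for x using etaN[OF cl[of x]] eta_pos cl[of x] by (auto simp: e_def)
 have N: "N > 0" using e_bd[of 0] by linarith
 have mn: "eta 1 <= eta x" "eta (-1) <= eta x" if "x : {-1..1}" for x using cInf_lower[OF imageI[OF that] bdd(2)] eta_bdry by simp_all
 have eta_sym: "eta (-1) = eta 1" using eta_bdry by simp
 have e_deriv: "(e has_real_derivative e1 x) (at x within {-1..1})" "(e1 has_real_derivative e2 x) (at x within {-1..1})" if "x : {-1..1}" for x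
  using eta_C2(1,2) that unfolding e_def e1_def e2_def by (auto intro!: has_derivative_compose_clip simp: clip_id[OF that])
 define c0 where "c0 = Inf ((%x. \<bar>eta' x\<bar>) ` ({-1..1} - omega0))"
 have c0: "c0 > 0" using eta_grad by (simp add: c0_def)
 have c0_le: "c0 <= \<bar>eta' x\<bar>" if "x : {-1..1} - omega0" for x
  unfolding c0_def by (rule cInf_lower[OF imageI[OF that]]) (rule bdd_belowI[of _ 0], auto)
 have om: "omega \<subseteq> {-1<..<0}" "omega0 \<subseteq> omega" using omega(3) omega0(3) closure_subset by blast+
 have "1 ~: omega0" "-1 ~: omega0" using om by force+
 \<comment> \<open>The endpoints lie outside \<open>omega0\<close>, so |eta'| >= c0 there, and
   minimality of \<open>eta\<close> decides the signs.\<close>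
 then have c0_bd: "e1 1 <= - c0" "c0 <= e1 (-1)" using endpoint_minimum_derivative[OF eta_C2(1) mn] c0_le[of 1] c0_le[of "-1"] by (auto simp: e1_def clip_def)
 have C: "compact (closure omega0)" "closure omega0 ~= {}"
  using omega0 om by (auto intro!: compact_closure[THEN iffD2] bounded_subset[OF bounded_closed_interval[of "-1" 0]])
 obtain r where r: "smooth_fun r" "!!x. 0 <= r x" "!!x. x : closure omega0 ==> 1 <= r x" "!!x. x ~: omega ==> r x = 0"
  by (rule smooth_cutoff[OF C omega(1) omega0(3)]) (rule that; (assumption | blast))
 note rc = smooth_fun_continuous[OF r(1)] smooth_fun_continuous[OF smooth_fun_deriv(1)[OF r(1)]]
 define rho rho' where "rho = (%x. r (clip (-1) 1 x))" and "rho' = (%x. deriv r (clip (-1) 1 x))"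
 obtain k3 where k3: "!!x. \<bar>rho x\<bar> <= k3" using bounded_compose_clip[of "-1" 1 r, OF _ continuous_on_subset[OF rc(1)]] unfolding rho_def by auto
 obtain k4 where k4: "!!x. \<bar>rho' x\<bar> <= k4" using bounded_compose_clip[of "-1" 1 "deriv r", OF _ continuous_on_subset[OF rc(2)]] unfolding rho'_def by auto
 obtain Mq where "AE t in lebesgue. t : {0<..<T} --> \<bar>qt t\<bar> <= Mq" using q_W1inf(3) by blast
 then obtain q1 where q1: "q1 : borel_measurable borel" "!!t. \<bar>q1 t\<bar> <= \<bar>Mq\<bar>" "ac_deriv 0 T q q1"
  by (rule lipschitz_coefficient_version[OF T_pos q_cont q_W1inf(1,2)]) (rule that; (assumption | blast))
 define qb where "qb = (%t. q (clip 0 T t))"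
 have clT: "clip 0 T t : {0..T}" for t using T_pos by (intro clip_in) simp
 obtain k5 where k5: "!!t. \<bar>qb t\<bar> <= k5" using bounded_compose_clip[of 0 T q, OF _ q_cont] T_pos unfolding qb_def by auto
 have qb_low: "qs <= qb t" for t using q_lower clT[of t] by (auto simp: qb_def less_imp_le)

 obtain dp pfxx pft where dp: "sqint lb2 dp" "sqint lb2 pfxx" "sqint lb2 pft"
  "!!z. z ~: {-1..1} \<times> {0<..<T} ==> dp z = 0" "!!z. z ~: Qset T ==> pfxx z = 0" "!!z. z ~: Qset T ==> pft z = 0"
  "AE z in lborel. z : Qset T --> px z = dp z & pxx z = pfxx z & pt z = pft z"
  "AE t in lborel. t : {0<..<T} --> ac_deriv (-1) 1 (%x. p (x, t)) (%x. dp (x, t)) & ac_deriv (-1) 1 (%x. dp (x, t)) (%x. pfxx (x, t))"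
  "AE t in lborel. t : {0<..<T} --> bdx p (-1) t = dp (-1, t) & bdx p 1 t = dp (1, t)"
  by (rule strong_regularity[OF T_pos p_cont p_L2 p_weak]) (rule that; (assumption | blast))
 have dpx: "AE z in lborel. z : Qset T --> px z = dp z" and dpt: "AE z in lborel. z : Qset T --> pt z = pft z" using dp(7) by (auto elim: eventually_mono)
 obtain fxt where fxt': "sqint lborel fxt" "!!z. z ~: Qset T ==> fxt z = 0" "AE z in lborel. z : Qset T --> pxt z = fxt z"
  by (rule L2_on_borel_version[OF p_W1inf(2) Qset_borel]) (rule that; (assumption | blast))
 have fxt: "sqint lb2 fxt" using fxt'(1) unfolding lborel_prod .
 obtain M1 where M1: "AE t in lebesgue. t : {0<..<T} -->
   set_nn_integral lebesgue {-1<..<1} (%x. ennreal ((p (x, t))^2 + (px (x, t))^2)) <= ennreal M1" using p_W1inf(3) by blast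
 obtain M2 where M2: "AE t in lebesgue. t : {0<..<T} -->
   set_nn_integral lebesgue {-1<..<1} (%x. ennreal ((pt (x, t))^2 + (pxt (x, t))^2)) <= ennreal M2" using p_W1inf(4) by blast
 define M where "M = \<bar>M1\<bar> + \<bar>M2\<bar>"
 have Qs: "z ~: Qset T" if "z ~: {-1..1} \<times> {0<..<T}" for z using that by (auto simp: Qset_def)
 have MM: "\<bar>M1\<bar> <= M" "\<bar>M2\<bar> <= M" "0 <= M" by (auto simp: M_def)
 have B1: "AE t in lborel. (LBINT x. (dp (x, t))^2) <= M" using slice_norm_bound[OF M1 dp(1) _ dpx] dp(4) MM(1) by (auto elim!: eventually_mono)
 have B2: "AE t in lborel. (LBINT x. (fxt (x, t))^2) <= M" using slice_norm_bound[OF M2 fxt _ fxt'(3)] fxt'(2) Qs MM(2) by (auto elim!: eventually_mono)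
 have B3: "AE t in lborel. (LBINT x. (pft (x, t))^2) <= M"
  using slice_norm_bound[OF M2[unfolded add.commute[of "(pt _)^2"]] dp(3) _ dpt] dp(6) Qs MM(2) by (auto elim!: eventually_mono)
 obtain k where k: "k : borel_measurable borel" "AE x in lborel. x : {-1<..<1} -->
   (AE t in lborel. t : {0<..<T} --> dp (x, t) = k x + (LBINT r. indicator {..t} r * fxt (x, r)))"
  by (rule mixed_derivative_representation[OF T_pos p_L2(1,2,4) p_W1inf(2) p_weak(1,3) p_W1inf(1) dp(1) dpx fxt fxt'(2,3)]) (assumption | (rule that; (assumption | blast)))+
 have "AE t in lborel. t : {0<..<T} --> ac_deriv (-1) 1 (%x. dp (x, t)) (%x. pfxx (x, t))" using dp(8) by (auto elim: eventually_mono)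
 from boundary_derivative_bounded[OF T_pos dp(1,4,2) fxt fxt'(2) this k B1 B2]
 obtain Cb where Cb: "AE t in lborel. t : {0<..<T} --> \<bar>dp (1, t)\<bar> <= Cb" by blast
 define b where "b t = dp (1, t) / beta" for t
 define a1 a2 a3 a4 a5 a6 a7 where "a1 = \<bar>k1\<bar>" and "a2 = \<bar>k2\<bar>" and "a3 = \<bar>k3\<bar>" and "a4 = \<bar>k4\<bar>" and "a5 = \<bar>k5\<bar>" and "a6 = \<bar>Mq\<bar>" and "a7 = \<bar>Cb\<bar> / beta"
 have a: "k1 <= a1" "k2 <= a2" "k3 <= a3" "k4 <= a4" "k5 <= a5" "0 <= a1" "0 <= a2" "0 <= a3" "0 <= a4" "0 <= a5" "0 <= a6" "0 <= a7"
  using beta_pos by (auto simp: a1_def a2_def a3_def a4_def a5_def a6_def a7_def)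
 \<comment> \<open>K dominates every quantity bounded in the locales. The largest slice constant is
   \<open>8 * (M / beta^2)\<close>: the square of \<open>2 / beta\<close> times M, doubled when
   \<open>g2\<close> is split off.\<close>
 define K where "K = 1 + T + T^2 + a1 + a2 + a3 + a4 + a5 + 1 / qs + a6 + a7 + 8 * (M / beta^2)"
 have pos: "0 <= 1 / qs" "0 <= M / beta^2" "0 <= T^2" using qs_pos MM by auto
 have "1 <= K" "T <= K" "T^2 <= K" "k1 <= K" "k2 <= K" "k3 <= K" "k4 <= K" "k5 <= K" "1 / qs <= K" "a6 <= K" "a7 <= K" "8 * (M / beta^2) <= K"
  unfolding K_def using pos a T_pos by linarith+
 note K = this[unfolded a6_def a7_def]
 define K2 cc where "K2 = 40 * K ^ 5" and "cc = min (min (6 * c0^2) 1) (2 * c0 ^ 4)"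
 have K2: "K2 > 0" and cc: "cc > 0" using K(1) c0 by (auto simp: K2_def cc_def)
 \<comment> \<open>The largest value allowed by \<open>dl <= 1\<close> and the three smallness
   conditions of \<open>carleman_system\<close>.\<close>
 define dl where "dl = min 1 (min (cc / (K2^2 * 8)) (min (c0 ^ 3 / (2 * K2^2 + 8 * K2 ^ 4 / c0)) (cc / 4 / (48 * K2 ^ 4 + 136 * K2 ^ 9 / c0))))"
 have dn: "0 < K2^2 * 8" "0 < 2 * K2^2 + 8 * K2 ^ 4 / c0" "0 < 48 * K2 ^ 4 + 136 * K2 ^ 9 / c0" using K2 c0 by (auto intro!: add_pos_pos divide_pos_pos)
 have d0: "dl > 0" using dn cc c0 by (auto simp: dl_def)
 have d1: "dl <= 1" "dl <= cc / (K2^2 * 8)" "dl <= c0 ^ 3 / (2 * K2^2 + 8 * K2 ^ 4 / c0)" "dl <= cc / 4 / (48 * K2 ^ 4 + 136 * K2 ^ 9 / c0)" by (auto simp: dl_def)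
 have small: "K2^2 * dl * 8 <= cc" "2 * K2^2 * dl + 8 * K2 ^ 4 / c0 * dl <= c0 ^ 3" "dl * (48 * K2 ^ 4 + 136 * K2 ^ 9 / c0) <= cc / 4"
 proof -
  show "K2^2 * dl * 8 <= cc" using d1(2)[unfolded pos_le_divide_eq[OF dn(1)]] by (simp add: mult_ac)
  show "2 * K2^2 * dl + 8 * K2 ^ 4 / c0 * dl <= c0 ^ 3" using d1(3)[unfolded pos_le_divide_eq[OF dn(2)]] by (simp add: algebra_simps)
  show "dl * (48 * K2 ^ 4 + 136 * K2 ^ 9 / c0) <= cc / 4" using d1(4)[unfolded pos_le_divide_eq[OF dn(3)]] .
 qed
 \<comment> \<open>\<open>s0 * (T + T^2)\<close> equals \<open>(T + T^2 + 1) / dl\<close>, so that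
   both \<open>1 <= dl * s\<close> and \<open>T^2 <= dl * s\<close> hold; the summand
   \<open>1 / (T + T^2)\<close> supplies the 1.\<close>
 define lam0 s0 where "lam0 = 1 / dl" and "s0 = 1 / dl * (1 + 1 / (T + T^2))"
 define C0 where "C0 = (76 * K2 ^ 6 * (4 / cc) + 3 / c0 + 10 * K^2 / c0 ^ 3) * (3 + 2 * K2^2 + 24 * K2^2 / c0) + 2"
 have TT: "0 < T + T^2" using T_pos by (simp add: add_pos_pos)
 have lam0: "lam0 >= 1" using d0 d1 by (simp add: lam0_def)
 have s0: "s0 >= 1"
 proof -
  have "1 * 1 <= 1 / dl * (1 + 1 / (T + T^2))" using d0 d1 TT by (intro mult_mono) auto
  then show ?thesis by (simp add: s0_def)
 qed
 have C0: "C0 > 0" using K2 cc c0 K unfolding C0_def by (intro add_nonneg_pos mult_nonneg_nonneg add_nonneg_nonneg) auto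
 show ?thesis
 proof (rule exI[of _ lam0], rule exI[of _ s0], rule exI[of _ C0], intro conjI lam0 s0 C0 allI impI)
  fix lam s :: real and phiT :: "real => real" and gammaT :: real and g1 :: "real \<times> real => real" and g2 :: "real => real"
   and phi phix phixx phit :: "real \<times> real => real" and gamma gammat :: "real => real"
  assume lam: "lam >= lam0" and s: "s >= s0 * (T + T^2)"
   and g: "L2_on (Qset T) g1" "L2_on {0<..<T} g2"
   and phi: "continuous_on ({-1..1} \<times> {0..T}) phi"
   and phi_L2: "L2_on (Qset T) phi" "L2_on (Qset T) phix" "L2_on (Qset T) phixx" "L2_on (Qset T) phit"
   and phi_weak: "weak_dx (Qset T) phi phix" "weak_dx (Qset T) phix phixx" "weak_dt (Qset T) phi phit"
   and gam: "continuous_on {0..T} gamma" "L2_on {0<..<T} gamma" "L2_on {0<..<T} gammat" "weak_deriv1 {0<..<T} gamma gammat"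
   and eq1: "AE z in lebesgue. z : Qset T -->
     - q (snd z) * phit z - phixx z - fst z / beta * bdx p 1 (snd z) * phix z + 1 / beta * bdx p 1 (snd z) * phi z = g1 z"
   and left: "\<forall>t\<in>{0<..<T}. phi (-1, t) = 0"
   and bc: "AE t in lebesgue. t : {0<..<T} -->
     phi (1, t) = gamma t + (LINT x:{-1<..<1}|lebesgue. x / beta * px (x, t) * phi (x, t))"
   and eq2: "AE t in lebesgue. t : {0<..<T} -->
     gammat t = (LINT x:{-1<..<1}|lebesgue. 2 / beta * pt (x, t) * phi (x, t)) + g2 t"
  have lam1: "lam >= 1" using lam lam0 by simp
  have sb: "s >= 1 / dl * (T + T^2 + 1)"
  proof -
   have "(1 + 1 / (T + T^2)) * (T + T^2) = T + T^2 + 1" using TT by (simp add: distrib_right)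
   then have "s0 * (T + T^2) = 1 / dl * (T + T^2 + 1)" by (simp only: s0_def mult.assoc)
   then show ?thesis using s by simp
  qed
  have sd: "1 <= dl * s" "T^2 <= dl * s"
  proof -
   have "dl * (1 / dl * (T + T^2 + 1)) <= dl * s" using sb d0 by (intro mult_left_mono) auto
   then have "T + T^2 + 1 <= dl * s" using d0 by simp
   then show "1 <= dl * s" "T^2 <= dl * s" using T_pos pos(3) by linarith+
  qed
  have s_pos: "s > 0" using sd(1) d0 by (smt (verit) mult_nonneg_nonpos)
  have s1: "s >= 1" using sd(1) mult_right_mono[OF d1(1) less_imp_le[OF s_pos]] by simp
  obtain d fxx ft where d: "sqint lb2 d" "sqint lb2 fxx" "sqint lb2 ft"
   "!!z. z ~: {-1..1} \<times> {0<..<T} ==> d z = 0" "!!z. z ~: Qset T ==> fxx z = 0" "!!z. z ~: Qset T ==> ft z = 0"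
   "AE z in lborel. z : Qset T --> phix z = d z & phixx z = fxx z & phit z = ft z"
   "AE t in lborel. t : {0<..<T} --> ac_deriv (-1) 1 (%x. phi (x, t)) (%x. d (x, t)) & ac_deriv (-1) 1 (%x. d (x, t)) (%x. fxx (x, t))"
   "AE x in lborel. x : {-1<..<1} --> ac_deriv 0 T (%t. phi (x, t)) (%t. ft (x, t))"
   "AE t in lborel. t : {0<..<T} --> bdx phi (-1) t = d (-1, t) & bdx phi 1 t = d (1, t)"
   "sqint lborel (%t. d (1, t))" "sqint lborel (%t. d (-1, t))" by (rule strong_regularity[OF T_pos phi phi_L2 phi_weak]) (rule that; (assumption | blast))
  obtain gt where gt: "sqint lborel gt" "!!t. t ~: {0<..<T} ==> gt t = 0" "AE t in lborel. t : {0<..<T} --> gammat t = gt t"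
   by (rule L2_on_borel_version[OF gam(3), OF borel_open[OF open_greaterThanLessThan]]) (rule that; (assumption | blast))
  obtain gm where gm: "sqint lborel gm" "!!t. t ~: {0<..<T} ==> gm t = 0" "AE t in lborel. t : {0<..<T} --> gamma t = gm t"
   by (rule L2_on_borel_version[OF gam(2), OF borel_open[OF open_greaterThanLessThan]]) (rule that; (assumption | blast))
  obtain h2 where h2: "sqint lborel h2" "!!t. t ~: {0<..<T} ==> h2 t = 0" "AE t in lborel. t : {0<..<T} --> g2 t = h2 t"
   by (rule L2_on_borel_version[OF g(2), OF borel_open[OF open_greaterThanLessThan]]) (rule that; (assumption | blast))
  obtain f1 where f1: "sqint lborel f1" "!!z. z ~: Qset T ==> f1 z = 0" "AE z in lborel. z : Qset T --> g1 z = f1 z"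
   by (rule L2_on_borel_version[OF g(1) Qset_borel]) (rule that; (assumption | blast))
  have gac: "ac_deriv 0 T gamma gt" by (rule weak_deriv1_ac_deriv[OF T_pos gam(4,1,3) gt])
  define S0 where "S0 t = (LBINT x. indicator {-1<..<1} x * (phi (x, t))^2)" for t
  have S0: "0 <= S0 t" for t unfolding S0_def by (auto intro!: integral_nonneg_AE)
  have xb: "\<bar>x / beta\<bar> <= 1 / beta" if "x : {-1<..<1}" for x using that beta_pos by (auto simp: abs_div divide_right_mono)
  have sl1: "AE t in lborel. t : {0<..<T} -->
   (LINT x:{-1<..<1}|lebesgue. x / beta * px (x, t) * phi (x, t)) = (LBINT x. indicator {-1<..<1} x * (x / beta * dp (x, t) * phi (x, t)))
   & (LINT x:{-1<..<1}|lebesgue. x / beta * px (x, t) * phi (x, t))^2 <= (1 / beta)^2 * M * S0 t"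
   unfolding S0_def by (rule slice_product_bound[OF T_pos phi dp(1) dpx B1 _ xb]) auto
  have sl2: "AE t in lborel. t : {0<..<T} -->
   (LINT x:{-1<..<1}|lebesgue. 2 / beta * pt (x, t) * phi (x, t)) = (LBINT x. indicator {-1<..<1} x * (2 / beta * pft (x, t) * phi (x, t)))
   & (LINT x:{-1<..<1}|lebesgue. 2 / beta * pt (x, t) * phi (x, t))^2 <= (2 / beta)^2 * M * S0 t"
   unfolding S0_def by (rule slice_product_bound[OF T_pos phi dp(3) dpt B3]) (use beta_pos in auto)
  have bc': "AE t in lborel. t : {0<..<T} --> phi (1, t) = gamma t + (LBINT x. indicator {-1<..<1} x * (x / beta * dp (x, t) * phi (x, t)))"
   using bc[unfolded AE_completion_iff] sl1 by eventually_elim auto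
  obtain h1 where h1: "sqint lborel h1" "!!t. t ~: {0<..<T} ==> h1 t = 0" "ac_deriv 0 T (%t. phi (1, t)) h1"
   "AE t in lborel. t : {0<..<T} --> (h1 t)^2 <= 3 * (gt t)^2 +
    3 * (M / beta^2) * ((LBINT x. indicator {-1<..<1} x * (phi (x, t))^2) + (LBINT x. (ft (x, t))^2))"
   by (rule boundary_value_ac[OF T_pos beta_pos phi d(3,6,9) dp(1) fxt fxt'(2) k B1 B2 gac gt(1,2) bc']) (assumption | (rule that; (assumption | blast)))+
  interpret W: carleman_weights T lam s N m e e1 e2
  proof
   show "\<exists>C. \<forall>x. \<bar>e1 x\<bar> <= C" "\<exists>C. \<forall>x. \<bar>e2 x\<bar> <= C" using k1 k2 by blast+
  qed (use T_pos lam1 s1 m_gt N e_cont e_bd e_deriv in auto)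
  \<comment> \<open>Combines \<open>xi >= 4 / T^2\<close> with \<open>T^2 <= dl * s\<close>.\<close>
  have yd: "1 <= dl * W.yw x t" if t: "t : {0<..<T}" for x t
  proof -
   have "1 * 1 <= dl * s / T^2 * 4" using sd(2) T_pos d0 s_pos by (intro mult_mono) auto
   also have "... = dl * (s * (4 / T^2))" by simp
   also have "... <= dl * (s * W.xiw x t)" using W.xiw_ge[OF t, of x] d0 s_pos by (intro mult_left_mono) auto
   finally show ?thesis by (simp add: W.yw_def)
  qed
  interpret S: carleman_solution T lam s N m e e1 e2 qb q1 K c0 dl rho rho' omega phi d fxx ft h1
  proof
   show "\<bar>e1 x\<bar> <= K" "\<bar>e2 x\<bar> <= K" for x using k1[of x] k2[of x] K by linarith+
   show "continuous_on UNIV qb" unfolding qb_def using T_pos by (intro continuous_on_compose_clip q_cont) simp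
   show "1 / K <= qb t" for t
   proof -
    have "1 / K <= 1 / (1 / qs)" using K(1,9) qs_pos by (intro divide_left_mono) auto
    then show ?thesis using qb_low[of t] by simp
   qed
   show "qb t <= K" for t using k5[of t] K by linarith
   show "\<bar>qb r - qb t\<bar> <= K * \<bar>r - t\<bar>" for r t
   proof -
    have "\<bar>q1 t\<bar> <= K" for t using q1(2)[of t] K by linarith
    then have "\<bar>qb r - qb t\<bar> <= K * \<bar>clip 0 T r - clip 0 T t\<bar>"
     unfolding qb_def by (intro lipschitz_of_bounded_derivative[OF T_pos q1(3)] clT)
    also have "... <= K * \<bar>r - t\<bar>" using K(1) by (intro mult_left_mono) (auto simp: clip_def)
    finally show ?thesis .
   qed
   show "ac_deriv 0 T qb q1" by (rule ac_deriv_cong'[OF q1(3)]) (auto simp: qb_def clip_id)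
   show "\<bar>q1 t\<bar> <= K" for t using q1(2)[of t] K by linarith
   show "(rho has_real_derivative rho' x) (at x within {-1..1})" if "x : {-1..1}" for x
    unfolding rho_def rho'_def clip_id[OF that] by (rule has_derivative_compose_clip[OF that has_field_derivative_at_within[OF smooth_fun_deriv(2)[OF r(1)]]])
   show "continuous_on UNIV rho" "continuous_on UNIV rho'" unfolding rho_def rho'_def
    by (auto intro!: continuous_on_compose_clip continuous_on_subset[OF rc(1)] continuous_on_subset[OF rc(2)])
   show "rho x <= K" "\<bar>rho' x\<bar> <= K" for x using k3[of x] k4[of x] K by linarith+
   show "rho x = 0" if "x ~: omega" for x
   proof -
    have "clip (-1) 1 x ~: omega" using that om by (auto simp: clip_def min_def max_def split: if_splits)
    then show ?thesis by (simp add: rho_def r(4))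
   qed
   \<comment> \<open>Off \<open>omega0\<close> the gradient bound applies; on \<open>omega0\<close>
     the cutoff is at least 1.\<close>
   show "c0 <= \<bar>e1 x\<bar> \<or> 1 <= rho x & x : omega" if "x : {-1..1}" for x
    using c0_le[of x] r(3)[of x] that om closure_subset[of omega0] by (auto simp: e1_def rho_def clip_id)
   show "1 <= dl * lam" using lam d0 by (simp add: lam0_def pos_divide_le_eq mult.commute)
   show "0 <= rho x" for x by (simp add: rho_def r(2))
   show "omega : sets borel" using omega(1) by simp
   show "1 ~: omega" "-1 ~: omega" using om by force+
   show "1 <= dl * W.yw x t" if "t : {0<..<T}" for x t by (rule yd[OF that])
   show "d z = 0" if "z ~: {-1..1} \<times> {0<..<T}" for z by (rule d(4)[OF that])
   show "fxx z = 0" "ft z = 0" if "z ~: Qset T" for z by (rule d(5)[OF that], rule d(6)[OF that])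
   show "h1 t = 0" if "t ~: {0<..<T}" for t by (rule h1(2)[OF that])
   show "phi (-1, t) = 0" if "t : {0<..<T}" for t using left that by blast
  qed (fact K q1 c0 c0_bd d0 d1 sd phi d h1)+
  interpret Y: carleman_system T lam s N m e e1 e2 qb q1 K c0 dl rho rho' omega phi d fxx ft h1 b gt h2 gm f1
  proof
   show "e 1 <= e x" if "x : {-1..1}" for x using mn(1)[OF that] that by (simp add: e_def clip_id)
   show "e (-1) = e 1" using eta_sym by (simp add: e_def clip_def)
   show "S.K2^2 * dl * 8 <= S.cc" "2 * S.K2^2 * dl + 8 * S.K2 ^ 4 / c0 * dl <= c0 ^ 3" "dl * (48 * S.K2 ^ 4 + 136 * S.K2 ^ 9 / c0) <= S.cc / 4"
    using small unfolding S.K2_def S.cc_def K2_def cc_def by auto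
   show "AE t in lborel. \<bar>b t\<bar> <= K" using Cb
   proof eventually_elim
    case (elim t)
    show ?case
    proof (cases "t : {0<..<T}")
     case True
     then have "\<bar>dp (1, t)\<bar> <= \<bar>Cb\<bar>" using elim by auto
     then have "\<bar>b t\<bar> <= \<bar>Cb\<bar> / beta" using beta_pos by (simp add: b_def divide_right_mono)
     then show ?thesis using K by linarith
    next
     case False
     then show ?thesis using dp(4)[of "(1, t)"] K by (simp add: b_def)
    qed
   qed
   show "sqint lb2 f1" using f1(1) unfolding lborel_prod .
   show "AE z in lb2. z : Qset T --> qb (snd z) * ft z + fxx z = - f1 z - fst z * b (snd z) * d z + b (snd z) * phi z"
    using eq1[unfolded AE_completion_iff, folded lborel_prod] d(7)[folded lborel_prod] f1(3)[folded lborel_prod] AE_lb2_snd[OF dp(9)]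
   proof eventually_elim
    case (elim z)
    show ?case
    proof
     assume z: "z : Qset T"
     then have t: "snd z : {0<..<T}" by (auto simp: Qset_def)
     then have "qb (snd z) = q (snd z)" "bdx p 1 (snd z) = beta * b (snd z)" using elim(4) beta_pos by (auto simp: qb_def clip_id b_def)
     then have "- qb (snd z) * ft z - fxx z - fst z * b (snd z) * d z + b (snd z) * phi z = f1 z" using elim(1,2,3) z beta_pos by simp
     then show "qb (snd z) * ft z + fxx z = - f1 z - fst z * b (snd z) * d z + b (snd z) * phi z" by linarith
    qed
   qed
   show "AE t in lborel. t : {0<..<T} --> (h1 t)^2 <= 3 * (gt t)^2 + K * ((LBINT x. indicator {-1<..<1} x * (phi (x, t))^2) + (LBINT x. (ft (x, t))^2))"
    using h1(4)
   proof eventually_elim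
    case (elim t)
    have "0 <= (LBINT x. (ft (x, t))^2)" by simp
    then have "3 * (M / beta^2) * (S0 t + (LBINT x. (ft (x, t))^2)) <= K * (S0 t + (LBINT x. (ft (x, t))^2))"
     using S0[of t] K(12) pos(2) by (intro mult_right_mono) auto
    then show ?case using elim unfolding S0_def by auto
   qed
   show "AE t in lborel. t : {0<..<T} --> (gt t)^2 <= K * (LBINT x. indicator {-1<..<1} x * (phi (x, t))^2) + 2 * (h2 t)^2"
    using eq2[unfolded AE_completion_iff] sl2 gt(3) h2(3)
   proof eventually_elim
    case (elim t)
    show ?case
    proof
     assume t: "t : {0<..<T}"
     define I where "I = (LINT x:{-1<..<1}|lebesgue. 2 / beta * pt (x, t) * phi (x, t))"
     have "gt t = I + h2 t" "I^2 <= (2 / beta)^2 * M * S0 t" using elim t unfolding I_def by auto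
     then have "(gt t)^2 <= 2 * ((2 / beta)^2 * M * S0 t) + 2 * (h2 t)^2" using square_add_le[of I "h2 t"] by simp
     also have "2 * ((2 / beta)^2 * M * S0 t) = 8 * (M / beta^2) * S0 t" by (simp add: power_divide)
     also have "... <= K * S0 t" using K(12) S0[of t] by (rule mult_right_mono)
     finally show "(gt t)^2 <= K * (LBINT x. indicator {-1<..<1} x * (phi (x, t))^2) + 2 * (h2 t)^2" by (simp add: S0_def)
    qed
   qed
   show "AE t in lborel. t : {0<..<T} --> (gm t)^2 <= 2 * (phi (1, t))^2 + K * (LBINT x. indicator {-1<..<1} x * (phi (x, t))^2)"
    using bc[unfolded AE_completion_iff] sl1 gm(3)
   proof eventually_elim
    case (elim t)
    show ?case
    proof
     assume t: "t : {0<..<T}"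
     define I where "I = (LINT x:{-1<..<1}|lebesgue. x / beta * px (x, t) * phi (x, t))"
     have e: "gm t = phi (1, t) + (- I)" "I^2 <= (1 / beta)^2 * M * S0 t" using elim t unfolding I_def by auto
     have "(gm t)^2 <= 2 * (phi (1, t))^2 + 2 * ((1 / beta)^2 * M * S0 t)"
      unfolding e(1) using square_add_le[of "phi (1, t)" "- I"] e(2) by simp
     also have "2 * ((1 / beta)^2 * M * S0 t) = 2 * (M / beta^2) * S0 t" by (simp add: power_divide)
     also have "... <= K * S0 t" using K(12) pos(2) S0[of t] by (intro mult_right_mono) auto
     finally show "(gm t)^2 <= 2 * (phi (1, t))^2 + K * (LBINT x. indicator {-1<..<1} x * (phi (x, t))^2)" by (simp add: S0_def)
    qed
   qed
  qed (fact gt h2 gm)+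
  have ex: "e x = eta x" if "x : {-1..1}" for x using that by (simp add: e_def clip_id)
  have y_eq: "W.yw x t = s * xi eta m lam T x t" if "x : {-1..1}" for x t
   unfolding xi_def N_def[symmetric] by (simp add: W.yw_def W.xiw_def W.Ef_def W.th_def ex[OF that])
  have ew_eq: "(W.ew x t)^2 = exp (- 2 * s * alpha eta m lam T x t)" if "x : {-1..1}" "t : {0<..<T}" for x t
  proof -
   have "W.alw x t = alpha eta m lam T x t"
    unfolding alpha_def N_def[symmetric] by (simp add: W.alw_def W.Af_def W.Ef_def W.th_def ex[OF that(1)])
   then show ?thesis using that by (simp add: W.ew_def exp_double[symmetric])
  qed
  have hat: "alpha_hat eta m lam T t = alpha eta m lam T 1 t" "xi_hat eta m lam T t = xi eta m lam T 1 t" if "t : {0<..<T}" for t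
   using hat_weights[of eta lam t T m] mn(1) lam1 that by auto
  have pb: "S.pb z = phi z" if "z : {-1..1} \<times> {0<..<T}" for z using that by (auto simp: S.pb_def)
  define LI where "LI z = (((phit z)^2 + (phixx z)^2) / (s * xi eta m lam T (fst z) (snd z))
      + lam^2 * (s * xi eta m lam T (fst z) (snd z)) * (phix z)^2
      + lam ^ 4 * (s * xi eta m lam T (fst z) (snd z)) ^ 3 * (phi z)^2)
     * exp (- 2 * s * alpha eta m lam T (fst z) (snd z))" for z
  define LB where "LB t = ((gammat t)^2
      + lam * (s * xi_hat eta m lam T t) * ((bdx phi (-1) t)^2 + (bdx phi 1 t)^2)
      + lam ^ 3 * (s * xi_hat eta m lam T t) ^ 3 * ((phi (1, t))^2 + (gamma t)^2))
     * exp (- 2 * s * alpha_hat eta m lam T t)" for t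
  \<comment> \<open>The given weak derivatives agree almost everywhere on Q with the Borel versions,
    so the integrands coincide there.\<close>
  have A: "set_nn_integral lebesgue (Qset T) (%z. ennreal (LI z)) <= (\<integral>\<^sup>+z. ennreal (Y.Zi z) \<partial>lebesgue)"
  proof (rule nn_integral_mono_AE)
   show "AE z in lebesgue. ennreal (LI z) * indicator (Qset T) z <= ennreal (Y.Zi z)" using AE_completion[OF d(7)]
   proof eventually_elim
    case (elim z)
    show ?case
    proof (cases "z : Qset T")
     case True
     then have z: "fst z : {-1..1}" "snd z : {0<..<T}" "z : {-1..1} \<times> {0<..<T}" by (auto simp: Qset_def)
     then have "LI z = Y.Zi z" using elim True by (simp add: LI_def Y.Zi_def y_eq ew_eq pb mult.commute)
     then show ?thesis using True by simp
    qed simp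
   qed
  qed
  have B: "set_nn_integral lebesgue {0<..<T} (%t. ennreal (LB t)) <= (\<integral>\<^sup>+t. ennreal (Y.Zb t) \<partial>lebesgue)"
  proof (rule nn_integral_mono_AE)
   show "AE t in lebesgue. ennreal (LB t) * indicator {0<..<T} t <= ennreal (Y.Zb t)"
    using AE_completion[OF d(10)] AE_completion[OF gt(3)] AE_completion[OF gm(3)]
   proof eventually_elim
    case (elim t)
    show ?case
    proof (cases "t : {0<..<T}")
     case True
     then have "LB t = Y.Zb t" using elim pb[of "(1, t)"] by (simp add: LB_def Y.Zb_def hat y_eq ew_eq mult.commute)
     then show ?thesis using True by simp
    qed simp
   qed
  qed
  have Cc: "(\<integral>\<^sup>+z. ennreal ((W.ew (fst z) (snd z) * f1 z)^2) \<partial>lebesgue) = set_nn_integral lebesgue (Qset T) (%z. ennreal ((g1 z)^2 * exp (- 2 * s * alpha eta m lam T (fst z) (snd z))))"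
  proof (rule nn_integral_cong_AE)
   show "AE z in lebesgue. ennreal ((W.ew (fst z) (snd z) * f1 z)^2) = ennreal ((g1 z)^2 * exp (- 2 * s * alpha eta m lam T (fst z) (snd z))) * indicator (Qset T) z"
    using AE_completion[OF f1(3)]
   proof eventually_elim
    case (elim z)
    show ?case
    proof (cases "z : Qset T")
     case True
     then have "fst z : {-1..1}" "snd z : {0<..<T}" by (auto simp: Qset_def)
     then show ?thesis using elim True by (simp add: power_mult_distrib ew_eq mult.commute)
    qed (use f1(2)[of z] in simp)
   qed
  qed
  have D: "(\<integral>\<^sup>+t. ennreal ((W.ew 1 t * h2 t)^2) \<partial>lebesgue) = set_nn_integral lebesgue {0<..<T} (%t. ennreal ((g2 t)^2 * exp (- 2 * s * alpha_hat eta m lam T t)))"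
  proof (rule nn_integral_cong_AE)
   show "AE t in lebesgue. ennreal ((W.ew 1 t * h2 t)^2) = ennreal ((g2 t)^2 * exp (- 2 * s * alpha_hat eta m lam T t)) * indicator {0<..<T} t"
    using AE_completion[OF h2(3)]
   proof eventually_elim
    case (elim t)
    show ?case
    proof (cases "t : {0<..<T}")
     case True
     then show ?thesis using elim by (simp add: power_mult_distrib ew_eq hat mult.commute)
    qed (use h2(2)[of t] in simp)
   qed
  qed
  define cs where "cs = s ^ 3 * lam ^ 4"
  have cs: "cs > 0" using s_pos lam1 by (simp add: cs_def)
  \<comment> \<open>\<open>WW\<close> contains \<open>lam^4 (s xi)^3\<close>; the factor
    \<open>s^3 lam^4\<close> is pulled out to reach the form of the observation term in the
    statement.\<close>
  have E: "(\<integral>\<^sup>+z. ennreal (indicator omega (fst z) * S.WW z) \<partial>lebesgue) = ennreal cs * set_nn_integral lebesgue (omega \<times> {0<..<T}) (%z. ennreal (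
      (xi eta m lam T (fst z) (snd z)) ^ 3 * (phi z)^2 * exp (- 2 * s * alpha eta m lam T (fst z) (snd z))))"
  proof -
   define h where "h z = indicator omega (fst z) * S.WW z / cs" for z
   have "h : borel_measurable lb2" using borel_measurable_integrable[OF S.quadratic_integrable(8)] by (simp add: h_def[abs_def])
   then have hm: "(%z. ennreal (h z)) : borel_measurable lebesgue" unfolding lborel_prod by (intro measurable_completion) simp
   have "(\<integral>\<^sup>+z. ennreal (indicator omega (fst z) * S.WW z) \<partial>lebesgue) = (\<integral>\<^sup>+z. ennreal cs * ennreal (h z) \<partial>lebesgue)"
    using cs Y.WW_nonneg(1) by (intro nn_integral_cong) (simp add: h_def ennreal_mult[symmetric])
   also have "... = ennreal cs * (\<integral>\<^sup>+z. ennreal (h z) \<partial>lebesgue)" by (rule nn_integral_cmult[OF hm])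
   also have "(\<integral>\<^sup>+z. ennreal (h z) \<partial>lebesgue) = set_nn_integral lebesgue (omega \<times> {0<..<T}) (%z. ennreal (
      (xi eta m lam T (fst z) (snd z)) ^ 3 * (phi z)^2 * exp (- 2 * s * alpha eta m lam T (fst z) (snd z))))"
   proof (rule nn_integral_cong)
    fix z
    show "ennreal (h z) = ennreal ((xi eta m lam T (fst z) (snd z)) ^ 3 * (phi z)^2 * exp (- 2 * s * alpha eta m lam T (fst z) (snd z))) * indicator (omega \<times> {0<..<T}) z"
    proof (cases "z : omega \<times> {0<..<T}")
     case True
     then have z: "fst z : omega" "fst z : {-1..1}" "snd z : {0<..<T}" "z : {-1..1} \<times> {0<..<T}" using om by auto
     have "S.WW z = cs * ((xi eta m lam T (fst z) (snd z)) ^ 3 * (phi z)^2 * (W.ew (fst z) (snd z))^2)"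
      by (simp add: S.WW_def S.w_def pb[OF z(4)] y_eq[OF z(2)] cs_def power_mult_distrib)
     then have "h z = (xi eta m lam T (fst z) (snd z)) ^ 3 * (phi z)^2 * exp (- 2 * s * alpha eta m lam T (fst z) (snd z))"
      using z(1) cs unfolding h_def ew_eq[OF z(2,3)] by simp
     then show ?thesis using True by simp
    next
     case False
     then have "fst z ~: omega \<or> S.WW z = 0" using S.outside[of "fst z" "snd z"] by (cases z) (auto simp: S.WW_def)
     then have "h z = 0" by (auto simp: h_def)
     then show ?thesis using False by simp
    qed
   qed
   finally show ?thesis .
  qed
  have Cst: "Y.Cf * (3 + 2 * S.K2^2 + 24 * S.K2^2 / c0) + 2 = C0"
   unfolding C0_def Y.Cf_def S.K2_def S.cc_def K2_def cc_def ..
  show "set_nn_integral lebesgue (Qset T) (%z. ennreal (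
     (((phit z)^2 + (phixx z)^2) / (s * xi eta m lam T (fst z) (snd z))
      + lam^2 * (s * xi eta m lam T (fst z) (snd z)) * (phix z)^2
      + lam ^ 4 * (s * xi eta m lam T (fst z) (snd z)) ^ 3 * (phi z)^2)
     * exp (- 2 * s * alpha eta m lam T (fst z) (snd z))))
   + set_nn_integral lebesgue {0<..<T} (%t. ennreal (
     ((gammat t)^2
      + lam * (s * xi_hat eta m lam T t) * ((bdx phi (-1) t)^2 + (bdx phi 1 t)^2)
      + lam ^ 3 * (s * xi_hat eta m lam T t) ^ 3 * ((phi (1, t))^2 + (gamma t)^2))
     * exp (- 2 * s * alpha_hat eta m lam T t)))
   <= ennreal C0 * (
     set_nn_integral lebesgue (Qset T) (%z. ennreal ((g1 z)^2 * exp (- 2 * s * alpha eta m lam T (fst z) (snd z))))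
    + set_nn_integral lebesgue {0<..<T} (%t. ennreal ((g2 t)^2 * exp (- 2 * s * alpha_hat eta m lam T t)))
    + ennreal (s ^ 3 * lam ^ 4) *
     set_nn_integral lebesgue (omega \<times> {0<..<T}) (%z. ennreal (
      (xi eta m lam T (fst z) (snd z)) ^ 3 * (phi z)^2 * exp (- 2 * s * alpha eta m lam T (fst z) (snd z)))))"
   using order_trans[OF add_mono[OF A B] Y.carleman_estimate_nn] unfolding Cc D E Cst LI_def LB_def cs_def .
 qed
qed

end
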